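(* Let $\mathbf T$ be a non-degenerate isoperimetric periodic $2$-tiling of $\mathbb{R}^2$ with generators $E_1,E_2$, and suppose $\mathbf T$ is of type $(3;9)$, with $E_1$ the Reuleaux triangle. Then the lattice is that of a regular honeycomb: $E_1$ is a Reuleaux triangle, and $E_2$ is obtained from a regular hexagon by removing three circular-arc regions at every other vertex. Moreover, $$0<\frac{|E_1|}{|E_1|+|E_2|}<\frac{\pi}{\sqrt3}-1,\qquad \mathrm{Per}(\mathbf T)=\sqrt2\sqrt{\pi-\sqrt3}\,\sqrt{|E_1|}+\sqrt[4]{12}\,\sqrt{|E_1|+|E_2|}.$$ Given $|E_1|$ and $|E_2|$, the configuration is uniquely determined up to isometries.
   Context: A lattice $G$ in $\mathbb{R}^2$ is the group of translations generated by two linearly independent vectors. A periodic $2$-tiling is a collection $\mathbf T=\{E_k+g:k=1,2,\ g\in G\}$ of measurable sets which pairwise overlap in null sets and cover $\mathbb{R}^2$ up to a null set. It is non-degenerate if $|E_1|,|E_2|>0$. Its perimeter is $\mathrm{Per}(\mathbf T)=\frac12(\mathrm{Per}(E_1)+\mathrm{Per}(E_2))$. $\mathbf T$ is isoperimetric if its perimeter is $\le$ that of every periodic 2-tiling, with any lattice, whose generators have the same areas. Configuration $(3;9)$ means the following. $E_1$ is a Reuleaux triangle: a curvilinear triangle bounded by three circular arcs of equal curvature, meeting at angles of $120^\circ$. $E_2$ is a curvilinear enneagon with six flat edges and three concave circular edges, all angles $120^\circ$. *)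

theory Defs
  imports "HOL-Complex_Analysis.Complex_Analysis"
begin

text \<open>The plane R^2 is modelled by the type complex (as a 2-dimensional real
Euclidean space); area is Lebesgue measure on it.\<close>

definition plane_lattice :: "complex set \<Rightarrow> bool" where
  "plane_lattice G \<longleftrightarrow>
     (\<exists>u v. u \<noteq> v \<and> independent {u, v} \<and>
        G = {real_of_int m *\<^sub>R u + real_of_int n *\<^sub>R v | m n. True})"

definition ae_eq :: "complex set \<Rightarrow> complex set \<Rightarrow> bool" where
  "ae_eq A B \<longleftrightarrow> A - B \<in> null_sets lebesgue \<and> B - A \<in> null_sets lebesgue"

definition periodic_2tiling :: "complex set \<Rightarrow> (nat \<Rightarrow> complex set) \<Rightarrow> bool" where
  "periodic_2tiling G E \<longleftrightarrow>
     plane_lattice G \<and>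
     (\<forall>k\<in>{1,2}. E k \<in> sets lebesgue) \<and>
     (\<forall>k\<in>{1,2}. \<forall>k'\<in>{1,2}. \<forall>g\<in>G. \<forall>g'\<in>G. (k, g) \<noteq> (k', g') \<longrightarrow>
        ((+) g ` E k) \<inter> ((+) g' ` E k') \<in> null_sets lebesgue) \<and>
     UNIV - (\<Union>k\<in>{1,2}. \<Union>g\<in>G. (+) g ` E k) \<in> null_sets lebesgue"

definition nondegenerate_tiling :: "(nat \<Rightarrow> complex set) \<Rightarrow> bool" where
  "nondegenerate_tiling E \<longleftrightarrow> emeasure lebesgue (E 1) > 0 \<and> emeasure lebesgue (E 2) > 0"

definition divergence :: "(complex \<Rightarrow> complex) \<Rightarrow> complex \<Rightarrow> real" where
  "divergence \<phi> x = (\<Sum>b\<in>Basis. frechet_derivative \<phi> (at x) b \<bullet> b)"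

definition test_field :: "(complex \<Rightarrow> complex) \<Rightarrow> bool" where
  "test_field \<phi> \<longleftrightarrow>
     (\<forall>x. \<phi> differentiable at x) \<and>
     (\<forall>b\<in>Basis. continuous_on UNIV (\<lambda>x. frechet_derivative \<phi> (at x) b)) \<and>
     bounded {x. \<phi> x \<noteq> 0} \<and>
     (\<forall>x. norm (\<phi> x) \<le> 1)"

definition perimeter :: "complex set \<Rightarrow> ereal" where
  "perimeter E = (SUP \<phi>\<in>{\<phi>. test_field \<phi>}. ereal (integral E (divergence \<phi>)))"

definition tiling_perimeter :: "(nat \<Rightarrow> complex set) \<Rightarrow> ereal" where
  "tiling_perimeter E = (perimeter (E 1) + perimeter (E 2)) / 2"

definition isoperimetric_tiling :: "complex set \<Rightarrow> (nat \<Rightarrow> complex set) \<Rightarrow> bool" where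
  "isoperimetric_tiling G E \<longleftrightarrow> periodic_2tiling G E \<and>
     (\<forall>G' F. periodic_2tiling G' F \<and>
        emeasure lebesgue (F 1) = emeasure lebesgue (E 1) \<and>
        emeasure lebesgue (F 2) = emeasure lebesgue (E 2)
        \<longrightarrow> tiling_perimeter E \<le> tiling_perimeter F)"

text \<open>Arc-length parametrised curve of constant signed curvature \<kappa>, starting at p
with initial direction angle \<theta> and length len, evaluated at parameter t in [0,1].
\<kappa> = 0 gives a segment, \<kappa> \<noteq> 0 a circular arc of radius 1/|\<kappa>|.\<close>
definition ccurve :: "complex \<Rightarrow> real \<Rightarrow> real \<Rightarrow> real \<Rightarrow> real \<Rightarrow> complex" where
  "ccurve p \<theta> \<kappa> len t =
     (if \<kappa> = 0 then p + complex_of_real (t * len) * cis \<theta>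
      else p + (cis (\<theta> + \<kappa> * (t * len)) - cis \<theta>) / (\<i> * complex_of_real \<kappa>))"

definition cpoly_path :: "nat \<Rightarrow> (nat \<Rightarrow> complex) \<Rightarrow> (nat \<Rightarrow> real) \<Rightarrow> (nat \<Rightarrow> real)
    \<Rightarrow> (nat \<Rightarrow> real) \<Rightarrow> real \<Rightarrow> complex" where
  "cpoly_path n p \<theta> \<kappa> len t =
     (let i = nat \<lfloor>real n * t\<rfloor> in
      if i < n then ccurve (p i) (\<theta> i) (\<kappa> i) (len i) (real n * t - real i) else p 0)"

text \<open>E is (up to a null set) the region enclosed by a counterclockwise simple closed
curve made of n edges of constant curvature, all interior angles equal to 120 degrees
(i.e. the tangent turns by pi/3 at each vertex). With counterclockwise orientation,
\<kappa> i > 0 means a convex circular edge, \<kappa> i < 0 a concave one, \<kappa> i = 0 a flat one.\<close>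
definition curvilinear_polygon_120 ::
  "nat \<Rightarrow> (nat \<Rightarrow> complex) \<Rightarrow> (nat \<Rightarrow> real) \<Rightarrow> (nat \<Rightarrow> real) \<Rightarrow> (nat \<Rightarrow> real)
     \<Rightarrow> complex set \<Rightarrow> bool" where
  "curvilinear_polygon_120 n p \<theta> \<kappa> len E \<longleftrightarrow>
     (let \<Gamma> = cpoly_path n p \<theta> \<kappa> len in
       (\<forall>i<n. 0 < len i \<and> \<bar>\<kappa> i\<bar> * len i < 2 * pi) \<and>
       (\<forall>i<n. ccurve (p i) (\<theta> i) (\<kappa> i) (len i) 1 = p (Suc i mod n)) \<and>
       (\<forall>i<n. cis (\<theta> (Suc i mod n)) = cis (\<theta> i + \<kappa> i * len i + pi / 3)) \<and>
       simple_path \<Gamma> \<and> pathfinish \<Gamma> = pathstart \<Gamma> \<and>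
       (\<forall>z\<in>inside (path_image \<Gamma>). winding_number \<Gamma> z = 1) \<and>
       ae_eq E (inside (path_image \<Gamma>)))"

definition reuleaux_triangle :: "complex set \<Rightarrow> bool" where
  "reuleaux_triangle E \<longleftrightarrow>
     (\<exists>p \<theta> \<kappa> len. curvilinear_polygon_120 3 p \<theta> \<kappa> len E \<and>
        (\<forall>i<3. \<kappa> i \<noteq> 0 \<and> \<kappa> i = \<kappa> 0))"

definition curvilinear_enneagon_6_3 :: "complex set \<Rightarrow> bool" where
  "curvilinear_enneagon_6_3 E \<longleftrightarrow>
     (\<exists>p \<theta> \<kappa> len. curvilinear_polygon_120 9 p \<theta> \<kappa> len E \<and>
        card {i. i < 9 \<and> \<kappa> i = 0} = 6 \<and> card {i. i < 9 \<and> \<kappa> i < 0} = 3)"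

definition reg_hexagon :: "real \<Rightarrow> complex set" where
  "reg_hexagon s = convex hull {complex_of_real s * cis (real k * pi / 3) | k. k < (6::nat)}"

definition honeycomb_lattice :: "real \<Rightarrow> complex set" where
  "honeycomb_lattice s = {of_int m * complex_of_real (sqrt 3 * s) * cis (pi / 6)
                          + of_int n * complex_of_real (sqrt 3 * s) * \<i> | m n. True}"

definition reuleaux_at :: "complex \<Rightarrow> real \<Rightarrow> complex set" where
  "reuleaux_at c t = (\<Inter>j<(3::nat). cball (c + complex_of_real t * cis (2 * pi * real j / 3)) (sqrt 3 * t))"

definition cut_hexagon :: "real \<Rightarrow> real \<Rightarrow> complex set" where
  "cut_hexagon s t = reg_hexagon s -
     (\<Union>j<(3::nat). reuleaux_at (complex_of_real s * cis (2 * pi * real j / 3)) t)"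

definition isometry_plane :: "(complex \<Rightarrow> complex) \<Rightarrow> bool" where
  "isometry_plane \<psi> \<longleftrightarrow>
     (\<exists>a c. cmod c = 1 \<and> (\<psi> = (\<lambda>z. a + c * z) \<or> \<psi> = (\<lambda>z. a + c * cnj z)))"

end

theory Submission
  imports Defs
begin

text \<open>A region bounded by finitely many arcs is recovered almost everywhere from the sum of the Cauchy
integrals of its edges, so perimeter, area and equality of regions up to null sets can all be read off from a
chain of arcs. In a periodic tiling the chains of all tiles cancel; testing this cancellation on the circle
of an edge of \<open>E 1\<close> shows that each concave edge of \<open>E 2\<close> is a reversed lattice translate of exactly one edge of
\<open>E 1\<close>. Prolonging the flat edges of \<open>E 2\<close> by the circumradius \<open>t\<close> of the Reuleaux triangle turns \<open>E 2\<close> into an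
equiangular hexagon, three corners of which are lattice translates of the centre of \<open>E 1\<close>. Comparing the area of this hexagon
with the covolume forces opposite sides to be equal. If the sides are \<open>a\<close>, \<open>b\<close>, \<open>c\<close>, the
perimeter of \<open>E 2\<close> is \<open>2 (a + b + c)\<close> plus a quantity depending on \<open>E 1\<close> only, while the total area fixes
\<open>ab + bc + ca = 3 s\<^sup>2\<close>. The honeycomb of side \<open>s\<close> with a copy of \<open>E 1\<close> at every other vertex is a competitor of the same
areas, so \<open>a + b + c \<le> 3 s\<close> and hence \<open>a = b = c = s\<close>.\<close>

subsection \<open>Test functions and the regularised Cauchy kernel\<close>

text \<open>The perimeter is a supremum over test fields and the tiles are known only up to null
  sets, so boundaries are encoded by an identity that holds almost everywhere. It is linear and
  ignores the order of the edges: chains can be translated, reversed, cut and cancelled term by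
  term. The competitor never has to be shown to have a simple boundary, since an upper bound for its
  perimeter is enough. The circumradius appears because three angles of 120 degrees meet at a vertex
  of the Reuleaux triangle, so the flat edge leaving that vertex runs along the ray from the centre.
  Opposite sides agree for an arithmetic reason. The distinguished corners differ by lattice
  vectors, whose determinant is an integer multiple of the covolume. This multiple is
  \<open>1 + d^2 / H\<close>, where \<open>d\<close> is the difference of opposite sides and
  \<open>H\<close>, proportional to the area of the hexagon, is larger than \<open>d^2\<close>; so
  \<open>d = 0\<close>. The last step is the equality case of
  \<open>(a + b + c)^2 >= 3 (ab + bc + ca)\<close>.\<close>

definition C1c :: "(complex \<Rightarrow> complex) \<Rightarrow> bool" where
  "C1c f \<longleftrightarrow> (\<forall>x. f differentiable at x) \<and>
     (\<forall>b\<in>Basis. continuous_on UNIV (\<lambda>x. frechet_derivative f (at x) b)) \<and>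
     bounded {x. f x \<noteq> 0}"

definition dbar :: "(complex \<Rightarrow> complex) \<Rightarrow> complex \<Rightarrow> complex" where
  "dbar f z = (frechet_derivative f (at z) 1 + \<i> * frechet_derivative f (at z) \<i>) / 2"

lemma lborel_integral_translate:
  fixes h :: "'a::euclidean_space \<Rightarrow> 'b::{banach,second_countable_topology}"
  assumes "h \<in> borel_measurable borel"
  shows "integral\<^sup>L lborel (\<lambda>z. h (z + c)) = integral\<^sup>L lborel h"
proof -
  have "integral\<^sup>L lborel h = integral\<^sup>L (distr lborel borel ((+) c)) h"
    by (simp only: lborel_distr_plus)
  also have "\<dots> = integral\<^sup>L lborel (\<lambda>z. h (c + z))"
    by (rule integral_distr) (use assms in auto)
  finally show ?thesis by (simp add: add.commute)
qed

lemma ball_cball_sets [measurable]: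
  "ball (w::complex) e \<in> sets borel" "cball (w::complex) e \<in> sets borel"
  by auto

lemma integrable_bounded_support:
  fixes h :: "'a::euclidean_space \<Rightarrow> 'b::{banach,second_countable_topology}"
  assumes m: "h \<in> borel_measurable borel" and b: "\<And>z. norm (h z) \<le> B"
    and s: "\<And>z. norm z > \<rho> \<Longrightarrow> h z = 0"
  shows "integrable lborel h"
proof (rule integrableI_bounded_set[where A="cball 0 \<rho>" and B=B])
  show "emeasure lborel (cball 0 \<rho> :: 'a set) < \<infinity>"
    using emeasure_bounded_finite[OF bounded_cball] by auto
qed (use assms in \<open>auto simp: not_le\<close>)

lemma has_vector_derivative_at_0_quotient:
  fixes f :: "real \<Rightarrow> 'a::real_normed_vector"
  assumes "(f has_vector_derivative d) (at 0)"
  shows "((\<lambda>s. (f s - f 0) /\<^sub>R s) \<longlongrightarrow> d) (at 0)"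
proof -
  have "((\<lambda>s. (f s - f 0 - s *\<^sub>R d) /\<^sub>R \<bar>s\<bar>) \<longlongrightarrow> 0) (at 0)"
    using assms by (simp add: has_vector_derivative_def has_derivative_at_within)
  then have "((\<lambda>s. norm ((f s - f 0 - s *\<^sub>R d) /\<^sub>R \<bar>s\<bar>)) \<longlongrightarrow> 0) (at 0)"
    by (rule tendsto_norm_zero)
  moreover have "\<forall>\<^sub>F s in at 0. norm ((f s - f 0 - s *\<^sub>R d) /\<^sub>R \<bar>s\<bar>) = norm ((f s - f 0) /\<^sub>R s - d)"
  proof (rule eventually_at_filter[THEN iffD2], rule always_eventually, intro allI impI)
    fix s :: real assume s: "s \<noteq> 0"
    have "(f s - f 0) /\<^sub>R s - d = (f s - f 0 - s *\<^sub>R d) /\<^sub>R s"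
      using s by (simp add: scaleR_right_diff_distrib)
    then show "norm ((f s - f 0 - s *\<^sub>R d) /\<^sub>R \<bar>s\<bar>) = norm ((f s - f 0) /\<^sub>R s - d)"
      by simp
  qed
  ultimately have "((\<lambda>s. norm ((f s - f 0) /\<^sub>R s - d)) \<longlongrightarrow> 0) (at 0)"
    by (simp add: tendsto_cong)
  then show ?thesis by (simp add: tendsto_norm_zero_iff LIM_zero_iff)
qed

text \<open>Difference quotients of an integrable function have integral zero by translation
  invariance, and the Lipschitz constant dominates them. Asking for the derivative only almost
  everywhere matters: the regularised kernel below is not differentiable on a circle.\<close>

lemma integral_directional_derivative_eq_0:
  fixes h h' :: "complex \<Rightarrow> complex"
  assumes lip: "\<And>z w. norm (h z - h w) \<le> L * norm (z - w)"
    and supp: "\<And>z. norm z \<ge> \<rho> \<Longrightarrow> h z = 0"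
    and meas: "h' \<in> borel_measurable borel"
    and der: "AE z in lborel. ((\<lambda>s::real. h (z + s *\<^sub>R b)) has_vector_derivative h' z) (at 0)"
  shows "integral\<^sup>L lborel h' = 0" "integrable lborel h'"
proof -
  have L: "0 \<le> L" using lip[of 1 0] norm_ge_zero[of "h 1 - h 0"] by (simp del: norm_ge_zero)
  have cont: "continuous_on UNIV h"
    by (rule lipschitz_on_continuous_on[of L]) (auto simp: lipschitz_on_def dist_norm L lip)
  then have hm[measurable]: "h \<in> borel_measurable borel" by (rule borel_measurable_continuous_onI)
  have bd: "norm (h z) \<le> L * (\<bar>\<rho>\<bar> + \<bar>\<rho>\<bar>)" for z
  proof (cases "norm z \<ge> \<rho>")
    case True then show ?thesis using supp L by simp
  next
    case False
    \<comment> \<open>A real point outside the support; the Lipschitz condition measured from it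
      bounds \<open>h\<close> everywhere.\<close>
    have "h (of_real \<bar>\<rho>\<bar>) = 0" by (rule supp) simp
    then have "norm (h z) \<le> L * norm (z - of_real \<bar>\<rho>\<bar>)" using lip[of z "of_real \<bar>\<rho>\<bar>"] by simp
    also have "\<dots> \<le> L * (\<bar>\<rho>\<bar> + \<bar>\<rho>\<bar>)"
      using norm_triangle_ineq4[of z "of_real \<bar>\<rho>\<bar>"] False
      by (intro mult_left_mono L) (auto)
    finally show ?thesis .
  qed
  have hint: "integrable lborel h"
    by (rule integrable_bounded_support[OF hm bd, of \<rho>]) (use supp in auto)
  define q where "q n z = (real (Suc n)) *\<^sub>R (h (z + (1 / real (Suc n)) *\<^sub>R b) - h z)" for n z
  have hint': "integrable lborel (\<lambda>z. h (z + c))" for c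
  proof (rule integrable_bounded_support[where B="L * (\<bar>\<rho>\<bar> + \<bar>\<rho>\<bar>)" and \<rho>="\<rho> + norm c"])
    fix z :: complex assume "norm z > \<rho> + norm c"
    then have "norm (z + c) \<ge> \<rho>" using norm_triangle_ineq4[of "z+c" c] by simp
    then show "h (z + c) = 0" by (rule supp)
  qed (use bd in auto)
  have q0: "integral\<^sup>L lborel (q n) = 0" for n
    proof -
    have "integral\<^sup>L lborel (q n) = real (Suc n) *\<^sub>R (integral\<^sup>L lborel (\<lambda>z. h (z + (1 / real (Suc n)) *\<^sub>R b)) - integral\<^sup>L lborel h)"
      unfolding q_def by (subst integral_scaleR_right) (simp only: Bochner_Integration.integral_diff[OF hint' hint])
    then show ?thesis by (simp only: lborel_integral_translate[OF hm]) simp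
  qed
  have qlim: "AE z in lborel. (\<lambda>n. q n z) \<longlonglongrightarrow> h' z"
  proof (rule AE_mp[OF der], rule AE_I2, rule impI)
    fix z assume "((\<lambda>s::real. h (z + s *\<^sub>R b)) has_vector_derivative h' z) (at 0)"
    then have l: "((\<lambda>s. (h (z + s *\<^sub>R b) - h z) /\<^sub>R s) \<longlongrightarrow> h' z) (at 0)"
      using has_vector_derivative_at_0_quotient[of "\<lambda>s. h (z + s *\<^sub>R b)"] by simp
    have "filterlim (\<lambda>n. 1 / real (Suc n)) (at 0) sequentially"
      using LIMSEQ_inverse_real_of_nat by (simp add: filterlim_at inverse_eq_divide)
    from filterlim_compose[OF l this] show "(\<lambda>n. q n z) \<longlonglongrightarrow> h' z"
      unfolding q_def by simp
  qed
  let ?w = "\<lambda>z. indicator (cball 0 (\<rho> + norm b)) z * (L * norm b)"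
  have bound: "AE z in lborel. norm (q n z) \<le> ?w z" for n
  proof (rule AE_I2)
    fix z
    show "norm (q n z) \<le> ?w z"
    proof (cases "norm z \<le> \<rho> + norm b")
      case True
      have "norm (q n z) \<le> real (Suc n) * (L * norm ((1 / real (Suc n)) *\<^sub>R b))"
        unfolding q_def using lip[of "z + (1 / real (Suc n)) *\<^sub>R b" z]
        by (simp only: norm_scaleR abs_of_nat) (rule mult_left_mono, simp_all)
      also have "\<dots> = L * norm b" by (simp del: of_nat_Suc)
      finally show ?thesis using True by simp
    next
      case False
      have "norm ((1 / real (Suc n)) *\<^sub>R b) \<le> norm b" by (simp add: divide_le_eq algebra_simps)
      then have "norm (z + (1 / real (Suc n)) *\<^sub>R b) \<ge> \<rho>"
        using False norm_diff_ineq[of z "(1 / real (Suc n)) *\<^sub>R b"] by linarith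
      moreover have "norm z \<ge> \<rho>" using False norm_ge_zero[of b] by linarith
      ultimately show ?thesis unfolding q_def using supp False by simp
    qed
  qed
  have wint: "integrable lborel ?w"
    by (rule integrable_bounded_support[where B="\<bar>L * norm b\<bar>" and \<rho>="\<rho> + norm b"])
       (auto simp: indicator_def)
  have m2: "q n \<in> borel_measurable lborel" for n unfolding q_def by measurable
  have m1: "h' \<in> borel_measurable lborel" using meas by simp
  have "(\<lambda>n. integral\<^sup>L lborel (q n)) \<longlonglongrightarrow> integral\<^sup>L lborel h'"
    by (rule integral_dominated_convergence[OF m1 m2 wint qlim bound])
  then show "integral\<^sup>L lborel h' = 0" using q0 by (simp add: LIMSEQ_const_iff)
  show "integrable lborel h'"
    by (rule integrable_dominated_convergence[OF m1 m2 wint qlim bound])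
qed

text \<open>The Cauchy kernel \<open>1 / z\<close> with its singularity replaced by
  \<open>cnj z / e^2\<close> on the disc of radius \<open>e\<close>. The two formulas agree on the
  circle, so the kernel is Lipschitz; its dbar derivative is \<open>1 / e^2\<close> inside and zero
  outside.\<close>

definition ckernel :: "real \<Rightarrow> complex \<Rightarrow> complex" where
  "ckernel e z = cnj z / of_real (max ((norm z)\<^sup>2) (e\<^sup>2))"

lemma ckernel_out: assumes "e \<le> norm z" "0 < e" shows "ckernel e z = 1 / z"
proof -
  have "ckernel e z = cnj z / (z * cnj z)"
    using assms by (simp only: ckernel_def max_absorb1 power_mono complex_norm_square[symmetric] less_imp_le)
  moreover have "z \<noteq> 0" using assms by auto
  ultimately show ?thesis by simp
qed

lemma ckernel_in: "norm z \<le> e \<Longrightarrow> ckernel e z = cnj z / of_real (e\<^sup>2)"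
  by (simp add: ckernel_def max_absorb2 power_mono)

lemma norm_ckernel_le: "0 < e \<Longrightarrow> norm (ckernel e z) \<le> 1 / e"
proof (cases "e \<le> norm z")
  case True assume "0 < e" then show ?thesis using True by (simp add: ckernel_out norm_divide frac_le)
next
  case False assume "0 < e" then show ?thesis using False
    by (simp add: ckernel_in norm_divide norm_power power2_eq_square field_simps norm_mult)
qed

lemma norm_ckernel_le': "0 < e \<Longrightarrow> norm (ckernel e z) \<le> 1 / norm z"
proof (cases "e \<le> norm z")
  case True assume "0 < e" then show ?thesis using True by (simp add: ckernel_out norm_divide)
next
  case False assume "0 < e" then show ?thesis using False
    apply (cases "z = 0") by (auto simp add: ckernel_in norm_divide norm_mult power2_eq_square field_simps intro!: mult_mono)
qed

text \<open>The case of two points separated by the circle of radius \<open>e\<close>. Inserting the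
  inner formula at \<open>w\<close> leaves a discrepancy of scalar factors governed by
  \<open>norm w - e\<close>, which is at most the distance of the points.\<close>

lemma ckernel_lipschitz_aux:
  assumes e: "0 < e" and z: "norm z \<le> e" and w: "e \<le> norm w"
  shows "norm (ckernel e z - ckernel e w) \<le> 3 / e\<^sup>2 * norm (z - w)"
proof -
  have w0: "w \<noteq> 0" using e w by auto
  have c: "ckernel e w = cnj w / of_real ((norm w)\<^sup>2)"
    using e w by (simp add: ckernel_def max_absorb1 power_mono)
  have "ckernel e z - ckernel e w = (cnj z - cnj w) / of_real (e\<^sup>2) + cnj w * of_real (1 / e\<^sup>2 - 1 / (norm w)\<^sup>2)"
    unfolding c ckernel_in[OF z] by (simp add: diff_divide_distrib algebra_simps)
  also have "norm \<dots> \<le> norm (z - w) / e\<^sup>2 + norm w * \<bar>1 / e\<^sup>2 - 1 / (norm w)\<^sup>2\<bar>"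
    by (rule order_trans[OF norm_triangle_ineq])
       (simp only: norm_divide norm_mult norm_of_real complex_mod_cnj complex_cnj_diff[symmetric], simp)
  also have "norm w * \<bar>1 / e\<^sup>2 - 1 / (norm w)\<^sup>2\<bar> = (norm w - e) * ((norm w + e) / norm w) / e\<^sup>2"
  proof -
    have "1 / (norm w)\<^sup>2 \<le> 1 / e\<^sup>2" using e w by (simp add: frac_le power_mono)
    then have "\<bar>1 / e\<^sup>2 - 1 / (norm w)\<^sup>2\<bar> = 1 / e\<^sup>2 - 1 / (norm w)\<^sup>2" by simp
    then show ?thesis using e w0 by (simp add: field_simps power2_eq_square)
  qed
  also have "\<dots> \<le> (norm w - e) * 2 / e\<^sup>2"
    using e w w0 by (intro divide_right_mono mult_left_mono) (auto simp: field_simps)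
  also have "\<dots> \<le> norm (z - w) * 2 / e\<^sup>2"
    using norm_triangle_ineq3[of w z] z
    by (intro divide_right_mono mult_right_mono) (auto simp: norm_minus_commute)
  finally show ?thesis by (simp add: field_simps)
qed

lemma ckernel_lipschitz:
  assumes e: "0 < e"
  shows "norm (ckernel e z - ckernel e w) \<le> 3 / e\<^sup>2 * norm (z - w)"
proof -
  have key: "norm (z - w) / e\<^sup>2 \<le> 3 / e\<^sup>2 * norm (z - w)" using e by (simp add: field_simps)
  consider "norm z \<le> e" "norm w \<le> e" | "norm z \<le> e" "e \<le> norm w" | "e \<le> norm z" "norm w \<le> e" | "e \<le> norm z" "e \<le> norm w"
    by linarith
  then show ?thesis
  proof cases
    case 1
    have "norm (ckernel e z - ckernel e w) = norm (z - w) / e\<^sup>2"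
      unfolding ckernel_in[OF 1(1)] ckernel_in[OF 1(2)] diff_divide_distrib[symmetric] complex_cnj_diff[symmetric]
      by (simp only: norm_divide complex_mod_cnj norm_of_real) simp
    then show ?thesis using key by simp
  next
    case 2 then show ?thesis using ckernel_lipschitz_aux[OF e] by simp
  next
    case 3 then show ?thesis using ckernel_lipschitz_aux[OF e, of w z] by (simp add: norm_minus_commute)
  next
    case 4
    then have nz: "z \<noteq> 0" "w \<noteq> 0" using e by auto
    have "1 / z - 1 / w = (w - z) / (z * w)" using nz by (simp add: field_simps)
    then have "norm (ckernel e z - ckernel e w) = norm (z - w) / (norm z * norm w)"
      using 4 e by (simp add: ckernel_out norm_divide norm_mult norm_minus_commute)
    also have "\<dots> \<le> norm (z - w) / e\<^sup>2"
      using 4 e by (intro divide_left_mono) (auto simp: power2_eq_square intro!: mult_mono mult_pos_pos)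
    finally show ?thesis using key by linarith
  qed
qed

lemma ckernel_measurable[measurable]: "ckernel e \<in> borel_measurable borel"
  unfolding ckernel_def divide_inverse by (intro borel_measurable_times borel_measurable_inverse borel_measurable_continuous_onI continuous_intros)

lemma ckernel_deriv:
  assumes e: "0 < e" and z: "norm z \<noteq> e"
  shows "((\<lambda>s::real. ckernel e (z + s *\<^sub>R b)) has_vector_derivative
     (if norm z < e then cnj b / of_real (e\<^sup>2) else - b / z\<^sup>2)) (at 0)"
proof (cases "norm z < e")
  case True
  have ev: "\<forall>\<^sub>F s in nhds (0::real). norm (z + s *\<^sub>R b) < e"
  proof -
    have "((\<lambda>s::real. norm (z + s *\<^sub>R b)) \<longlongrightarrow> norm (z + 0 *\<^sub>R b)) (nhds 0)"
      by (intro tendsto_intros filterlim_ident)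
    then show ?thesis using True by (auto dest: order_tendstoD(2))
  qed
  have "((\<lambda>s::real. (cnj z + s *\<^sub>R cnj b) / of_real (e\<^sup>2)) has_vector_derivative cnj b / of_real (e\<^sup>2)) (at 0)"
    unfolding has_vector_derivative_def divide_inverse by (auto intro!: derivative_eq_intros)
  moreover have "\<forall>\<^sub>F s in nhds (0::real). ckernel e (z + s *\<^sub>R b) = (cnj z + s *\<^sub>R cnj b) / of_real (e\<^sup>2)"
    using ev by eventually_elim (simp add: ckernel_in scaleR_conv_of_real)
  ultimately have "((\<lambda>s::real. ckernel e (z + s *\<^sub>R b)) has_vector_derivative cnj b / of_real (e\<^sup>2)) (at 0)"
    by (subst has_vector_derivative_cong_ev[where g="\<lambda>s. (cnj z + s *\<^sub>R cnj b) / of_real (e\<^sup>2)"])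
       (auto dest: eventually_nhds_x_imp_x elim: eventually_mono)
  then show ?thesis using True by simp
next
  case False
  then have zz: "e < norm z" using z by simp
  then have z0: "z \<noteq> 0" using e by auto
  have ev: "\<forall>\<^sub>F s in nhds (0::real). norm (z + s *\<^sub>R b) > e"
  proof -
    have "((\<lambda>s::real. norm (z + s *\<^sub>R b)) \<longlongrightarrow> norm (z + 0 *\<^sub>R b)) (nhds 0)"
      by (intro tendsto_intros filterlim_ident)
    then show ?thesis using zz by (auto dest: order_tendstoD(1))
  qed
  have "((\<lambda>s::real. inverse (z + s *\<^sub>R b)) has_derivative (\<lambda>s. - (s *\<^sub>R b) * (1 / z\<^sup>2))) (at 0)"
    using z0 by (auto intro!: derivative_eq_intros simp: power2_eq_square field_simps)
  then have "((\<lambda>s::real. inverse (z + s *\<^sub>R b)) has_vector_derivative - b / z\<^sup>2) (at 0)"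
    unfolding has_vector_derivative_def by (simp add: divide_inverse)
  moreover have "\<forall>\<^sub>F s in nhds (0::real). ckernel e (z + s *\<^sub>R b) = inverse (z + s *\<^sub>R b)"
    using ev by eventually_elim (use e in \<open>simp add: ckernel_out inverse_eq_divide\<close>)
  ultimately have "((\<lambda>s::real. ckernel e (z + s *\<^sub>R b)) has_vector_derivative - b / z\<^sup>2) (at 0)"
    by (subst has_vector_derivative_cong_ev[where g="\<lambda>s. inverse (z + s *\<^sub>R b)"])
       (auto dest: eventually_nhds_x_imp_x elim: eventually_mono)
  then show ?thesis using False by simp
qed


lemma C1c_has_derivative: "C1c f \<Longrightarrow> (f has_derivative frechet_derivative f (at z)) (at z)"
  using frechet_derivative_works unfolding C1c_def by blast

lemma C1c_continuous: "C1c f \<Longrightarrow> continuous_on UNIV f"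
  by (intro continuous_at_imp_continuous_on ballI has_derivative_continuous[OF C1c_has_derivative])

lemma C1c_linear: "C1c f \<Longrightarrow> linear (frechet_derivative f (at z))"
  by (rule has_derivative_linear[OF C1c_has_derivative])

lemma C1c_support:
  assumes "C1c f"
  obtains \<rho> where "\<rho> > 0" "\<And>z. norm z \<ge> \<rho> \<Longrightarrow> f z = 0"
    "\<And>z v. norm z \<ge> \<rho> \<Longrightarrow> frechet_derivative f (at z) v = 0"
proof -
  obtain a where a: "\<And>x. f x \<noteq> 0 \<Longrightarrow> norm x \<le> a"
    using assms unfolding C1c_def bounded_iff by blast
  show thesis
  proof (rule that[of "\<bar>a\<bar> + 1"])
    fix z :: complex assume z: "norm z \<ge> \<bar>a\<bar> + 1"
    show "f z = 0" using a[of z] z by fastforce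
    have "((\<lambda>_. 0) has_derivative (\<lambda>v. 0)) (at z)" by simp
    then have "(f has_derivative (\<lambda>v. 0)) (at z)"
    proof (rule has_derivative_transform_within_open[of _ _ _ _ "- cball 0 \<bar>a\<bar>"])
      show "\<And>x. x \<in> - cball 0 \<bar>a\<bar> \<Longrightarrow> 0 = f x" using a by force
    qed (use z in auto)
    then have "frechet_derivative f (at z) = (\<lambda>v. 0)" by (rule frechet_derivative_at[symmetric])
    then show "frechet_derivative f (at z) v = 0" for v by simp
  qed simp
qed

lemma C1c_cont_bounded:
  fixes f g :: "complex \<Rightarrow> complex"
  assumes "continuous_on UNIV g" "\<And>z. norm z \<ge> \<rho> \<Longrightarrow> g z = 0"
  obtains B where "B \<ge> 0" "\<And>z. norm (g z) \<le> B"
proof -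
  have "compact (g ` cball 0 \<rho>)"
    by (rule compact_continuous_image) (use assms(1) continuous_on_subset in blast, simp)
  then obtain B where B: "\<And>z. z \<in> cball 0 \<rho> \<Longrightarrow> norm (g z) \<le> B"
    by (metis compact_imp_bounded bounded_iff imageI)
  show thesis
  proof (rule that[of "\<bar>B\<bar>"])
    fix z show "norm (g z) \<le> \<bar>B\<bar>"
      using B[of z] assms(2)[of z] by (cases "norm z \<le> \<rho>") fastforce+
  qed simp
qed

lemma C1c_bounds:
  assumes f: "C1c f"
  obtains \<rho> L where "\<rho> > 0" "L \<ge> 0" "\<And>z. norm z \<ge> \<rho> \<Longrightarrow> f z = 0"
    "\<And>z v. norm z \<ge> \<rho> \<Longrightarrow> frechet_derivative f (at z) v = 0"
    "\<And>z. norm (f z) \<le> L" "\<And>z v. norm (frechet_derivative f (at z) v) \<le> L * norm v"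
    "\<And>z w. norm (f z - f w) \<le> L * norm (z - w)"
proof -
  obtain \<rho> where \<rho>: "\<rho> > 0" "\<And>z. norm z \<ge> \<rho> \<Longrightarrow> f z = 0"
    "\<And>z v. norm z \<ge> \<rho> \<Longrightarrow> frechet_derivative f (at z) v = 0" using C1c_support[OF f] by blast
  obtain B where B: "B \<ge> 0" "\<And>z. norm (f z) \<le> B"
    by (rule C1c_cont_bounded[OF C1c_continuous[OF f] \<rho>(2)]) auto
  have c: "continuous_on UNIV (\<lambda>z. frechet_derivative f (at z) 1)"
          "continuous_on UNIV (\<lambda>z. frechet_derivative f (at z) \<i>)"
    using f by (auto simp: C1c_def Basis_complex_def)
  obtain B1 where B1: "B1 \<ge> 0" "\<And>z. norm (frechet_derivative f (at z) 1) \<le> B1"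
    by (rule C1c_cont_bounded[OF c(1) \<rho>(3)]) auto
  obtain B2 where B2: "B2 \<ge> 0" "\<And>z. norm (frechet_derivative f (at z) \<i>) \<le> B2"
    by (rule C1c_cont_bounded[OF c(2) \<rho>(3)]) auto
  define L where "L = B + B1 + B2"
  have d: "norm (frechet_derivative f (at z) v) \<le> L * norm v" for z v
  proof -
    have "frechet_derivative f (at z) v = frechet_derivative f (at z) (Re v *\<^sub>R 1 + Im v *\<^sub>R \<i>)"
      by (rule arg_cong[where f="frechet_derivative f (at z)"]) (simp add: complex_eq_iff)
    also have "\<dots> = Re v *\<^sub>R frechet_derivative f (at z) 1 + Im v *\<^sub>R frechet_derivative f (at z) \<i>"
      using C1c_linear[OF f] by (simp only: linear_add linear_scale)
    also have "norm \<dots> \<le> \<bar>Re v\<bar> * B1 + \<bar>Im v\<bar> * B2"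
      by (rule order_trans[OF norm_triangle_ineq]) (auto intro!: add_mono mult_left_mono B1 B2)
    also have "\<dots> \<le> norm v * B1 + norm v * B2"
      by (intro add_mono mult_right_mono abs_Re_le_cmod abs_Im_le_cmod B1 B2)
    also have "\<dots> \<le> L * norm v" using B by (simp add: L_def algebra_simps)
    finally show ?thesis .
  qed
  have L0: "L \<ge> 0" using B B1 B2 by (simp add: L_def)
  have "norm (f z - f w) \<le> L * norm (z - w)" for z w
  proof (rule differentiable_bound[where S=UNIV and f'="\<lambda>x. frechet_derivative f (at x)"])
    show "onorm (frechet_derivative f (at x)) \<le> L" for x
      by (rule onorm_bound[OF L0 d])
  qed (use C1c_has_derivative[OF f] has_derivative_at_withinI in auto)
  moreover have "norm (f z) \<le> L" for z
    using B(2)[of z] B1(1) B2(1) by (simp add: L_def)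
  ultimately show thesis using that[OF \<rho>(1) L0 \<rho>(2,3)] d by blast
qed

lemma dbar_continuous: "C1c f \<Longrightarrow> continuous_on UNIV (dbar f)"
  unfolding dbar_def by (intro continuous_intros) (auto simp: C1c_def Basis_complex_def)

lemma C1c_line_derivative:
  assumes "C1c f"
  shows "((\<lambda>s::real. f (z + s *\<^sub>R b)) has_vector_derivative frechet_derivative f (at z) b) (at 0)"
proof -
  have "((\<lambda>s::real. z + s *\<^sub>R b) has_derivative (\<lambda>s. s *\<^sub>R b)) (at 0)"
    by (auto intro!: derivative_eq_intros)
  from has_derivative_compose[OF this, of f "frechet_derivative f (at z)"]
  have "((\<lambda>s::real. f (z + s *\<^sub>R b)) has_derivative (\<lambda>s. frechet_derivative f (at z) (s *\<^sub>R b))) (at 0)"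
    using C1c_has_derivative[OF assms] by simp
  then show ?thesis
    unfolding has_vector_derivative_def using linear_scale[OF C1c_linear[OF assms]] by simp
qed

text \<open>The dbar derivative of the product \<open>f z * ckernel e (z - w)\<close> integrates to
  zero; the term in which the kernel is differentiated survives only on the disc, where it equals
  \<open>f z / e^2\<close>.\<close>

lemma integral_dbar_ckernel:
  assumes f: "C1c f" and e: "0 < e"
  shows "integral\<^sup>L lborel (\<lambda>z. dbar f z * ckernel e (z - w)) =
     - integral\<^sup>L lborel (\<lambda>z. indicator (ball w e) z *\<^sub>R (f z / of_real (e\<^sup>2)))"
proof -
  obtain \<rho> L where b: "\<rho> > 0" "L \<ge> 0" "\<And>z. norm z \<ge> \<rho> \<Longrightarrow> f z = 0"
    "\<And>z v. norm z \<ge> \<rho> \<Longrightarrow> frechet_derivative f (at z) v = 0"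
    "\<And>z. norm (f z) \<le> L" "\<And>z v. norm (frechet_derivative f (at z) v) \<le> L * norm v"
    "\<And>z w. norm (f z - f w) \<le> L * norm (z - w)" using C1c_bounds[OF f] by metis
  have fm[measurable]: "f \<in> borel_measurable borel"
    by (rule borel_measurable_continuous_onI[OF C1c_continuous[OF f]])
  have fdm[measurable]: "(\<lambda>z. frechet_derivative f (at z) b) \<in> borel_measurable borel" if "b \<in> Basis" for b
    using f that by (intro borel_measurable_continuous_onI) (auto simp: C1c_def)
  define h where "h z = f z * ckernel e (z - w)" for z
  define K where "K b z = (if norm (z - w) < e then cnj b / of_real (e\<^sup>2) else - b / (z - w)\<^sup>2)" for b z
  define h' where "h' b z = frechet_derivative f (at z) b * ckernel e (z - w) + f z * K b z" for b z
  have lip: "norm (h z - h u) \<le> (L / e + L * (3 / e\<^sup>2)) * norm (z - u)" for z u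
  proof -
    have "h z - h u = (f z - f u) * ckernel e (z - w) + f u * (ckernel e (z - w) - ckernel e (u - w))"
      by (simp add: h_def algebra_simps)
    also have "norm \<dots> \<le> norm (f z - f u) * norm (ckernel e (z - w)) + norm (f u) * norm (ckernel e (z - w) - ckernel e (u - w))"
      by (rule order_trans[OF norm_triangle_ineq]) (simp add: norm_mult)
    also have "\<dots> \<le> (L * norm (z - u)) * (1 / e) + L * (3 / e\<^sup>2 * norm (z - u))"
      using ckernel_lipschitz[OF e, of "z - w" "u - w"] b
      by (intro add_mono mult_mono norm_ckernel_le e) auto
    finally show ?thesis by (simp add: algebra_simps)
  qed
  have supp: "norm z \<ge> \<rho> \<Longrightarrow> h z = 0" for z using b by (simp add: h_def)
  have K_m[measurable]: "K b \<in> borel_measurable borel" for b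
    unfolding K_def by measurable
  have h'_m: "h' b \<in> borel_measurable borel" if "b \<in> Basis" for b
    unfolding h'_def using fdm[OF that] by measurable
  have sph: "AE z in lborel. norm (z - w) \<noteq> e"
  proof -
    have "sphere w e \<in> null_sets lebesgue" using negligible_sphere negligible_iff_null_sets by blast
    then have "sphere w e \<in> null_sets lborel" by (simp add: null_sets_def null_sets_completion_iff[of _ lborel])
    then show ?thesis by (rule AE_I') (auto simp: dist_norm norm_minus_commute)
  qed
  have der: "AE z in lborel. ((\<lambda>s::real. h (z + s *\<^sub>R b)) has_vector_derivative h' b z) (at 0)" for b
  proof (rule AE_mp[OF sph], rule AE_I2, rule impI)
    fix z assume z: "norm (z - w) \<noteq> e"
    have "((\<lambda>s::real. f (z + s *\<^sub>R b) * ckernel e ((z - w) + s *\<^sub>R b)) has_vector_derivative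
       f (z + 0 *\<^sub>R b) * K b z + frechet_derivative f (at z) b * ckernel e ((z - w) + 0 *\<^sub>R b)) (at 0)"
      unfolding K_def by (rule has_vector_derivative_mult[OF C1c_line_derivative[OF f] ckernel_deriv[OF e z]])
    then show "((\<lambda>s::real. h (z + s *\<^sub>R b)) has_vector_derivative h' b z) (at 0)"
      unfolding h_def h'_def by (simp add: algebra_simps)
  qed
  have i1: "integral\<^sup>L lborel (h' 1) = 0" "integrable lborel (h' 1)"
    using integral_directional_derivative_eq_0[OF lip supp h'_m der] by (auto simp: Basis_complex_def)
  have i2: "integral\<^sup>L lborel (h' \<i>) = 0" "integrable lborel (h' \<i>)"
    using integral_directional_derivative_eq_0[OF lip supp h'_m der] by (auto simp: Basis_complex_def)
  let ?g = "\<lambda>z. indicator (ball w e) z *\<^sub>R (f z / of_real (e\<^sup>2))"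
  have gi: "integrable lborel ?g"
  proof (rule integrable_bounded_support[where B="L / e\<^sup>2" and \<rho>=\<rho>])
    show "norm (?g z) \<le> L / e\<^sup>2" for z using b(5)[of z] b(2)
      by (auto simp: indicator_def norm_divide norm_power divide_right_mono)
    show "?g \<in> borel_measurable borel" by measurable
  qed (use b in auto)
  have eq: "dbar f z * ckernel e (z - w) = (h' 1 z + \<i> * h' \<i> z) / 2 - ?g z" for z
  proof (cases "norm (z - w) < e")
    case True
    then have "z \<in> ball w e" by (simp add: dist_norm norm_minus_commute)
    then show ?thesis using True by (simp add: dbar_def h'_def K_def field_simps)
  next
    case False
    then have "z \<notin> ball w e" by (simp add: dist_norm norm_minus_commute)
    then show ?thesis using False by (simp add: dbar_def h'_def K_def field_simps)
  qed
  have "integral\<^sup>L lborel (\<lambda>z. dbar f z * ckernel e (z - w))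
      = integral\<^sup>L lborel (\<lambda>z. (h' 1 z + \<i> * h' \<i> z) / 2) - integral\<^sup>L lborel ?g"
    unfolding eq using i1 i2 gi by (intro Bochner_Integration.integral_diff) auto
  also have "integral\<^sup>L lborel (\<lambda>z. (h' 1 z + \<i> * h' \<i> z) / 2) = 0"
    using i1 i2 by simp
  finally show ?thesis by simp
qed

subsection \<open>The Cauchy-Pompeiu formula\<close>

lemma emeasure_ball_complex:
  "0 \<le> r \<Longrightarrow> emeasure lborel (ball (w::complex) r) = ennreal (pi * r\<^sup>2)"
  by (simp add: emeasure_ball unit_ball_vol_2)

text \<open>At distance between \<open>(1/2)^(k+1)\<close> and \<open>(1/2)^k\<close> from
  \<open>w\<close> the integrand is at most \<open>2^(k+1)\<close>, and the disc of radius
  \<open>(1/2)^k\<close> has area \<open>pi * (1/4)^k\<close>: a geometric series. The point is that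
  the bound does not depend on \<open>w\<close>, as Fubini along an edge requires.\<close>

lemma nn_integral_inverse_norm_le:
  fixes w :: complex
  shows "(\<integral>\<^sup>+z. ennreal (indicator (cball 0 \<rho>) z / norm (z - w)) \<partial>lborel)
     \<le> emeasure lborel (cball (0::complex) \<rho>) + (\<Sum>k. ennreal (2 * pi * (1/2)^k))"
proof -
  let ?f = "\<lambda>k z. ennreal (2 ^ Suc k) * indicator (ball w ((1/2)^k)) z :: ennreal"
  have pw: "ennreal (indicator (cball 0 \<rho>) z / norm (z - w)) \<le> indicator (cball 0 \<rho>) z + (\<Sum>k. ?f k z)" for z
  proof -
    consider "z = w" | "norm (z - w) \<ge> 1" | "0 < norm (z - w)" "norm (z - w) < 1" by fastforce
    then show ?thesis
    proof cases
      case 1 then show ?thesis by simp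
    next
      case 2
      have "ennreal (indicator (cball 0 \<rho>) z / norm (z - w)) \<le> ennreal (indicator (cball 0 \<rho>) z)"
        using 2 by (intro ennreal_leI) (auto simp: indicator_def divide_le_eq)
      also have "\<dots> = indicator (cball 0 \<rho>) z" by (simp add: ennreal_indicator)
      finally show ?thesis by (simp add: add_increasing2)
    next
      case 3
      obtain n0 where n0: "(1/2::real) ^ n0 < norm (z - w)"
        using real_arch_pow_inv[OF 3(1), of "1/2"] by auto
      define n where "n = (LEAST n. (1/2::real) ^ n \<le> norm (z - w))"
      have n: "(1/2::real) ^ n \<le> norm (z - w)" unfolding n_def by (rule LeastI[of _ n0]) (use n0 in simp)
      then have "n \<noteq> 0" using 3 by (auto intro: ccontr)
      then obtain k where k: "n = Suc k" by (cases n) auto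
      have nk: "norm (z - w) < (1/2) ^ k"
        using not_less_Least[of k "\<lambda>n. (1/2::real) ^ n \<le> norm (z - w)"] k n_def by simp
      have "indicator (cball 0 \<rho>) z / norm (z - w) \<le> 1 / (1/2::real) ^ n"
        using n 3 by (intro frac_le) (auto simp: indicator_def)
      also have "\<dots> = 2 ^ Suc k" by (simp add: k power_divide)
      finally have "ennreal (indicator (cball 0 \<rho>) z / norm (z - w)) \<le> ?f k z"
        using nk by (simp add: dist_norm norm_minus_commute ennreal_leI)
      also have "?f k z \<le> (\<Sum>k. ?f k z)"
        by (rule order_trans[OF _ sum_le_suminf[OF summableI, of "{k}"]]) (auto simp del: sum_mult_indicator sum_indicator_mult)
      finally show ?thesis by (simp add: add_increasing)
    qed
  qed
  have "(\<integral>\<^sup>+z. ennreal (indicator (cball 0 \<rho>) z / norm (z - w)) \<partial>lborel)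
     \<le> (\<integral>\<^sup>+z. indicator (cball 0 \<rho>) z + (\<Sum>k. ?f k z) \<partial>lborel)"
    by (rule nn_integral_mono) (rule pw)
  also have "\<dots> = (\<integral>\<^sup>+z. indicator (cball (0::complex) \<rho>) z \<partial>lborel) + (\<integral>\<^sup>+z. (\<Sum>k. ?f k z) \<partial>lborel)"
    by (rule nn_integral_add) measurable
  also have "(\<integral>\<^sup>+z. (\<Sum>k. ?f k z) \<partial>lborel) = (\<Sum>k. \<integral>\<^sup>+z. ?f k z \<partial>lborel)"
    by (rule nn_integral_suminf) measurable
  also have "(\<lambda>k. \<integral>\<^sup>+z. ?f k z \<partial>lborel) = (\<lambda>k. ennreal (2 * pi * (1/2)^k))"
  proof
    fix k
    have "(\<integral>\<^sup>+z. ?f k z \<partial>lborel) = ennreal (2 ^ Suc k) * ennreal (pi * ((1/2)^k)\<^sup>2)"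
      by (simp add: nn_integral_cmult_indicator emeasure_ball_complex)
    also have "\<dots> = ennreal (2 * pi * (1/2)^k)"
      by (simp add: ennreal_mult'[symmetric] power2_eq_square power_divide field_simps)
    finally show "(\<integral>\<^sup>+z. ?f k z \<partial>lborel) = ennreal (2 * pi * (1/2)^k)" .
  qed
  finally show ?thesis by simp
qed

lemma integral_inverse_norm_bound:
  obtains C where "C \<ge> 0"
    "\<And>w::complex. integrable lborel (\<lambda>z. indicator (cball 0 \<rho>) z / norm (z - w))"
    "\<And>w::complex. integral\<^sup>L lborel (\<lambda>z. indicator (cball 0 \<rho>) z / norm (z - w)) \<le> C"
proof -
  define C where "C = emeasure lborel (cball (0::complex) \<rho>) + (\<Sum>k. ennreal (2 * pi * (1/2)^k))"
  have "(\<Sum>k. ennreal (2 * pi * (1/2)^k)) = ennreal (\<Sum>k. 2 * pi * (1/2)^k)"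
    by (rule suminf_ennreal2) (auto intro!: summable_mult summable_geometric)
  then have C: "C < \<infinity>"
    using emeasure_bounded_finite[OF bounded_cball, of "0::complex" \<rho>] by (simp add: C_def)
  have b: "(\<integral>\<^sup>+z. ennreal (indicator (cball 0 \<rho>) z / norm (z - w)) \<partial>lborel) \<le> C" for w :: complex
    unfolding C_def by (rule nn_integral_inverse_norm_le)
  have i: "integrable lborel (\<lambda>z. indicator (cball 0 \<rho>) z / norm (z - w))" for w :: complex
  proof (rule integrableI_nonneg)
    show "(\<integral>\<^sup>+z. ennreal (indicator (cball 0 \<rho>) z / norm (z - w)) \<partial>lborel) < \<infinity>"
      using b[of w] C by (simp add: order_le_less_trans)
    show "(\<lambda>z. indicator (cball 0 \<rho>) z / norm (z - w)) \<in> borel_measurable lborel" by measurable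
  qed auto
  have "integral\<^sup>L lborel (\<lambda>z. indicator (cball 0 \<rho>) z / norm (z - w)) \<le> enn2real C" for w :: complex
  proof -
    have "integral\<^sup>L lborel (\<lambda>z. indicator (cball 0 \<rho>) z / norm (z - w))
       = enn2real (\<integral>\<^sup>+z. ennreal (indicator (cball 0 \<rho>) z / norm (z - w)) \<partial>lborel)"
    proof (rule integral_eq_nn_integral)
      show "(\<lambda>z. indicator (cball 0 \<rho>) z / norm (z - w)) \<in> borel_measurable lborel" by measurable
    qed auto
    also have "\<dots> \<le> enn2real C" using b[of w] C by (intro enn2real_mono) auto
    finally show ?thesis .
  qed
  then show thesis using that[of "enn2real C"] i by simp
qed

text \<open>Normalisation is by \<open>e^2\<close> and not by the area of the disc, which is the
  origin of the factor \<open>pi\<close>.\<close>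

lemma ball_average_tendsto:
  fixes f :: "complex \<Rightarrow> complex"
  assumes c: "continuous_on UNIV f" and B: "\<And>z. norm (f z) \<le> B"
    and e: "\<And>n. e n > 0" "e \<longlonglongrightarrow> 0"
  shows "(\<lambda>n. integral\<^sup>L lborel (\<lambda>z. indicator (ball w (e n)) z *\<^sub>R (f z / of_real ((e n)\<^sup>2)))) \<longlonglongrightarrow> of_real pi * f w"
proof (rule tendstoI)
  fix d :: real assume d: "d > 0"
  have fm[measurable]: "f \<in> borel_measurable borel" by (rule borel_measurable_continuous_onI[OF c])
  have "isCont f w" using c by (simp add: continuous_on_eq_continuous_at)
  then obtain r where r: "r > 0" "\<And>z. dist z w < r \<Longrightarrow> dist (f z) (f w) < d / (2 * pi)"
    unfolding continuous_at_eps_delta using d by (metis divide_pos_pos mult_pos_pos pi_gt_zero zero_less_numeral)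
  have "\<forall>\<^sub>F n in sequentially. e n < r" using e(2) r(1) by (rule order_tendstoD(2))
  then show "\<forall>\<^sub>F n in sequentially. dist (integral\<^sup>L lborel (\<lambda>z. indicator (ball w (e n)) z *\<^sub>R (f z / of_real ((e n)\<^sup>2)))) (of_real pi * f w) < d"
  proof eventually_elim
    case (elim n)
    let ?e = "e n"
    have m: "measure lborel (ball w ?e) = pi * ?e\<^sup>2"
      using e(1)[of n] by (simp add: measure_def emeasure_ball_complex)
    have fin: "emeasure lborel (ball w ?e) < \<infinity>" using e(1)[of n] by (simp add: emeasure_ball_complex less_top[symmetric])
    have i0: "integrable lborel (\<lambda>z. indicator (ball w ?e) z *\<^sub>R (c / of_real (?e\<^sup>2)))" for c :: complex
      using fin by (intro integrable_scaleR_left) (auto intro!: integrable_real_indicator)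
    have v0: "integral\<^sup>L lborel (\<lambda>z. indicator (ball w ?e) z *\<^sub>R (c / of_real (?e\<^sup>2))) = of_real pi * c" for c :: complex
    proof -
      have "integral\<^sup>L lborel (\<lambda>z. indicator (ball w ?e) z *\<^sub>R (c / of_real (?e\<^sup>2))) = (pi * ?e\<^sup>2) *\<^sub>R (c / of_real (?e\<^sup>2))"
        using fin m by (subst integral_scaleR_left) (auto intro!: integrable_real_indicator)
      then show ?thesis using e(1)[of n] by (simp add: scaleR_conv_of_real)
    qed
    have i1: "integrable lborel (\<lambda>z. indicator (ball w ?e) z *\<^sub>R (f z / of_real (?e\<^sup>2)))"
    proof (rule integrable_bounded_support[where B="B / ?e\<^sup>2" and \<rho>="norm w + ?e"])
      show "norm (indicator (ball w ?e) z *\<^sub>R (f z / of_real (?e\<^sup>2))) \<le> B / ?e\<^sup>2" for z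
        using B[of z] order_trans[OF norm_ge_zero B[of z]] by (auto simp: indicator_def norm_divide norm_power divide_right_mono)
      show "norm w + ?e < norm z \<Longrightarrow> indicator (ball w ?e) z *\<^sub>R (f z / of_real (?e\<^sup>2)) = 0" for z
        using norm_triangle_ineq2[of z w] by (auto simp: indicator_def dist_norm norm_minus_commute)
      show "(\<lambda>z. indicator (ball w ?e) z *\<^sub>R (f z / of_real (?e\<^sup>2))) \<in> borel_measurable borel" by measurable
    qed
    have "integral\<^sup>L lborel (\<lambda>z. indicator (ball w ?e) z *\<^sub>R (f z / of_real (?e\<^sup>2))) - of_real pi * f w
       = integral\<^sup>L lborel (\<lambda>z. indicator (ball w ?e) z *\<^sub>R (f z / of_real (?e\<^sup>2)) - indicator (ball w ?e) z *\<^sub>R (f w / of_real (?e\<^sup>2)))"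
      unfolding v0[symmetric] by (rule Bochner_Integration.integral_diff[OF i1 i0, symmetric])
    also have "norm \<dots> \<le> integral\<^sup>L lborel (\<lambda>z. indicator (ball w ?e) z *\<^sub>R (d / (2 * pi) / ?e\<^sup>2))"
    proof (rule Bochner_Integration.integral_norm_bound_integral)
      show "integrable lborel (\<lambda>z. indicator (ball w ?e) z *\<^sub>R (d / (2 * pi) / ?e\<^sup>2))"
        using fin by (intro integrable_scaleR_left) (auto intro!: integrable_real_indicator)
      fix z
      show "norm (indicator (ball w ?e) z *\<^sub>R (f z / of_real (?e\<^sup>2)) - indicator (ball w ?e) z *\<^sub>R (f w / of_real (?e\<^sup>2)))
         \<le> indicator (ball w ?e) z *\<^sub>R (d / (2 * pi) / ?e\<^sup>2)"
      proof (cases "z \<in> ball w ?e")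
        case True
        then have "norm (f z - f w) \<le> d / (2 * pi)"
          using r(2)[of z] elim by (auto simp: dist_norm norm_minus_commute)
        then have "norm (f z - f w) / ?e\<^sup>2 \<le> d / (2 * pi) / ?e\<^sup>2" by (rule divide_right_mono) simp
        then show ?thesis using True by (simp add: diff_divide_distrib[symmetric] norm_divide norm_power)
      qed simp
    qed (intro Bochner_Integration.integrable_diff i1 i0)
    also have "\<dots> = (pi * ?e\<^sup>2) *\<^sub>R (d / (2 * pi) / ?e\<^sup>2)"
      using fin m by (subst integral_scaleR_left) (auto intro!: integrable_real_indicator)
    also have "\<dots> = d / 2" using e(1)[of n] by (simp add: field_simps)
    also have "\<dots> < d" using d by simp
    finally show ?case by (simp add: dist_norm)
  qed
qed

lemma Cauchy_Pompeiu_aux: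
  assumes f: "C1c f"
  obtains \<rho> D where "D \<ge> 0"
    "\<And>z w. norm (dbar f z / (z - w)) \<le> D * (indicator (cball 0 \<rho>) z / norm (z - w))"
    "\<And>z. norm (dbar f z) \<le> D * indicator (cball 0 \<rho>) z"
proof -
  obtain \<rho> L where b: "\<rho> > 0" "L \<ge> 0" "\<And>z. norm z \<ge> \<rho> \<Longrightarrow> f z = 0"
    "\<And>z v. norm z \<ge> \<rho> \<Longrightarrow> frechet_derivative f (at z) v = 0"
    "\<And>z. norm (f z) \<le> L" "\<And>z v. norm (frechet_derivative f (at z) v) \<le> L * norm v"
    "\<And>z w. norm (f z - f w) \<le> L * norm (z - w)" using C1c_bounds[OF f] by metis
  have d: "norm (dbar f z) \<le> L * indicator (cball 0 \<rho>) z" for z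
  proof (cases "norm z \<le> \<rho>")
    case True
    have "norm (dbar f z) \<le> (norm (frechet_derivative f (at z) 1) + norm (frechet_derivative f (at z) \<i>)) / 2"
      unfolding dbar_def norm_divide using norm_triangle_ineq[of "frechet_derivative f (at z) 1" "\<i> * frechet_derivative f (at z) \<i>"]
      by (simp add: norm_mult divide_right_mono)
    also have "\<dots> \<le> L" using b(6)[of z 1] b(6)[of z \<i>] by simp
    finally show ?thesis using True by simp
  next
    case False then show ?thesis using b(4)[of z] by (simp add: dbar_def)
  qed
  show thesis
  proof (rule that[OF b(2) _ d])
    fix z w show "norm (dbar f z / (z - w)) \<le> L * (indicator (cball 0 \<rho>) z / norm (z - w))"
      using divide_right_mono[OF d[of z], of "norm (z - w)"] by (simp add: norm_divide)
  qed
qed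

text \<open>Limit of \<open>integral_dbar_ckernel\<close> for radius tending to zero: all
  regularised kernels are dominated by \<open>1 / norm (z - w)\<close>, and the disc averages
  converge since \<open>f\<close> is continuous.\<close>

lemma Cauchy_Pompeiu:
  assumes f: "C1c f"
  shows "integrable lborel (\<lambda>z. dbar f z / (z - w))"
    and "integral\<^sup>L lborel (\<lambda>z. dbar f z / (z - w)) = - of_real pi * f w"
proof -
  obtain \<rho> D where D: "D \<ge> 0"
    "\<And>z w. norm (dbar f z / (z - w)) \<le> D * (indicator (cball 0 \<rho>) z / norm (z - w))"
    "\<And>z. norm (dbar f z) \<le> D * indicator (cball 0 \<rho>) z" using Cauchy_Pompeiu_aux[OF f] by metis
  obtain L where L: "\<And>z. norm (f z) \<le> L" using C1c_bounds[OF f] by metis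
  have dm[measurable]: "dbar f \<in> borel_measurable borel"
    by (rule borel_measurable_continuous_onI[OF dbar_continuous[OF f]])
  obtain C where C: "\<And>w::complex. integrable lborel (\<lambda>z. indicator (cball 0 \<rho>) z / norm (z - w))"
    using integral_inverse_norm_bound[of \<rho>] by metis
  let ?w = "\<lambda>z. D * (indicator (cball 0 \<rho>) z / norm (z - w))"
  have wi: "integrable lborel ?w" by (rule integrable_mult_right[OF C])
  define e where "e n = 1 / real (Suc n)" for n
  have e: "e n > 0" for n by (simp add: e_def)
  have e0: "e \<longlonglongrightarrow> 0" unfolding e_def using LIMSEQ_inverse_real_of_nat by (simp add: inverse_eq_divide)
  have m1: "(\<lambda>z. dbar f z / (z - w)) \<in> borel_measurable lborel" by measurable
  have m2: "(\<lambda>z. dbar f z * ckernel (e n) (z - w)) \<in> borel_measurable lborel" for n by measurable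
  have lim: "AE z in lborel. (\<lambda>n. dbar f z * ckernel (e n) (z - w)) \<longlonglongrightarrow> dbar f z / (z - w)"
  proof (rule AE_I2)
    fix z
    show "(\<lambda>n. dbar f z * ckernel (e n) (z - w)) \<longlonglongrightarrow> dbar f z / (z - w)"
    proof (cases "z = w")
      case True then show ?thesis by (simp add: ckernel_def)
    next
      case False
      then have "\<forall>\<^sub>F n in sequentially. e n < norm (z - w)" using e0 by (intro order_tendstoD(2)) auto
      then have "\<forall>\<^sub>F n in sequentially. dbar f z * ckernel (e n) (z - w) = dbar f z / (z - w)"
        by eventually_elim (use e in \<open>simp add: ckernel_out\<close>)
      then show ?thesis by (simp add: tendsto_eventually)
    qed
  qed
  have bd: "AE z in lborel. norm (dbar f z * ckernel (e n) (z - w)) \<le> ?w z" for n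
  proof (rule AE_I2)
    fix z
    have "norm (dbar f z * ckernel (e n) (z - w)) \<le> norm (dbar f z) * (1 / norm (z - w))"
      unfolding norm_mult by (intro mult_left_mono norm_ckernel_le' e) auto
    also have "\<dots> = norm (dbar f z / (z - w))" by (simp add: norm_divide)
    also have "\<dots> \<le> ?w z" by (rule D(2))
    finally show "norm (dbar f z * ckernel (e n) (z - w)) \<le> ?w z" .
  qed
  show "integrable lborel (\<lambda>z. dbar f z / (z - w))"
    by (rule integrable_dominated_convergence[OF m1 m2 wi lim bd])
  have "(\<lambda>n. integral\<^sup>L lborel (\<lambda>z. dbar f z * ckernel (e n) (z - w))) \<longlonglongrightarrow> integral\<^sup>L lborel (\<lambda>z. dbar f z / (z - w))"
    by (rule integral_dominated_convergence[OF m1 m2 wi lim bd])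
  moreover have "(\<lambda>n. integral\<^sup>L lborel (\<lambda>z. dbar f z * ckernel (e n) (z - w))) \<longlonglongrightarrow> - (of_real pi * f w)"
    unfolding integral_dbar_ckernel[OF f e]
    by (intro tendsto_minus ball_average_tendsto[OF C1c_continuous[OF f] L e e0])
  ultimately have "integral\<^sup>L lborel (\<lambda>z. dbar f z / (z - w)) = - (of_real pi * f w)"
    by (rule LIMSEQ_unique)
  then show "integral\<^sup>L lborel (\<lambda>z. dbar f z / (z - w)) = - of_real pi * f w" by simp
qed

text \<open>The Cauchy integral of one edge, without the factor \<open>1 / (2 pi i)\<close>. The
  Lebesgue integral is total, so no case distinction is needed for \<open>z\<close> on the
  edge.\<close>

definition wk :: "(real \<Rightarrow> complex) \<Rightarrow> (real \<Rightarrow> complex) \<Rightarrow> complex \<Rightarrow> complex" where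
  "wk \<gamma> \<gamma>' z = integral\<^sup>L lborel (\<lambda>t. indicator {0..1} t *\<^sub>R (\<gamma>' t / (\<gamma> t - z)))"

text \<open>Cauchy-Pompeiu at the moving point \<open>\<gamma> t\<close>, integrated along the edge.
  The integrations may be exchanged because \<open>1 / norm (z - \<gamma> t)\<close> has an integral
  over discs bounded independently of \<open>t\<close>.\<close>

lemma edge_Green:
  assumes f: "C1c f" and g: "continuous_on UNIV \<gamma>" "continuous_on UNIV \<gamma>'"
  shows "integrable lborel (\<lambda>z. dbar f z * wk \<gamma> \<gamma>' z)"
    and "integral\<^sup>L lborel (\<lambda>z. dbar f z * wk \<gamma> \<gamma>' z) =
      of_real pi * integral\<^sup>L lborel (\<lambda>t. indicator {0..1} t *\<^sub>R (f (\<gamma> t) * \<gamma>' t))"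
proof -
  obtain \<rho> D where D: "D \<ge> 0"
    "\<And>z w. norm (dbar f z / (z - w)) \<le> D * (indicator (cball 0 \<rho>) z / norm (z - w))"
    "\<And>z. norm (dbar f z) \<le> D * indicator (cball 0 \<rho>) z" using Cauchy_Pompeiu_aux[OF f] by metis
  obtain C where C: "C \<ge> 0"
    "\<And>w::complex. integrable lborel (\<lambda>z. indicator (cball 0 \<rho>) z / norm (z - w))"
    "\<And>w::complex. integral\<^sup>L lborel (\<lambda>z. indicator (cball 0 \<rho>) z / norm (z - w)) \<le> C"
    using integral_inverse_norm_bound[of \<rho>] by metis
  have dm[measurable]: "dbar f \<in> borel_measurable borel"
    by (rule borel_measurable_continuous_onI[OF dbar_continuous[OF f]])
  have gm[measurable]: "\<gamma> \<in> borel_measurable borel" "\<gamma>' \<in> borel_measurable borel"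
    using g by (auto intro: borel_measurable_continuous_onI)
  define F where "F t z = indicator {0..1} t *\<^sub>R (\<gamma>' t * (- (dbar f z / (z - \<gamma> t))))" for t z
  have Fm: "case_prod F \<in> borel_measurable (lborel \<Otimes>\<^sub>M lborel)"
    unfolding F_def by measurable
  have "compact (\<gamma>' ` {0..1})" by (rule compact_continuous_image) (use g(2) continuous_on_subset in blast, simp)
  then obtain M where M: "\<And>t. t \<in> {0..1} \<Longrightarrow> norm (\<gamma>' t) \<le> M"
    by (metis compact_imp_bounded bounded_iff imageI)
  have M0: "M \<ge> 0" using order_trans[OF norm_ge_zero M[of 0]] by simp
  have i1: "integrable lborel (\<lambda>z. dbar f z / (z - \<gamma> t))" for t using Cauchy_Pompeiu(1)[OF f] .
  have ii: "integrable lborel (F t)" for t unfolding F_def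
    by (intro integrable_scaleR_right integrable_mult_right integrable_minus i1)
  have bd: "integral\<^sup>L lborel (\<lambda>z. norm (F t z)) \<le> indicator {0..1} t * (M * (D * C))" for t
  proof (cases "t \<in> {0..1}")
    case True
    have "integral\<^sup>L lborel (\<lambda>z. norm (F t z)) \<le> integral\<^sup>L lborel (\<lambda>z. M * (D * (indicator (cball 0 \<rho>) z / norm (z - \<gamma> t))))"
    proof (rule integral_mono)
      show "integrable lborel (\<lambda>z. norm (F t z))" using ii by simp
      show "integrable lborel (\<lambda>z. M * (D * (indicator (cball 0 \<rho>) z / norm (z - \<gamma> t))))"
        by (intro integrable_mult_right C)
      show "norm (F t z) \<le> M * (D * (indicator (cball 0 \<rho>) z / norm (z - \<gamma> t)))" for z
      proof -
        have "norm (F t z) = norm (\<gamma>' t) * norm (dbar f z / (z - \<gamma> t))"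
          using True unfolding F_def norm_scaleR norm_mult norm_minus_cancel by simp
        also have "\<dots> \<le> M * (D * (indicator (cball 0 \<rho>) z / norm (z - \<gamma> t)))"
          by (intro mult_mono M[OF True] D(2) M0) simp
        finally show ?thesis .
      qed
    qed
    also have "\<dots> = M * (D * integral\<^sup>L lborel (\<lambda>z. indicator (cball 0 \<rho>) z / norm (z - \<gamma> t)))" by (simp only: integral_mult_right_zero)
    also have "\<dots> \<le> M * (D * C)" by (intro mult_left_mono C(3) D(1) M0)
    finally show ?thesis using True by simp
  next
    case False then show ?thesis by (simp add: F_def)
  qed
  have Fi: "integrable (lborel \<Otimes>\<^sub>M lborel) (case_prod F)"
  proof (rule lborel_pair.Fubini_integrable[OF Fm])
    show "integrable lborel (\<lambda>x. \<integral>y. norm (case_prod F (x, y)) \<partial>lborel)"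
    proof (rule integrableI_bounded_set[where A="{0..1}" and B="M * (D * C)"])
      show "(\<lambda>x. \<integral>y. norm (case_prod F (x, y)) \<partial>lborel) \<in> borel_measurable lborel"
        using Fm by measurable
      show "AE x in lborel. x \<in> {0..1} \<longrightarrow> norm (\<integral>y. norm (case_prod F (x, y)) \<partial>lborel) \<le> M * (D * C)"
      proof (intro AE_I2 impI)
        fix x :: real assume x: "x \<in> {0..1}"
        have "0 \<le> integral\<^sup>L lborel (\<lambda>z. norm (F x z))" by (rule integral_nonneg_AE) simp
        then show "norm (\<integral>y. norm (case_prod F (x, y)) \<partial>lborel) \<le> M * (D * C)"
          using bd[of x] x by simp
      qed
      show "AE x in lborel. x \<notin> {0..1} \<longrightarrow> (\<integral>y. norm (case_prod F (x, y)) \<partial>lborel) = 0"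
        by (intro AE_I2) (simp add: F_def)
    qed auto
    show "AE x in lborel. integrable lborel (\<lambda>y. case_prod F (x, y))" using ii by simp
  qed
  have wkeq: "dbar f z * wk \<gamma> \<gamma>' z = integral\<^sup>L lborel (\<lambda>t. F t z)" for z
  proof -
    have "F t z = dbar f z * (indicator {0..1} t *\<^sub>R (\<gamma>' t / (\<gamma> t - z)))" for t
    proof -
      have e: "z - \<gamma> t = - (\<gamma> t - z)" by simp
      show ?thesis unfolding F_def e by (simp only: divide_minus_right minus_minus) (simp add: mult.commute)
    qed
    then show ?thesis unfolding wk_def by (simp only: integral_mult_right_zero)
  qed
  show "integrable lborel (\<lambda>z. dbar f z * wk \<gamma> \<gamma>' z)"
    unfolding wkeq using lborel_pair.integrable_snd[OF Fi] by simp
  have "integral\<^sup>L lborel (\<lambda>z. dbar f z * wk \<gamma> \<gamma>' z) = (\<integral>t. (\<integral>z. F t z \<partial>lborel) \<partial>lborel)"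
    unfolding wkeq by (rule lborel_pair.Fubini_integral[OF Fi])
  also have "(\<lambda>t. \<integral>z. F t z \<partial>lborel) = (\<lambda>t. of_real pi * (indicator {0..1} t *\<^sub>R (f (\<gamma> t) * \<gamma>' t)))"
  proof
    fix t
    show "(\<integral>z. F t z \<partial>lborel) = of_real pi * (indicator {0..1} t *\<^sub>R (f (\<gamma> t) * \<gamma>' t))"
      unfolding F_def integral_scaleR_right integral_mult_right_zero Bochner_Integration.integral_minus
        Cauchy_Pompeiu(2)[OF f] by simp
  qed
  finally show "integral\<^sup>L lborel (\<lambda>z. dbar f z * wk \<gamma> \<gamma>' z) =
      of_real pi * integral\<^sup>L lborel (\<lambda>t. indicator {0..1} t *\<^sub>R (f (\<gamma> t) * \<gamma>' t))" by (simp only: integral_mult_right_zero)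
qed

subsection \<open>Boundary curves and Green's formula\<close>

text \<open>The flux of \<open>N\<close> across the edge: \<open>Im (cnj N * T)\<close> is the
  scalar product of \<open>N\<close> with the normal to the right of the tangent \<open>T\<close>,
  the outward one for a counterclockwise boundary.\<close>

definition lint :: "(real \<Rightarrow> complex) \<Rightarrow> (real \<Rightarrow> complex) \<Rightarrow> (complex \<Rightarrow> complex) \<Rightarrow> real" where
  "lint \<gamma> \<gamma>' N = integral\<^sup>L lborel (\<lambda>t. indicator {0..1} t * Im (cnj (N (\<gamma> t)) * \<gamma>' t))"

text \<open>Nothing is said about closedness, order or injectivity; the identity for the Cauchy
  integrals replaces statements about winding numbers. It is additive in the chain, so cutting and
  cancelling edges is algebra.\<close>

definition has_boundary :: "'i set \<Rightarrow> ('i \<Rightarrow> real \<Rightarrow> complex) \<Rightarrow> ('i \<Rightarrow> real \<Rightarrow> complex) \<Rightarrow> complex set \<Rightarrow> bool" where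
  "has_boundary I \<gamma> \<gamma>' S \<longleftrightarrow> finite I \<and>
     (\<forall>i\<in>I. continuous_on UNIV (\<gamma> i) \<and> continuous_on UNIV (\<gamma>' i)) \<and>
     (AE z in lebesgue. (\<Sum>i\<in>I. wk (\<gamma> i) (\<gamma>' i) z) = 2 * of_real pi * \<i> * indicator S z)"

lemma C1cI:
  assumes "\<And>z. (f has_derivative f' z) (at z)" "\<And>b. b \<in> Basis \<Longrightarrow> continuous_on UNIV (\<lambda>z. f' z b)"
    "\<And>z. norm z > \<rho> \<Longrightarrow> f z = 0"
  shows "C1c f" "frechet_derivative f (at z) = f' z"
proof -
  have fd: "frechet_derivative f (at z) = f' z" for z
    using frechet_derivative_at[OF assms(1)] by simp
  have "bounded {x. f x \<noteq> 0}"
    unfolding bounded_iff using assms(3) by (intro exI[of _ \<rho>]) (auto simp: not_less[symmetric])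
  then show "C1c f" unfolding C1c_def fd using assms(1,2) differentiableI by blast
  show "frechet_derivative f (at z) = f' z" by (rule fd)
qed

lemma C1c_cnj:
  assumes "C1c \<phi>"
  shows "C1c (\<lambda>z. cnj (\<phi> z))"
    "frechet_derivative (\<lambda>z. cnj (\<phi> z)) (at z) v = cnj (frechet_derivative \<phi> (at z) v)"
proof -
  obtain \<rho> where \<rho>: "\<And>z. norm z \<ge> \<rho> \<Longrightarrow> \<phi> z = 0" using C1c_support[OF assms] by metis
  have d: "((\<lambda>z. cnj (\<phi> z)) has_derivative (\<lambda>v. cnj (frechet_derivative \<phi> (at z) v))) (at z)" for z
    by (rule has_derivative_compose[OF C1c_has_derivative[OF assms], of cnj cnj])
       (rule bounded_linear_imp_has_derivative[OF bounded_linear_cnj])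
  have c: "continuous_on UNIV (\<lambda>z. cnj (frechet_derivative \<phi> (at z) b))" if "b \<in> Basis" for b
    using assms that by (intro continuous_intros) (auto simp: C1c_def)
  have z: "norm z > \<rho> \<Longrightarrow> cnj (\<phi> z) = 0" for z using \<rho>[of z] by simp
  note * = C1cI[of "\<lambda>z. cnj (\<phi> z)" "\<lambda>z v. cnj (frechet_derivative \<phi> (at z) v)", OF d c z]
  show "C1c (\<lambda>z. cnj (\<phi> z))" using *(1) by simp
  show "frechet_derivative (\<lambda>z. cnj (\<phi> z)) (at z) v = cnj (frechet_derivative \<phi> (at z) v)"
    using *(2)[where z=z] by simp
qed

lemma divergence_complex:
  "divergence \<phi> z = Re (frechet_derivative \<phi> (at z) 1) + Im (frechet_derivative \<phi> (at z) \<i>)"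
  by (simp add: divergence_def Basis_complex_def inner_complex_def)

lemma divergence_eq_dbar:
  assumes "C1c \<phi>"
  shows "divergence \<phi> z = Im (2 * \<i> * dbar (\<lambda>z. cnj (\<phi> z)) z)"
  by (simp add: divergence_complex dbar_def C1c_cnj[OF assms])

lemma C1c_divergence:
  assumes "C1c \<phi>"
  shows "continuous_on UNIV (divergence \<phi>)" "integrable lborel (divergence \<phi>)"
proof -
  show c: "continuous_on UNIV (divergence \<phi>)"
    unfolding divergence_complex
    using assms by (intro continuous_intros) (auto simp: C1c_def Basis_complex_def)
  obtain \<rho> L where b: "\<rho> > 0" "L \<ge> 0" "\<And>z. norm z \<ge> \<rho> \<Longrightarrow> \<phi> z = 0"
    "\<And>z v. norm z \<ge> \<rho> \<Longrightarrow> frechet_derivative \<phi> (at z) v = 0"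
    "\<And>z. norm (\<phi> z) \<le> L" "\<And>z v. norm (frechet_derivative \<phi> (at z) v) \<le> L * norm v"
    using C1c_bounds[OF assms] by metis
  show "integrable lborel (divergence \<phi>)"
  proof (rule integrable_bounded_support[where B="2*L" and \<rho>=\<rho>])
    show "divergence \<phi> \<in> borel_measurable borel" by (rule borel_measurable_continuous_onI[OF c])
    show "norm (divergence \<phi> z) \<le> 2 * L" for z
      using b(6)[of z 1] b(6)[of z \<i>] abs_Re_le_cmod[of "frechet_derivative \<phi> (at z) 1"]
        abs_Im_le_cmod[of "frechet_derivative \<phi> (at z) \<i>"]
      by (simp add: divergence_complex)
    show "\<rho> < norm z \<Longrightarrow> divergence \<phi> z = 0" for z
      using b(4)[of z] by (simp add: divergence_complex)
  qed
qed

lemma integrable_lebesgue_indicator: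
  fixes g :: "complex \<Rightarrow> 'a::euclidean_space"
  assumes "integrable lborel g" "S \<in> sets lebesgue"
  shows "integrable lebesgue (\<lambda>z. indicator S z *\<^sub>R g z)"
proof -
  have "integrable lebesgue g" using assms(1) by (simp add: integrable_completion)
  then show ?thesis using assms(2) by (rule integrable_mult_indicator[rotated])
qed

lemma integral_eq_lebesgue_integral:
  fixes g :: "complex \<Rightarrow> 'a::euclidean_space"
  assumes "integrable lborel g" "S \<in> sets lebesgue"
  shows "integral S g = integral\<^sup>L lebesgue (\<lambda>z. indicator S z *\<^sub>R g z)"
  using set_lebesgue_integral_eq_integral(2)[of S g] integrable_lebesgue_indicator[OF assms]
  by (simp add: set_integrable_def set_lebesgue_integral_def)

lemma edge_integrable:
  fixes h :: "real \<Rightarrow> 'a::{banach,second_countable_topology}"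
  assumes "continuous_on {0..1} h"
  shows "integrable lborel (\<lambda>t. indicator {0..1} t *\<^sub>R h t)"
  using borel_integrable_compact[OF compact_Icc assms] by (simp add: set_integrable_def)

lemma lint_integrable:
  fixes \<gamma> \<gamma>' :: "real \<Rightarrow> complex"
  assumes "continuous_on UNIV N" "continuous_on UNIV \<gamma>" "continuous_on UNIV \<gamma>'"
  shows "integrable lborel (\<lambda>t. indicator {0..1} t * Im (cnj (N (\<gamma> t)) * \<gamma>' t))"
proof -
  have "continuous_on {0..1} (\<lambda>t. Im (cnj (N (\<gamma> t)) * \<gamma>' t))"
    using assms by (intro continuous_intros continuous_on_compose2[OF assms(1)]) (auto intro: continuous_on_subset)
  from edge_integrable[OF this] show ?thesis by simp
qed

text \<open>The defining identity of \<open>has_boundary\<close> is paired with the dbar derivative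
  of the conjugate of \<open>\<phi>\<close>. Each edge yields its flux by \<open>edge_Green\<close>;
  the right side yields the divergence, which is the imaginary part of \<open>2 * i\<close> times
  that dbar derivative.\<close>

theorem Green_boundary:
  assumes B: "has_boundary I \<gamma> \<gamma>' S" and S: "S \<in> sets lebesgue" and \<phi>: "C1c \<phi>"
  shows "integral S (divergence \<phi>) = (\<Sum>i\<in>I. lint (\<gamma> i) (\<gamma>' i) \<phi>)"
proof -
  let ?f = "\<lambda>z. cnj (\<phi> z)"
  have f: "C1c ?f" by (rule C1c_cnj[OF \<phi>])
  have g: "continuous_on UNIV (\<gamma> i)" "continuous_on UNIV (\<gamma>' i)" if "i \<in> I" for i
    using B that by (auto simp: has_boundary_def)
  have fin: "finite I" using B by (simp add: has_boundary_def)
  have ae: "AE z in lebesgue. (\<Sum>i\<in>I. wk (\<gamma> i) (\<gamma>' i) z) = 2 * of_real pi * \<i> * indicator S z"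
    using B by (simp add: has_boundary_def)
  have di: "integrable lborel (\<lambda>z. divergence \<phi> z)" using C1c_divergence(2)[OF \<phi>] .
  have i1: "integrable lborel (\<lambda>z. \<Sum>i\<in>I. dbar ?f z * wk (\<gamma> i) (\<gamma>' i) z)"
    using edge_Green(1)[OF f g] by (intro Bochner_Integration.integrable_sum) auto
  have ci: "integrable lborel (\<lambda>t. indicator {0..1} t *\<^sub>R (?f (\<gamma> i t) * \<gamma>' i t))" if "i \<in> I" for i
    using g[OF that] C1c_continuous[OF f]
    by (intro edge_integrable continuous_intros continuous_on_compose2[OF C1c_continuous[OF f]]) (auto intro: continuous_on_subset)
  have lint_eq: "lint (\<gamma> i) (\<gamma>' i) \<phi> = Im (integral\<^sup>L lborel (\<lambda>t. indicator {0..1} t *\<^sub>R (?f (\<gamma> i t) * \<gamma>' i t)))" if "i \<in> I" for i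
    unfolding lint_def using integral_Im[OF ci[OF that]] by simp
  have "of_real pi * (\<Sum>i\<in>I. integral\<^sup>L lborel (\<lambda>t. indicator {0..1} t *\<^sub>R (?f (\<gamma> i t) * \<gamma>' i t)))
      = (\<Sum>i\<in>I. integral\<^sup>L lborel (\<lambda>z. dbar ?f z * wk (\<gamma> i) (\<gamma>' i) z))"
    unfolding sum_distrib_left using edge_Green(2)[OF f g] by (intro sum.cong) auto
  also have "\<dots> = integral\<^sup>L lborel (\<lambda>z. \<Sum>i\<in>I. dbar ?f z * wk (\<gamma> i) (\<gamma>' i) z)"
    using edge_Green(1)[OF f g] by (intro Bochner_Integration.integral_sum[symmetric]) auto
  also have "\<dots> = integral\<^sup>L lebesgue (\<lambda>z. \<Sum>i\<in>I. dbar ?f z * wk (\<gamma> i) (\<gamma>' i) z)"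
    using i1 by (intro integral_completion[symmetric]) auto
  finally have *: "of_real pi * (\<Sum>i\<in>I. integral\<^sup>L lborel (\<lambda>t. indicator {0..1} t *\<^sub>R (?f (\<gamma> i t) * \<gamma>' i t)))
      = integral\<^sup>L lebesgue (\<lambda>z. \<Sum>i\<in>I. dbar ?f z * wk (\<gamma> i) (\<gamma>' i) z)" .
  have i2: "integrable lebesgue (\<lambda>z. \<Sum>i\<in>I. dbar ?f z * wk (\<gamma> i) (\<gamma>' i) z)"
    using i1 by (simp add: integrable_completion)
  have "pi * (\<Sum>i\<in>I. lint (\<gamma> i) (\<gamma>' i) \<phi>) = Im (of_real pi * (\<Sum>i\<in>I. integral\<^sup>L lborel (\<lambda>t. indicator {0..1} t *\<^sub>R (?f (\<gamma> i t) * \<gamma>' i t))))"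
    using lint_eq by simp
  also have "\<dots> = integral\<^sup>L lebesgue (\<lambda>z. Im (\<Sum>i\<in>I. dbar ?f z * wk (\<gamma> i) (\<gamma>' i) z))"
    unfolding * by (rule integral_Im[OF i2, symmetric])
  also have "\<dots> = integral\<^sup>L lebesgue (\<lambda>z. pi * (indicator S z *\<^sub>R divergence \<phi> z))"
  proof (rule integral_cong_AE)
    show "(\<lambda>z. Im (\<Sum>i\<in>I. dbar ?f z * wk (\<gamma> i) (\<gamma>' i) z)) \<in> borel_measurable lebesgue"
      using integrable_Im[OF i2] by (rule borel_measurable_integrable)
    show "(\<lambda>z. pi * (indicator S z *\<^sub>R divergence \<phi> z)) \<in> borel_measurable lebesgue"
      using integrable_lebesgue_indicator[OF di S] by (intro borel_measurable_integrable integrable_mult_right) auto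
    show "AE z in lebesgue. Im (\<Sum>i\<in>I. dbar ?f z * wk (\<gamma> i) (\<gamma>' i) z) = pi * (indicator S z *\<^sub>R divergence \<phi> z)"
      using ae
    proof eventually_elim
      case (elim z)
      have "Im (\<Sum>i\<in>I. dbar ?f z * wk (\<gamma> i) (\<gamma>' i) z) = Im (dbar ?f z * (2 * of_real pi * \<i> * indicator S z))"
        unfolding sum_distrib_left[symmetric] elim ..
      also have "\<dots> = pi * (indicator S z *\<^sub>R divergence \<phi> z)"
        unfolding divergence_eq_dbar[OF \<phi>] by (cases "z \<in> S") auto
      finally show ?case .
    qed
  qed
  also have "\<dots> = pi * integral S (divergence \<phi>)"
    unfolding integral_eq_lebesgue_integral[OF di S] by simp
  finally show ?thesis by simp
qed

section \<open>C1 cutoffs and approximation of continuous fields\<close>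

definition sqp :: "real \<Rightarrow> real" where "sqp u = (max 0 u)\<^sup>2"

lemma sqp_deriv: "(sqp has_real_derivative 2 * max 0 u) (at u)"
proof -
  consider "u > 0" | "u < 0" | "u = 0" by linarith
  then show ?thesis
  proof cases
    case 1
    have "((\<lambda>u. u\<^sup>2) has_real_derivative 2 * u) (at u)" by (auto intro!: derivative_eq_intros)
    then have "(sqp has_real_derivative 2 * u) (at u)"
      by (rule has_field_derivative_transform_within_open[of _ _ _ "{0<..}"]) (use 1 in \<open>auto simp: sqp_def\<close>)
    then show ?thesis using 1 by simp
  next
    case 2
    have "((\<lambda>u. 0) has_real_derivative 0) (at u)" by simp
    then have "(sqp has_real_derivative 0) (at u)"
      by (rule has_field_derivative_transform_within_open[of _ _ _ "{..<0}"]) (use 2 in \<open>auto simp: sqp_def\<close>)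
    then show ?thesis using 2 by simp
  next
    case 3
    have "((\<lambda>h. (sqp (0 + h) - sqp 0) / h) \<longlongrightarrow> 0) (at 0)"
    proof (rule Lim_null_comparison)
      show "\<forall>\<^sub>F h in at 0. norm ((sqp (0 + h) - sqp 0) / h) \<le> \<bar>h\<bar>"
        by (rule always_eventually) (auto simp: sqp_def power2_eq_square max_def)
      show "((\<lambda>h::real. \<bar>h\<bar>) \<longlongrightarrow> 0) (at 0)" by (rule tendsto_rabs_zero) (rule tendsto_ident_at)
    qed
    then show ?thesis using 3 by (simp add: DERIV_def)
  qed
qed

lemma sqp_cont: "continuous_on S g \<Longrightarrow> continuous_on S (\<lambda>z. sqp (g z))"
  unfolding sqp_def by (intro continuous_intros)

lemma sqp_nonneg: "0 \<le> sqp u" by (simp add: sqp_def)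

lemma sqp_has_derivative:
  assumes "(g has_derivative g') (at z)"
  shows "((\<lambda>z. sqp (g z)) has_derivative (\<lambda>v. 2 * max 0 (g z) * g' v)) (at z)"
  using DERIV_compose_FDERIV[OF sqp_deriv assms] by (simp add: mult.commute)

lemma normsq_has_derivative:
  "((\<lambda>z::complex. (norm z)\<^sup>2) has_derivative (\<lambda>v. 2 * (z \<bullet> v))) (at z)"
  unfolding power2_norm_eq_inner by (auto intro!: derivative_eq_intros simp: inner_commute)

definition cutf :: "real \<Rightarrow> complex \<Rightarrow> real" where "cutf \<rho> z = sqp (\<rho>\<^sup>2 - (norm z)\<^sup>2)"

lemma cutf_has_derivative:
  "(cutf \<rho> has_derivative (\<lambda>v. 2 * max 0 (\<rho>\<^sup>2 - (norm z)\<^sup>2) * (- (2 * (z \<bullet> v))))) (at z)"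
proof -
  have "((\<lambda>z::complex. \<rho>\<^sup>2 - (norm z)\<^sup>2) has_derivative (\<lambda>v. - (2 * (z \<bullet> v)))) (at z)"
    by (auto intro!: derivative_eq_intros normsq_has_derivative)
  from sqp_has_derivative[OF this] show ?thesis unfolding cutf_def .
qed

lemma C1c_cutf:
  fixes P :: "complex \<Rightarrow> complex"
  assumes P: "\<And>z. (P has_derivative P' z) (at z)" "\<And>v. continuous_on UNIV (\<lambda>z. P' z v)" and \<rho>: "0 \<le> \<rho>"
  shows "C1c (\<lambda>z. cutf \<rho> z *\<^sub>R P z)" "norm z \<ge> \<rho> \<Longrightarrow> cutf \<rho> z = 0"
proof -
  have z: "norm z \<ge> \<rho> \<Longrightarrow> cutf \<rho> z = 0" for z
    using \<rho> by (simp add: cutf_def sqp_def power_mono)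
  then show "norm z \<ge> \<rho> \<Longrightarrow> cutf \<rho> z = 0" .
  have cP: "continuous_on UNIV P"
    by (intro continuous_at_imp_continuous_on ballI has_derivative_continuous[OF P(1)])
  show "C1c (\<lambda>z. cutf \<rho> z *\<^sub>R P z)"
  proof (rule C1cI(1))
    show "((\<lambda>z. cutf \<rho> z *\<^sub>R P z) has_derivative
      (\<lambda>v. cutf \<rho> z *\<^sub>R P' z v + (2 * max 0 (\<rho>\<^sup>2 - (norm z)\<^sup>2) * (- (2 * (z \<bullet> v)))) *\<^sub>R P z)) (at z)" for z
      by (rule has_derivative_scaleR[OF cutf_has_derivative P(1)])
    show "continuous_on UNIV (\<lambda>z. cutf \<rho> z *\<^sub>R P' z b + (2 * max 0 (\<rho>\<^sup>2 - (norm z)\<^sup>2) * (- (2 * (z \<bullet> b)))) *\<^sub>R P z)" for b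
      unfolding cutf_def by (intro continuous_intros sqp_cont P(2) cP)
    show "norm z > \<rho> \<Longrightarrow> cutf \<rho> z *\<^sub>R P z = 0" for z using z by simp
  qed
qed

lemma real_polynomial_function_C1:
  fixes p :: "complex \<Rightarrow> real"
  assumes "real_polynomial_function p"
  shows "\<exists>p'. (\<forall>z. (p has_derivative p' z) (at z)) \<and> (\<forall>v. continuous_on UNIV (\<lambda>z. p' z v)) \<and> continuous_on UNIV p"
  using assms
proof (induction rule: real_polynomial_function.induct)
  case (linear f)
  then show ?case
    by (intro exI[of _ "\<lambda>_. f"]) (auto intro: bounded_linear_imp_has_derivative linear_continuous_on)
next
  case (const c) then show ?case by (intro exI[of _ "\<lambda>_ _. 0"]) auto
next
  case (add f g)
  then obtain f' g' where "\<forall>z. (f has_derivative f' z) (at z)" "\<forall>v. continuous_on UNIV (\<lambda>z. f' z v)" "continuous_on UNIV f"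
     "\<forall>z. (g has_derivative g' z) (at z)" "\<forall>v. continuous_on UNIV (\<lambda>z. g' z v)" "continuous_on UNIV g" by blast
  then show ?case
    by (intro exI[of _ "\<lambda>z v. f' z v + g' z v"]) (auto intro!: has_derivative_add continuous_intros)
next
  case (mult f g)
  then obtain f' g' where "\<forall>z. (f has_derivative f' z) (at z)" "\<forall>v. continuous_on UNIV (\<lambda>z. f' z v)" "continuous_on UNIV f"
     "\<forall>z. (g has_derivative g' z) (at z)" "\<forall>v. continuous_on UNIV (\<lambda>z. g' z v)" "continuous_on UNIV g" by blast
  then show ?case
    by (intro exI[of _ "\<lambda>z v. f z * g' z v + f' z v * g z"]) (auto intro!: has_derivative_mult continuous_intros)
qed

lemma polynomial_function_C1:
  fixes P :: "complex \<Rightarrow> complex"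
  assumes "polynomial_function P"
  obtains P' where "\<And>z. (P has_derivative P' z) (at z)" "\<And>v. continuous_on UNIV (\<lambda>z. P' z v)"
proof -
  have "real_polynomial_function (Re \<circ> P)" "real_polynomial_function (Im \<circ> P)"
    using assms bounded_linear_Re bounded_linear_Im unfolding polynomial_function_def by blast+
  then obtain a b where a: "\<And>z. ((Re \<circ> P) has_derivative a z) (at z)" "\<And>v. continuous_on UNIV (\<lambda>z. a z v)"
    and b: "\<And>z. ((Im \<circ> P) has_derivative b z) (at z)" "\<And>v. continuous_on UNIV (\<lambda>z. b z v)"
    using real_polynomial_function_C1 by metis
  show thesis
  proof (rule that[of "\<lambda>z v. of_real (a z v) + \<i> * of_real (b z v)"])
    fix z
    have "((\<lambda>z. complex_of_real ((Re \<circ> P) z) + \<i> * complex_of_real ((Im \<circ> P) z)) has_derivative (\<lambda>v. of_real (a z v) + \<i> * of_real (b z v))) (at z)"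
      by (intro has_derivative_add has_derivative_mult_right has_derivative_of_real a b)
    then show "(P has_derivative (\<lambda>v. of_real (a z v) + \<i> * of_real (b z v))) (at z)"
      by (simp add: o_def complex_eq[symmetric])
  next
    show "continuous_on UNIV (\<lambda>z. complex_of_real (a z v) + \<i> * complex_of_real (b z v))" for v
      by (intro continuous_intros a b)
  qed
qed

text \<open>Weierstrass polynomials are smooth but not compactly supported, which multiplication by
  \<open>cutf\<close> repairs. The field is first divided by the same cutoff, which is at least one
  where the field lives, so that the product approximates \<open>N\<close> itself.\<close>

lemma C1c_dense:
  fixes N :: "complex \<Rightarrow> complex"
  assumes N: "continuous_on UNIV N" "\<And>z. norm z \<ge> \<rho> \<Longrightarrow> N z = 0" and \<rho>: "0 \<le> \<rho>" and e: "0 < e"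
  obtains \<phi> where "C1c \<phi>" "\<And>z. norm (\<phi> z - N z) \<le> e" "\<And>z. norm z \<ge> \<rho> + 1 \<Longrightarrow> \<phi> z = 0"
proof -
  let ?r = "\<rho> + 1"
  define N' where "N' z = N z /\<^sub>R max (cutf ?r z) 1" for z
  have cN': "continuous_on UNIV N'"
    unfolding N'_def cutf_def by (intro continuous_intros sqp_cont N(1)) (auto simp: max_def)
  have chi: "cutf ?r z \<ge> 1" if "norm z \<le> \<rho>" for z
  proof -
    have "(norm z)\<^sup>2 \<le> \<rho>\<^sup>2" using that by (simp add: power_mono)
    then have "?r\<^sup>2 - (norm z)\<^sup>2 \<ge> 1" using \<rho> by (simp add: power2_eq_square algebra_simps)
    then show ?thesis by (simp add: cutf_def sqp_def)
  qed
  have NN: "N z = cutf ?r z *\<^sub>R N' z" for z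
  proof (cases "norm z \<le> \<rho>")
    case True then show ?thesis using chi[OF True] by (simp add: N'_def max_absorb1)
  next
    case False then show ?thesis using N(2)[of z] by (simp add: N'_def)
  qed
  define M where "M = (?r\<^sup>2)\<^sup>2"
  have M0: "M > 0" using \<rho> by (simp add: M_def)
  have M: "cutf ?r z \<le> M" for z
    unfolding cutf_def sqp_def M_def by (intro power_mono) auto
  obtain P where P: "polynomial_function P" "\<And>z. z \<in> cball 0 ?r \<Longrightarrow> norm (N' z - P z) < e / M"
    using Stone_Weierstrass_polynomial_function[of "cball 0 ?r" N' "e / M"] cN' e M0
    by (metis compact_cball continuous_on_subset divide_pos_pos subset_UNIV)
  obtain P' where P': "\<And>z. (P has_derivative P' z) (at z)" "\<And>v. continuous_on UNIV (\<lambda>z. P' z v)"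
    using polynomial_function_C1[OF P(1)] by metis
  have r0: "0 \<le> ?r" using \<rho> by simp
  note C = C1c_cutf[OF P' r0]
  show thesis
  proof (rule that[of "\<lambda>z. cutf ?r z *\<^sub>R P z"])
    show "C1c (\<lambda>z. cutf ?r z *\<^sub>R P z)" by (rule C)
    show "norm z \<ge> \<rho> + 1 \<Longrightarrow> cutf ?r z *\<^sub>R P z = 0" for z using C(2) by simp
    fix z
    show "norm (cutf ?r z *\<^sub>R P z - N z) \<le> e"
    proof (cases "norm z \<le> ?r")
      case True
      have "norm (cutf ?r z *\<^sub>R P z - N z) = cutf ?r z * norm (N' z - P z)"
        unfolding NN scaleR_diff_right[symmetric] norm_scaleR
        by (simp add: norm_minus_commute cutf_def sqp_nonneg)
      also have "\<dots> \<le> M * (e / M)"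
        using P(2)[of z] True M0 by (intro mult_mono M) (auto simp: dist_norm)
      finally show ?thesis using M0 by simp
    next
      case False then show ?thesis using C(2)[of z] N(2)[of z] e by simp
    qed
  qed
qed

text \<open>Approximation may raise the norm to \<open>1 + e / 2\<close>; shrinking by
  \<open>k = 1 / (1 + e / 2)\<close> restores the constraint on test fields and costs at most
  another \<open>e / 2\<close>.\<close>

lemma test_field_dense:
  fixes N :: "complex \<Rightarrow> complex"
  assumes N: "continuous_on UNIV N" "\<And>z. norm z \<ge> \<rho> \<Longrightarrow> N z = 0" "\<And>z. norm (N z) \<le> 1" and \<rho>: "0 \<le> \<rho>" and e: "0 < e"
  obtains \<phi> where "test_field \<phi>" "\<And>z. norm (\<phi> z - N z) \<le> e"
proof -
  obtain \<phi> where \<phi>: "C1c \<phi>" "\<And>z. norm (\<phi> z - N z) \<le> e / 2" "\<And>z. norm z \<ge> \<rho> + 1 \<Longrightarrow> \<phi> z = 0"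
    using C1c_dense[OF N(1,2) \<rho>, of "e / 2"] e by auto
  define k where "k = 1 / (1 + e / 2)"
  have k: "0 < k" "k * (1 + e / 2) = 1" using e by (auto simp: k_def)
  have n1: "norm (\<phi> z) \<le> 1 + e / 2" for z
    using \<phi>(2)[of z] N(3)[of z] norm_triangle_sub[of "\<phi> z" "N z"] by linarith
  have "C1c (\<lambda>z. k *\<^sub>R \<phi> z)"
  proof (rule C1cI(1))
    show "((\<lambda>z. k *\<^sub>R \<phi> z) has_derivative (\<lambda>v. k *\<^sub>R frechet_derivative \<phi> (at z) v)) (at z)" for z
      by (intro has_derivative_scaleR_right C1c_has_derivative \<phi>)
    show "continuous_on UNIV (\<lambda>z. k *\<^sub>R frechet_derivative \<phi> (at z) b)" if "b \<in> Basis" for b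
      using \<phi>(1) that by (intro continuous_intros) (auto simp: C1c_def)
    show "norm z > \<rho> + 1 \<Longrightarrow> k *\<^sub>R \<phi> z = 0" for z using \<phi>(3) by simp
  qed
  moreover have "norm (k *\<^sub>R \<phi> z) \<le> 1" for z
    using mult_left_mono[OF n1[of z], of k] k by simp
  ultimately have t: "test_field (\<lambda>z. k *\<^sub>R \<phi> z)" unfolding test_field_def C1c_def by blast
  have "norm (k *\<^sub>R \<phi> z - N z) \<le> e" for z
  proof -
    have k1: "1 - k = k * (e / 2)" "k \<le> 1" using e by (auto simp: field_simps k_def)
    have "norm (k *\<^sub>R \<phi> z - N z) \<le> norm (\<phi> z - N z) + norm (k *\<^sub>R \<phi> z - \<phi> z)"
      using norm_triangle_ineq[of "\<phi> z - N z" "k *\<^sub>R \<phi> z - \<phi> z"] by simp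
    also have "norm (k *\<^sub>R \<phi> z - \<phi> z) = (1 - k) * norm (\<phi> z)"
    proof -
      have "k *\<^sub>R \<phi> z - \<phi> z = (k - 1) *\<^sub>R \<phi> z" by (simp add: scaleR_diff_left)
      then show ?thesis using k1 by simp
    qed
    also have "\<dots> \<le> (1 - k) * (1 + e / 2)" using k1 n1 by (intro mult_left_mono) auto
    also have "\<dots> = e / 2" using k by (simp only: left_diff_distrib) simp
    finally show ?thesis using \<phi>(2)[of z] by simp
  qed
  then show thesis using that t by blast
qed

subsection \<open>Perimeter and area from boundary curves\<close>

lemma test_field_C1c: "test_field \<phi> \<Longrightarrow> C1c \<phi>"
  by (simp add: test_field_def C1c_def)

lemma Im_cnj_mult_le: "\<bar>Im (cnj a * b)\<bar> \<le> norm a * norm b"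
  using abs_Im_le_cmod[of "cnj a * b"] by (simp add: norm_mult)

lemma has_boundary_continuous:
  assumes "has_boundary I \<gamma> \<gamma>' S" "i \<in> I"
  shows "continuous_on UNIV (\<gamma> i)" "continuous_on UNIV (\<gamma>' i)"
  using assms by (auto simp: has_boundary_def)

lemma integral_indicator_const: "integral\<^sup>L lborel (\<lambda>t::real. indicator {0..1} t * c) = (c::real)"
  "integrable lborel (\<lambda>t::real. indicator {0..1} t * (c::real))"
  by auto

text \<open>A field of norm at most one has flux at most the length across each edge. Overlapping
  edges do no harm, so this direction applies to the competitor, whose boundary is known only as a
  chain.\<close>

lemma perimeter_le_length:
  assumes B: "has_boundary I \<gamma> \<gamma>' S" and S: "S \<in> sets lebesgue"
    and len: "\<And>i t. i \<in> I \<Longrightarrow> t \<in> {0..1} \<Longrightarrow> norm (\<gamma>' i t) \<le> len i"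
  shows "perimeter S \<le> ereal (\<Sum>i\<in>I. len i)"
  unfolding perimeter_def
proof (rule SUP_least)
  fix \<phi> assume "\<phi> \<in> {\<phi>. test_field \<phi>}"
  then have t: "test_field \<phi>" by simp
  have b: "norm (\<phi> z) \<le> 1" for z using t by (simp add: test_field_def)
  have "lint (\<gamma> i) (\<gamma>' i) \<phi> \<le> len i" if i: "i \<in> I" for i
  proof -
    have "lint (\<gamma> i) (\<gamma>' i) \<phi> \<le> integral\<^sup>L lborel (\<lambda>t::real. indicator {0..1} t * len i)"
      unfolding lint_def
    proof (rule integral_mono)
      show "integrable lborel (\<lambda>t. indicator {0..1} t * Im (cnj (\<phi> (\<gamma> i t)) * \<gamma>' i t))"
        using has_boundary_continuous[OF B i] C1c_continuous[OF test_field_C1c[OF t]] by (intro lint_integrable)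
      show "integrable lborel (\<lambda>t::real. indicator {0..1} t * len i)" by (rule integral_indicator_const)
      fix t :: real
      show "indicator {0..1} t * Im (cnj (\<phi> (\<gamma> i t)) * \<gamma>' i t) \<le> indicator {0..1} t * len i"
      proof (cases "t \<in> {0..1}")
        case True
        have "Im (cnj (\<phi> (\<gamma> i t)) * \<gamma>' i t) \<le> norm (\<phi> (\<gamma> i t)) * norm (\<gamma>' i t)"
          using Im_cnj_mult_le abs_le_D1 by blast
        also have "\<dots> \<le> 1 * len i" by (intro mult_mono b len[OF i True]) auto
        finally show ?thesis using True by simp
      qed simp
    qed
    then show ?thesis by (simp only: integral_indicator_const)
  qed
  then show "ereal (integral S (divergence \<phi>)) \<le> ereal (\<Sum>i\<in>I. len i)"
    unfolding Green_boundary[OF B S test_field_C1c[OF t]] by (simp add: sum_mono)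
qed

text \<open>Removing a parameter interval of length \<open>d\<close> at both ends makes the edges
  disjoint compact sets, on which the unit normal is continuous; Tietze extends it to the plane with
  the same bound.\<close>

lemma normal_field_exists:
  fixes \<gamma> \<gamma>' :: "'i \<Rightarrow> real \<Rightarrow> complex"
  assumes fin: "finite I" and c: "\<And>i. i \<in> I \<Longrightarrow> continuous_on UNIV (\<gamma> i)" "\<And>i. i \<in> I \<Longrightarrow> continuous_on UNIV (\<gamma>' i)"
    and len: "\<And>i t. i \<in> I \<Longrightarrow> t \<in> {0..1} \<Longrightarrow> norm (\<gamma>' i t) = len i" "\<And>i. i \<in> I \<Longrightarrow> len i > 0"
    and inj: "\<And>i j s t. i \<in> I \<Longrightarrow> j \<in> I \<Longrightarrow> s \<in> {0<..<1} \<Longrightarrow> t \<in> {0<..<1} \<Longrightarrow> \<gamma> i s = \<gamma> j t \<Longrightarrow> i = j \<and> s = t"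
    and d: "0 < d"
  obtains N where "continuous_on UNIV N" "\<And>z. norm (N z) \<le> 1"
    "\<And>i t. i \<in> I \<Longrightarrow> t \<in> {d..1-d} \<Longrightarrow> N (\<gamma> i t) = - \<i> * \<gamma>' i t / of_real (len i)"
proof -
  define J where "J = {d..1-d}"
  have J: "J \<subseteq> {0<..<1}" "compact J" using d by (auto simp: J_def)
  define K where "K i = \<gamma> i ` J" for i
  define g where "g i = inv_into J (\<gamma> i)" for i
  have g: "g i (\<gamma> i t) = t" if "i \<in> I" "t \<in> J" for i t
    unfolding g_def
  proof (rule inv_into_f_f)
    show "inj_on (\<gamma> i) J"
    proof (rule inj_onI)
      fix x y assume "x \<in> J" "y \<in> J" "\<gamma> i x = \<gamma> i y"
      then show "x = y" using inj[of i i x y] that(1) J(1) by blast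
    qed
  qed (rule that)
  have cg: "continuous_on (K i) (g i)" if "i \<in> I" for i
    unfolding K_def using g that J(2) c(1)[OF that] continuous_on_subset
    by (intro continuous_on_inv) blast+
  define F where "F i z = - \<i> * \<gamma>' i (g i z) / of_real (len i)" for i z
  have cF: "continuous_on (K i) (F i)" if "i \<in> I" for i
    unfolding F_def using len(2)[OF that]
    by (intro continuous_intros continuous_on_compose2[OF c(2)[OF that] cg[OF that]]) auto
  define M where "M z = F (SOME i. i \<in> I \<and> z \<in> K i) z" for z
  have uniq: "i = j" if "i \<in> I" "j \<in> I" "z \<in> K i" "z \<in> K j" for i j z
    using that inj J unfolding K_def by blast
  have M: "M z = F i z" if "i \<in> I" "z \<in> K i" for i z
  proof -
    have "(SOME i. i \<in> I \<and> z \<in> K i) = i" using that uniq by (intro some_equality) auto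
    then show ?thesis by (simp add: M_def)
  qed
  have cK: "compact (K i)" if "i \<in> I" for i
    unfolding K_def using J(2) c(1)[OF that] by (intro compact_continuous_image) (auto intro: continuous_on_subset)
  have "continuous_on (\<Union>i\<in>I. K i) M"
  proof (rule continuous_on_closed_Union[OF fin])
    show "closed (K i)" if "i \<in> I" for i using cK[OF that] compact_imp_closed by blast
    show "continuous_on (K i) M" if "i \<in> I" for i
      using cF[OF that] M[OF that] by (simp cong: continuous_on_cong)
  qed
  moreover have "closed (\<Union>i\<in>I. K i)" using fin cK compact_imp_closed by (intro closed_UN) auto
  moreover have "norm (M z) \<le> 1" if z: "z \<in> (\<Union>i\<in>I. K i)" for z
  proof -
    obtain i t where it: "i \<in> I" "t \<in> J" "z = \<gamma> i t" using z by (auto simp: K_def)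
    then have "M z = F i z" using M by (auto simp: K_def)
    then show ?thesis using it g[of i t] len(1)[of i t] len(2)[of i] J by (auto simp: F_def norm_divide norm_mult)
  qed
  ultimately obtain N where N: "continuous_on UNIV N" "\<And>z. z \<in> (\<Union>i\<in>I. K i) \<Longrightarrow> N z = M z" "\<And>z. norm (N z) \<le> 1"
    using Tietze[of "\<Union>i\<in>I. K i" M UNIV 1] by auto
  show thesis
  proof (rule that[OF N(1,3)])
    fix i t assume it: "i \<in> I" "t \<in> {d..1-d}"
    have zK: "\<gamma> i t \<in> K i" using it by (simp add: K_def J_def)
    then have "N (\<gamma> i t) = F i (\<gamma> i t)" using N(2)[of "\<gamma> i t"] M[of i "\<gamma> i t"] it by auto
    then show "N (\<gamma> i t) = - \<i> * \<gamma>' i t / of_real (len i)" using g[of i t] it by (simp add: F_def J_def)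
  qed
qed

lemma perimeter_ge_length:
  assumes B: "has_boundary I \<gamma> \<gamma>' S" and S: "S \<in> sets lebesgue"
    and len: "\<And>i t. i \<in> I \<Longrightarrow> t \<in> {0..1} \<Longrightarrow> norm (\<gamma>' i t) = len i" "\<And>i. i \<in> I \<Longrightarrow> len i > 0"
    and inj: "\<And>i j s t. i \<in> I \<Longrightarrow> j \<in> I \<Longrightarrow> s \<in> {0<..<1} \<Longrightarrow> t \<in> {0<..<1} \<Longrightarrow> \<gamma> i s = \<gamma> j t \<Longrightarrow> i = j \<and> s = t"
  shows "perimeter S \<ge> ereal (\<Sum>i\<in>I. len i)"
proof -
  have fin: "finite I" using B by (simp add: has_boundary_def)
  note c = has_boundary_continuous[OF B]
  have "bounded (\<Union>i\<in>I. \<gamma> i ` {0..1})"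
    using fin c(1) by (intro bounded_UN) (auto intro!: compact_imp_bounded compact_continuous_image intro: continuous_on_subset)
  then obtain \<rho> where \<rho>: "\<rho> > 0" "\<And>i t. i \<in> I \<Longrightarrow> t \<in> {0..1} \<Longrightarrow> norm (\<gamma> i t) \<le> \<rho>"
    unfolding bounded_pos by blast
  \<comment> \<open>The factor 5 collects a relative loss of \<open>d\<close> from the approximation
    and of \<open>2 * d\<close> from each of the two end pieces.\<close>
  have key: "perimeter S \<ge> ereal ((\<Sum>i\<in>I. len i) * (1 - 5 * d))" if d: "0 < d" for d
  proof -
    obtain N where N: "continuous_on UNIV N" "\<And>z. norm (N z) \<le> 1"
      "\<And>i t. i \<in> I \<Longrightarrow> t \<in> {d..1-d} \<Longrightarrow> N (\<gamma> i t) = - \<i> * \<gamma>' i t / of_real (len i)"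
      using normal_field_exists[of I \<gamma> \<gamma>' len d, OF fin c len inj d] by blast
    define N' where "N' z = max 0 (min 1 (\<rho> + 1 - norm z)) *\<^sub>R N z" for z
    have cN': "continuous_on UNIV N'" unfolding N'_def by (intro continuous_intros N(1))
    have N'0: "norm z \<ge> \<rho> + 1 \<Longrightarrow> N' z = 0" for z by (simp add: N'_def)
    have N'1: "norm (N' z) \<le> 1" for z
      unfolding N'_def norm_scaleR using N(2)[of z] by (intro mult_le_one) auto
    have N'eq: "N' (\<gamma> i t) = N (\<gamma> i t)" if "i \<in> I" "t \<in> {0..1}" for i t
      using \<rho>(2)[OF that] by (simp add: N'_def)
    have r1: "0 \<le> \<rho> + 1" using \<rho>(1) by simp
    obtain \<phi> where \<phi>: "test_field \<phi>" "\<And>z. norm (\<phi> z - N' z) \<le> d"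
      using test_field_dense[OF cN' N'0 N'1 r1 d] by metis
    have b: "norm (\<phi> z) \<le> 1" for z using \<phi>(1) by (simp add: test_field_def)
    have L: "lint (\<gamma> i) (\<gamma>' i) \<phi> \<ge> len i * (1 - 5 * d)" if i: "i \<in> I" for i
    proof -
      \<comment> \<open>Lower bound for the integrand: \<open>len i * (1 - d)\<close> away from the
        ends, and on the end pieces a subtraction of \<open>2 * len i\<close> that brings it below
        the trivial bound \<open>- len i\<close>.\<close>
      let ?h = "\<lambda>t::real. indicator {0..1} t * (len i * (1 - d)) - indicator {0..d} t * (2 * len i) - indicator {1-d..1} t * (2 * len i)"
      have "integral\<^sup>L lborel ?h \<le> lint (\<gamma> i) (\<gamma>' i) \<phi>"
        unfolding lint_def
      proof (rule integral_mono)
        show "integrable lborel ?h"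
          by (intro Bochner_Integration.integrable_diff integrable_mult_left integrable_real_indicator)
             (auto simp: emeasure_lborel_Icc_eq less_top[symmetric])
        show "integrable lborel (\<lambda>t. indicator {0..1} t * Im (cnj (\<phi> (\<gamma> i t)) * \<gamma>' i t))"
          using c[OF i] C1c_continuous[OF test_field_C1c[OF \<phi>(1)]] by (intro lint_integrable)
        fix t :: real
        show "?h t \<le> indicator {0..1} t * Im (cnj (\<phi> (\<gamma> i t)) * \<gamma>' i t)"
        proof (cases "t \<in> {0..1}")
          case False
          then have I0: "indicator {0..1} t = (0::real)" by simp
          have "indicator {0..d} t * (2 * len i) \<ge> 0" "indicator {1-d..1} t * (2 * len i) \<ge> 0"
            using len(2)[OF i] by auto
          then show ?thesis unfolding I0 mult_zero_left by linarith
        next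
          case t: True
          have lb: "Im (cnj (\<phi> (\<gamma> i t)) * \<gamma>' i t) \<ge> - len i"
            using Im_cnj_mult_le[of "\<phi> (\<gamma> i t)" "\<gamma>' i t"] mult_right_mono[OF b[of "\<gamma> i t"] less_imp_le[OF len(2)[OF i]]]
            unfolding len(1)[OF i t] by linarith
          show ?thesis
          proof (cases "t \<in> {d..1-d}")
            case True
            have e: "N' (\<gamma> i t) = - \<i> * \<gamma>' i t / of_real (len i)" using N'eq[OF i t] N(3)[OF i True] by simp
            have "cnj (N' (\<gamma> i t)) * \<gamma>' i t = \<i> * (\<gamma>' i t * cnj (\<gamma>' i t)) / of_real (len i)"
              unfolding e by (simp add: algebra_simps)
            also have "\<dots> = \<i> * of_real (len i)"
              unfolding complex_norm_square[symmetric] len(1)[OF i t] using len(2)[OF i] by (simp add: power2_eq_square)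
            finally have "Im (cnj (N' (\<gamma> i t)) * \<gamma>' i t) = len i" by simp
            moreover have "cnj (\<phi> (\<gamma> i t)) * \<gamma>' i t = cnj (N' (\<gamma> i t)) * \<gamma>' i t + cnj (\<phi> (\<gamma> i t) - N' (\<gamma> i t)) * \<gamma>' i t"
              by (simp add: algebra_simps)
            moreover have "\<bar>Im (cnj (\<phi> (\<gamma> i t) - N' (\<gamma> i t)) * \<gamma>' i t)\<bar> \<le> d * len i"
              using Im_cnj_mult_le[of "\<phi> (\<gamma> i t) - N' (\<gamma> i t)" "\<gamma>' i t"] mult_right_mono[OF \<phi>(2)[of "\<gamma> i t"] less_imp_le[OF len(2)[OF i]]]
              unfolding len(1)[OF i t] by linarith
            ultimately have "Im (cnj (\<phi> (\<gamma> i t)) * \<gamma>' i t) \<ge> len i - d * len i"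
              by (simp only: plus_complex.sel)
            then have "Im (cnj (\<phi> (\<gamma> i t)) * \<gamma>' i t) \<ge> len i * (1 - d)" by (simp only: right_diff_distrib mult_1_right mult.commute)
            moreover have "indicator {0..d} t * (2 * len i) \<ge> 0" "indicator {1-d..1} t * (2 * len i) \<ge> 0"
              using len(2)[OF i] by auto
            moreover have I1: "indicator {0..1} t = (1::real)" using t by simp
            ultimately show ?thesis unfolding I1 mult_1_left by linarith
          next
            case False
            then have "indicator {0..d} t + indicator {1-d..1} t \<ge> (1::real)" using t by (auto simp: indicator_def)
            then have "indicator {0..d} t * (2 * len i) + indicator {1-d..1} t * (2 * len i) \<ge> 2 * len i"
              using len(2)[OF i] mult_right_mono[of 1 "indicator {0..d} t + indicator {1-d..1} t" "2 * len i"]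
              by (simp add: distrib_right)
            moreover have "len i * (1 - d) \<le> len i" using d len(2)[OF i] by (simp add: algebra_simps)
            moreover have I1: "indicator {0..1} t = (1::real)" using t by simp
            ultimately show ?thesis using lb unfolding I1 mult_1_left by linarith
          qed
        qed
      qed
      moreover have "integral\<^sup>L lborel ?h = len i * (1 - d) - d * (2 * len i) - d * (2 * len i)"
        using d by (subst Bochner_Integration.integral_diff; (subst Bochner_Integration.integral_diff)?) auto
      ultimately show ?thesis by (simp add: algebra_simps)
    qed
    have "(\<Sum>i\<in>I. len i) * (1 - 5 * d) \<le> (\<Sum>i\<in>I. lint (\<gamma> i) (\<gamma>' i) \<phi>)"
      unfolding sum_distrib_right by (rule sum_mono[OF L])
    also have "\<dots> = integral S (divergence \<phi>)" by (rule Green_boundary[OF B S test_field_C1c[OF \<phi>(1)], symmetric])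
    finally show ?thesis unfolding perimeter_def using \<phi>(1)
      by (intro SUP_upper2[of \<phi>]) auto
  qed
  define L where "L = (\<Sum>i\<in>I. len i)"
  have "(\<lambda>n. ereal (L * (1 - 5 * (1 / real (Suc n))))) \<longlonglongrightarrow> ereal (L * (1 - 5 * 0))"
    using LIMSEQ_inverse_real_of_nat by (intro tendsto_intros) (simp add: inverse_eq_divide)
  then have "ereal (L * (1 - 5 * 0)) \<le> perimeter S"
  proof (rule LIMSEQ_le_const2)
    have "ereal (L * (1 - 5 * (1 / real (Suc n)))) \<le> perimeter S" for n
      unfolding L_def by (rule key) simp
    then show "\<exists>N. \<forall>n\<ge>N. ereal (L * (1 - 5 * (1 / real (Suc n)))) \<le> perimeter S" by blast
  qed
  then show ?thesis by (simp add: L_def)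
qed

section \<open>Area as half the flux of the identity field\<close>

definition plateau :: "real \<Rightarrow> complex \<Rightarrow> real" where
  "plateau \<rho> z = sqp (1 - sqp ((norm z)\<^sup>2 - \<rho>\<^sup>2))"

lemma plateau_field:
  assumes "0 \<le> \<rho>"
  shows "C1c (\<lambda>z. plateau \<rho> z *\<^sub>R z)"
    "norm z \<le> \<rho> \<Longrightarrow> plateau \<rho> z = 1"
    "norm z \<le> \<rho> \<Longrightarrow> divergence (\<lambda>z. plateau \<rho> z *\<^sub>R z) z = 2"
proof -
  have one: "norm z \<le> \<rho> \<Longrightarrow> plateau \<rho> z = 1" for z
    by (simp add: plateau_def sqp_def power_mono)
  then show "norm z \<le> \<rho> \<Longrightarrow> plateau \<rho> z = 1" .
  define D where "D z v = 2 * max 0 (1 - sqp ((norm z)\<^sup>2 - \<rho>\<^sup>2)) * (- (2 * max 0 ((norm z)\<^sup>2 - \<rho>\<^sup>2) * (2 * (z \<bullet> v))))" for z v :: complex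
  have d: "(plateau \<rho> has_derivative D z) (at z)" for z
  proof -
    have "((\<lambda>z::complex. (norm z)\<^sup>2 - \<rho>\<^sup>2) has_derivative (\<lambda>v. 2 * (z \<bullet> v))) (at z)"
      by (auto intro!: derivative_eq_intros normsq_has_derivative)
    from sqp_has_derivative[OF this]
    have "((\<lambda>z::complex. 1 - sqp ((norm z)\<^sup>2 - \<rho>\<^sup>2)) has_derivative (\<lambda>v. - (2 * max 0 ((norm z)\<^sup>2 - \<rho>\<^sup>2) * (2 * (z \<bullet> v))))) (at z)"
      by (auto intro!: derivative_eq_intros)
    from sqp_has_derivative[OF this] show ?thesis unfolding plateau_def D_def .
  qed
  have pd: "((\<lambda>z. plateau \<rho> z *\<^sub>R z) has_derivative (\<lambda>v. plateau \<rho> z *\<^sub>R v + D z v *\<^sub>R z)) (at z)" for z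
    by (rule has_derivative_scaleR[OF d has_derivative_ident])
  have pc: "continuous_on UNIV (\<lambda>z. plateau \<rho> z *\<^sub>R b + D z b *\<^sub>R z)" for b
    unfolding plateau_def D_def by (intro continuous_intros sqp_cont)
  have pz: "norm z > \<rho> + 1 \<Longrightarrow> plateau \<rho> z *\<^sub>R z = 0" for z :: complex
  proof -
    assume z: "norm z > \<rho> + 1"
    have "(\<rho> + 1)\<^sup>2 \<le> (norm z)\<^sup>2" using z assms by (intro power_mono) auto
    then have "(norm z)\<^sup>2 - \<rho>\<^sup>2 \<ge> 1" using assms by (simp add: power2_eq_square algebra_simps)
    then have "sqp ((norm z)\<^sup>2 - \<rho>\<^sup>2) \<ge> 1" by (simp add: sqp_def)
    then show "plateau \<rho> z *\<^sub>R z = 0" by (simp add: plateau_def sqp_def)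
  qed
  note C = C1cI[OF pd pc pz]
  show "C1c (\<lambda>z. plateau \<rho> z *\<^sub>R z)" by (rule C(1))
  show "norm z \<le> \<rho> \<Longrightarrow> divergence (\<lambda>z. plateau \<rho> z *\<^sub>R z) z = 2"
  proof -
    assume z: "norm z \<le> \<rho>"
    then have "D z v = 0" for v by (simp add: D_def power_mono)
    then show ?thesis using one[OF z] by (simp add: divergence_complex C(2))
  qed
qed

text \<open>The identity field has divergence 2 but no compact support; \<open>plateau\<close> cuts
  it off outside a disc that contains all edges and almost all of \<open>S\<close>.\<close>

lemma area_boundary:
  assumes B: "has_boundary I \<gamma> \<gamma>' S" and S: "S \<in> sets lebesgue" "AE z in lebesgue. z \<in> S \<longrightarrow> norm z \<le> R"
  shows "measure lebesgue S = (\<Sum>i\<in>I. lint (\<gamma> i) (\<gamma>' i) (\<lambda>z. z)) / 2" "emeasure lebesgue S < \<infinity>"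
proof -
  have fin: "finite I" using B by (simp add: has_boundary_def)
  note c = has_boundary_continuous[OF B]
  have "bounded (\<Union>i\<in>I. \<gamma> i ` {0..1})"
    using fin c(1) by (intro bounded_UN) (auto intro!: compact_imp_bounded compact_continuous_image intro: continuous_on_subset)
  then obtain \<rho>0 where \<rho>0: "\<rho>0 > 0" "\<And>i t. i \<in> I \<Longrightarrow> t \<in> {0..1} \<Longrightarrow> norm (\<gamma> i t) \<le> \<rho>0"
    unfolding bounded_pos by blast
  define \<rho> where "\<rho> = max \<rho>0 R"
  have \<rho>: "0 \<le> \<rho>" "\<rho>0 \<le> \<rho>" "R \<le> \<rho>" using \<rho>0(1) by (auto simp: \<rho>_def)
  note P = plateau_field[OF \<rho>(1)]
  let ?\<phi> = "\<lambda>z. plateau \<rho> z *\<^sub>R z"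
  have "emeasure lebesgue S \<le> emeasure lebesgue (cball (0::complex) \<rho>)"
    using S \<rho> by (intro emeasure_mono_AE) (auto elim!: eventually_mono)
  also have "\<dots> < \<infinity>" using emeasure_bounded_finite[OF bounded_cball, of "0::complex" \<rho>] by simp
  finally show fm: "emeasure lebesgue S < \<infinity>" .
  have "integral S (divergence ?\<phi>) = integral\<^sup>L lebesgue (\<lambda>z. indicator S z *\<^sub>R divergence ?\<phi> z)"
    by (rule integral_eq_lebesgue_integral[OF C1c_divergence(2)[OF P(1)] S(1)])
  also have "\<dots> = integral\<^sup>L lebesgue (\<lambda>z. indicator S z *\<^sub>R (2::real))"
  proof (rule integral_cong_AE)
    show "(\<lambda>z. indicator S z *\<^sub>R divergence ?\<phi> z) \<in> borel_measurable lebesgue"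
      using integrable_lebesgue_indicator[OF C1c_divergence(2)[OF P(1)] S(1)] by (rule borel_measurable_integrable)
    show "(\<lambda>z. indicator S z *\<^sub>R (2::real)) \<in> borel_measurable lebesgue" using S(1) by simp
    show "AE z in lebesgue. indicator S z *\<^sub>R divergence ?\<phi> z = indicator S z *\<^sub>R (2::real)"
      using S(2) by eventually_elim (use P(3) \<rho>(3) in \<open>auto simp: indicator_def\<close>)
  qed
  also have "\<dots> = 2 * measure lebesgue S" using S(1) fm by simp
  finally have "2 * measure lebesgue S = (\<Sum>i\<in>I. lint (\<gamma> i) (\<gamma>' i) ?\<phi>)"
    using Green_boundary[OF B S(1) P(1)] by simp
  also have "\<dots> = (\<Sum>i\<in>I. lint (\<gamma> i) (\<gamma>' i) (\<lambda>z. z))"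
  proof (rule sum.cong[OF refl])
    fix i assume i: "i \<in> I"
    have "indicator {0..1} t * Im (cnj (plateau \<rho> (\<gamma> i t) *\<^sub>R \<gamma> i t) * \<gamma>' i t) = indicator {0..1} t * Im (cnj (\<gamma> i t) * \<gamma>' i t)" for t :: real
      using P(2)[of "\<gamma> i t"] \<rho>0(2)[OF i, of t] \<rho>(2) by (auto simp: indicator_def)
    then show "lint (\<gamma> i) (\<gamma>' i) ?\<phi> = lint (\<gamma> i) (\<gamma>' i) (\<lambda>z. z)" unfolding lint_def by (simp only:)
  qed
  finally show "measure lebesgue S = (\<Sum>i\<in>I. lint (\<gamma> i) (\<gamma>' i) (\<lambda>z. z)) / 2" by simp
qed

subsection \<open>Curves of constant curvature\<close>

definition cdir :: "real \<Rightarrow> real \<Rightarrow> real \<Rightarrow> real \<Rightarrow> complex" where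
  "cdir \<theta> \<kappa> len t = of_real len * cis (\<theta> + \<kappa> * (t * len))"

lemma norm_cdir: "len > 0 \<Longrightarrow> norm (cdir \<theta> \<kappa> len t) = len"
  by (simp add: cdir_def norm_mult)

lemma cis_has_vector_derivative:
  assumes "(f has_real_derivative f') (at t)"
  shows "((\<lambda>t. cis (f t)) has_vector_derivative (of_real f' * \<i> * cis (f t))) (at t)"
proof -
  have "((\<lambda>t. \<i> * of_real (f t)) has_vector_derivative \<i> * of_real f') (at t)"
    using assms
    by (intro has_vector_derivative_mult_right has_vector_derivative_of_real) (simp add: has_real_derivative_iff_has_vector_derivative)
  from field_vector_diff_chain_at[OF this DERIV_exp]
  have "((\<lambda>t. exp (\<i> * of_real (f t))) has_vector_derivative (\<i> * of_real f' * exp (\<i> * of_real (f t)))) (at t)"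
    by (simp add: o_def)
  then show ?thesis by (simp add: cis_conv_exp mult.commute mult.left_commute)
qed

lemma ccurve_has_vector_derivative:
  "(ccurve p \<theta> \<kappa> len has_vector_derivative cdir \<theta> \<kappa> len t) (at t)"
proof (cases "\<kappa> = 0")
  case True
  have "((\<lambda>t. p + of_real (t * len) * cis \<theta>) has_vector_derivative of_real len * cis \<theta>) (at t)"
    by (auto intro!: derivative_eq_intros simp: has_vector_derivative_def scaleR_conv_of_real algebra_simps)
  then show ?thesis using True by (simp add: ccurve_def[abs_def] cdir_def)
next
  case False
  have "((\<lambda>t. \<theta> + \<kappa> * (t * len)) has_real_derivative \<kappa> * len) (at t)"
    by (auto intro!: derivative_eq_intros)
  from cis_has_vector_derivative[OF this]
  have "((\<lambda>t. p + (cis (\<theta> + \<kappa> * (t * len)) - cis \<theta>) / (\<i> * of_real \<kappa>)) has_vector_derivative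
     (0 + (of_real (\<kappa> * len) * \<i> * cis (\<theta> + \<kappa> * (t * len)) - 0) / (\<i> * of_real \<kappa>))) (at t)"
    by (intro has_vector_derivative_add has_vector_derivative_const has_vector_derivative_divide has_vector_derivative_diff)
  moreover have "0 + (of_real (\<kappa> * len) * \<i> * cis (\<theta> + \<kappa> * (t * len)) - 0) / (\<i> * of_real \<kappa>) = cdir \<theta> \<kappa> len t"
  proof -
    have nz: "\<i> * of_real \<kappa> \<noteq> (0::complex)" using False by simp
    show ?thesis unfolding cdir_def add_0 diff_zero nonzero_divide_eq_eq[OF nz] by (simp add: mult_ac)
  qed
  ultimately show ?thesis using False by (simp add: ccurve_def[abs_def])
qed

lemma ccurve_continuous: "continuous_on S (ccurve p \<theta> \<kappa> len)"
  by (meson ccurve_has_vector_derivative continuous_at_imp_continuous_on has_vector_derivative_continuous)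

lemma cdir_continuous: "continuous_on S (cdir \<theta> \<kappa> len)"
  unfolding cdir_def cis_conv_exp by (intro continuous_intros)

lemma ccurve_0: "ccurve p \<theta> \<kappa> len 0 = p" by (simp add: ccurve_def)

lemma wk_eq_integral:
  assumes "continuous_on UNIV \<gamma>" "continuous_on UNIV \<gamma>'" "z \<notin> \<gamma> ` {0..1}"
  shows "((\<lambda>t. 1 / (\<gamma> t - z) * \<gamma>' t) has_integral wk \<gamma> \<gamma>' z) {0..1}"
proof -
  have c: "continuous_on {0..1} (\<lambda>t. \<gamma>' t / (\<gamma> t - z))"
    using assms by (intro continuous_intros) (auto intro: continuous_on_subset)
  have "set_integrable lborel {0..1} (\<lambda>t. \<gamma>' t / (\<gamma> t - z))"
    using edge_integrable[OF c] by (simp add: set_integrable_def)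
  from has_integral_set_lebesgue[of "{0..1}" "\<lambda>t. \<gamma>' t / (\<gamma> t - z)"] set_borel_integral_eq_integral[OF this]
  have "(\<lambda>t. \<gamma>' t / (\<gamma> t - z)) integrable_on {0..1}" "wk \<gamma> \<gamma>' z = integral {0..1} (\<lambda>t. \<gamma>' t / (\<gamma> t - z))"
    by (simp_all add: wk_def set_lebesgue_integral_def)
  then show ?thesis by (simp add: has_integral_iff)
qed

section \<open>Closed paths made of edges of constant curvature\<close>

context
  fixes n :: nat and p \<theta> \<kappa> len
  assumes n: "0 < n"
    and clos: "\<And>i. i < n \<Longrightarrow> ccurve (p i) (\<theta> i) (\<kappa> i) (len i) 1 = p (Suc i mod n)"
begin

lemma cpoly_path_eq:
  assumes i: "i < n" and t: "t \<in> {real i / real n .. real (Suc i) / real n}"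
  shows "cpoly_path n p \<theta> \<kappa> len t = ccurve (p i) (\<theta> i) (\<kappa> i) (len i) (real n * t - real i)"
proof (cases "t = real (Suc i) / real n")
  case False
  then have "real i \<le> real n * t" "real n * t < real i + 1" using t n by (auto simp: field_simps)
  then have "\<lfloor>real n * t\<rfloor> = int i" by linarith
  then show ?thesis using i by (simp add: cpoly_path_def Let_def)
next
  \<comment> \<open>At the right end the floor already selects the next edge, or the default
    \<open>p 0\<close> after the last one; the closing condition \<open>clos\<close> identifies both
    with the end of the current edge.\<close>
  case True
  then have nt: "real n * t = real (Suc i)" using n by simp
  have fl: "nat \<lfloor>real n * t\<rfloor> = Suc i" unfolding nt by simp
  have s: "real n * t - real i = 1" "real n * t - real (Suc i) = 0" unfolding nt by simp_all
  show ?thesis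
  proof (cases "Suc i < n")
    case True then show ?thesis using clos[OF i] by (simp add: cpoly_path_def Let_def fl s ccurve_0 del: of_nat_Suc)
  next
    case False
    then have "Suc i mod n = 0" using i by (metis Suc_lessI mod_self)
    then show ?thesis using clos[OF i] False by (simp add: cpoly_path_def Let_def fl s)
  qed
qed

lemma cpoly_index:
  assumes "t \<in> {0..1}" obtains i where "i < n" "t \<in> {real i / real n .. real (Suc i) / real n}"
proof (cases "t = 1")
  case True
  show thesis by (rule that[of "n - 1"]) (use n True in \<open>auto simp: field_simps\<close>)
next
  case False
  then have "real n * t < real n" "0 \<le> real n * t" using assms n by auto
  then have "nat \<lfloor>real n * t\<rfloor> < n" "real (nat \<lfloor>real n * t\<rfloor>) \<le> real n * t" "real n * t \<le> real (Suc (nat \<lfloor>real n * t\<rfloor>))"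
    by linarith+
  then show thesis using n by (intro that[of "nat \<lfloor>real n * t\<rfloor>"]) (auto simp: field_simps)
qed

lemma cpoly_image: "path_image (cpoly_path n p \<theta> \<kappa> len) = (\<Union>i<n. ccurve (p i) (\<theta> i) (\<kappa> i) (len i) ` {0..1})"
proof (intro subset_antisym subsetI)
  fix z assume "z \<in> path_image (cpoly_path n p \<theta> \<kappa> len)"
  then obtain t where t: "t \<in> {0..1}" "z = cpoly_path n p \<theta> \<kappa> len t" by (auto simp: path_image_def)
  obtain i where i: "i < n" "t \<in> {real i / real n .. real (Suc i) / real n}" using cpoly_index[OF t(1)] .
  have "real n * t - real i \<in> {0..1}" using i n by (auto simp: field_simps)
  then show "z \<in> (\<Union>i<n. ccurve (p i) (\<theta> i) (\<kappa> i) (len i) ` {0..1})" 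
    unfolding t(2) cpoly_path_eq[OF i] using i(1) by blast
next
  fix z assume "z \<in> (\<Union>i<n. ccurve (p i) (\<theta> i) (\<kappa> i) (len i) ` {0..1})"
  then obtain i s where i: "i < n" "s \<in> {0..1}" "z = ccurve (p i) (\<theta> i) (\<kappa> i) (len i) s" by auto
  let ?t = "(real i + s) / real n"
  have t: "?t \<in> {real i / real n .. real (Suc i) / real n}" using i n by (auto simp: field_simps)
  have "real i + s \<le> real n" using i by auto
  then have "?t \<in> {0..1}" using i n by (auto simp: field_simps)
  moreover have "cpoly_path n p \<theta> \<kappa> len ?t = z" using cpoly_path_eq[OF i(1) t] i n by simp
  ultimately show "z \<in> path_image (cpoly_path n p \<theta> \<kappa> len)" by (auto simp: path_image_def)
qed

lemma cpoly_deriv: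
  assumes i: "i < n" and t: "t \<in> {real i / real n <..< real (Suc i) / real n}"
  shows "(cpoly_path n p \<theta> \<kappa> len has_vector_derivative real n *\<^sub>R cdir (\<theta> i) (\<kappa> i) (len i) (real n * t - real i)) (at t)"
proof -
  have "((\<lambda>t. real n * t - real i) has_vector_derivative real n) (at t)"
    by (auto intro!: derivative_eq_intros simp: has_vector_derivative_def)
  from vector_diff_chain_at[OF this ccurve_has_vector_derivative]
  have "((\<lambda>t. ccurve (p i) (\<theta> i) (\<kappa> i) (len i) (real n * t - real i)) has_vector_derivative real n *\<^sub>R cdir (\<theta> i) (\<kappa> i) (len i) (real n * t - real i)) (at t)"
    by (simp add: o_def)
  then show ?thesis
    by (rule has_vector_derivative_transform_within_open[OF _ _ t]) (use cpoly_path_eq[OF i] in auto)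
qed

lemma cpoly_open_index:
  assumes "t \<in> {0..1} - (\<lambda>i. real i / real n) ` {..n}"
  obtains i where "i < n" "t \<in> {real i / real n <..< real (Suc i) / real n}"
proof -
  obtain i where i: "i < n" "t \<in> {real i / real n .. real (Suc i) / real n}" using cpoly_index assms by blast
  moreover have "t \<noteq> real i / real n" "t \<noteq> real (Suc i) / real n"
    using assms i imageI[of i "{..n}" "\<lambda>i. real i / real n"] imageI[of "Suc i" "{..n}" "\<lambda>i. real i / real n"] by auto
  ultimately show thesis using that[of i] by fastforce
qed

lemma cpoly_valid:
  assumes "path (cpoly_path n p \<theta> \<kappa> len)"
  shows "valid_path (cpoly_path n p \<theta> \<kappa> len)"
proof -
  let ?G = "cpoly_path n p \<theta> \<kappa> len"
  let ?S = "(\<lambda>i. real i / real n) ` {..n}"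
  define D where "D t = (let i = nat \<lfloor>real n * t\<rfloor> in real n *\<^sub>R cdir (\<theta> i) (\<kappa> i) (len i) (real n * t - real i))" for t
  have D: "D t = real n *\<^sub>R cdir (\<theta> i) (\<kappa> i) (len i) (real n * t - real i)"
    if "i < n" "t \<in> {real i / real n <..< real (Suc i) / real n}" for i t
  proof -
    have "real i \<le> real n * t" "real n * t < real i + 1" using that n by (auto simp: field_simps)
    then have "\<lfloor>real n * t\<rfloor> = int i" by linarith
    then show ?thesis by (simp add: D_def Let_def)
  qed
  have "?G C1_differentiable_on ({0..1} - ?S)"
    unfolding C1_differentiable_on_def
  proof (intro exI conjI ballI)
    fix t assume t: "t \<in> {0..1} - ?S"
    obtain i where i: "i < n" "t \<in> {real i / real n <..< real (Suc i) / real n}" using cpoly_open_index[OF t] .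
    show "(?G has_vector_derivative D t) (at t)" using cpoly_deriv[OF i] D[OF i] by simp
  next
    show "continuous_on ({0..1} - ?S) D"
    proof (intro continuous_at_imp_continuous_on ballI)
      fix t assume t: "t \<in> {0..1} - ?S"
      obtain i where i: "i < n" "t \<in> {real i / real n <..< real (Suc i) / real n}" using cpoly_open_index[OF t] .
      have "continuous_on UNIV (\<lambda>t. real n *\<^sub>R cdir (\<theta> i) (\<kappa> i) (len i) (real n * t - real i))"
        by (intro continuous_intros continuous_on_compose2[OF cdir_continuous[of UNIV]]) auto
      then have "continuous_on {real i / real n <..< real (Suc i) / real n} D"
        using D[OF i(1)] by (subst continuous_on_cong[OF refl, of _ D "\<lambda>t. real n *\<^sub>R cdir (\<theta> i) (\<kappa> i) (len i) (real n * t - real i)"]) (auto intro: continuous_on_subset)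
      then show "isCont D t" using i(2) by (simp add: continuous_on_eq_continuous_at)
    qed
  qed
  then show ?thesis
    using assms unfolding valid_path_def piecewise_C1_differentiable_on_def path_def by blast
qed

text \<open>The contour integral of the winding number splits at the multiples of
  \<open>1 / n\<close>, and an affine change of parameter turns each piece into the Cauchy integral
  of one edge.\<close>

lemma cpoly_winding:
  assumes P: "path (cpoly_path n p \<theta> \<kappa> len)" and z: "z \<notin> path_image (cpoly_path n p \<theta> \<kappa> len)"
  shows "(\<Sum>i<n. wk (ccurve (p i) (\<theta> i) (\<kappa> i) (len i)) (cdir (\<theta> i) (\<kappa> i) (len i)) z)
     = 2 * of_real pi * \<i> * winding_number (cpoly_path n p \<theta> \<kappa> len) z"
proof -
  let ?G = "cpoly_path n p \<theta> \<kappa> len"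
  let ?w = "\<lambda>i. wk (ccurve (p i) (\<theta> i) (\<kappa> i) (len i)) (cdir (\<theta> i) (\<kappa> i) (len i)) z"
  let ?h = "\<lambda>t. 1 / (?G t - z) * vector_derivative ?G (at t)"
  have piece: "(?h has_integral ?w i) {real i / real n .. real (Suc i) / real n}" if i: "i < n" for i
  proof -
    have "z \<notin> ccurve (p i) (\<theta> i) (\<kappa> i) (len i) ` {0..1}" using z i unfolding cpoly_image by auto
    from wk_eq_integral[OF ccurve_continuous cdir_continuous this]
    have "((\<lambda>s. 1 / (ccurve (p i) (\<theta> i) (\<kappa> i) (len i) s - z) * cdir (\<theta> i) (\<kappa> i) (len i) s) has_integral ?w i) (cbox 0 1)" by simp
    from has_integral_affinity'[OF this, of "real n" "- real i"] n
    have "((\<lambda>t. 1 / (ccurve (p i) (\<theta> i) (\<kappa> i) (len i) (real n * t - real i) - z) * cdir (\<theta> i) (\<kappa> i) (len i) (real n * t - real i)) has_integral ?w i /\<^sub>R real n) {real i / real n .. real (Suc i) / real n}"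
      by (simp add: field_simps)
    from has_integral_cmul[OF this, of "real n"]
    have "((\<lambda>t. real n *\<^sub>R (1 / (ccurve (p i) (\<theta> i) (\<kappa> i) (len i) (real n * t - real i) - z) * cdir (\<theta> i) (\<kappa> i) (len i) (real n * t - real i))) has_integral ?w i) {real i / real n .. real (Suc i) / real n}"
      using n by simp
    then show ?thesis
    proof (rule has_integral_spike_finite[of "{real i / real n, real (Suc i) / real n}", rotated 2])
      fix t assume "t \<in> {real i / real n .. real (Suc i) / real n} - {real i / real n, real (Suc i) / real n}"
      then have t: "t \<in> {real i / real n <..< real (Suc i) / real n}" by auto
      show "?h t = real n *\<^sub>R (1 / (ccurve (p i) (\<theta> i) (\<kappa> i) (len i) (real n * t - real i) - z) * cdir (\<theta> i) (\<kappa> i) (len i) (real n * t - real i))"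
        using vector_derivative_at[OF cpoly_deriv[OF i t]] cpoly_path_eq[OF i, of t] t by (simp add: scaleR_conv_of_real)
    qed simp
  qed
  have "(?h has_integral (\<Sum>i<k. ?w i)) {0 .. real k / real n}" if "k \<le> n" for k
    using that
  proof (induction k)
    case 0 then show ?case using has_integral_refl(2)[of ?h 0] by simp
  next
    case (Suc k)
    have "(?h has_integral ((\<Sum>i<k. ?w i) + ?w k)) {0 .. real (Suc k) / real n}"
      by (rule has_integral_combine[OF _ _ _ piece]) (use Suc n in \<open>auto simp: divide_right_mono\<close>)
    then show ?case by simp
  qed
  from this[of n] have "(?h has_integral (\<Sum>i<n. ?w i)) {0..1}" using n by simp
  then have "((\<lambda>w. 1 / (w - z)) has_contour_integral (\<Sum>i<n. ?w i)) ?G"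
    by (simp add: has_contour_integral)
  then have "contour_integral ?G (\<lambda>w. 1 / (w - z)) = (\<Sum>i<n. ?w i)" by (rule contour_integral_unique)
  then show ?thesis using winding_number_valid_path[OF cpoly_valid[OF P] z] by simp
qed

end

lemma ccurve_image_negligible: "negligible (ccurve p \<theta> \<kappa> len ` {0..1})"
proof (rule negligible_differentiable_image_lowdim)
  show "ccurve p \<theta> \<kappa> len differentiable_on {0..1}"
    using ccurve_has_vector_derivative
    by (meson differentiable_at_imp_differentiable_on has_vector_derivative_def differentiableI)
qed simp

text \<open>The winding number is one inside by the definition of the polygon and zero outside; the
  path is negligible, each edge being a differentiable image of an interval.\<close>

lemma cpoly_has_boundary:
  assumes n: "0 < n" and C: "curvilinear_polygon_120 n p \<theta> \<kappa> len E"
  shows "has_boundary {..<n} (\<lambda>i. ccurve (p i) (\<theta> i) (\<kappa> i) (len i)) (\<lambda>i. cdir (\<theta> i) (\<kappa> i) (len i)) E"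
    "AE z in lebesgue. z \<in> E \<longleftrightarrow> z \<in> inside (path_image (cpoly_path n p \<theta> \<kappa> len))"
proof -
  let ?G = "cpoly_path n p \<theta> \<kappa> len"
  have clos: "\<And>i. i < n \<Longrightarrow> ccurve (p i) (\<theta> i) (\<kappa> i) (len i) 1 = p (Suc i mod n)"
    and sp: "simple_path ?G" and cl: "pathfinish ?G = pathstart ?G"
    and w1: "\<And>z. z \<in> inside (path_image ?G) \<Longrightarrow> winding_number ?G z = 1"
    and ae: "ae_eq E (inside (path_image ?G))"
    using C unfolding curvilinear_polygon_120_def Let_def by auto
  have P: "path ?G" using sp simple_path_imp_path by blast
  have img: "path_image ?G = (\<Union>i<n. ccurve (p i) (\<theta> i) (\<kappa> i) (len i) ` {0..1})"
    by (rule cpoly_image[OF n]) (rule clos)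
  have "negligible (path_image ?G)"
    unfolding img by (intro negligible_Union) (auto intro: ccurve_image_negligible)
  then have 1: "AE z in lebesgue. z \<notin> path_image ?G"
    by (intro AE_not_in) (simp add: negligible_iff_null_sets)
  have 2: "AE z in lebesgue. z \<notin> E - inside (path_image ?G)" "AE z in lebesgue. z \<notin> inside (path_image ?G) - E"
    using ae AE_not_in unfolding ae_eq_def by blast+
  show 3: "AE z in lebesgue. z \<in> E \<longleftrightarrow> z \<in> inside (path_image ?G)"
    using 2(1) 2(2) by eventually_elim auto
  have "AE z in lebesgue. (\<Sum>i<n. wk (ccurve (p i) (\<theta> i) (\<kappa> i) (len i)) (cdir (\<theta> i) (\<kappa> i) (len i)) z) = 2 * of_real pi * \<i> * indicator E z"
    using 1 3
  proof eventually_elim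
    case (elim z)
    have "winding_number ?G z = indicator E z"
    proof (cases "z \<in> inside (path_image ?G)")
      case True then show ?thesis using w1 elim by simp
    next
      case False
      then have "z \<in> outside (path_image ?G)" using elim(1) inside_Un_outside by blast
      then show ?thesis using winding_number_zero_in_outside[OF P cl] False elim by simp
    qed
    then show ?case using cpoly_winding[where n=n and p=p and \<theta>=\<theta> and \<kappa>=\<kappa> and len=len, OF n clos P elim(1)] by simp
  qed
  then show "has_boundary {..<n} (\<lambda>i. ccurve (p i) (\<theta> i) (\<kappa> i) (len i)) (\<lambda>i. cdir (\<theta> i) (\<kappa> i) (len i)) E"
    by (simp add: has_boundary_def ccurve_continuous cdir_continuous)
qed

text \<open>With half-open parameter intervals every vertex occurs once, as the start of an edge, so
  equality of points reduces to injectivity of the simple path on \<open>{0..<1}\<close>.\<close>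

lemma cpoly_inj:
  assumes n: "0 < n" and C: "curvilinear_polygon_120 n p \<theta> \<kappa> len E"
    and ij: "i < n" "j < n" and s: "s \<in> {0..<1}" and t: "t \<in> {0..<1}"
    and eq: "ccurve (p i) (\<theta> i) (\<kappa> i) (len i) s = ccurve (p j) (\<theta> j) (\<kappa> j) (len j) t"
  shows "i = j \<and> s = t"
proof -
  let ?G = "cpoly_path n p \<theta> \<kappa> len"
  have clos: "\<And>i. i < n \<Longrightarrow> ccurve (p i) (\<theta> i) (\<kappa> i) (len i) 1 = p (Suc i mod n)"
    and sp: "simple_path ?G"
    using C unfolding curvilinear_polygon_120_def Let_def by auto
  have G: "?G ((real i + s) / real n) = ccurve (p i) (\<theta> i) (\<kappa> i) (len i) s" if "i < n" "s \<in> {0..<1}" for i s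
    using cpoly_path_eq[where n=n and p=p and \<theta>=\<theta> and \<kappa>=\<kappa> and len=len, OF n clos that(1), of "(real i + s) / real n"] that n by (auto simp: field_simps)
  have in01: "(real i + s) / real n \<in> {0..<1}" if "i < n" "s \<in> {0..<1}" for i s
  proof -
    have "real i + 1 \<le> real n" using that by linarith
    then show ?thesis using that n by (auto simp: field_simps)
  qed
  have inj: "x = y" if "x \<in> {0..<1}" "y \<in> {0..<1}" "?G x = ?G y" for x y
  proof -
    have "x = y \<or> x = 0 \<and> y = 1 \<or> x = 1 \<and> y = 0"
      using sp[unfolded simple_path_def loop_free_def, THEN conjunct2, rule_format, of x y] that by auto
    then show ?thesis using that by auto
  qed
  have "(real i + s) / real n = (real j + t) / real n"
    by (rule inj[OF in01[OF ij(1) s] in01[OF ij(2) t]]) (simp only: G[OF ij(1) s] G[OF ij(2) t] eq)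
  then have e: "real i + s = real j + t" using n by simp
  then have "real i < real j + 1" "real j < real i + 1" using s t by auto
  then have "i = j" by linarith
  then show ?thesis using e by simp
qed

subsection \<open>Segments and triangles\<close>

text \<open>A line separates \<open>z\<close> from \<open>Q\<close>, so a branch of the logarithm of
  \<open>w - z\<close> exists on all of \<open>Q\<close>. The single primitive \<open>F\<close>
  serves every curve in \<open>Q\<close>; hence Cauchy integrals of closed chains in
  \<open>Q\<close> telescope to zero without any winding number.\<close>

lemma primitive_outside_convex:
  assumes "closed Q" "convex Q" "z \<notin> Q"
  obtains F :: "complex \<Rightarrow> complex" where
    "\<And>\<gamma> \<gamma>'. (\<And>t. (\<gamma> has_vector_derivative \<gamma>' t) (at t)) \<Longrightarrow> continuous_on UNIV \<gamma>' \<Longrightarrow> \<gamma> ` {0..1} \<subseteq> Q \<Longrightarrow>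
       wk \<gamma> \<gamma>' z = F (\<gamma> 1) - F (\<gamma> 0)"
proof -
  obtain a b where ab: "a \<bullet> z < b" "\<And>x. x \<in> Q \<Longrightarrow> a \<bullet> x > b"
    using separating_hyperplane_closed_point[of Q z] assms by blast
  have pos: "Re (cnj a * (x - z)) > 0" if "x \<in> Q" for x
  proof -
    have "Re (cnj a * (x - z)) = a \<bullet> x - a \<bullet> z" by (simp add: inner_complex_def algebra_simps)
    then show ?thesis using ab(1) ab(2)[OF that] by simp
  qed
  show thesis
  proof (rule that[of "\<lambda>w. Ln (cnj a * (w - z))"])
    fix \<gamma> \<gamma>' :: "real \<Rightarrow> complex"
    assume d: "\<And>t. (\<gamma> has_vector_derivative \<gamma>' t) (at t)" and c: "continuous_on UNIV \<gamma>'" and Q: "\<gamma> ` {0..1} \<subseteq> Q"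
    have cg: "continuous_on UNIV \<gamma>" using d by (meson continuous_at_imp_continuous_on has_vector_derivative_continuous)
    have "((\<lambda>t. 1 / (\<gamma> t - z) * \<gamma>' t) has_integral (Ln (cnj a * (\<gamma> 1 - z)) - Ln (cnj a * (\<gamma> 0 - z)))) {0..1}"
    proof (rule fundamental_theorem_of_calculus)
      fix t :: real assume t: "t \<in> {0..1}"
      then have p: "Re (cnj a * (\<gamma> t - z)) > 0" using pos Q by blast
      then have nz: "cnj a * (\<gamma> t - z) \<notin> \<real>\<^sub>\<le>\<^sub>0" "a \<noteq> 0" "\<gamma> t \<noteq> z" by (auto simp: complex_nonpos_Reals_iff)
      have "((\<lambda>w. cnj a * (w - z)) has_field_derivative cnj a) (at (\<gamma> t))" by (auto intro!: derivative_eq_intros)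
      from DERIV_chain2[OF has_field_derivative_Ln[OF nz(1)] this]
      have "((\<lambda>w. Ln (cnj a * (w - z))) has_field_derivative inverse (cnj a * (\<gamma> t - z)) * cnj a) (at (\<gamma> t))" .
      from field_vector_diff_chain_at[OF d this]
      have "((\<lambda>t. Ln (cnj a * (\<gamma> t - z))) has_vector_derivative \<gamma>' t * (inverse (cnj a * (\<gamma> t - z)) * cnj a)) (at t)"
        by (simp add: o_def)
      moreover have "\<gamma>' t * (inverse (cnj a * (\<gamma> t - z)) * cnj a) = 1 / (\<gamma> t - z) * \<gamma>' t"
        using nz by (simp add: field_simps)
      ultimately show "((\<lambda>t. Ln (cnj a * (\<gamma> t - z))) has_vector_derivative 1 / (\<gamma> t - z) * \<gamma>' t) (at t within {0..1})"
        by (simp add: has_vector_derivative_at_within)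
    qed simp
    moreover have "((\<lambda>t. 1 / (\<gamma> t - z) * \<gamma>' t) has_integral wk \<gamma> \<gamma>' z) {0..1}"
      by (rule wk_eq_integral[OF cg c]) (use Q assms(3) in blast)
    ultimately show "wk \<gamma> \<gamma>' z = Ln (cnj a * (\<gamma> 1 - z)) - Ln (cnj a * (\<gamma> 0 - z))"
      by (rule has_integral_unique[rotated])
  qed
qed

definition seg :: "complex \<Rightarrow> complex \<Rightarrow> real \<Rightarrow> complex" where
  "seg a b t = a + of_real t * (b - a)"

abbreviation wseg :: "complex \<Rightarrow> complex \<Rightarrow> complex \<Rightarrow> complex" where
  "wseg a b \<equiv> wk (seg a b) (\<lambda>_. b - a)"

lemma seg_has_vector_derivative: "(seg a b has_vector_derivative b - a) (at t)"
  unfolding seg_def[abs_def] has_vector_derivative_def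
  by (auto intro!: derivative_eq_intros simp: scaleR_conv_of_real)

lemma seg_continuous: "continuous_on S (seg a b)"
  unfolding seg_def by (intro continuous_intros)

lemma seg_01 [simp]: "seg a b 0 = a" "seg a b 1 = b" by (simp_all add: seg_def)

lemma seg_eq_linepath: "seg a b = linepath a b"
  by (rule ext) (simp add: seg_def linepath_def scaleR_conv_of_real algebra_simps)

lemma seg_image: "seg a b ` {0..1} = closed_segment a b"
  by (simp add: seg_eq_linepath linepath_image_01)

lemma lint_seg: "lint (seg a b) (\<lambda>_. b - a) (\<lambda>z. z) = Im (cnj a * b)"
proof -
  have "Im (cnj (seg a b t) * (b - a)) = Im (cnj a * b)" for t
    by (simp add: seg_def algebra_simps)
  then show ?thesis unfolding lint_def by (simp only: integral_indicator_const)
qed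

lemma wseg_contour:
  assumes "z \<notin> closed_segment a b"
  shows "((\<lambda>w. 1 / (w - z)) has_contour_integral wseg a b z) (linepath a b)"
proof -
  have "((\<lambda>t. 1 / (seg a b t - z) * (b - a)) has_integral wseg a b z) {0..1}"
    by (rule wk_eq_integral) (use assms seg_image in \<open>auto intro: seg_continuous\<close>)
  then show ?thesis by (simp add: has_contour_integral_linepath seg_eq_linepath)
qed

lemma wseg_split:
  assumes z: "z \<notin> closed_segment a b" and c: "c \<in> closed_segment a b"
  shows "wseg a b z = wseg a c z + wseg c b z"
proof -
  have sub: "closed_segment a c \<subseteq> closed_segment a b" "closed_segment c b \<subseteq> closed_segment a b"
    using c by (auto simp: subset_closed_segment)
  have "contour_integral (linepath a b) (\<lambda>w. 1 / (w - z)) = contour_integral (linepath a c) (\<lambda>w. 1 / (w - z)) + contour_integral (linepath c b) (\<lambda>w. 1 / (w - z))"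
    by (rule contour_integral_split_linepath[OF _ c]) (use z in \<open>auto intro!: continuous_intros\<close>)
  then show ?thesis
    using contour_integral_unique[OF wseg_contour] z sub by (metis subsetD)
qed

lemma wk_reverse: "wk (\<lambda>t. \<gamma> (1 - t)) (\<lambda>t. - \<gamma>' (1 - t)) z = - wk \<gamma> \<gamma>' z"
proof -
  have "integral\<^sup>L lborel (\<lambda>t::real. indicator {0..1} t *\<^sub>R (\<gamma>' t / (\<gamma> t - z))) =
     \<bar>-1\<bar> *\<^sub>R integral\<^sup>L lborel (\<lambda>t. indicator {0..1} (1 + (-1) * t) *\<^sub>R (\<gamma>' (1 + (-1) * t) / (\<gamma> (1 + (-1) * t) - z)))"
    by (rule lborel_integral_real_affine) simp
  also have "\<dots> = integral\<^sup>L lborel (\<lambda>t. indicator {0..1} t *\<^sub>R (\<gamma>' (1 - t) / (\<gamma> (1 - t) - z)))"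
  proof -
    have "indicator {0..1} (1 + (-1) * t) = (indicator {0..1} t :: real)" for t :: real
      by (auto simp: indicator_def)
    then show ?thesis by simp
  qed
  finally show ?thesis unfolding wk_def by simp
qed

lemma wseg_reverse: "wseg b a z = - wseg a b z"
proof -
  have "seg b a = (\<lambda>t. seg a b (1 - t))" by (rule ext) (simp add: seg_def algebra_simps)
  then show ?thesis using wk_reverse[of "seg a b" "\<lambda>_. b - a" z] by simp
qed

lemma AE_line:
  assumes "w \<noteq> 0" shows "AE z in lebesgue. Im (cnj w * z) \<noteq> c"
proof -
  have "negligible {z. (\<i> * w) \<bullet> z = c}" by (rule negligible_hyperplane) (use assms in simp)
  moreover have "{z. (\<i> * w) \<bullet> z = c} = {z. Im (cnj w * z) = c}" by (auto simp: inner_complex_def algebra_simps)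
  ultimately have "{z. Im (cnj w * z) = c} \<in> null_sets lebesgue" by (simp add: negligible_iff_null_sets)
  from AE_not_in[OF this] show ?thesis by simp
qed

lemma AE_not_segment: "AE z in lebesgue. z \<notin> closed_segment (a::complex) b"
proof -
  have "negligible (seg a b ` {0..1})"
    by (rule negligible_differentiable_image_lowdim)
       (auto intro!: differentiable_at_imp_differentiable_on intro: differentiableI_vector seg_has_vector_derivative)
  then show ?thesis unfolding seg_image by (intro AE_not_in) (simp add: negligible_iff_null_sets)
qed

lemma interior_convex_AE:
  assumes "convex (S :: complex set)"
  shows "AE z in lebesgue. z \<in> S \<longrightarrow> z \<in> interior S"
proof -
  have "negligible (frontier S)" by (rule negligible_convex_frontier[OF assms])
  then have "AE z in lebesgue. z \<notin> frontier S" by (intro AE_not_in) (simp add: negligible_iff_null_sets)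
  then show ?thesis by eventually_elim (use closure_subset in \<open>auto simp: frontier_def\<close>)
qed

lemma triangle_outside:
  assumes "z \<notin> convex hull {a, b, c}"
  shows "wseg a b z + wseg b c z + wseg c a z = 0"
proof -
  let ?Q = "convex hull {a,b,c}"
  obtain F where F: "\<And>\<gamma> \<gamma>'. (\<And>t. (\<gamma> has_vector_derivative \<gamma>' t) (at t)) \<Longrightarrow> continuous_on UNIV \<gamma>' \<Longrightarrow> \<gamma> ` {0..1} \<subseteq> ?Q \<Longrightarrow>
       wk \<gamma> \<gamma>' z = F (\<gamma> 1) - F (\<gamma> 0)"
    by (rule primitive_outside_convex[of ?Q z]) (use assms in \<open>simp_all add: compact_imp_closed finite_imp_compact_convex_hull\<close>)
  have "wseg x y z = F y - F x" if "x \<in> {a,b,c}" "y \<in> {a,b,c}" for x y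
  proof -
    have "seg x y ` {0..1} \<subseteq> ?Q" unfolding seg_image
      by (rule closed_segment_subset) (use that in \<open>auto intro: hull_inc\<close>)
    from F[OF seg_has_vector_derivative _ this] show ?thesis by simp
  qed
  then show ?thesis by simp
qed

text \<open>The winding number of a triangle is known up to the sign of its orientation, decided by
  \<open>Im ((b - a) * cnj (b - z))\<close>. This equals the barycentric weight of \<open>c\<close>
  times the positive determinant in \<open>pos\<close>.\<close>

lemma triangle_inside:
  assumes pos: "Im (cnj (b - a) * (c - a)) > 0" and z: "z \<in> interior (convex hull {a, b, c})"
  shows "wseg a b z + wseg b c z + wseg c a z = 2 * of_real pi * \<i>"
proof -
  have znot: "z \<notin> closed_segment a b" "z \<notin> closed_segment b c" "z \<notin> closed_segment c a"
    using z interior_of_triangle[of a b c] by (auto simp: insert_commute closed_segment_commute segment_convex_hull)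
  obtain x y w where xyw: "z = x *\<^sub>R a + y *\<^sub>R b + w *\<^sub>R c" "x \<ge> 0" "y \<ge> 0" "w \<ge> 0" "x + y + w = 1"
    using z interior_subset unfolding convex_hull_3 by blast
  have w: "w > 0"
  proof (rule ccontr)
    assume "\<not> w > 0"
    then have "w = 0" using xyw by simp
    then have "z \<in> closed_segment a b" using xyw unfolding closed_segment_def
      by (auto intro!: exI[of _ y])
    then show False using znot by simp
  qed
  have "(b - a) * cnj (b - z) = x *\<^sub>R ((b - a) * cnj (b - a)) + w *\<^sub>R ((b - a) * cnj (b - a) - (b - a) * cnj (c - a))"
  proof -
    have bz: "b - z = x *\<^sub>R (b - a) + w *\<^sub>R ((b - a) - (c - a))"
    proof -
      have "b - z = (x + y + w) *\<^sub>R b - z" using xyw(5) by simp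
      also have "\<dots> = x *\<^sub>R (b - a) + w *\<^sub>R ((b - a) - (c - a))" unfolding xyw(1) by (simp add: algebra_simps)
      finally show ?thesis .
    qed
    show ?thesis unfolding bz by (simp add: algebra_simps)
  qed
  then have "Im ((b - a) * cnj (b - z)) = Im (x *\<^sub>R ((b - a) * cnj (b - a)) + w *\<^sub>R ((b - a) * cnj (b - a) - (b - a) * cnj (c - a)))"
    by (simp only:)
  also have "\<dots> = w * Im (cnj (b - a) * (c - a))" by (simp add: algebra_simps)
  finally have "Im ((b - a) * cnj (b - z)) = w * Im (cnj (b - a) * (c - a))" .
  then have "0 < Im ((b - a) * cnj (b - z))" using w pos by (simp only: mult_pos_pos)
  then have wn: "winding_number (linepath a b +++ linepath b c +++ linepath c a) z = 1"
    using winding_number_triangle[OF z] by simp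
  have "((\<lambda>w. 1 / (w - z)) has_contour_integral (wseg a b z + (wseg b c z + wseg c a z))) (linepath a b +++ linepath b c +++ linepath c a)"
    by (intro has_contour_integral_join wseg_contour znot) auto
  moreover have "z \<notin> path_image (linepath a b +++ linepath b c +++ linepath c a)"
    using znot by (simp add: path_image_join)
  ultimately show ?thesis
    using wn winding_number_valid_path[of "linepath a b +++ linepath b c +++ linepath c a" z]
    by (auto simp: contour_integral_unique field_simps)
qed

lemma measure_triangle:
  assumes pos: "Im (cnj (b - a) * (c - a)) > 0"
  shows "measure lebesgue (convex hull {a, b, c}) = Im (cnj (b - a) * (c - a)) / 2"
proof -
  let ?T = "convex hull {a, b, c}"
  let ?g = "\<lambda>i::nat. if i = 0 then seg a b else if i = 1 then seg b c else seg c a"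
  let ?g' = "\<lambda>i::nat. if i = 0 then (\<lambda>_::real. b - a) else if i = 1 then (\<lambda>_. c - b) else (\<lambda>_. a - c)"
  have T: "compact ?T" by (simp add: finite_imp_compact_convex_hull)
  have "AE z in lebesgue. (\<Sum>i<3. wk (?g i) (?g' i) z) = 2 * of_real pi * \<i> * indicator ?T z"
    using interior_convex_AE[OF convex_convex_hull, of "{a,b,c}"]
  proof eventually_elim
    case (elim z)
    have "(\<Sum>i<3. wk (?g i) (?g' i) z) = wseg a b z + wseg b c z + wseg c a z"
      by (simp add: numeral_3_eq_3)
    then show ?case using elim triangle_inside[OF pos, of z] triangle_outside[of z a b c] by (auto simp: indicator_def)
  qed
  then have B: "has_boundary {..<3} ?g ?g' ?T" by (auto simp: has_boundary_def seg_continuous)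
  obtain R where "\<And>z. z \<in> ?T \<Longrightarrow> norm z \<le> R" using compact_imp_bounded[OF T] unfolding bounded_iff by blast
  then have "measure lebesgue ?T = (\<Sum>i<3. lint (?g i) (?g' i) (\<lambda>z. z)) / 2"
    using T by (intro area_boundary(1)[OF B, of R]) (auto intro: lmeasurable_compact fmeasurableD)
  also have "(\<Sum>i<3. lint (?g i) (?g' i) (\<lambda>z. z)) = Im (cnj a * b) + Im (cnj b * c) + Im (cnj c * a)"
    by (simp add: numeral_3_eq_3 lint_seg del: times_complex.sel cnj.sel)
  also have "\<dots> = Im (cnj (b - a) * (c - a))" by (simp add: algebra_simps)
  finally show ?thesis .
qed

subsection \<open>Plane lattices\<close>

definition lat :: "complex \<Rightarrow> complex \<Rightarrow> complex set" where
  "lat u v = {of_int m * u + of_int n * v | m n. True}"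

lemma independent_det:
  assumes "u \<noteq> v" "independent {u, v}"
  shows "Im (cnj u * v) \<noteq> 0"
proof
  assume 0: "Im (cnj u * v) = 0"
  have iu: "independent {v}" "u \<notin> span {v}" using assms by (auto simp: independent_insert)
  then have v: "v \<noteq> 0" using dependent_zero by blast
  have "cnj u * v = of_real (Re (cnj u * v))" using 0 by (simp add: complex_eq_iff)
  then have "cnj (cnj u * v) = of_real (Re (cnj u * v))" by (metis complex_cnj_complex_of_real)
  then have "u * cnj v = of_real (Re (cnj u * v))" by simp
  then have "u * (cnj v * v) = of_real (Re (cnj u * v)) * v" by (simp add: mult.assoc[symmetric])
  moreover have "cnj v * v = of_real ((norm v)\<^sup>2)" by (simp only: complex_norm_square mult.commute)
  ultimately have "u = (Re (cnj u * v) / (norm v)\<^sup>2) *\<^sub>R v"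
    using v by (simp add: scaleR_conv_of_real field_simps)
  then have "u \<in> span {v}" by (metis span_base span_scale singletonI)
  then show False using iu by simp
qed

text \<open>Exchanging the generators changes the sign of the determinant, so a positively oriented
  basis is available.\<close>

lemma plane_latticeE:
  assumes "plane_lattice G"
  obtains u v where "G = lat u v" "Im (cnj u * v) > 0"
proof -
  obtain u v where uv: "u \<noteq> v" "independent {u, v}" "G = {real_of_int m *\<^sub>R u + real_of_int n *\<^sub>R v | m n. True}"
    using assms unfolding plane_lattice_def by blast
  have G: "G = lat u v" unfolding uv(3) lat_def by (simp add: scaleR_conv_of_real)
  have G': "G = lat v u" unfolding G lat_def by (auto, metis add.commute, metis add.commute)
  have "Im (cnj v * u) = - Im (cnj u * v)" by (simp add: algebra_simps)
  then show thesis using independent_det[OF uv(1,2)] that[OF G] that[OF G'] by linarith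
qed

lemma plane_lattice_lat:
  assumes "Im (cnj u * v) \<noteq> 0"
  shows "plane_lattice (lat u v)"
proof -
  have v: "v \<noteq> 0" using assms by auto
  have "u \<notin> span {v}"
  proof
    assume "u \<in> span {v}"
    then obtain k where "u = k *\<^sub>R v" by (auto simp: span_singleton)
    then have "Im (cnj u * v) = 0" by simp
    then show False using assms by simp
  qed
  then have "independent {u, v}" using v by (simp add: independent_insert)
  moreover have "u \<noteq> v" using assms by auto
  ultimately show ?thesis unfolding plane_lattice_def lat_def
    by (intro exI[of _ u] exI[of _ v]) (simp add: scaleR_conv_of_real)
qed

lemma lat_group:
  "0 \<in> lat u v" "g \<in> lat u v \<Longrightarrow> h \<in> lat u v \<Longrightarrow> g + h \<in> lat u v"
  "g \<in> lat u v \<Longrightarrow> - g \<in> lat u v" "g \<in> lat u v \<Longrightarrow> h \<in> lat u v \<Longrightarrow> g - h \<in> lat u v"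
proof -
  show "0 \<in> lat u v" unfolding lat_def by (auto intro!: exI[of _ 0])
  show a: "g + h \<in> lat u v" if gh: "g \<in> lat u v" "h \<in> lat u v" for g h
  proof -
    obtain m n m' n' where "g = of_int m * u + of_int n * v" "h = of_int m' * u + of_int n' * v"
      using gh unfolding lat_def by blast
    then have "g + h = of_int (m + m') * u + of_int (n + n') * v" by (simp add: algebra_simps)
    then show ?thesis unfolding lat_def by blast
  qed
  show m: "- g \<in> lat u v" if gl: "g \<in> lat u v" for g
  proof -
    obtain m n where "g = of_int m * u + of_int n * v" using gl unfolding lat_def by blast
    then have "- g = of_int (- m) * u + of_int (- n) * v" by simp
    then show ?thesis unfolding lat_def by blast
  qed
  show "g - h \<in> lat u v" if "g \<in> lat u v" "h \<in> lat u v" for g h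
    using a[OF that(1) m[OF that(2)]] by simp
qed

lemma lat_countable: "countable (lat u v)"
proof -
  have "lat u v = (\<lambda>(m, n). of_int m * u + of_int n * v) ` (UNIV :: (int \<times> int) set)"
    by (auto simp: lat_def)
  then show ?thesis by simp
qed

text \<open>Coordinates in the basis \<open>u\<close>, \<open>v\<close> by Cramer's rule, with
  \<open>Im (cnj u * v)\<close> as determinant.\<close>

definition lc1 where "lc1 u v z = Im (cnj z * v) / Im (cnj u * v)"
definition lc2 where "lc2 u v z = Im (cnj u * z) / Im (cnj u * v)"

lemma lat_coords:
  assumes "Im (cnj u * v) \<noteq> 0"
  shows "z = of_real (lc1 u v z) * u + of_real (lc2 u v z) * v"
proof -
  define D where "D = Im (cnj u * v)"
  have D: "D \<noteq> 0" using assms by (simp only: D_def simp_thms)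
  have "of_real (lc1 u v z) * u + of_real (lc2 u v z) * v = (of_real (Im (cnj z * v)) * u + of_real (Im (cnj u * z)) * v) / of_real D"
    unfolding lc1_def lc2_def D_def[symmetric] by (simp only: of_real_divide add_divide_distrib times_divide_eq_left)
  also have "of_real (Im (cnj z * v)) * u + of_real (Im (cnj u * z)) * v = of_real D * z"
    by (simp add: D_def complex_eq_iff algebra_simps)
  finally show ?thesis using D by simp
qed

lemma lc_linear:
  "lc1 u v (z + w) = lc1 u v z + lc1 u v w" "lc2 u v (z + w) = lc2 u v z + lc2 u v w"
  "lc1 u v (z - w) = lc1 u v z - lc1 u v w" "lc2 u v (z - w) = lc2 u v z - lc2 u v w"
  "lc1 u v (of_real r * z) = r * lc1 u v z" "lc2 u v (of_real r * z) = r * lc2 u v z"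
  by (simp_all add: lc1_def lc2_def add_divide_distrib[symmetric] diff_divide_distrib[symmetric] del: Im_divide_of_real)
     (simp_all add: algebra_simps)

lemma lc_comb:
  assumes "Im (cnj u * v) \<noteq> 0"
  shows "lc1 u v (of_real x * u + of_real y * v) = x" "lc2 u v (of_real x * u + of_real y * v) = y"
proof -
  have "Im (cnj u * u) = 0" "Im (cnj v * v) = 0" by simp_all
  then have "lc1 u v u = 1" "lc2 u v u = 0" "lc1 u v v = 0" "lc2 u v v = 1" using assms by (simp_all add: lc1_def lc2_def del: times_complex.sel)
  then show "lc1 u v (of_real x * u + of_real y * v) = x" "lc2 u v (of_real x * u + of_real y * v) = y"
    by (simp_all add: lc_linear)
qed

lemma lat_finite:
  assumes D: "Im (cnj u * v) \<noteq> 0"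
  shows "finite {g \<in> lat u v. norm g \<le> M}"
proof -
  define B where "B = max (M * norm v / \<bar>Im (cnj u * v)\<bar>) (M * norm u / \<bar>Im (cnj u * v)\<bar>)"
  have "{g \<in> lat u v. norm g \<le> M} \<subseteq> (\<lambda>(m, n). of_int m * u + of_int n * v) ` ({\<lfloor>- B\<rfloor>..\<lceil>B\<rceil>} \<times> {\<lfloor>- B\<rfloor>..\<lceil>B\<rceil>})"
  proof
    fix g assume g: "g \<in> {g \<in> lat u v. norm g \<le> M}"
    then obtain m n where mn: "g = of_int m * u + of_int n * v" unfolding lat_def by blast
    have "lc1 u v g = real_of_int m" "lc2 u v g = real_of_int n"
      using lc_comb[OF D, of "real_of_int m" "real_of_int n"] mn by simp_all
    moreover have "\<bar>lc1 u v g\<bar> \<le> M * norm v / \<bar>Im (cnj u * v)\<bar>" "\<bar>lc2 u v g\<bar> \<le> M * norm u / \<bar>Im (cnj u * v)\<bar>"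
    proof -
      have "\<bar>Im (cnj g * v)\<bar> \<le> M * norm v"
        using Im_cnj_mult_le[of g v] mult_right_mono[of "norm g" M "norm v"] g by auto
      then show "\<bar>lc1 u v g\<bar> \<le> M * norm v / \<bar>Im (cnj u * v)\<bar>"
        unfolding lc1_def abs_divide by (rule divide_right_mono) simp
      have "\<bar>Im (cnj u * g)\<bar> \<le> M * norm u"
        using Im_cnj_mult_le[of u g] mult_left_mono[of "norm g" M "norm u"] g by (auto simp: mult.commute)
      then show "\<bar>lc2 u v g\<bar> \<le> M * norm u / \<bar>Im (cnj u * v)\<bar>"
        unfolding lc2_def abs_divide by (rule divide_right_mono) simp
    qed
    ultimately have "\<bar>real_of_int m\<bar> \<le> B" "\<bar>real_of_int n\<bar> \<le> B" unfolding B_def by linarith+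
    then have "m \<in> {\<lfloor>- B\<rfloor>..\<lceil>B\<rceil>}" "n \<in> {\<lfloor>- B\<rfloor>..\<lceil>B\<rceil>}" by (auto; linarith)+
    then show "g \<in> (\<lambda>(m, n). of_int m * u + of_int n * v) ` ({\<lfloor>- B\<rfloor>..\<lceil>B\<rceil>} \<times> {\<lfloor>- B\<rfloor>..\<lceil>B\<rceil>})"
      using mn by auto
  qed
  then show ?thesis by (rule finite_subset) auto
qed

lemma mem_translate: "z \<in> (+) g ` S \<longleftrightarrow> z - g \<in> (S :: complex set)"
  by (auto simp: image_iff) (metis add_diff_cancel_left' add_diff_eq diff_add_cancel)

lemma AE_translate:
  assumes "AE z in lebesgue. P (z::complex)"
  shows "AE z in lebesgue. P (z - g)"
proof -
  obtain N where N: "{z. \<not> P z} \<subseteq> N" "N \<in> null_sets lebesgue"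
    using assms by (auto elim!: AE_E simp: null_sets_def)
  have "negligible N" using N(2) by (simp add: negligible_iff_null_sets)
  then have "negligible ((+) g ` N)" by (rule negligible_translation)
  then have "(+) g ` N \<in> null_sets lebesgue" by (simp add: negligible_iff_null_sets)
  from AE_not_in[OF this] show ?thesis
    by eventually_elim (use N(1) in \<open>auto simp: mem_translate\<close>)
qed

text \<open>Since the lattice is countable, the null overlaps of all pairs can be removed at once.
  Afterwards a tiling is a statement about single points, the form in which it is used and, by
  \<open>tilingI\<close>, also produced.\<close>

lemma tiling_AE:
  assumes "periodic_2tiling G E"
  shows "AE z in lebesgue. \<exists>!x. x \<in> {1,2} \<times> G \<and> z - snd x \<in> E (fst x)"
proof -
  have pl: "plane_lattice G" using assms by (simp add: periodic_2tiling_def)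
  obtain u v where "G = lat u v" using plane_latticeE[OF pl] by metis
  then have cG: "countable ({1,2::nat} \<times> G)" using lat_countable by auto
  have "AE z in lebesgue. \<forall>x\<in>{1,2} \<times> G. \<forall>y\<in>{1,2} \<times> G. x \<noteq> y \<longrightarrow> \<not> (z - snd x \<in> E (fst x) \<and> z - snd y \<in> E (fst y))"
    unfolding AE_ball_countable[OF cG]
  proof (intro ballI)
    fix x y :: "nat \<times> complex" assume xy: "x \<in> {1,2} \<times> G" "y \<in> {1,2} \<times> G"
    show "AE z in lebesgue. x \<noteq> y \<longrightarrow> \<not> (z - snd x \<in> E (fst x) \<and> z - snd y \<in> E (fst y))"
    proof (cases "x = y")
      case False
      then have "((+) (snd x) ` E (fst x)) \<inter> ((+) (snd y) ` E (fst y)) \<in> null_sets lebesgue"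
        using assms xy unfolding periodic_2tiling_def by (auto simp: prod_eq_iff)
      from AE_not_in[OF this] show ?thesis by (simp add: mem_translate)
    qed simp
  qed
  moreover have "AE z in lebesgue. \<exists>x\<in>{1,2} \<times> G. z - snd x \<in> E (fst x)"
  proof -
    have "UNIV - (\<Union>k\<in>{1,2}. \<Union>g\<in>G. (+) g ` E k) \<in> null_sets lebesgue"
      using assms by (simp add: periodic_2tiling_def)
    from AE_not_in[OF this] show ?thesis
    proof eventually_elim
      case (elim z)
      then obtain k g where "k \<in> {1,2}" "g \<in> G" "z \<in> (+) g ` E k" by blast
      then show ?case by (intro bexI[of _ "(k, g)"]) (auto simp: mem_translate)
    qed
  qed
  ultimately show ?thesis
  proof eventually_elim
    case (elim z)
    from elim(2) obtain x where x: "x \<in> {1,2} \<times> G" "z - snd x \<in> E (fst x)" by blast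
    show ?case
    proof (rule ex1I[of _ x])
      show "x \<in> {1,2} \<times> G \<and> z - snd x \<in> E (fst x)" using x by simp
      fix y assume y: "y \<in> {1,2} \<times> G \<and> z - snd y \<in> E (fst y)"
      have "x \<noteq> y \<longrightarrow> \<not> (z - snd x \<in> E (fst x) \<and> z - snd y \<in> E (fst y))"
        using bspec[OF bspec[OF elim(1) x(1)] conjunct1[OF y]] .
      then show "y = x" using x(2) y by metis
    qed
  qed
qed

lemma tilingI:
  assumes pl: "plane_lattice G" and m: "E 1 \<in> sets lebesgue" "E 2 \<in> sets lebesgue"
    and ae: "AE z in lebesgue. \<exists>!x. x \<in> {1,2} \<times> G \<and> z - snd x \<in> E (fst x)"
  shows "periodic_2tiling G E"
proof -
  have null: "S \<in> null_sets lebesgue" if "AE z in lebesgue. z \<notin> S" for S :: "complex set"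
    using that by (simp add: completion.complete_measure_axioms complete_measure.AE_iff_null_sets AE_iff_null_sets)
  have 1: "((+) g ` E k) \<inter> ((+) g' ` E k') \<in> null_sets lebesgue"
    if kg: "k \<in> {1,2}" "k' \<in> {1,2}" "g \<in> G" "g' \<in> G" "(k, g) \<noteq> (k', g')" for k k' g g'
  proof (rule null, use ae in eventually_elim)
    case (elim z)
    from elim obtain x where x: "\<forall>y. y \<in> {1,2} \<times> G \<and> z - snd y \<in> E (fst y) \<longrightarrow> y = x"
      by (rule ex1E) (rule that, assumption)
    show ?case
    proof
      assume "z \<in> ((+) g ` E k) \<inter> ((+) g' ` E k')"
      then have "(k, g) = x" "(k', g') = x" using x[rule_format, of "(k, g)"] x[rule_format, of "(k', g')"] kg by (auto simp: mem_translate)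
      then show False using kg by simp
    qed
  qed
  have 2: "UNIV - (\<Union>k\<in>{1,2}. \<Union>g\<in>G. (+) g ` E k) \<in> null_sets lebesgue"
  proof (rule null, use ae in eventually_elim)
    case (elim z)
    from elim obtain x where "x \<in> {1,2} \<times> G \<and> z - snd x \<in> E (fst x)"
      by (rule ex1E) (rule that, assumption)
    then have "z \<in> (\<Union>k\<in>{1,2}. \<Union>g\<in>G. (+) g ` E k)"
      by (intro UN_I[of "fst x"] UN_I[of "snd x"]) (auto simp: mem_translate)
    then show ?case by blast
  qed
  show ?thesis unfolding periodic_2tiling_def using pl m 1 2 by auto
qed

section \<open>The fundamental parallelogram\<close>

definition fund :: "complex \<Rightarrow> complex \<Rightarrow> complex set" where
  "fund u v = {z. 0 \<le> lc1 u v z \<and> lc1 u v z < 1 \<and> 0 \<le> lc2 u v z \<and> lc2 u v z < 1}"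

lemma fund_unique:
  assumes D: "Im (cnj u * v) \<noteq> 0"
  shows "\<exists>!g. g \<in> lat u v \<and> z + g \<in> fund u v"
proof (rule ex1I)
  let ?m = "- \<lfloor>lc1 u v z\<rfloor>" and ?n = "- \<lfloor>lc2 u v z\<rfloor>"
  have lc: "lc1 u v (of_int m * u + of_int n * v) = of_int m" "lc2 u v (of_int m * u + of_int n * v) = of_int n" for m n
    using lc_comb[OF D, of "real_of_int m" "real_of_int n"] by simp_all
  show "of_int ?m * u + of_int ?n * v \<in> lat u v \<and> z + (of_int ?m * u + of_int ?n * v) \<in> fund u v"
  proof
    show "of_int ?m * u + of_int ?n * v \<in> lat u v" unfolding lat_def by blast
    show "z + (of_int ?m * u + of_int ?n * v) \<in> fund u v"
      unfolding fund_def mem_Collect_eq lc_linear(1,2)[of u v z] lc by (simp; linarith)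
  qed
  fix g assume g: "g \<in> lat u v \<and> z + g \<in> fund u v"
  then obtain m n where mn: "g = of_int m * u + of_int n * v" unfolding lat_def by blast
  have "0 \<le> lc1 u v z + of_int m" "lc1 u v z + of_int m < 1" "0 \<le> lc2 u v z + of_int n" "lc2 u v z + of_int n < 1"
    using g unfolding fund_def mn mem_Collect_eq lc_linear(1,2)[of u v z] lc by auto
  then have "m = ?m" "n = ?n" by linarith+
  then show "g = of_int ?m * u + of_int ?n * v" using mn by simp
qed

lemma fund_bounded:
  assumes D: "Im (cnj u * v) \<noteq> 0" and "z \<in> fund u v"
  shows "norm z \<le> norm u + norm v"
proof -
  have "norm z \<le> norm (of_real (lc1 u v z) * u) + norm (of_real (lc2 u v z) * v)"
    using lat_coords[OF D, of z] norm_triangle_ineq by metis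
  also have "\<dots> \<le> norm u + norm v"
    using assms(2) by (intro add_mono) (auto simp: norm_mult fund_def intro!: mult_left_le_one_le)
  finally show ?thesis .
qed

lemma fund_sets: "fund u v \<in> sets borel"
proof -
  have [measurable]: "lc1 u v \<in> borel_measurable borel" "lc2 u v \<in> borel_measurable borel"
    unfolding lc1_def lc2_def divide_inverse by (intro borel_measurable_continuous_onI continuous_intros)+
  have "{z \<in> space borel. 0 \<le> lc1 u v z \<and> lc1 u v z < 1 \<and> 0 \<le> lc2 u v z \<and> lc2 u v z < 1} \<in> sets borel"
    by measurable
  then show ?thesis by (simp add: fund_def)
qed

text \<open>The diagonal \<open>u + v\<close> cuts the parallelogram into two triangles; the
  diagonal and the excluded sides lie on lines, which are null.\<close>

lemma measure_fund:
  assumes D: "Im (cnj u * v) > 0"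
  shows "measure lebesgue (fund u v) = Im (cnj u * v)"
proof -
  let ?A = "convex hull {0, u, u + v}" and ?B = "convex hull {0, u + v, v}"
  have a: "Im (cnj (u - 0) * (u + v - 0)) = Im (cnj u * v)" and b: "Im (cnj (u + v - 0) * (v - 0)) = Im (cnj u * v)"
    by (simp_all add: algebra_simps)
  have mA: "measure lebesgue ?A = Im (cnj u * v) / 2" using measure_triangle[of u 0 "u + v"] D unfolding a by simp
  have mB: "measure lebesgue ?B = Im (cnj u * v) / 2" using measure_triangle[of "u + v" 0 v] D unfolding b by simp
  have D0: "Im (cnj u * v) \<noteq> 0" using D by simp
  have "u + v \<noteq> 0"
  proof
    assume "u + v = 0" then have "v = - u" by (simp add: add_eq_0_iff)
    then show False using D by simp
  qed
  have fA: "?A \<in> lmeasurable" "?B \<in> lmeasurable" by (auto intro!: lmeasurable_compact finite_imp_compact_convex_hull)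
  have n1: "AE z in lebesgue. lc1 u v z \<noteq> lc2 u v z"
  proof -
    have "lc1 u v z = lc2 u v z \<longleftrightarrow> Im (cnj (u + v) * z) = 0" for z
      using D0 by (simp add: lc1_def lc2_def del: times_complex.sel) (auto simp: algebra_simps)
    then show ?thesis using AE_line[OF \<open>u + v \<noteq> 0\<close>, of 0] by simp
  qed
  have n2: "AE z in lebesgue. lc1 u v z \<noteq> 1" "AE z in lebesgue. lc2 u v z \<noteq> 1"
  proof -
    have "u \<noteq> 0" "v \<noteq> 0" using D0 by auto
    have "lc2 u v z = 1 \<longleftrightarrow> Im (cnj u * z) = Im (cnj u * v)" for z using D0 by (auto simp: lc2_def divide_eq_1_iff simp del: times_complex.sel)
    then show "AE z in lebesgue. lc2 u v z \<noteq> 1" using AE_line[OF \<open>u \<noteq> 0\<close>] by simp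
    have "Im (cnj z * v) = - Im (cnj v * z)" for z by (simp add: algebra_simps)
    then have "lc1 u v z = 1 \<longleftrightarrow> Im (cnj v * z) = - Im (cnj u * v)" for z
      unfolding lc1_def using D0 by (simp add: field_simps del: times_complex.sel) (metis minus_minus)
    then show "AE z in lebesgue. lc1 u v z \<noteq> 1" using AE_line[OF \<open>v \<noteq> 0\<close>] by simp
  qed
  have A: "z \<in> ?A \<longleftrightarrow> 0 \<le> lc2 u v z \<and> lc2 u v z \<le> lc1 u v z \<and> lc1 u v z \<le> 1" for z
  proof
    assume "z \<in> ?A"
    then obtain x y w where w: "z = x *\<^sub>R 0 + y *\<^sub>R u + w *\<^sub>R (u + v)" "x \<ge> 0" "y \<ge> 0" "w \<ge> 0" "x + y + w = 1"
      unfolding convex_hull_3 by blast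
    have "z = of_real (y + w) * u + of_real w * v" unfolding w(1) by (simp add: scaleR_conv_of_real algebra_simps)
    then show "0 \<le> lc2 u v z \<and> lc2 u v z \<le> lc1 u v z \<and> lc1 u v z \<le> 1" using lc_comb[OF D0, of "y + w" w] w by simp
  next
    assume *: "0 \<le> lc2 u v z \<and> lc2 u v z \<le> lc1 u v z \<and> lc1 u v z \<le> 1"
    have "z = (1 - lc1 u v z) *\<^sub>R 0 + (lc1 u v z - lc2 u v z) *\<^sub>R u + lc2 u v z *\<^sub>R (u + v)"
      using lat_coords[OF D0, of z] by (simp add: scaleR_conv_of_real algebra_simps)
    then show "z \<in> ?A" unfolding convex_hull_3 using *
      by (intro CollectI exI[of _ "1 - lc1 u v z"] exI[of _ "lc1 u v z - lc2 u v z"] exI[of _ "lc2 u v z"] conjI) simp_all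
  qed
  have B: "z \<in> ?B \<longleftrightarrow> 0 \<le> lc1 u v z \<and> lc1 u v z \<le> lc2 u v z \<and> lc2 u v z \<le> 1" for z
  proof
    assume "z \<in> ?B"
    then obtain x y w where w: "z = x *\<^sub>R 0 + y *\<^sub>R (u + v) + w *\<^sub>R v" "x \<ge> 0" "y \<ge> 0" "w \<ge> 0" "x + y + w = 1"
      unfolding convex_hull_3 by blast
    have "z = of_real y * u + of_real (y + w) * v" unfolding w(1) by (simp add: scaleR_conv_of_real algebra_simps)
    then show "0 \<le> lc1 u v z \<and> lc1 u v z \<le> lc2 u v z \<and> lc2 u v z \<le> 1" using lc_comb[OF D0, of y "y + w"] w by simp
  next
    assume *: "0 \<le> lc1 u v z \<and> lc1 u v z \<le> lc2 u v z \<and> lc2 u v z \<le> 1"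
    have "z = (1 - lc2 u v z) *\<^sub>R 0 + lc1 u v z *\<^sub>R (u + v) + (lc2 u v z - lc1 u v z) *\<^sub>R v"
      using lat_coords[OF D0, of z] by (simp add: scaleR_conv_of_real algebra_simps)
    then show "z \<in> ?B" unfolding convex_hull_3 using *
      by (intro CollectI exI[of _ "1 - lc2 u v z"] exI[of _ "lc1 u v z"] exI[of _ "lc2 u v z - lc1 u v z"] conjI) simp_all
  qed
  have "AE z in lebesgue. indicator (fund u v) z = (indicator ?A z + indicator ?B z :: real)"
    using n1 n2 by eventually_elim (auto simp: indicator_def A B fund_def)
  then have "integral\<^sup>L lebesgue (indicator (fund u v)) = integral\<^sup>L lebesgue (\<lambda>z. indicator ?A z + indicator ?B z :: real)"
    using fmeasurableD[OF fA(1)] fmeasurableD[OF fA(2)] sets_completionI_sets[of "fund u v" lborel] fund_sets[of u v]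
    by (intro integral_cong_AE borel_measurable_add borel_measurable_indicator) simp_all
  also have "\<dots> = measure lebesgue ?A + measure lebesgue ?B"
    using fA by (subst Bochner_Integration.integral_add) (auto simp: fmeasurable_def intro!: integrable_real_indicator)
  finally show ?thesis using mA mB fund_sets[of u v] by simp
qed

subsection \<open>Bounded periodic tilings\<close>

lemma measure_AE_sum:
  assumes fin: "finite A" and T: "\<And>x. x \<in> A \<Longrightarrow> T x \<in> lmeasurable" and S: "S \<in> sets lebesgue"
    and ae: "AE z in lebesgue. indicator S z = (\<Sum>x\<in>A. indicator (T x) (z::complex) :: real)"
  shows "measure lebesgue S = (\<Sum>x\<in>A. measure lebesgue (T x))"
proof -
  have "integral\<^sup>L lebesgue (indicator S) = integral\<^sup>L lebesgue (\<lambda>z. \<Sum>x\<in>A. indicator (T x) z :: real)"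
    using ae fmeasurableD[OF T] S by (intro integral_cong_AE borel_measurable_sum borel_measurable_indicator) simp_all
  also have "\<dots> = (\<Sum>x\<in>A. integral\<^sup>L lebesgue (indicator (T x)))"
  proof (rule Bochner_Integration.integral_sum)
    fix x assume "x \<in> A"
    then show "integrable lebesgue (indicator (T x) :: complex \<Rightarrow> real)"
      using T unfolding fmeasurable_def by (intro integrable_real_indicator) blast+
  qed
  finally show ?thesis using S fmeasurableD[OF T] by simp
qed

lemma sum_indicator_unique:
  assumes fin: "finite A" and ex: "x0 \<in> A" "P x0" and u: "\<And>x. x \<in> A \<Longrightarrow> P x \<Longrightarrow> x = x0"
  shows "(\<Sum>x\<in>A. if P x then 1 else 0 :: real) = 1"
proof -
  have "(\<Sum>x\<in>A. if P x then 1 else 0 :: real) = (\<Sum>x\<in>A. if x = x0 then 1 else 0)"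
  proof (rule sum.cong[OF refl])
    fix x assume "x \<in> A"
    then show "(if P x then 1 else 0 :: real) = (if x = x0 then 1 else 0)" using ex(2) u[of x] by (cases "P x") auto
  qed
  then show ?thesis using fin ex by simp
qed

lemma translate_lebesgue: "S \<in> sets lebesgue \<Longrightarrow> (+) g ` S \<in> sets lebesgue" for S :: "complex set"
  by (rule lebesgue_sets_translation)

locale bounded_tiling =
  fixes u v :: complex and E :: "nat \<Rightarrow> complex set" and R :: real
  assumes D: "Im (cnj u * v) > 0" and til: "periodic_2tiling (lat u v) E"
    and bd: "k \<in> {1,2} \<Longrightarrow> AE z in lebesgue. z \<in> E k \<longrightarrow> norm z \<le> R"
begin

text \<open>Truncation of the lattice that keeps sums over tiles finite; for a bounded region a
  large \<open>M\<close> loses nothing.\<close>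

definition ball_lat :: "real \<Rightarrow> complex set" where "ball_lat M = {g \<in> lat u v. norm g \<le> M}"

lemma finite_ball_lat: "finite (ball_lat M)"
  unfolding ball_lat_def by (rule lat_finite) (use D in simp)

lemma E_sets: "k \<in> {1,2} \<Longrightarrow> E k \<in> sets lebesgue"
  using til by (auto simp: periodic_2tiling_def)

lemma E_lmeasurable: "k \<in> {1,2} \<Longrightarrow> E k \<in> lmeasurable"
proof -
  assume k: "k \<in> {1,2}"
  have "emeasure lebesgue (E k) \<le> emeasure lebesgue (cball (0::complex) R)"
    using bd[OF k] by (intro emeasure_mono_AE) (auto elim!: eventually_mono)
  also have "\<dots> < \<infinity>" using emeasure_bounded_finite[OF bounded_cball, of "0::complex" R] by simp
  finally show ?thesis using E_sets[OF k] by (simp add: fmeasurable_def)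
qed

text \<open>A translate through a point of norm at most \<open>\<rho>\<close> has a lattice vector
  of norm at most \<open>R + \<rho>\<close>, so the truncated sum already contains the unique tile
  at that point.\<close>

lemma cover_sum:
  "AE z in lebesgue. norm z \<le> \<rho> \<longrightarrow> R + \<rho> \<le> M \<longrightarrow> (\<Sum>x\<in>{1,2} \<times> ball_lat M. indicator ((+) (snd x) ` E (fst x)) z) = (1::real)"
proof -
  have c: "countable ({1,2::nat} \<times> lat u v)" using lat_countable by auto
  have "AE z in lebesgue. \<forall>x\<in>{1,2} \<times> lat u v. z - snd x \<in> E (fst x) \<longrightarrow> norm (z - snd x) \<le> R"
    unfolding AE_ball_countable[OF c]
  proof
    fix x assume x: "x \<in> {1,2::nat} \<times> lat u v"
    show "AE z in lebesgue. z - snd x \<in> E (fst x) \<longrightarrow> norm (z - snd x) \<le> R"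
      by (rule AE_translate[of "\<lambda>z. z \<in> E (fst x) \<longrightarrow> norm z \<le> R"]) (use bd[of "fst x"] x in auto)
  qed
  then show ?thesis using tiling_AE[OF til]
  proof eventually_elim
    case (elim z)
    show ?case
    proof (intro impI)
      assume z: "norm z \<le> \<rho>" "R + \<rho> \<le> M"
      from elim(2) obtain x0 where x0: "x0 \<in> {1,2} \<times> lat u v \<and> z - snd x0 \<in> E (fst x0)"
        and un: "\<forall>y. y \<in> {1,2} \<times> lat u v \<and> z - snd y \<in> E (fst y) \<longrightarrow> y = x0"
        by (rule ex1E) (rule that, assumption+)
      have "norm (z - snd x0) \<le> R" using elim(1) x0 by blast
      then have "norm (snd x0) \<le> M" using norm_triangle_ineq3[of "snd x0" z] z by (simp add: norm_minus_commute)
      then have x0A: "x0 \<in> {1,2} \<times> ball_lat M" using x0 by (auto simp: ball_lat_def mem_Times_iff)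
      have "(\<Sum>x\<in>{1,2} \<times> ball_lat M. if z - snd x \<in> E (fst x) then 1 else 0 :: real) = 1"
      proof (rule sum_indicator_unique[OF _ x0A])
        show "finite ({1,2::nat} \<times> ball_lat M)" using finite_ball_lat by simp
        show "z - snd x0 \<in> E (fst x0)" using x0 by simp
        fix x assume "x \<in> {1,2} \<times> ball_lat M" "z - snd x \<in> E (fst x)"
        then show "x = x0" by (intro un[rule_format]) (auto simp: ball_lat_def mem_Times_iff)
      qed
      then show "(\<Sum>x\<in>{1,2} \<times> ball_lat M. indicator ((+) (snd x) ` E (fst x)) z) = (1::real)"
        unfolding indicator_def of_bool_def mem_translate .
    qed
  qed
qed

text \<open>The translated tiles partition the fundamental parallelogram; each piece is moved back
  into its tile, and there the pieces reassemble the tile because the translated parallelograms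
  partition it.\<close>

theorem covolume: "measure lebesgue (E 1) + measure lebesgue (E 2) = Im (cnj u * v)"
proof -
  have D0: "Im (cnj u * v) \<noteq> 0" using D by simp
  \<comment> \<open>Large enough for both partitions: tiles that meet the parallelogram, and
    parallelograms that meet a tile.\<close>
  define M where "M = \<bar>R\<bar> + norm u + norm v"
  let ?F = "ball_lat M" and ?P = "fund u v"
  have Ps: "?P \<in> sets lebesgue" using fund_sets by (simp add: sets_completionI_sets)
  have Pf: "?P \<in> lmeasurable"
    by (rule bounded_set_imp_lmeasurable[OF _ Ps]) (use fund_bounded[OF D0] in \<open>auto simp: bounded_iff\<close>)
  have T: "?P \<inter> (+) g ` E k \<in> lmeasurable" if "k \<in> {1,2}" for k g
    using fmeasurable_Int_fmeasurable[OF Pf translate_lebesgue[OF E_sets[OF that]]] .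
  have tr: "measure lebesgue (?P \<inter> (+) g ` E k) = measure lebesgue ((+) (- g) ` ?P \<inter> E k)" for k g
  proof -
    have "(+) (- g) ` (?P \<inter> (+) g ` E k) = (+) (- g) ` ?P \<inter> E k" by (auto simp: mem_translate)
    then show ?thesis using measure_translation[of "- g" "?P \<inter> (+) g ` E k"] by simp
  qed
  have "measure lebesgue ?P = (\<Sum>x\<in>{1,2} \<times> ?F. measure lebesgue (?P \<inter> (+) (snd x) ` E (fst x)))"
  proof (rule measure_AE_sum[OF _ _ Ps])
    show "finite ({1,2::nat} \<times> ?F)" using finite_ball_lat by simp
    show "x \<in> {1,2} \<times> ?F \<Longrightarrow> ?P \<inter> (+) (snd x) ` E (fst x) \<in> lmeasurable" for x using T[of "fst x"] by auto
    show "AE z in lebesgue. indicator ?P z = (\<Sum>x\<in>{1,2} \<times> ?F. indicator (?P \<inter> (+) (snd x) ` E (fst x)) z :: real)"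
      using cover_sum[of "norm u + norm v" M]
    proof eventually_elim
      case (elim z)
      have "(\<Sum>x\<in>{1,2} \<times> ?F. indicator (?P \<inter> (+) (snd x) ` E (fst x)) z :: real) = indicator ?P z * (\<Sum>x\<in>{1,2} \<times> ?F. indicator ((+) (snd x) ` E (fst x)) z)"
        unfolding sum_distrib_left indicator_inter_arith ..
      also have "\<dots> = indicator ?P z"
      proof (cases "z \<in> ?P")
        case True
        then have "norm z \<le> norm u + norm v" by (rule fund_bounded[OF D0])
        moreover have "R + (norm u + norm v) \<le> M" by (simp add: M_def)
        ultimately have "(\<Sum>x\<in>{1,2} \<times> ?F. indicator ((+) (snd x) ` E (fst x)) z) = (1::real)" using elim by blast
        then show ?thesis by (simp only: mult_1_right)
      qed simp
      finally show ?case by simp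
    qed
  qed
  also have "\<dots> = (\<Sum>x\<in>{1,2} \<times> ?F. measure lebesgue ((+) (- snd x) ` ?P \<inter> E (fst x)))" unfolding tr ..
  also have "\<dots> = (\<Sum>k\<in>{1,2}. \<Sum>g\<in>?F. measure lebesgue ((+) (- g) ` ?P \<inter> E k))"
    by (simp add: sum.cartesian_product case_prod_beta)
  also have "\<dots> = (\<Sum>k\<in>{1,2}. measure lebesgue (E k))"
  proof (rule sum.cong[OF refl])
    fix k :: nat assume k: "k \<in> {1,2}"
    show "(\<Sum>g\<in>?F. measure lebesgue ((+) (- g) ` ?P \<inter> E k)) = measure lebesgue (E k)"
    proof (rule measure_AE_sum[symmetric, OF finite_ball_lat _ E_sets[OF k]])
      show "(+) (- g) ` ?P \<inter> E k \<in> lmeasurable" for g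
        using fmeasurable_Int_fmeasurable[OF E_lmeasurable[OF k] translate_lebesgue[OF Ps, of "- g"]] by (simp only: Int_commute)
      show "AE z in lebesgue. indicator (E k) z = (\<Sum>g\<in>?F. indicator ((+) (- g) ` ?P \<inter> E k) z :: real)"
        using bd[OF k]
      proof eventually_elim
        case (elim z)
        have "(\<Sum>g\<in>?F. indicator ((+) (- g) ` ?P \<inter> E k) z :: real) = (\<Sum>g\<in>?F. indicator ((+) (- g) ` ?P) z) * indicator (E k) z"
          unfolding sum_distrib_right indicator_inter_arith ..
        also have "\<dots> = indicator (E k) z"
        proof (cases "z \<in> E k")
          case True
          from fund_unique[OF D0, of z] obtain g0 where g0: "g0 \<in> lat u v \<and> z + g0 \<in> ?P"
            and un: "\<forall>g. g \<in> lat u v \<and> z + g \<in> ?P \<longrightarrow> g = g0"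
            by (rule ex1E) (rule that, assumption+)
          have "norm g0 \<le> norm (z + g0) + norm z" using norm_triangle_ineq4[of "z + g0" z] by simp
          then have "norm g0 \<le> M" using fund_bounded[OF D0, of "z + g0"] g0 elim True by (simp add: M_def)
          then have gF: "g0 \<in> ?F" using g0 by (simp add: ball_lat_def)
          have "(\<Sum>g\<in>?F. if z - - g \<in> ?P then 1 else 0 :: real) = 1"
          proof (rule sum_indicator_unique[OF finite_ball_lat gF])
            show "z - - g0 \<in> ?P" using g0 by simp
            show "\<And>x. x \<in> ?F \<Longrightarrow> z - - x \<in> ?P \<Longrightarrow> x = g0" using un by (simp add: ball_lat_def)
          qed
          then have "(\<Sum>g\<in>?F. indicator ((+) (- g) ` ?P) z) = (1::real)"
            unfolding indicator_def of_bool_def mem_translate .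
          then show ?thesis by (simp only: mult_1_left)
        qed simp
        finally show ?case by simp
      qed
    qed
  qed
  finally show ?thesis using measure_fund[OF D] by simp
qed

end

section \<open>Cancellation of the boundary chains in a tiling\<close>

lemma wk_translate: "wk (\<lambda>t. \<gamma> t + g) \<gamma>' z = wk \<gamma> \<gamma>' (z - g)"
  unfolding wk_def by (simp add: algebra_simps)

lemma has_boundary_translate:
  assumes "has_boundary I \<gamma> \<gamma>' S"
  shows "has_boundary I (\<lambda>i t. \<gamma> i t + g) \<gamma>' ((+) g ` S)"
proof -
  have ae: "AE z in lebesgue. (\<Sum>i\<in>I. wk (\<gamma> i) (\<gamma>' i) z) = 2 * of_real pi * \<i> * indicator S z"
    using assms by (simp add: has_boundary_def)
  have "AE z in lebesgue. (\<Sum>i\<in>I. wk (\<gamma> i) (\<gamma>' i) (z - g)) = 2 * of_real pi * \<i> * indicator S (z - g)"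
    by (rule AE_translate[OF ae])
  moreover have "indicator ((+) g ` S) z = (indicator S (z - g) :: complex)" for z
    by (simp add: indicator_def mem_translate)
  moreover have "\<forall>i\<in>I. continuous_on UNIV (\<lambda>t. \<gamma> i t + g) \<and> continuous_on UNIV (\<gamma>' i)"
    using assms by (auto simp: has_boundary_def intro!: continuous_intros)
  ultimately show ?thesis using assms by (simp add: has_boundary_def wk_translate)
qed

lemma integral_divergence_eq_0:
  assumes "C1c \<phi>" shows "integral\<^sup>L lborel (divergence \<phi>) = 0"
proof -
  obtain \<rho> L where b: "\<rho> > 0" "L \<ge> 0" "\<And>z. norm z \<ge> \<rho> \<Longrightarrow> \<phi> z = 0"
    "\<And>z. norm (\<phi> z) \<le> L" "\<And>z w. norm (\<phi> z - \<phi> w) \<le> L * norm (z - w)" using C1c_bounds[OF assms] by metis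
  have m: "(\<lambda>z. frechet_derivative \<phi> (at z) b) \<in> borel_measurable borel" if "b \<in> Basis" for b
    using assms that by (intro borel_measurable_continuous_onI) (auto simp: C1c_def)
  have d: "AE z in lborel. ((\<lambda>s::real. \<phi> (z + s *\<^sub>R b)) has_vector_derivative frechet_derivative \<phi> (at z) b) (at 0)" for b
    using C1c_line_derivative[OF assms] by simp
  have 1: "integral\<^sup>L lborel (\<lambda>z. frechet_derivative \<phi> (at z) b) = 0" "integrable lborel (\<lambda>z. frechet_derivative \<phi> (at z) b)"
    if "b \<in> Basis" for b
    using integral_directional_derivative_eq_0[OF b(5) b(3) m[OF that] d] by auto
  have B: "1 \<in> (Basis :: complex set)" "\<i> \<in> (Basis :: complex set)" by (auto simp: Basis_complex_def)
  have "integral\<^sup>L lborel (divergence \<phi>) = integral\<^sup>L lborel (\<lambda>z. Re (frechet_derivative \<phi> (at z) 1)) + integral\<^sup>L lborel (\<lambda>z. Im (frechet_derivative \<phi> (at z) \<i>))"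
    unfolding divergence_complex[abs_def]
    using integrable_Re[OF 1(2)[OF B(1)]] integrable_Im[OF 1(2)[OF B(2)]] by (rule Bochner_Integration.integral_add)
  also have "\<dots> = 0" using integral_Re[OF 1(2)[OF B(1)]] integral_Im[OF 1(2)[OF B(2)]] 1(1)[OF B(1)] 1(1)[OF B(2)] by simp
  finally show ?thesis .
qed

locale tiling_curves = bounded_tiling +
  fixes I :: "nat \<Rightarrow> 'i set" and c c' :: "nat \<Rightarrow> 'i \<Rightarrow> real \<Rightarrow> complex"
  assumes bdry: "k \<in> {1,2} \<Longrightarrow> has_boundary (I k) (c k) (c' k) (E k)"
begin

abbreviation tsum :: "real \<Rightarrow> (nat \<Rightarrow> complex \<Rightarrow> 'i \<Rightarrow> real) \<Rightarrow> real" where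
  "tsum M f \<equiv> \<Sum>x\<in>{1,2} \<times> ball_lat M. \<Sum>i\<in>I (fst x). f (fst x) (snd x) i"

text \<open>The total flux is the integral of the divergence against the sum of the indicators of
  the tiles, which is one on the support of \<open>\<phi>\<close>; and the divergence of a compactly
  supported field integrates to zero.\<close>

lemma current_C1c:
  assumes \<phi>: "C1c \<phi>" and z: "\<And>z. norm z \<ge> \<rho> \<Longrightarrow> \<phi> z = 0" and M: "R + \<rho> + 1 \<le> M"
  shows "tsum M (\<lambda>k g i. lint (\<lambda>t. c k i t + g) (c' k i) \<phi>) = 0"
proof -
  have dz: "divergence \<phi> z = 0" if "norm z > \<rho>" for z
  proof -
    have "((\<lambda>_. 0) has_derivative (\<lambda>v. 0)) (at z)" by simp
    then have "(\<phi> has_derivative (\<lambda>v. 0)) (at z)"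
      by (rule has_derivative_transform_within_open[of _ _ _ _ "- cball 0 \<rho>"]) (use z that in auto)
    from frechet_derivative_at[OF this, symmetric] show ?thesis by (simp add: divergence_complex)
  qed
  have di: "integrable lborel (divergence \<phi>)" by (rule C1c_divergence[OF \<phi>])
  have dl: "integrable lebesgue (divergence \<phi>)" using di by (simp add: integrable_completion)
  let ?A = "{1,2::nat} \<times> ball_lat M"
  have s: "(+) (snd x) ` E (fst x) \<in> sets lebesgue" if "x \<in> ?A" for x
    using that E_sets by (intro translate_lebesgue) auto
  have "tsum M (\<lambda>k g i. lint (\<lambda>t. c k i t + g) (c' k i) \<phi>) = (\<Sum>x\<in>?A. integral ((+) (snd x) ` E (fst x)) (divergence \<phi>))"
  proof (rule sum.cong[OF refl])
    fix x assume x: "x \<in> ?A"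
    then have "fst x \<in> {1,2}" by auto
    from Green_boundary[OF has_boundary_translate[OF bdry[OF this]] s[OF x] \<phi>]
    show "(\<Sum>i\<in>I (fst x). lint (\<lambda>t. c (fst x) i t + snd x) (c' (fst x) i) \<phi>) = integral ((+) (snd x) ` E (fst x)) (divergence \<phi>)" by simp
  qed
  also have "\<dots> = (\<Sum>x\<in>?A. integral\<^sup>L lebesgue (\<lambda>z. indicator ((+) (snd x) ` E (fst x)) z *\<^sub>R divergence \<phi> z))"
    by (rule sum.cong[OF refl]) (rule integral_eq_lebesgue_integral[OF di s])
  also have "\<dots> = integral\<^sup>L lebesgue (\<lambda>z. \<Sum>x\<in>?A. indicator ((+) (snd x) ` E (fst x)) z *\<^sub>R divergence \<phi> z)"
    using integrable_lebesgue_indicator[OF di s] by (intro Bochner_Integration.integral_sum[symmetric]) auto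
  also have "\<dots> = integral\<^sup>L lebesgue (divergence \<phi>)"
  proof (rule integral_cong_AE)
    show "(\<lambda>z. \<Sum>x\<in>?A. indicator ((+) (snd x) ` E (fst x)) z *\<^sub>R divergence \<phi> z) \<in> borel_measurable lebesgue"
      using integrable_lebesgue_indicator[OF di s] by (intro borel_measurable_sum borel_measurable_integrable) auto
    show "divergence \<phi> \<in> borel_measurable lebesgue" using dl by simp
    show "AE z in lebesgue. (\<Sum>x\<in>?A. indicator ((+) (snd x) ` E (fst x)) z *\<^sub>R divergence \<phi> z) = divergence \<phi> z"
      using cover_sum[of \<rho> M]
    proof eventually_elim
      case (elim z)
      show ?case
      proof (cases "norm z \<le> \<rho>")
        case True
        then have "(\<Sum>x\<in>?A. indicator ((+) (snd x) ` E (fst x)) z) = (1::real)" using elim M by simp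
        then show ?thesis unfolding scaleR_left.sum[symmetric] by simp
      next
        case False then show ?thesis using dz[of z] by simp
      qed
    qed
  qed
  also have "\<dots> = integral\<^sup>L lborel (divergence \<phi>)" using di by (intro integral_completion) auto
  also have "\<dots> = 0" by (rule integral_divergence_eq_0[OF \<phi>])
  finally show ?thesis .
qed

lemma curve_cont: "k \<in> {1,2} \<Longrightarrow> i \<in> I k \<Longrightarrow> continuous_on UNIV (\<lambda>t. c k i t + g)"
  "k \<in> {1,2} \<Longrightarrow> i \<in> I k \<Longrightarrow> continuous_on UNIV (c' k i)"
  using has_boundary_continuous[OF bdry] by (auto intro!: continuous_intros)

text \<open>Flux involves only the values of the field, and a uniform error \<open>e\<close> changes
  the finite sum by at most \<open>e\<close> times the total length \<open>C\<close>; density of C1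
  fields thus removes differentiability.\<close>

lemma current_continuous:
  assumes N: "continuous_on UNIV N" "\<And>z. norm z \<ge> \<rho> \<Longrightarrow> N z = 0" and \<rho>: "0 \<le> \<rho>" and M: "R + \<rho> + 2 \<le> M"
  shows "tsum M (\<lambda>k g i. lint (\<lambda>t. c k i t + g) (c' k i) N) = 0"
proof -
  let ?L = "\<lambda>N. tsum M (\<lambda>k g i. lint (\<lambda>t. c k i t + g) (c' k i) N)"
  define len where "len k i = integral\<^sup>L lborel (\<lambda>t::real. indicator {0..1} t * norm (c' k i t))" for k i
  define C where "C = tsum M (\<lambda>k g i. len k i)"
  have li: "integrable lborel (\<lambda>t::real. indicator {0..1} t * norm (c' k i t))" if "k \<in> {1,2}" "i \<in> I k" for k i
    using edge_integrable[of "\<lambda>t. norm (c' k i t)"] curve_cont(2)[OF that] by (simp add: continuous_on_norm continuous_on_subset)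
  have key: "\<bar>?L N\<bar> \<le> e * C" if e: "e > 0" for e
  proof -
    obtain \<phi> where \<phi>: "C1c \<phi>" "\<And>z. norm (\<phi> z - N z) \<le> e" "\<And>z. norm z \<ge> \<rho> + 1 \<Longrightarrow> \<phi> z = 0"
      using C1c_dense[OF N \<rho> e] by metis
    have z: "?L \<phi> = 0" by (rule current_C1c[OF \<phi>(1,3)]) (use M in auto)
    have d: "\<bar>lint (\<lambda>t. c k i t + g) (c' k i) N - lint (\<lambda>t. c k i t + g) (c' k i) \<phi>\<bar> \<le> e * len k i"
      if ki: "k \<in> {1,2}" "i \<in> I k" for k i g
    proof -
      have i1: "integrable lborel (\<lambda>t. indicator {0..1} t * Im (cnj (N (c k i t + g)) * c' k i t))"
        by (rule lint_integrable[OF N(1) curve_cont[OF ki]])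
      have i2: "integrable lborel (\<lambda>t. indicator {0..1} t * Im (cnj (\<phi> (c k i t + g)) * c' k i t))"
        by (rule lint_integrable[OF C1c_continuous[OF \<phi>(1)] curve_cont[OF ki]])
      have "lint (\<lambda>t. c k i t + g) (c' k i) N - lint (\<lambda>t. c k i t + g) (c' k i) \<phi> =
         integral\<^sup>L lborel (\<lambda>t. indicator {0..1} t * Im (cnj (N (c k i t + g)) * c' k i t) - indicator {0..1} t * Im (cnj (\<phi> (c k i t + g)) * c' k i t))"
        unfolding lint_def by (rule Bochner_Integration.integral_diff[OF i1 i2, symmetric])
      also have "norm \<dots> \<le> integral\<^sup>L lborel (\<lambda>t. e * (indicator {0..1} t * norm (c' k i t)))"
      proof (rule Bochner_Integration.integral_norm_bound_integral)
        show "integrable lborel (\<lambda>t. e * (indicator {0..1} t * norm (c' k i t)))"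
          by (rule integrable_mult_right[OF li[OF ki]])
        fix t :: real
        have "Im (cnj (N (c k i t + g)) * c' k i t) - Im (cnj (\<phi> (c k i t + g)) * c' k i t) = Im (cnj (N (c k i t + g) - \<phi> (c k i t + g)) * c' k i t)"
          by (simp add: algebra_simps)
        moreover have "\<bar>Im (cnj (N (c k i t + g) - \<phi> (c k i t + g)) * c' k i t)\<bar> \<le> e * norm (c' k i t)"
          using Im_cnj_mult_le[of "N (c k i t + g) - \<phi> (c k i t + g)" "c' k i t"]
            mult_right_mono[OF \<phi>(2)[of "c k i t + g"] norm_ge_zero[of "c' k i t"]]
          unfolding norm_minus_commute[of "\<phi> (c k i t + g)"] by linarith
        ultimately show "norm (indicator {0..1} t * Im (cnj (N (c k i t + g)) * c' k i t) - indicator {0..1} t * Im (cnj (\<phi> (c k i t + g)) * c' k i t)) \<le> e * (indicator {0..1} t * norm (c' k i t))"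
          unfolding right_diff_distrib[symmetric] real_norm_def by (simp only: abs_mult) (simp add: indicator_def)
      qed (intro Bochner_Integration.integrable_diff i1 i2)
      also have "\<dots> = e * len k i" unfolding len_def by (simp only: integral_mult_right_zero)
      finally show ?thesis by simp
    qed
    have "?L N = ?L N - ?L \<phi>" using z by simp
    also have "\<dots> = tsum M (\<lambda>k g i. lint (\<lambda>t. c k i t + g) (c' k i) N - lint (\<lambda>t. c k i t + g) (c' k i) \<phi>)"
      by (simp add: sum_subtractf)
    also have "\<bar>\<dots>\<bar> \<le> tsum M (\<lambda>k g i. e * len k i)"
      by (rule order_trans[OF sum_abs], rule sum_mono, rule order_trans[OF sum_abs], rule sum_mono, rule d) auto
    also have "\<dots> = e * C" unfolding C_def by (simp add: sum_distrib_left)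
    finally show ?thesis .
  qed
  have C0: "C \<ge> 0" unfolding C_def len_def by (intro sum_nonneg integral_nonneg_AE) auto
  show ?thesis
  proof (rule ccontr)
    assume "?L N \<noteq> 0"
    then have "\<bar>?L N\<bar> > 0" by simp
    moreover have "\<bar>?L N\<bar> \<le> \<bar>?L N\<bar> / (2 * (C + 1)) * C" using key[of "\<bar>?L N\<bar> / (2 * (C + 1))"] C0 calculation by simp
    moreover have "\<bar>?L N\<bar> / (2 * (C + 1)) * C \<le> \<bar>?L N\<bar> / 2"
      using C0 by (simp add: field_simps mult_left_mono)
    ultimately show False by linarith
  qed
qed

lemma current_compact:
  assumes K: "compact K" "K \<noteq> {}" and N: "continuous_on UNIV N"
  shows "\<exists>M0. \<forall>M\<ge>M0. tsum M (\<lambda>k g i. integral\<^sup>L lborel (\<lambda>t. indicator {0..1} t * (indicator K (c k i t + g) * Im (cnj (N (c k i t + g)) * c' k i t)))) = 0"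
proof -
  obtain r where r: "\<And>z. z \<in> K \<Longrightarrow> norm z \<le> r" "r > 0"
    using compact_imp_bounded[OF K(1)] unfolding bounded_pos by blast
  define ch where "ch n z = max 0 (1 - real (Suc n) * infdist z K)" for n z
  have ch: "0 \<le> ch n z" "ch n z \<le> 1" for n z by (auto simp: ch_def infdist_nonneg)
  have cchi: "continuous_on UNIV (ch n)" for n unfolding ch_def by (intro continuous_intros)
  have supp: "ch n z = 0" if "norm z \<ge> r + 1" for n z
  proof -
    have "infdist z K \<ge> 1"
    proof -
      obtain y where y: "y \<in> K" "infdist z K = dist z y" using infdist_attains_inf[OF compact_imp_closed[OF K(1)] K(2)] by blast
      have "dist z y \<ge> 1" using norm_triangle_ineq2[of z y] r(1)[OF y(1)] that by (simp add: dist_norm)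
      then show ?thesis using y by simp
    qed
    then have "1 * 1 \<le> real (Suc n) * infdist z K" by (intro mult_mono) auto
    then show ?thesis by (simp add: ch_def)
  qed
  have lim: "(\<lambda>n. ch n z) \<longlonglongrightarrow> indicator K z" for z
  proof (cases "z \<in> K")
    case True then show ?thesis by (simp add: ch_def)
  next
    case False
    then have p: "infdist z K > 0" using in_closed_iff_infdist_zero[OF compact_imp_closed[OF K(1)] K(2)] infdist_nonneg[of z K] by force
    obtain n0 where n0: "1 / infdist z K < real n0" using reals_Archimedean2 by blast
    have "ch n z = 0" if "n \<ge> n0" for n
    proof -
      have "1 < real n0 * infdist z K" using n0 p by (simp add: field_simps)
      also have "\<dots> \<le> real (Suc n) * infdist z K" using that p by (intro mult_right_mono) auto
      finally show ?thesis by (simp add: ch_def)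
    qed
    then have "\<forall>\<^sub>F n in sequentially. ch n z = 0" using eventually_sequentially by blast
    then show ?thesis using False by (simp add: tendsto_eventually)
  qed
  show ?thesis
  proof (intro exI[of _ "R + (r + 1) + 2"] allI impI)
    fix M assume M: "M \<ge> R + (r + 1) + 2"
    let ?J = "\<lambda>k g i. integral\<^sup>L lborel (\<lambda>t. indicator {0..1} t * (indicator K (c k i t + g) * Im (cnj (N (c k i t + g)) * c' k i t)))"
    have z: "tsum M (\<lambda>k g i. lint (\<lambda>t. c k i t + g) (c' k i) (\<lambda>z. ch n z *\<^sub>R N z)) = 0" for n
    proof (rule current_continuous[OF _ _ _ M])
      show "continuous_on UNIV (\<lambda>z. ch n z *\<^sub>R N z)" by (intro continuous_intros cchi N)
      show "norm z \<ge> r + 1 \<Longrightarrow> ch n z *\<^sub>R N z = 0" for z using supp by simp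
    qed (use r in simp)
    have "(\<lambda>n. tsum M (\<lambda>k g i. lint (\<lambda>t. c k i t + g) (c' k i) (\<lambda>z. ch n z *\<^sub>R N z))) \<longlonglongrightarrow> tsum M ?J"
    proof (intro tendsto_sum)
      fix x i assume x: "x \<in> {1,2} \<times> ball_lat M" and i: "i \<in> I (fst x)"
      define k g where "k = fst x" and "g = snd x"
      have ki: "k \<in> {1,2}" "i \<in> I k" using x i by (auto simp: k_def)
      have m: "(\<lambda>t. N (c k i t + g)) \<in> borel_measurable borel" "(\<lambda>t. c k i t + g) \<in> borel_measurable borel" "c' k i \<in> borel_measurable borel"
        using curve_cont[OF ki] continuous_on_compose2[OF N curve_cont(1)[OF ki]] by (auto intro!: borel_measurable_continuous_onI)
      have mx: "(\<lambda>t. ch n (c k i t + g)) \<in> borel_measurable borel" for n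
        using continuous_on_compose2[OF cchi curve_cont(1)[OF ki]] by (auto intro!: borel_measurable_continuous_onI)
      have mi: "(\<lambda>t. Im (cnj (N (c k i t + g)) * c' k i t)) \<in> borel_measurable borel"
        using curve_cont[OF ki] continuous_on_compose2[OF N curve_cont(1)[OF ki]] by (auto intro!: borel_measurable_continuous_onI continuous_intros)
      have mK: "(\<lambda>t. indicator K (c k i t + g) :: real) \<in> borel_measurable borel"
        using m(2) compact_imp_closed[OF K(1)] by (intro measurable_compose[OF m(2)] borel_measurable_indicator) auto
      have "(\<lambda>n. lint (\<lambda>t. c k i t + g) (c' k i) (\<lambda>z. ch n z *\<^sub>R N z)) \<longlonglongrightarrow> ?J k g i"
        unfolding lint_def
      proof (rule integral_dominated_convergence[where w="\<lambda>t. \<bar>indicator {0..1} t * Im (cnj (N (c k i t + g)) * c' k i t)\<bar>"])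
        have e: "Im (cnj (ch n z *\<^sub>R w) * y) = ch n z * Im (cnj w * y)" for n z w y by (simp add: algebra_simps)
        show "(\<lambda>t. indicator {0..1} t * (indicator K (c k i t + g) * Im (cnj (N (c k i t + g)) * c' k i t))) \<in> borel_measurable lborel"
          using mi mK by (intro borel_measurable_times) auto
        show "(\<lambda>t. indicator {0..1} t * Im (cnj (ch n (c k i t + g) *\<^sub>R N (c k i t + g)) * c' k i t)) \<in> borel_measurable lborel" for n
          unfolding e using mi mx by (intro borel_measurable_times) auto
        show "integrable lborel (\<lambda>t. \<bar>indicator {0..1} t * Im (cnj (N (c k i t + g)) * c' k i t)\<bar>)"
          using lint_integrable[OF N curve_cont[OF ki]] by (rule integrable_abs)
        show "AE t in lborel. (\<lambda>n. indicator {0..1} t * Im (cnj (ch n (c k i t + g) *\<^sub>R N (c k i t + g)) * c' k i t)) \<longlonglongrightarrow> indicator {0..1} t * (indicator K (c k i t + g) * Im (cnj (N (c k i t + g)) * c' k i t))"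
          unfolding e by (intro AE_I2 tendsto_intros lim)
        show "AE t in lborel. norm (indicator {0..1} t * Im (cnj (ch n (c k i t + g) *\<^sub>R N (c k i t + g)) * c' k i t)) \<le> \<bar>indicator {0..1} t * Im (cnj (N (c k i t + g)) * c' k i t)\<bar>" for n
          unfolding e real_norm_def abs_mult using ch[of n] by (intro AE_I2 mult_left_mono mult_left_le_one_le) auto
      qed
      then show "(\<lambda>n. lint (\<lambda>t. c (fst x) i t + snd x) (c' (fst x) i) (\<lambda>z. ch n z *\<^sub>R N z)) \<longlonglongrightarrow> ?J (fst x) (snd x) i"
        by (simp only: k_def g_def)
    qed
    then show "tsum M ?J = 0" unfolding z by (simp add: LIMSEQ_const_iff)
  qed
qed

end

subsection \<open>Matching the arcs of the two tiles\<close>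

definition ccen :: "complex \<Rightarrow> real \<Rightarrow> real \<Rightarrow> complex" where
  "ccen p \<theta> \<kappa> = p - cis \<theta> / (\<i> * of_real \<kappa>)"

lemma ccurve_ccen:
  "\<kappa> \<noteq> 0 \<Longrightarrow> ccurve p \<theta> \<kappa> len t = ccen p \<theta> \<kappa> + cis (\<theta> + \<kappa> * (t * len)) / (\<i> * of_real \<kappa>)"
  by (simp add: ccurve_def ccen_def diff_divide_distrib)

lemma cis_eq_cis_iff: "cis x = cis y \<longleftrightarrow> (\<exists>n::int. x = y + 2 * pi * of_int n)"
  using sin_cos_eq_iff[of x y] by (auto simp: complex_eq_iff)

text \<open>An interval on which the sine is nonnegative cannot cross a negative half period. This
  is the connectedness argument that later confines a concave edge to a single edge of the Reuleaux
  triangle.\<close>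

lemma sin_nonneg_interval:
  assumes "a \<le> b" "\<And>y. a \<le> y \<Longrightarrow> y \<le> b \<Longrightarrow> sin y \<ge> 0"
  obtains k :: int where "2 * pi * of_int k \<le> a" "b \<le> 2 * pi * of_int k + pi"
proof -
  define k where "k = \<lfloor>a / (2 * pi)\<rfloor>"
  have k: "2 * pi * of_int k \<le> a" "a < 2 * pi * of_int k + 2 * pi"
    using floor_divide_lower[of "2 * pi" a] floor_divide_upper[of "2 * pi" a] unfolding k_def by (simp_all add: algebra_simps)
  have per: "sin y = sin (y - 2 * pi * of_int k)" for y
  proof -
    have "sin (y - 2 * pi * of_int k) = sin y * cos (2 * pi * of_int k) - cos y * sin (2 * pi * of_int k)" by (rule sin_diff)
    then show ?thesis by simp
  qed
  have neg: "sin y < 0" if "2 * pi * of_int k + pi < y" "y < 2 * pi * of_int k + 2 * pi" for y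
    unfolding per[of y] using that by (intro sin_lt_zero) auto
  have "b \<le> 2 * pi * of_int k + pi"
  proof (rule ccontr)
    assume b: "\<not> b \<le> 2 * pi * of_int k + pi"
    \<comment> \<open>The middle of the negative half period, clamped to the interval from
      \<open>a\<close> to \<open>b\<close>.\<close>
    define y where "y = max a (min b (2 * pi * of_int k + 3 * pi / 2))"
    have "a \<le> y" "y \<le> b" using assms(1) by (auto simp: y_def)
    moreover have "2 * pi * of_int k + pi < y" "y < 2 * pi * of_int k + 2 * pi"
      using b k pi_gt_zero by (auto simp: y_def max_def min_def)
    ultimately show False using neg[of y] assms(2)[of y] by simp
  qed
  then show thesis using that k by blast
qed

lemma quadratic_finite:
  fixes a b c :: "'a::{field}"
  assumes "a \<noteq> 0" shows "finite {x. a * x\<^sup>2 + b * x + c = 0}"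
proof -
  have "finite {x. poly [:c, b, a:] x = 0}" by (rule poly_roots_finite) (use assms in simp)
  then show ?thesis by (simp add: algebra_simps power2_eq_square)
qed

lemma flat_circle_finite:
  assumes "len > 0"
  shows "finite {t. norm (ccurve p \<theta> 0 len t + g - m) = r}"
proof -
  let ?w = "p + g - m"
  have "{t. norm (ccurve p \<theta> 0 len t + g - m) = r} \<subseteq> {t. len\<^sup>2 * t\<^sup>2 + (2 * len * (Re ?w * cos \<theta> + Im ?w * sin \<theta>)) * t + ((norm ?w)\<^sup>2 - r\<^sup>2) = 0}"
  proof
    fix t assume "t \<in> {t. norm (ccurve p \<theta> 0 len t + g - m) = r}"
    then have "(norm (?w + of_real (t * len) * cis \<theta>))\<^sup>2 = r\<^sup>2" by (simp add: ccurve_def algebra_simps)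
    moreover have "(norm (?w + of_real (t * len) * cis \<theta>))\<^sup>2 = (norm ?w)\<^sup>2 + (2 * len * (Re ?w * cos \<theta> + Im ?w * sin \<theta>)) * t + (len\<^sup>2 * t\<^sup>2 * (cos \<theta>)\<^sup>2 + len\<^sup>2 * t\<^sup>2 * (sin \<theta>)\<^sup>2)"
      unfolding cmod_power2 by (simp add: power2_eq_square algebra_simps)
    moreover have "len\<^sup>2 * t\<^sup>2 * (cos \<theta>)\<^sup>2 + len\<^sup>2 * t\<^sup>2 * (sin \<theta>)\<^sup>2 = len\<^sup>2 * t\<^sup>2"
      by (simp only: distrib_left[symmetric] sin_cos_squared_add2 mult_1_right)
    ultimately show "t \<in> {t. len\<^sup>2 * t\<^sup>2 + (2 * len * (Re ?w * cos \<theta> + Im ?w * sin \<theta>)) * t + ((norm ?w)\<^sup>2 - r\<^sup>2) = 0}" by simp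
  qed
  then show ?thesis by (rule finite_subset) (rule quadratic_finite, use assms in simp)
qed

lemma cis_inj_on_arc:
  assumes "\<kappa> \<noteq> 0" "len > 0" "\<bar>\<kappa>\<bar> * len < 2 * pi"
  shows "inj_on (\<lambda>t. cis (\<theta> + \<kappa> * (t * len))) {0..1}"
proof (rule inj_onI)
  fix s t :: real assume st: "s \<in> {0..1}" "t \<in> {0..1}" "cis (\<theta> + \<kappa> * (s * len)) = cis (\<theta> + \<kappa> * (t * len))"
  then obtain n :: int where n: "\<kappa> * len * (s - t) = 2 * pi * of_int n"
    unfolding cis_eq_cis_iff by (auto simp: algebra_simps)
  have "\<bar>\<kappa> * len * (s - t)\<bar> = \<bar>\<kappa>\<bar> * len * \<bar>s - t\<bar>" using assms by (simp add: abs_mult)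
  also have "\<dots> \<le> \<bar>\<kappa>\<bar> * len * 1" using st assms by (intro mult_left_mono) auto
  also have "\<dots> < 2 * pi" using assms by simp
  finally have "2 * pi * \<bar>of_int n :: real\<bar> < 2 * pi * 1" unfolding n by (simp add: abs_mult)
  then have "\<bar>of_int n :: real\<bar> < 1" using pi_gt_zero by (simp only: mult_less_cancel_left_pos)
  then have "n = 0" by linarith
  then show "s = t" using n assms by simp
qed

text \<open>Distinct circles meet in finitely many points. With the unit number \<open>?u t\<close>
  as unknown \<open>x\<close>, the squared equation for \<open>norm (e + x)\<close> becomes after
  multiplication by \<open>x\<close> a quadratic with leading coefficient \<open>cnj e\<close>,
  which is nonzero unless the circles are concentric.\<close>

lemma arc_circle_finite:
  assumes k: "\<kappa> \<noteq> 0" "len > 0" "\<bar>\<kappa>\<bar> * len < 2 * pi" and ne: "\<not> (ccen p \<theta> \<kappa> + g = m \<and> 1 / \<bar>\<kappa>\<bar> = r)"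
  shows "finite {t \<in> {0..1}. norm (ccurve p \<theta> \<kappa> len t + g - m) = r}"
proof -
  let ?u = "\<lambda>t. cis (\<theta> + \<kappa> * (t * len))"
  define e where "e = (ccen p \<theta> \<kappa> + g - m) * (\<i> * of_real \<kappa>)"
  have eq: "norm (ccurve p \<theta> \<kappa> len t + g - m) * \<bar>\<kappa>\<bar> = norm (e + ?u t)" for t
  proof -
    have "(ccurve p \<theta> \<kappa> len t + g - m) * (\<i> * of_real \<kappa>) = e + ?u t"
      unfolding ccurve_ccen[OF k(1)] e_def using k(1) by (simp add: field_simps)
    then have "norm ((ccurve p \<theta> \<kappa> len t + g - m) * (\<i> * of_real \<kappa>)) = norm (e + ?u t)" by simp
    then show ?thesis by (simp add: norm_mult)
  qed
  show ?thesis
  proof (cases "e = 0")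
    case True
    then have "ccen p \<theta> \<kappa> + g = m" using k(1) by (simp add: e_def)
    moreover have "norm (ccurve p \<theta> \<kappa> len t + g - m) = 1 / \<bar>\<kappa>\<bar>" for t using eq[of t] True k(1) by (simp add: field_simps)
    ultimately show ?thesis using ne by simp
  next
    case False
    let ?U = "{x. cnj e * x\<^sup>2 + (of_real ((norm e)\<^sup>2 + 1 - r\<^sup>2 * \<kappa>\<^sup>2)) * x + e = 0}"
    have U: "finite ?U" by (rule quadratic_finite) (use False in simp)
    have "{t \<in> {0..1}. norm (ccurve p \<theta> \<kappa> len t + g - m) = r} \<subseteq> ?u -` ?U \<inter> {0..1}"
    proof
      fix t assume t: "t \<in> {t \<in> {0..1}. norm (ccurve p \<theta> \<kappa> len t + g - m) = r}"
      let ?x = "?u t"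
      have "norm (e + ?x) = r * \<bar>\<kappa>\<bar>" using eq[of t] t by simp
      then have "(norm (e + ?x))\<^sup>2 = r\<^sup>2 * \<kappa>\<^sup>2" by (simp add: power_mult_distrib)
      then have "(e + ?x) * cnj (e + ?x) = of_real (r\<^sup>2 * \<kappa>\<^sup>2)" by (metis complex_norm_square)
      moreover have xx: "?x * cnj ?x = 1" by (simp add: complex_norm_square[symmetric])
      have ee: "e * cnj e = of_real ((norm e)\<^sup>2)" by (rule complex_norm_square[symmetric])
      have "(e + ?x) * cnj (e + ?x) * ?x = (e * cnj e) * ?x + e * (?x * cnj ?x) + cnj e * ?x\<^sup>2 + (?x * cnj ?x) * ?x"
        by (simp add: algebra_simps power2_eq_square)
      ultimately have "of_real (r\<^sup>2 * \<kappa>\<^sup>2) * ?x = of_real ((norm e)\<^sup>2) * ?x + e + cnj e * ?x\<^sup>2 + ?x"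
        unfolding xx ee by simp
      then have "cnj e * ?x\<^sup>2 + (of_real ((norm e)\<^sup>2 + 1 - r\<^sup>2 * \<kappa>\<^sup>2)) * ?x + e = 0" by (simp add: algebra_simps)
      then show "t \<in> ?u -` ?U \<inter> {0..1}" using t by simp
    qed
    then show ?thesis using finite_vimage_IntI[OF U cis_inj_on_arc[OF k]] by (rule finite_subset)
  qed
qed

text \<open>The part in \<open>K\<close> of the flux of the field \<open>z - m\<close> across a
  translated edge. On an arc about \<open>m\<close> the integrand is the constant
  \<open>len / \<kappa>\<close>, so convex arcs count positively and concave ones negatively; an
  edge that meets the circle carrying \<open>K\<close> in finitely many points contributes
  zero.\<close>

definition Jint :: "(real \<Rightarrow> complex) \<Rightarrow> (real \<Rightarrow> complex) \<Rightarrow> complex \<Rightarrow> complex set \<Rightarrow> complex \<Rightarrow> real" where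
  "Jint \<gamma> \<gamma>' g K m = integral\<^sup>L lborel (\<lambda>t. indicator {0..1} t * (indicator K (\<gamma> t + g) * Im (cnj (\<gamma> t + g - m) * \<gamma>' t)))"

lemma Jint_zero:
  assumes "finite {t \<in> {0..1}. norm (\<gamma> t + g - m) = r}" "K \<subseteq> sphere m r"
  shows "Jint \<gamma> \<gamma>' g K m = 0"
proof -
  have "AE t in lborel. t \<notin> {t \<in> {0..1}. norm (\<gamma> t + g - m) = r}"
    by (rule AE_not_in[OF finite_imp_null_set_lborel[OF assms(1)]])
  then have "AE t in lborel. indicator {0..1} t * (indicator K (\<gamma> t + g) * Im (cnj (\<gamma> t + g - m) * \<gamma>' t)) = (0::real)"
  proof eventually_elim
    case (elim t)
    show ?case
    proof (cases "t \<in> {0..1} \<and> \<gamma> t + g \<in> K")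
      case True
      then have "\<gamma> t + g \<in> sphere m r" using assms(2) by blast
      then have "norm (\<gamma> t + g - m) = r" by (simp add: dist_norm norm_minus_commute)
      then show ?thesis using elim True by simp
    qed (auto simp: indicator_def)
  qed
  then show ?thesis unfolding Jint_def by (rule integral_eq_zero_AE)
qed

definition hits :: "(real \<Rightarrow> complex) \<Rightarrow> complex \<Rightarrow> complex set \<Rightarrow> real set" where
  "hits \<gamma> g K = {t \<in> {0..1}. \<gamma> t + g \<in> K}"

lemma hits_measure:
  assumes "continuous_on UNIV \<gamma>" "compact K"
  shows "hits \<gamma> g K \<in> sets borel" "emeasure lborel (hits \<gamma> g K) < \<infinity>" "measure lborel (hits \<gamma> g K) \<le> 1"
proof -
  have "closed ((\<lambda>t. \<gamma> t + g) -` K)" using assms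
    by (intro continuous_closed_vimage compact_imp_closed continuous_intros) (auto simp: continuous_on_eq_continuous_at intro!: continuous_intros)
  then have "compact ({0..1} \<inter> (\<lambda>t. \<gamma> t + g) -` K)" by (intro compact_Int_closed) auto
  moreover have e: "{0..1} \<inter> (\<lambda>t. \<gamma> t + g) -` K = hits \<gamma> g K" by (auto simp: hits_def)
  ultimately have c: "compact (hits \<gamma> g K)" by simp
  then show s: "hits \<gamma> g K \<in> sets borel" by (simp add: borel_compact)
  show f: "emeasure lborel (hits \<gamma> g K) < \<infinity>" using emeasure_bounded_finite[OF compact_imp_bounded[OF c]] by simp
  have "measure lborel (hits \<gamma> g K) \<le> measure lborel {0..1::real}"
    using s by (intro measure_mono_fmeasurable) (auto simp: hits_def fmeasurable_def)
  then show "measure lborel (hits \<gamma> g K) \<le> 1" by simp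
qed

lemma Jint_arc:
  assumes k: "\<kappa> \<noteq> 0" and m: "ccen p \<theta> \<kappa> + g = m" and K: "compact K"
  shows "Jint (ccurve p \<theta> \<kappa> len) (cdir \<theta> \<kappa> len) g K m = (len / \<kappa>) * measure lborel (hits (ccurve p \<theta> \<kappa> len) g K)"
proof -
  have "Im (cnj (ccurve p \<theta> \<kappa> len t + g - m) * cdir \<theta> \<kappa> len t) = len / \<kappa>" for t
  proof -
    let ?x = "cis (\<theta> + \<kappa> * (t * len))"
    have "ccurve p \<theta> \<kappa> len t + g - m = ?x / (\<i> * of_real \<kappa>)" unfolding ccurve_ccen[OF k] m[symmetric] by simp
    moreover have "cnj (?x / (\<i> * of_real \<kappa>)) = cnj ?x * (\<i> * of_real (1 / \<kappa>))" using k by (simp add: field_simps)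
    ultimately have "cnj (ccurve p \<theta> \<kappa> len t + g - m) * cdir \<theta> \<kappa> len t = (?x * cnj ?x) * (\<i> * of_real (len / \<kappa>))"
      by (simp only: cdir_def) (simp add: mult_ac)
    also have "?x * cnj ?x = 1" by (simp add: complex_norm_square[symmetric])
    finally show ?thesis by simp
  qed
  then have "Jint (ccurve p \<theta> \<kappa> len) (cdir \<theta> \<kappa> len) g K m = integral\<^sup>L lborel (\<lambda>t. indicator (hits (ccurve p \<theta> \<kappa> len) g K) t * (len / \<kappa>))"
    unfolding Jint_def by (intro Bochner_Integration.integral_cong refl) (auto simp: hits_def indicator_def)
  also have "\<dots> = measure lborel (hits (ccurve p \<theta> \<kappa> len) g K) * (len / \<kappa>)"
    using hits_measure[OF ccurve_continuous K] by simp
  finally show ?thesis by simp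
qed

lemma hits_pos:
  assumes c: "continuous_on UNIV \<gamma>" and K: "compact K" and t0: "t0 \<in> {0..1}" and e: "e > 0"
    and sub: "\<And>t. t \<in> {0..1} \<Longrightarrow> dist (\<gamma> t) (\<gamma> t0) < e \<Longrightarrow> \<gamma> t + g \<in> K"
  shows "measure lborel (hits \<gamma> g K) > 0"
proof -
  have "isCont \<gamma> t0" using c by (simp add: continuous_on_eq_continuous_at)
  then obtain d where d: "d > 0" "\<And>t. dist t t0 < d \<Longrightarrow> dist (\<gamma> t) (\<gamma> t0) < e"
    unfolding continuous_at_eps_delta using e by blast
  define a b where "a = max 0 (t0 - d / 2)" and "b = min 1 (t0 + d / 2)"
  have ab: "a < b" using t0 d by (auto simp: a_def b_def)
  have "{a..b} \<subseteq> hits \<gamma> g K"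
  proof
    fix t assume t: "t \<in> {a..b}"
    then have "t \<in> {0..1}" "dist t t0 < d" using d(1) by (auto simp: a_def b_def dist_real_def)
    then show "t \<in> hits \<gamma> g K" using sub d(2) by (simp add: hits_def)
  qed
  then have "measure lborel {a..b} \<le> measure lborel (hits \<gamma> g K)"
    using hits_measure[OF c K] by (intro measure_mono_fmeasurable) (auto simp: fmeasurable_def)
  then show ?thesis using ab by simp
qed

section \<open>Balance of convex and concave arcs on a common circle\<close>

locale arc_tiling = bounded_tiling +
  fixes p1 p2 :: "nat \<Rightarrow> complex" and \<theta>1 \<theta>2 len1 len2 \<kappa>2 :: "nat \<Rightarrow> real" and K0 :: real
  assumes b1: "has_boundary {..<3::nat} (\<lambda>i. ccurve (p1 i) (\<theta>1 i) K0 (len1 i)) (\<lambda>i. cdir (\<theta>1 i) K0 (len1 i)) (E 1)"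
    and b2: "has_boundary {..<9::nat} (\<lambda>i. ccurve (p2 i) (\<theta>2 i) (\<kappa>2 i) (len2 i)) (\<lambda>i. cdir (\<theta>2 i) (\<kappa>2 i) (len2 i)) (E 2)"
    and K0: "K0 > 0" and len1: "i < 3 \<Longrightarrow> len1 i = pi / 3 / K0"
    and th1: "i < 3 \<Longrightarrow> cis (\<theta>1 i) = cis (\<theta>1 0 + 2 * pi * real i / 3)"
    and len2: "j < 9 \<Longrightarrow> len2 j > 0" "j < 9 \<Longrightarrow> \<bar>\<kappa>2 j\<bar> * len2 j < 2 * pi" and k2: "j < 9 \<Longrightarrow> \<kappa>2 j \<le> 0"
    and card2: "card {j. j < 9 \<and> \<kappa>2 j < 0} = 3"
begin

abbreviation "A i \<equiv> ccurve (p1 i) (\<theta>1 i) K0 (len1 i)"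
abbreviation "B j \<equiv> ccurve (p2 j) (\<theta>2 j) (\<kappa>2 j) (len2 j)"
abbreviation "JA i g K m \<equiv> Jint (A i) (cdir (\<theta>1 i) K0 (len1 i)) g K m"
abbreviation "JB j g K m \<equiv> Jint (B j) (cdir (\<theta>2 j) (\<kappa>2 j) (len2 j)) g K m"
abbreviation "cA i \<equiv> ccen (p1 i) (\<theta>1 i) K0"
abbreviation "cB j \<equiv> ccen (p2 j) (\<theta>2 j) (\<kappa>2 j)"

lemma len1': "i < 3 \<Longrightarrow> len1 i > 0" "i < 3 \<Longrightarrow> \<bar>K0\<bar> * len1 i < 2 * pi" "i < 3 \<Longrightarrow> K0 * len1 i = pi / 3"
  using len1 K0 by auto

sublocale tiling_curves u v E R "\<lambda>k. if k = 1 then {..<3} else {..<9::nat}"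
  "\<lambda>k i. if k = 1 then A i else B i" "\<lambda>k i. if k = 1 then cdir (\<theta>1 i) K0 (len1 i) else cdir (\<theta>2 i) (\<kappa>2 i) (len2 i)"
  by unfold_locales (use b1 b2 in auto)

text \<open>This is \<open>current_compact\<close> for the field \<open>z - m\<close>. The lower
  bound \<open>M1\<close> leaves room to force a given translate into the truncated sum.\<close>

lemma circle_balance:
  assumes "compact K" "K \<noteq> {}"
  shows "\<exists>M\<ge>M1. (\<Sum>g\<in>ball_lat M. (\<Sum>i<3. JA i g K m) + (\<Sum>j<9. JB j g K m)) = 0"
proof -
  have "continuous_on UNIV (\<lambda>z. z - m)" by (intro continuous_intros)
  from current_compact[OF assms this] obtain M0 where M0: "\<forall>M\<ge>M0. tsum M (\<lambda>k g i. integral\<^sup>L lborel (\<lambda>t. indicator {0..1} t *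
      (indicator K ((if k = 1 then A i else B i) t + g) * Im (cnj ((if k = 1 then A i else B i) t + g - m) *
       (if k = 1 then cdir (\<theta>1 i) K0 (len1 i) else cdir (\<theta>2 i) (\<kappa>2 i) (len2 i)) t)))) = 0"
    by (rule exE)
  let ?M = "max M0 M1"
  have split: "(\<Sum>x\<in>{1,2::nat} \<times> ball_lat ?M. f (fst x) (snd x)) = (\<Sum>g\<in>ball_lat ?M. f 1 g + f 2 g)" for f :: "nat \<Rightarrow> complex \<Rightarrow> real"
  proof -
    have "(\<Sum>x\<in>{1,2::nat} \<times> ball_lat ?M. f (fst x) (snd x)) = (\<Sum>k\<in>{1,2}. \<Sum>g\<in>ball_lat ?M. f k g)"
      by (simp add: sum.cartesian_product case_prod_beta)
    then show ?thesis by (simp add: sum.distrib)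
  qed
  have "(\<Sum>g\<in>ball_lat ?M. (\<Sum>i<3. JA i g K m) + (\<Sum>j<9. JB j g K m)) = 0"
    using M0[rule_format, of ?M] unfolding Jint_def[symmetric]
    unfolding split[of "\<lambda>k g. \<Sum>i\<in>(if k = 1 then {..<3} else {..<9}). Jint (if k = 1 then A i else B i) (if k = 1 then cdir (\<theta>1 i) K0 (len1 i) else cdir (\<theta>2 i) (\<kappa>2 i) (len2 i)) g K m"]
    by simp
  then show ?thesis by (intro exI[of _ ?M]) simp
qed

lemma JA_cases:
  assumes "i < 3" "compact K" "K \<subseteq> sphere m r"
  shows "JA i g K m = (if cA i + g = m \<and> 1 / K0 = r then len1 i / K0 * measure lborel (hits (A i) g K) else 0)"
proof (cases "cA i + g = m \<and> 1 / K0 = r")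
  case True then show ?thesis using Jint_arc[of K0 "p1 i" "\<theta>1 i" g m K] K0 assms by simp
next
  case False
  then show ?thesis using Jint_zero[OF arc_circle_finite[of K0 "len1 i" "p1 i" "\<theta>1 i" g m r] assms(3)] K0 len1'(1,2)[OF assms(1)] by auto
qed

lemma JB_cases:
  assumes "j < 9" "compact K" "K \<subseteq> sphere m r"
  shows "JB j g K m = (if \<kappa>2 j < 0 \<and> cB j + g = m \<and> 1 / \<bar>\<kappa>2 j\<bar> = r then len2 j / \<kappa>2 j * measure lborel (hits (B j) g K) else 0)"
proof (cases "\<kappa>2 j < 0 \<and> cB j + g = m \<and> 1 / \<bar>\<kappa>2 j\<bar> = r")
  case True
  then have k: "\<kappa>2 j \<noteq> 0" and c: "cB j + g = m" by auto
  show ?thesis unfolding if_P[OF True] by (rule Jint_arc[OF k c assms(2)])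
next
  case False
  show ?thesis
  proof (cases "\<kappa>2 j = 0")
    case True
    have "finite {t \<in> {0..1}. norm (B j t + g - m) = r}"
      using flat_circle_finite[OF len2(1)[OF assms(1)], of "p2 j" "\<theta>2 j" g m r] unfolding True by (rule rev_finite_subset) auto
    from Jint_zero[OF this assms(3)] show ?thesis using False by (simp only: if_False)
  next
    case n0: False
    then have "\<not> (cB j + g = m \<and> 1 / \<bar>\<kappa>2 j\<bar> = r)" using False k2[OF assms(1)] by auto
    from Jint_zero[OF arc_circle_finite[OF n0 len2[OF assms(1)] this] assms(3)] show ?thesis using False by (simp only: if_False)
  qed
qed

lemma JB_nonpos: "j < 9 \<Longrightarrow> compact K \<Longrightarrow> K \<subseteq> sphere m r \<Longrightarrow> JB j g K m \<le> 0"
  using len2(1)[of j] by (simp add: JB_cases divide_nonneg_neg mult_nonpos_nonneg)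

lemma JA_nonneg: "i < 3 \<Longrightarrow> compact K \<Longrightarrow> K \<subseteq> sphere m r \<Longrightarrow> JA i g K m \<ge> 0"
  using len1'(1)[of i] K0 by (simp add: JA_cases)

lemma arc_in_sphere: "\<kappa> \<noteq> 0 \<Longrightarrow> ccurve p \<theta> \<kappa> len t \<in> sphere (ccen p \<theta> \<kappa>) (1 / \<bar>\<kappa>\<bar>)"
  by (simp add: ccurve_ccen dist_norm norm_divide norm_mult)

text \<open>If a point of a concave edge avoided all translated arcs of \<open>E 1\<close> on the
  same circle, a small closed piece \<open>K\<close> of the edge around it would receive only
  nonpositive contributions, one of them negative, contrary to
  \<open>circle_balance\<close>.\<close>

lemma arc_covered:
  assumes j: "j < 9" "\<kappa>2 j < 0" and t0: "t0 \<in> {0..1}"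
  obtains i s where "i < 3" "s \<in> {0..1}" "cB j - cA i \<in> lat u v" "\<kappa>2 j = - K0" "A i s + (cB j - cA i) = B j t0"
proof -
  let ?m = "cB j" and ?r = "1 / \<bar>\<kappa>2 j\<bar>"
  \<comment> \<open>The arcs of \<open>E 1\<close> that have a translate on the circle of edge
    \<open>j\<close>; the lattice vector is determined by the two centres.\<close>
  define I' where "I' = {i. i < 3 \<and> ?m - cA i \<in> lat u v \<and> 1 / K0 = ?r}"
  define Z where "Z = (\<Union>i\<in>I'. (\<lambda>s. A i s + (?m - cA i)) ` {0..1})"
  have "closed Z" unfolding Z_def
  proof (rule closed_UN)
    show "finite I'" by (simp add: I'_def)
    show "\<forall>i\<in>I'. closed ((\<lambda>s. A i s + (?m - cA i)) ` {0..1})"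
      by (intro ballI compact_imp_closed compact_continuous_image continuous_intros ccurve_continuous) auto
  qed
  have "B j t0 \<in> Z"
  proof (rule ccontr)
    assume "B j t0 \<notin> Z"
    then obtain e where e: "e > 0" "ball (B j t0) e \<subseteq> - Z" using \<open>closed Z\<close> open_contains_ball[of "- Z"] by (auto simp: open_Compl)
    define K where "K = B j ` {0..1} \<inter> cball (B j t0) (e / 2)"
    have cK: "compact K" unfolding K_def by (intro compact_Int compact_continuous_image ccurve_continuous) auto
    have "B j t0 \<in> K" using t0 e by (auto simp: K_def)
    then have nK: "K \<noteq> {}" by blast
    have sK: "K \<subseteq> sphere ?m ?r" using arc_in_sphere[of "\<kappa>2 j"] j by (auto simp: K_def)
    obtain M where M: "M \<ge> 0" "(\<Sum>g\<in>ball_lat M. (\<Sum>i<3. JA i g K ?m) + (\<Sum>j<9. JB j g K ?m)) = 0"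
      using circle_balance[OF cK nK, of 0 ?m] by blast
    have JA0: "JA i g K ?m = 0" if i: "i < 3" and g: "g \<in> ball_lat M" for i g
    proof (cases "cA i + g = ?m \<and> 1 / K0 = ?r")
      case True
      then have ge: "g = ?m - cA i" by (metis add_diff_cancel_left')
      then have iI: "i \<in> I'" using True i g by (simp add: I'_def ball_lat_def)
      have h0: "hits (A i) g K = {}"
      proof -
        have "A i s + g \<notin> K" if "s \<in> {0..1}" for s
        proof
          assume "A i s + g \<in> K"
          moreover have "A i s + g \<in> Z" unfolding Z_def ge using iI that by blast
          moreover have "A i s + g \<in> ball (B j t0) e" using calculation(1) e(1) by (simp add: K_def)
          ultimately show False using e(2) by blast
        qed
        then show ?thesis by (auto simp: hits_def)
      qed
      show ?thesis unfolding JA_cases[OF i cK sK, of g] h0 by (simp only: measure_empty mult_zero_right if_cancel)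
    next
      case False then show ?thesis using JA_cases[OF i cK sK, of g] by (simp only: if_False)
    qed
    have JBj: "JB j 0 K ?m < 0"
    proof -
      have "measure lborel (hits (B j) 0 K) > 0"
      proof (rule hits_pos[OF ccurve_continuous cK t0])
        show "0 < e / 2" using e by simp
        show "\<And>t. t \<in> {0..1} \<Longrightarrow> dist (B j t) (B j t0) < e / 2 \<Longrightarrow> B j t + 0 \<in> K"
          by (auto simp: K_def dist_commute)
      qed
      moreover have "len2 j / \<kappa>2 j < 0" using len2(1)[OF j(1)] j(2) by (simp add: divide_pos_neg)
      moreover have "JB j 0 K ?m = len2 j / \<kappa>2 j * measure lborel (hits (B j) 0 K)"
        unfolding JB_cases[OF j(1) cK sK] using j(2) by simp
      ultimately show ?thesis by (simp only: mult_neg_pos)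
    qed
    have "0 \<in> ball_lat M" using M(1) lat_group(1) by (simp add: ball_lat_def)
    have "(\<Sum>g\<in>ball_lat M. (\<Sum>i<3. JA i g K ?m) + (\<Sum>j<9. JB j g K ?m)) = (\<Sum>g\<in>ball_lat M. \<Sum>j<9. JB j g K ?m)"
      using JA0 by (intro sum.cong) auto
    also have "\<dots> \<le> (\<Sum>g\<in>{0}. \<Sum>j<9. JB j g K ?m)"
    proof -
      have "(\<Sum>g\<in>ball_lat M. \<Sum>j<9. JB j g K ?m) = (\<Sum>j<9. JB j 0 K ?m) + (\<Sum>g\<in>ball_lat M - {0}. \<Sum>j<9. JB j g K ?m)"
        by (rule sum.remove[OF finite_ball_lat \<open>0 \<in> ball_lat M\<close>])
      moreover have "(\<Sum>g\<in>ball_lat M - {0}. \<Sum>j<9. JB j g K ?m) \<le> 0"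
        using JB_nonpos[OF _ cK sK] by (intro sum_nonpos) auto
      ultimately show ?thesis by simp
    qed
    also have "\<dots> = (\<Sum>j<9. JB j 0 K ?m)" by simp
    also have "\<dots> = JB j 0 K ?m + (\<Sum>j\<in>{..<9} - {j}. JB j 0 K ?m)"
      by (rule sum.remove) (use j in auto)
    also have "(\<Sum>j\<in>{..<9} - {j}. JB j 0 K ?m) \<le> 0" using JB_nonpos[OF _ cK sK] by (intro sum_nonpos) auto
    finally show False using JBj M(2) by simp
  qed
  then obtain i s where h: "i \<in> I'" "s \<in> {0..1}" "B j t0 = A i s + (?m - cA i)" unfolding Z_def by blast
  have "K0 = \<bar>\<kappa>2 j\<bar>" using h(1) K0 j(2) by (auto simp: I'_def field_simps)
  then have k: "\<kappa>2 j = - K0" using j(2) by linarith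
  have i3: "i < 3" "cB j - cA i \<in> lat u v" using h(1) unfolding I'_def by blast+
  show thesis by (rule that[OF i3(1) h(2) i3(2) k h(3)[symmetric]])
qed


text \<open>Both edges are described by the angle about the common centre. The shift by
  \<open>pi\<close> arises because opposite signs of curvature put the centre on opposite sides of
  the tangent.\<close>

lemma arc_angle:
  assumes i: "i < 3" and k: "\<kappa>2 j = - K0" and eq: "A i s + (cB j - cA i) = B j t"
  obtains n :: int where "\<theta>2 j - K0 * (t * len2 j) + pi = \<theta>1 0 + 2 * pi * real i / 3 + s * pi / 3 + 2 * pi * of_int n"
proof -
  have a: "cis (\<theta>1 i + K0 * (s * len1 i)) = cis (\<theta>1 0 + 2 * pi * real i / 3 + s * pi / 3)"
  proof -
    have "K0 * (s * len1 i) = s * (K0 * len1 i)" by simp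
    also have "\<dots> = s * pi / 3" unfolding len1'(3)[OF i] by simp
    finally have e: "K0 * (s * len1 i) = s * pi / 3" .
    show ?thesis unfolding e using th1[OF i] by (simp add: cis_mult[symmetric])
  qed
  have K: "K0 \<noteq> 0" "- K0 \<noteq> 0" using K0 by auto
  have "cis (\<theta>1 i + K0 * (s * len1 i)) / (\<i> * of_real K0) = cis (\<theta>2 j + - K0 * (t * len2 j)) / (\<i> * of_real (- K0))"
    using eq unfolding k ccurve_ccen[OF K(1)] ccurve_ccen[OF K(2)] by simp
  then have "cis (\<theta>1 i + K0 * (s * len1 i)) = - cis (\<theta>2 j + - K0 * (t * len2 j))"
    using K by (simp add: field_simps)
  also have "\<dots> = cis (\<theta>2 j - K0 * (t * len2 j) + pi)" by (simp add: cis_mult[symmetric])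
  finally have "cis (\<theta>2 j - K0 * (t * len2 j) + pi) = cis (\<theta>1 0 + 2 * pi * real i / 3 + s * pi / 3)" using a by simp
  then show thesis unfolding cis_eq_cis_iff using that by blast
qed

text \<open>Seen from its centre, edge \<open>j\<close> lies in the sector of edge \<open>i\<close>,
  with angles lifted by \<open>n\<close> full turns. The edge runs clockwise: the first inequality
  places its end above the lower limit of the sector, the second its start below the upper
  one.\<close>

definition Q :: "nat \<Rightarrow> nat \<Rightarrow> int \<Rightarrow> bool" where
  "Q j i n \<longleftrightarrow> i < 3 \<and> cB j - cA i \<in> lat u v \<and> \<kappa>2 j = - K0 \<and>
     K0 * len2 j \<le> \<theta>2 j + pi - \<theta>1 0 - 2 * pi * real i / 3 - 2 * pi * of_int n \<and>
     \<theta>2 j + pi - \<theta>1 0 - 2 * pi * real i / 3 - 2 * pi * of_int n \<le> pi / 3"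

lemma pi_cancel: "pi * a < pi * b \<Longrightarrow> a < b" "pi * a \<le> pi * b \<Longrightarrow> a \<le> b"
  using pi_gt_zero by (simp_all only: mult_less_cancel_left_pos mult_le_cancel_left_pos)

text \<open>Seen from their centres, the three edges of \<open>E 1\<close> occupy alternate sixths
  of the circle. Tripling the angle folds these sixths onto the half periods where the sine is
  nonnegative, so \<open>arc_covered\<close> gives \<open>sin (X t) >= 0\<close> along the whole
  edge, and \<open>sin_nonneg_interval\<close> leaves a single half period.\<close>

lemma Q_exists:
  assumes j: "j < 9" "\<kappa>2 j < 0"
  shows "\<exists>i n. Q j i n"
proof -
  define X where "X t = 3 * (\<theta>2 j - K0 * (t * len2 j) + pi - \<theta>1 0)" for t
  have l: "len2 j > 0" by (rule len2[OF j(1)])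
  have cov: "\<exists>i s n. i < 3 \<and> s \<in> {0..1} \<and> cB j - cA i \<in> lat u v \<and> \<kappa>2 j = - K0 \<and> X t = pi * (2 * of_int (int i + 3 * n) + s)"
    if tt: "t \<in> {0..1}" for t
  proof -
    obtain i s where h: "i < 3" "s \<in> {0..1}" "cB j - cA i \<in> lat u v" "\<kappa>2 j = - K0" "A i s + (cB j - cA i) = B j t"
      by (rule arc_covered[OF j tt])
    obtain n where n: "\<theta>2 j - K0 * (t * len2 j) + pi = \<theta>1 0 + 2 * pi * real i / 3 + s * pi / 3 + 2 * pi * of_int n"
      by (rule arc_angle[OF h(1,4,5)])
    have "X t = 3 * (2 * pi * real i / 3 + s * pi / 3 + 2 * pi * of_int n)" unfolding X_def n by simp
    also have "\<dots> = pi * (2 * of_int (int i + 3 * n) + s)" by (simp add: algebra_simps)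
    finally show ?thesis using h by blast
  qed
  have k: "\<kappa>2 j = - K0" using cov[of 0] by auto
  have sinX: "sin (X t) \<ge> 0" if t: "t \<in> {0..1}" for t
  proof -
    obtain i s n where x: "s \<in> {0..1}" "X t = pi * (2 * of_int (int i + 3 * n) + s)" using cov[OF t] by blast
    define q where "q = int i + 3 * n"
    have "sin (X t) = sin (pi * s + 2 * pi * of_int q)" unfolding x(2) q_def[symmetric] by (simp add: algebra_simps)
    also have "\<dots> = sin (pi * s)" unfolding sin_add by simp
    also have "\<dots> \<ge> 0" using x(1) by (intro sin_ge_zero) auto
    finally show ?thesis .
  qed
  have kl: "3 * (K0 * len2 j) > 0" using K0 l by simp
  have ab: "X 1 \<le> X 0" using kl by (simp add: X_def)
  have "sin y \<ge> 0" if y: "X 1 \<le> y" "y \<le> X 0" for y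
  proof -
    define t where "t = (X 0 - y) / (3 * (K0 * len2 j))"
    have "t \<in> {0..1}" using y kl unfolding t_def by (auto simp: X_def field_simps)
    moreover have "X t = y"
    proof -
      have "t * (3 * (K0 * len2 j)) = X 0 - y" unfolding t_def using K0 l by simp
      then show ?thesis unfolding X_def by (simp add: algebra_simps)
    qed
    ultimately show ?thesis using sinX by blast
  qed
  then obtain q :: int where q: "2 * pi * of_int q \<le> X 1" "X 0 \<le> 2 * pi * of_int q + pi"
    using sin_nonneg_interval[OF ab] by blast
  \<comment> \<open>The edge covering the midpoint identifies \<open>i\<close> and \<open>n\<close>
    for the half period \<open>q\<close>, since the half periods of different indices are
    disjoint.\<close>
  obtain i s n where h: "i < 3" "s \<in> {0..1}" "cB j - cA i \<in> lat u v" "X (1/2) = pi * (2 * of_int (int i + 3 * n) + s)"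
    using cov[of "1/2"] by auto
  have half: "X 1 < X (1/2)" "X (1/2) < X 0" using kl by (simp_all add: X_def)
  have "int i + 3 * n = q"
  proof -
    have "pi * (2 * of_int q) < pi * (2 * of_int (int i + 3 * n) + s)" using q half h(4) by (simp add: algebra_simps)
    then have 1: "2 * of_int q < 2 * of_int (int i + 3 * n) + s" by (rule pi_cancel)
    have "pi * (2 * of_int (int i + 3 * n) + s) < pi * (2 * of_int q + 1)" using q half h(4) by (simp add: algebra_simps)
    then have 2: "2 * of_int (int i + 3 * n) + s < 2 * of_int q + 1" by (rule pi_cancel)
    define z where "z = int i + 3 * n"
    have "2 * real_of_int q < 2 * real_of_int z + 1" "2 * real_of_int z < 2 * real_of_int q + 1"
      using 1 2 h(2) unfolding z_def[symmetric] by auto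
    then show ?thesis unfolding z_def[symmetric] by linarith
  qed
  then have qe: "2 * pi * of_int q = 2 * pi * real i + 6 * pi * of_int n" by (auto simp: algebra_simps)
  have "Q j i n" unfolding Q_def using h(1,3) k q unfolding qe X_def by auto
  then show ?thesis by blast
qed

text \<open>Gaps of \<open>pi / 3\<close> separate the closed sectors, so one common point already
  determines the sector.\<close>

lemma sector_unique:
  assumes Q: "Q j i n" and j: "j < 9" and t: "t \<in> {0..1}" and s: "s \<in> {0..1}" and i': "i' < 3"
    and eq: "A i' s + (cB j - cA i') = B j t"
  shows "i' = i"
proof -
  have k: "\<kappa>2 j = - K0" and i: "i < 3" using Q by (auto simp: Q_def)
  obtain n' where n': "\<theta>2 j - K0 * (t * len2 j) + pi = \<theta>1 0 + 2 * pi * real i' / 3 + s * pi / 3 + 2 * pi * of_int n'"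
    by (rule arc_angle[OF i' k eq])
  have tl: "0 \<le> K0 * (t * len2 j)" "K0 * (t * len2 j) \<le> K0 * len2 j"
    using t len2(1)[OF j] K0 by (auto intro!: mult_left_mono mult_left_le_one_le)
  define z z' where "z = int i + 3 * n" and "z' = int i' + 3 * n'"
  have e: "2 * pi * real i' / 3 + s * pi / 3 + 2 * pi * of_int n' = pi / 3 * (2 * of_int z' + s)"
    "2 * pi * real i / 3 + 2 * pi * of_int n = pi / 3 * (2 * of_int z)"
    by (simp_all add: z_def z'_def algebra_simps)
  have Y: "\<theta>2 j - K0 * (t * len2 j) + pi - \<theta>1 0 = pi / 3 * (2 * of_int z' + s)" using n' e(1) by linarith
  have q: "K0 * len2 j \<le> \<theta>2 j + pi - \<theta>1 0 - pi / 3 * (2 * of_int z)" "\<theta>2 j + pi - \<theta>1 0 - pi / 3 * (2 * of_int z) \<le> pi / 3"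
    using Q e(2) unfolding Q_def by linarith+
  have "pi / 3 * (2 * of_int z) \<le> pi / 3 * (2 * of_int z' + s)" using Y q tl by linarith
  moreover have "pi / 3 * (2 * of_int z' + s) \<le> pi / 3 * (2 * of_int z + 1)"
    unfolding distrib_left[of _ "2 * of_int z"] using Y q tl by linarith
  ultimately have "pi / 3 * (2 * of_int z) \<le> pi / 3 * (2 * of_int z' + s)" "pi / 3 * (2 * of_int z' + s) \<le> pi / 3 * (2 * of_int z + 1)" .
  then have "2 * of_int z \<le> 2 * of_int z' + s" "2 * of_int z' + s \<le> 2 * of_int z + 1"
    using pi_gt_zero by simp_all
  then have "z = z'" using s by auto
  then have "(int i) mod 3 = (int i') mod 3" unfolding z_def z'_def by presburger
  then show ?thesis using i i' by simp
qed

lemma JB_zero_unless: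
  assumes Q: "\<And>j. j < 9 \<Longrightarrow> \<kappa>2 j < 0 \<Longrightarrow> \<exists>n. Q j (\<sigma> j) n" and i: "i < 3" and j: "j < 9"
    and nz: "JB j g (A i ` {0..1}) (cA i) \<noteq> 0"
  shows "\<kappa>2 j < 0" "g = cA i - cB j" "\<sigma> j = i"
proof -
  let ?K = "A i ` {0..1}"
  have cK: "compact ?K" by (intro compact_continuous_image ccurve_continuous) auto
  have sK: "?K \<subseteq> sphere (cA i) (1 / \<bar>K0\<bar>)" using arc_in_sphere K0 by auto
  have c: "\<kappa>2 j < 0 \<and> cB j + g = cA i \<and> 1 / \<bar>\<kappa>2 j\<bar> = 1 / \<bar>K0\<bar>" and m: "measure lborel (hits (B j) g ?K) \<noteq> 0"
    using nz unfolding JB_cases[OF j cK sK] by (auto split: if_splits)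
  show k: "\<kappa>2 j < 0" using c by simp
  show g: "g = cA i - cB j" using c by (metis add_diff_cancel_left')
  have "hits (B j) g ?K \<noteq> {}" using m by auto
  then obtain t s where ts: "t \<in> {0..1}" "s \<in> {0..1}" "B j t + g = A i s" by (auto simp: hits_def)
  have "A i s + (cB j - cA i) = B j t" using ts(3) unfolding g by (simp add: algebra_simps)
  moreover obtain n where "Q j (\<sigma> j) n" using Q[OF j k] by blast
  ultimately show "\<sigma> j = i" using sector_unique[OF _ j ts(1,2) i] by blast
qed

text \<open>Tested on edge \<open>i\<close> itself, \<open>circle_balance\<close> contains a
  positive term \<open>len1 i / K0\<close>, so a concave edge with sector \<open>i\<close> must
  compensate it: \<open>\<sigma>\<close> is onto, and bijective since both sides have three
  elements. A single concave edge then pays for all of edge \<open>i\<close>, which forces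
  \<open>len1 i \<le> len2 j\<close>; the inequalities in \<open>Q\<close> give the converse and the
  matching end points.\<close>

theorem arcs_match:
  "\<exists>\<sigma>. bij_betw \<sigma> {j. j < 9 \<and> \<kappa>2 j < 0} {..<3} \<and> (\<forall>j. j < 9 \<and> \<kappa>2 j < 0 \<longrightarrow> \<kappa>2 j = - K0 \<and> len2 j = pi / 3 / K0 \<and>
      cis (\<theta>2 j) = - cis (\<theta>1 (\<sigma> j) + pi / 3) \<and> p2 j - A (\<sigma> j) 1 \<in> lat u v)"
proof -
  let ?J = "{j. j < 9 \<and> \<kappa>2 j < 0}"
  obtain \<sigma> where \<sigma>: "\<And>j. j < 9 \<Longrightarrow> \<kappa>2 j < 0 \<Longrightarrow> \<exists>n. Q j (\<sigma> j) n"
    using Q_exists by metis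
  have step: "\<exists>j\<in>?J. \<sigma> j = i" "\<And>j0. inj_on \<sigma> ?J \<Longrightarrow> j0 \<in> ?J \<Longrightarrow> \<sigma> j0 = i \<Longrightarrow> len1 i \<le> len2 j0" if i: "i < 3" for i
  proof -
    let ?K = "A i ` {0..1}" and ?m = "cA i"
    have cK: "compact ?K" by (intro compact_continuous_image ccurve_continuous) auto
    have sK: "?K \<subseteq> sphere (cA i) (1 / \<bar>K0\<bar>)" using arc_in_sphere K0 by auto
    have nK: "?K \<noteq> {}" by simp
    obtain M where M: "M \<ge> 0" "(\<Sum>g\<in>ball_lat M. (\<Sum>i<3. JA i g ?K ?m) + (\<Sum>j<9. JB j g ?K ?m)) = 0"
      using circle_balance[OF cK nK, of 0 ?m] by blast
    have z: "0 \<in> ball_lat M" using M(1) lat_group(1) by (simp add: ball_lat_def)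
    have J0: "JA i 0 ?K ?m = len1 i / K0"
    proof -
      have "hits (A i) 0 ?K = {0..1}" by (auto simp: hits_def)
      then show ?thesis using JA_cases[OF i cK sK, of 0] K0 by simp
    qed
    have "JA i 0 ?K ?m \<le> (\<Sum>i<3. JA i 0 ?K ?m)"
      using JA_nonneg[OF _ cK sK] i by (intro member_le_sum) auto
    also have "\<dots> \<le> (\<Sum>g\<in>ball_lat M. \<Sum>i<3. JA i g ?K ?m)"
    proof (rule member_le_sum[of 0 "ball_lat M" "\<lambda>g. \<Sum>i<3. JA i g ?K ?m", OF z _ finite_ball_lat])
      fix g
      show "0 \<le> (\<Sum>i<3. JA i g ?K ?m)" by (rule sum_nonneg) (rule JA_nonneg[OF _ cK sK], simp)
    qed
    finally have le: "(\<Sum>g\<in>ball_lat M. \<Sum>j<9. JB j g ?K ?m) \<le> - (len1 i / K0)"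
      using M(2) unfolding sum.distrib J0 by linarith
    have pos: "len1 i / K0 > 0" using len1'(1)[OF i] K0 by simp
    have "\<exists>g\<in>ball_lat M. \<exists>j<9. JB j g ?K ?m \<noteq> 0"
    proof (rule ccontr)
      assume "\<not> ?thesis"
      then have "(\<Sum>g\<in>ball_lat M. \<Sum>j<9. JB j g ?K ?m) = 0" by (intro sum.neutral ballI) auto
      then show False using le pos by simp
    qed
    then show "\<exists>j\<in>?J. \<sigma> j = i" using JB_zero_unless[of \<sigma>, OF \<sigma> i] by blast
    show "len1 i \<le> len2 j0" if inj: "inj_on \<sigma> ?J" and j0: "j0 \<in> ?J" "\<sigma> j0 = i" for j0
    proof -
      have j09: "j0 < 9" "\<kappa>2 j0 = - K0" using j0 \<sigma>[of j0] by (auto simp: Q_def)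
      have z1: "JB j g ?K ?m = 0" if "j < 9" "j \<noteq> j0" for j g
      proof (rule ccontr)
        assume "JB j g ?K ?m \<noteq> 0"
        from JB_zero_unless[of \<sigma>, OF \<sigma> i that(1) this] have "j \<in> ?J" "\<sigma> j = \<sigma> j0" using j0 that by auto
        then show False using inj j0 that(2) by (auto dest: inj_onD)
      qed
      have z2: "JB j0 g ?K ?m = 0" if "g \<noteq> cA i - cB j0" for g
        using JB_zero_unless(2)[of \<sigma>, OF \<sigma> i j09(1)] that by blast
      have lb: "JB j0 g ?K ?m \<ge> - (len2 j0 / K0)" for g
      proof -
        have l0: "len2 j0 / K0 \<ge> 0" using len2(1)[OF j09(1)] K0 by simp
        have "JB j0 g ?K ?m = 0 \<or> JB j0 g ?K ?m = len2 j0 / \<kappa>2 j0 * measure lborel (hits (B j0) g ?K)"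
          unfolding JB_cases[OF j09(1) cK sK] by auto
        moreover have "len2 j0 / \<kappa>2 j0 * measure lborel (hits (B j0) g ?K) \<ge> - (len2 j0 / K0)"
          using mult_left_mono[OF hits_measure(3)[OF ccurve_continuous cK, of "p2 j0" "\<theta>2 j0" "\<kappa>2 j0" "len2 j0" g] l0]
          unfolding j09(2) by simp
        ultimately show ?thesis using l0 by auto
      qed
      have "(\<Sum>g\<in>ball_lat M. \<Sum>j<9. JB j g ?K ?m) = (\<Sum>g\<in>ball_lat M. JB j0 g ?K ?m)"
      proof (rule sum.cong[OF refl])
        fix g
        have "(\<Sum>j<9. JB j g ?K ?m) = JB j0 g ?K ?m + (\<Sum>j\<in>{..<9} - {j0}. JB j g ?K ?m)"
          by (rule sum.remove) (use j09 in auto)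
        also have "(\<Sum>j\<in>{..<9} - {j0}. JB j g ?K ?m) = 0" using z1 by (intro sum.neutral ballI) auto
        finally show "(\<Sum>j<9. JB j g ?K ?m) = JB j0 g ?K ?m" by simp
      qed
      also have "\<dots> \<ge> - (len2 j0 / K0)"
      proof (cases "cA i - cB j0 \<in> ball_lat M")
        case True
        have "(\<Sum>g\<in>ball_lat M. JB j0 g ?K ?m) = JB j0 (cA i - cB j0) ?K ?m + (\<Sum>g\<in>ball_lat M - {cA i - cB j0}. JB j0 g ?K ?m)"
          by (rule sum.remove[OF finite_ball_lat True])
        also have "(\<Sum>g\<in>ball_lat M - {cA i - cB j0}. JB j0 g ?K ?m) = 0" using z2 by (intro sum.neutral ballI) auto
        finally show ?thesis using lb by simp
      next
        case False
        then have "(\<Sum>g\<in>ball_lat M. JB j0 g ?K ?m) = 0" using z2 by (intro sum.neutral ballI) metis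
        then show ?thesis using len2(1)[OF j09(1)] K0 by simp
      qed
      finally have "len1 i / K0 \<le> len2 j0 / K0" using le by linarith
      then show ?thesis using K0 by (simp add: divide_le_cancel)
    qed
  qed
  have sub: "\<sigma> ` ?J \<subseteq> {..<3}" using \<sigma> by (auto simp: Q_def)
  have im: "\<sigma> ` ?J = {..<3}" using sub step(1) by fastforce
  have inj: "inj_on \<sigma> ?J" by (rule eq_card_imp_inj_on) (use im card2 in auto)
  have bij: "bij_betw \<sigma> ?J {..<3}" using inj im by (simp add: bij_betw_def)
  have "\<kappa>2 j = - K0 \<and> len2 j = pi / 3 / K0 \<and> cis (\<theta>2 j) = - cis (\<theta>1 (\<sigma> j) + pi / 3) \<and> p2 j - A (\<sigma> j) 1 \<in> lat u v"
    if j: "j < 9 \<and> \<kappa>2 j < 0" for j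
  proof -
    obtain n where q: "Q j (\<sigma> j) n" using \<sigma> j by blast
    then have i: "\<sigma> j < 3" and k: "\<kappa>2 j = - K0" and g: "cB j - cA (\<sigma> j) \<in> lat u v" by (auto simp: Q_def)
    have "len1 (\<sigma> j) \<le> len2 j" by (rule step(2)[OF i inj]) (use j in auto)
    from mult_left_mono[OF this less_imp_le[OF K0]] have l1: "pi / 3 \<le> K0 * len2 j" unfolding len1'(3)[OF i] .
    \<comment> \<open>The two inequalities of \<open>Q\<close> have the lower limit
      \<open>K0 * len2 j\<close>, now at least \<open>pi / 3\<close>, and the upper limit
      \<open>pi / 3\<close>; all become equalities.\<close>
    have e: "K0 * len2 j = pi / 3" "\<theta>2 j + pi - \<theta>1 0 - 2 * pi * real (\<sigma> j) / 3 - 2 * pi * of_int n = pi / 3"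
      using q l1 unfolding Q_def by linarith+
    have len: "len2 j = pi / 3 / K0" using e(1) K0 by (simp add: field_simps)
    have "\<theta>2 j + pi = (\<theta>1 0 + 2 * pi * real (\<sigma> j) / 3 + pi / 3) + 2 * pi * of_int n" using e(2) by simp
    then have "cis (\<theta>2 j + pi) = cis (\<theta>1 0 + 2 * pi * real (\<sigma> j) / 3 + pi / 3)" unfolding cis_eq_cis_iff by blast
    then have "- cis (\<theta>2 j) = cis (\<theta>1 0 + 2 * pi * real (\<sigma> j) / 3) * cis (pi / 3)" by (simp add: cis_mult[symmetric])
    then have c: "- cis (\<theta>2 j) = cis (\<theta>1 (\<sigma> j) + pi / 3)" unfolding th1[OF i, symmetric] by (simp add: cis_mult)
    have "A (\<sigma> j) 1 = cA (\<sigma> j) + cis (\<theta>1 (\<sigma> j) + pi / 3) / (\<i> * of_real K0)"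
      using ccurve_ccen[of K0 "p1 (\<sigma> j)" "\<theta>1 (\<sigma> j)" "len1 (\<sigma> j)" 1] K0 len1'(3)[OF i] by simp
    moreover have "p2 j = cB j + cis (\<theta>2 j) / (\<i> * of_real (\<kappa>2 j))" by (simp add: ccen_def)
    moreover have "cis (\<theta>2 j) / (\<i> * of_real (\<kappa>2 j)) = cis (\<theta>1 (\<sigma> j) + pi / 3) / (\<i> * of_real K0)"
      unfolding k c[symmetric] by simp
    ultimately have "p2 j - A (\<sigma> j) 1 = cB j - cA (\<sigma> j)" by (metis add_diff_cancel_right)
    then show ?thesis using g k len c by (metis minus_minus)
  qed
  then show ?thesis using bij by blast
qed

end

subsection \<open>The Reuleaux triangle\<close>

abbreviation w6 :: complex where "w6 \<equiv> cis (pi / 3)"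

lemma w6_eq: "w6 = Complex (1/2) (sqrt 3 / 2)"
  by (simp add: complex_eq_iff cos_60 sin_60)

text \<open>Reduces every polynomial in \<open>w6\<close> to a linear one, so that identities
  between sixty degree figures become comparisons of coefficients.\<close>

lemma w6_sq: "w6 * w6 = w6 - 1"
  unfolding w6_eq by (simp add: complex_eq_iff)

lemma w6_cnj: "cnj w6 = 1 - w6" unfolding w6_eq by (simp add: complex_eq_iff)

lemma i_sqrt3: "\<i> * of_real (sqrt 3) = 2 * w6 - 1" unfolding w6_eq by (simp add: complex_eq_iff)

lemma w6_powers: "cis (2 * pi / 3) = w6 - 1" "cis (4 * pi / 3) = - w6" "w6 ^ 2 = w6 - 1" "w6 ^ 3 = - 1" "w6 ^ 4 = - w6" "w6 ^ 5 = 1 - w6" "w6 ^ 6 = 1"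
proof -
  show 2: "w6 ^ 2 = w6 - 1" by (simp only: power2_eq_square w6_sq)
  have "cis (2 * pi / 3) = w6 ^ 2" unfolding power2_eq_square cis_mult by (rule arg_cong[of _ _ cis]) simp
  then show "cis (2 * pi / 3) = w6 - 1" using 2 by simp
  have "w6 ^ 3 = w6 ^ 2 * w6" by (simp add: power3_eq_cube power2_eq_square)
  also have "\<dots> = - 1" unfolding 2 by (simp add: algebra_simps w6_sq)
  finally show 3: "w6 ^ 3 = - 1" .
  have "w6 ^ 4 = w6 ^ 3 * w6" using power_Suc2[of w6 3] by (simp only: Suc_numeral arith_simps)
  then show 4: "w6 ^ 4 = - w6" unfolding 3 by simp
  have "cis (4 * pi / 3) = cis (2 * pi / 3) * cis (2 * pi / 3)" unfolding cis_mult by (rule arg_cong[of _ _ cis]) simp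
  also have "\<dots> = w6 ^ 4" unfolding \<open>cis (2 * pi / 3) = w6 ^ 2\<close> by (simp add: power_add[symmetric])
  finally have "cis (4 * pi / 3) = w6 ^ 4" .
  then show "cis (4 * pi / 3) = - w6" using 4 by simp
  have "w6 ^ 5 = w6 ^ 4 * w6" using power_Suc2[of w6 4] by (simp only: Suc_numeral arith_simps)
  then show 5: "w6 ^ 5 = 1 - w6" unfolding 4 by (simp add: w6_sq)
  have "w6 ^ 6 = w6 ^ 5 * w6" using power_Suc2[of w6 5] by (simp only: Suc_numeral arith_simps)
  then show "w6 ^ 6 = 1" unfolding 5 by (simp add: algebra_simps w6_sq)
qed

lemma lint_add_const:
  assumes "continuous_on UNIV \<gamma>'"
    and d: "\<And>t. (\<gamma> has_vector_derivative \<gamma>' t) (at t)"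
    and eq: "\<And>t. Im (cnj (\<gamma> t) * \<gamma>' t) = Im (cnj m * \<gamma>' t) + e"
  shows "lint \<gamma> \<gamma>' (\<lambda>z. z) = Im (cnj m * (\<gamma> 1 - \<gamma> 0)) + e"
proof -
  have c: "continuous_on {0..1} \<gamma>'" using assms(1) continuous_on_subset by blast
  have i: "integrable lborel (\<lambda>t::real. indicator {0..1} t *\<^sub>R \<gamma>' t)" by (rule edge_integrable[OF c])
  have "(\<gamma>' has_integral (\<gamma> 1 - \<gamma> 0)) {0..1}"
    by (rule fundamental_theorem_of_calculus) (auto intro: has_vector_derivative_at_within d)
  moreover have "set_integrable lborel {0..1} \<gamma>'" using i by (simp add: set_integrable_def)
  ultimately have v: "integral\<^sup>L lborel (\<lambda>t::real. indicator {0..1} t *\<^sub>R \<gamma>' t) = \<gamma> 1 - \<gamma> 0"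
    using set_borel_integral_eq_integral(2)[of "{0..1}" \<gamma>'] by (simp add: set_lebesgue_integral_def integral_unique)
  have "lint \<gamma> \<gamma>' (\<lambda>z. z) = integral\<^sup>L lborel (\<lambda>t. Im (cnj m * (indicator {0..1} t *\<^sub>R \<gamma>' t)) + indicator {0..1} t * e)"
    unfolding lint_def eq by (intro Bochner_Integration.integral_cong refl) (simp add: algebra_simps indicator_def)
  also have "\<dots> = integral\<^sup>L lborel (\<lambda>t. Im (cnj m * (indicator {0..1} t *\<^sub>R \<gamma>' t))) + integral\<^sup>L lborel (\<lambda>t::real. indicator {0..1} t * e)"
    by (rule Bochner_Integration.integral_add[OF integrable_Im[OF integrable_mult_right[OF i]] integral_indicator_const(2)])
  also have "integral\<^sup>L lborel (\<lambda>t. Im (cnj m * (indicator {0..1} t *\<^sub>R \<gamma>' t))) = Im (cnj m * (\<gamma> 1 - \<gamma> 0))"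
    using integral_Im[OF integrable_mult_right[OF i, of "cnj m"]] v by (simp only: integral_mult_right_zero)
  finally show ?thesis by (simp only: integral_indicator_const)
qed

text \<open>The position is split into centre plus radius: the centre contributes through the chord
  only, and the radius gives the constant \<open>len / \<kappa>\<close>, twice the signed area of
  the circular sector.\<close>

lemma lint_arc:
  assumes k: "\<kappa> \<noteq> 0"
  shows "lint (ccurve p \<theta> \<kappa> len) (cdir \<theta> \<kappa> len) (\<lambda>z. z) = Im (cnj (ccen p \<theta> \<kappa>) * (ccurve p \<theta> \<kappa> len 1 - p)) + len / \<kappa>"
proof -
  have "Im (cnj (ccurve p \<theta> \<kappa> len t) * cdir \<theta> \<kappa> len t) = Im (cnj (ccen p \<theta> \<kappa>) * cdir \<theta> \<kappa> len t) + len / \<kappa>" for t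
  proof -
    let ?x = "cis (\<theta> + \<kappa> * (t * len))"
    have "cnj (?x / (\<i> * of_real \<kappa>)) = cnj ?x * (\<i> * of_real (1 / \<kappa>))" using k by (simp add: field_simps)
    then have "cnj (ccurve p \<theta> \<kappa> len t) * cdir \<theta> \<kappa> len t = cnj (ccen p \<theta> \<kappa>) * cdir \<theta> \<kappa> len t + (?x * cnj ?x) * (\<i> * of_real (len / \<kappa>))"
      unfolding ccurve_ccen[OF k] by (simp only: complex_cnj_add cdir_def) (simp add: algebra_simps)
    also have "?x * cnj ?x = 1" by (simp add: complex_norm_square[symmetric])
    finally show ?thesis by (simp only: plus_complex.sel mult_1_left) simp
  qed
  from lint_add_const[OF cdir_continuous ccurve_has_vector_derivative this]
  show ?thesis by (simp only: ccurve_0)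
qed

lemma lint_flat: "lint (ccurve p \<theta> 0 len) (cdir \<theta> 0 len) (\<lambda>z. z) = Im (cnj p * ccurve p \<theta> 0 len 1)"
proof -
  have "Im (cnj (ccurve p \<theta> 0 len t) * cdir \<theta> 0 len t) = Im (cnj p * cdir \<theta> 0 len t) + 0" for t
    by (simp add: ccurve_def cdir_def algebra_simps)
  from lint_add_const[OF cdir_continuous ccurve_has_vector_derivative this]
  show ?thesis unfolding ccurve_0 by (simp add: algebra_simps)
qed

lemma cpoly_perimeter:
  assumes n: "0 < n" and C: "curvilinear_polygon_120 n p \<theta> \<kappa> len E" and E: "E \<in> sets lebesgue"
  shows "perimeter E = ereal (\<Sum>i<n. len i)"
proof (rule antisym)
  have l: "\<And>i. i < n \<Longrightarrow> len i > 0" using C unfolding curvilinear_polygon_120_def Let_def by auto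
  note B = cpoly_has_boundary(1)[OF n C]
  show "perimeter E \<le> ereal (\<Sum>i<n. len i)"
    by (rule perimeter_le_length[OF B E]) (simp add: norm_cdir l)
  show "ereal (\<Sum>i<n. len i) \<le> perimeter E"
  proof (rule perimeter_ge_length[OF B E])
    show "norm (cdir (\<theta> i) (\<kappa> i) (len i) t) = len i" if "i \<in> {..<n}" for i t using l that by (simp add: norm_cdir)
    show "len i > 0" if "i \<in> {..<n}" for i using l that by simp
    show "i = j \<and> s = t" if "i \<in> {..<n}" "j \<in> {..<n}" "s \<in> {0<..<1}" "t \<in> {0<..<1}"
      "ccurve (p i) (\<theta> i) (\<kappa> i) (len i) s = ccurve (p j) (\<theta> j) (\<kappa> j) (len j) t" for i j s t
      by (rule cpoly_inj[OF n C _ _ _ _ that(5)]) (use that in auto)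
  qed
qed

lemma cpoly_bounded:
  assumes n: "0 < n" and C: "curvilinear_polygon_120 n p \<theta> \<kappa> len E"
  obtains R where "AE z in lebesgue. z \<in> E \<longrightarrow> norm z \<le> R"
proof -
  let ?G = "cpoly_path n p \<theta> \<kappa> len"
  have "path ?G" using C unfolding curvilinear_polygon_120_def Let_def by (auto simp: simple_path_imp_path)
  then have "bounded (inside (path_image ?G))" by (intro bounded_inside bounded_path_image)
  then obtain R where "\<And>z. z \<in> inside (path_image ?G) \<Longrightarrow> norm z \<le> R" unfolding bounded_iff by blast
  then show thesis using cpoly_has_boundary(2)[OF n C] by (intro that[of R]) (auto elim!: eventually_mono)
qed

text \<open>For the quotient \<open>x = b / a\<close> the equation \<open>norm (1 + x) = 1\<close>
  gives \<open>x + cnj x = -1\<close>, so \<open>x\<close> is a primitive cube root of unity, that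
  is \<open>w6 - 1\<close> or \<open>- w6\<close>.\<close>

lemma unit_sum_zero:
  fixes a b c :: complex
  assumes "norm a = 1" "norm b = 1" "norm c = 1" "a + b + c = 0"
  obtains x where "b = x * a" "c = x * b" "a = x * c" "x = w6 - 1 \<or> x = - w6"
proof -
  define x where "x = b / a"
  have a0: "a \<noteq> 0" "b \<noteq> 0" using assms by auto
  have nx: "norm x = 1" using assms by (simp add: x_def norm_divide)
  have "c = (a + b + c) - (a + b)" by simp
  then have cc: "c = - (a + b)" unfolding assms(4) by simp
  have "1 + x = - (c / a)" unfolding x_def cc using a0 by (simp add: field_simps)
  then have "norm (1 + x) = 1" using assms by (simp add: norm_divide)
  then have p: "(1 + x) * cnj (1 + x) = 1" by (simp only: complex_norm_square[symmetric]) simp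
  have xx: "x * cnj x = 1" using nx by (simp only: complex_norm_square[symmetric]) simp
  have "x + cnj x = (1 + x) * cnj (1 + x) - 1 - x * cnj x" by (simp add: algebra_simps)
  then have s: "x + cnj x = - 1" unfolding p xx by simp
  have "x * x + x + 1 = x * (x + cnj x) - x * cnj x + x + 1" by (simp add: algebra_simps)
  then have q: "x * x + x + 1 = 0" unfolding s xx by simp
  have "x * x = (x * x + x + 1) - 1 - x" by simp
  then have q2: "x * x = - 1 - x" unfolding q by simp
  have "(x - (w6 - 1)) * (x - (- w6)) = x * x + x - (w6 * w6 - w6)" by (simp add: algebra_simps)
  also have "\<dots> = 0" using q by (simp add: w6_sq)
  finally have "x = w6 - 1 \<or> x = - w6" by (auto simp: eq_neg_iff_add_eq_0)
  moreover have b: "b = x * a" using a0 by (simp add: x_def)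
  moreover have c: "c = x * b"
  proof -
    have "c = (- 1 - x) * a" using b cc by (simp add: algebra_simps)
    then show ?thesis unfolding b q2[symmetric] by simp
  qed
  moreover have "a = x * c"
  proof -
    have "x * c = (x * x) * (x * a)" unfolding c b by simp
    also have "\<dots> = (- 1 - x) * (x * a)" unfolding q2 ..
    also have "\<dots> = - x * a - (x * x) * a" by (simp add: algebra_simps)
    also have "\<dots> = a" unfolding q2 by (simp add: algebra_simps)
    finally show ?thesis by simp
  qed
  ultimately show thesis using that by blast
qed


lemma sum_lt3: "(\<Sum>i<3. f i) = f 0 + f 1 + f (2::nat)" for f :: "nat \<Rightarrow> 'a::comm_monoid_add"
  by (simp add: numeral_3_eq_3 numeral_2_eq_2 add.assoc)

text \<open>The centre parts of \<open>lint_arc\<close>, summed over three arcs: \<open>F\<close>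
  and \<open>Dd\<close> are final and initial tangents, \<open>m\<close> the centres, and
  \<open>q\<close> turns tangents into radii. Both values of the common ratio \<open>x\<close> are
  kept, because the sign of the curvature is derived from the area before \<open>x\<close> is
  known.\<close>

lemma reuleaux_signed_area:
  fixes p m F Dd :: "nat \<Rightarrow> complex" and x q :: complex
  assumes q: "q * cnj q = of_real k" and F: "norm (F 0) = 1" "F 1 = x * F 0" "F 2 = x * F 1" "F 0 = x * F 2"
    and Dd: "Dd 1 = w6 * F 0" "Dd 2 = w6 * F 1" "Dd 0 = w6 * F 2"
    and m: "m 1 = m 0 + q * (1 - w6) * F 0" "m 2 = m 1 + q * (1 - w6) * F 1"
    and x: "x = w6 - 1 \<or> x = - w6"
  shows "(\<Sum>i<3. Im (cnj (m i) * (q * (F i - Dd i)))) = (if x = w6 - 1 then - sqrt 3 * k else - 2 * sqrt 3 * k)"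
proof -
  have FF: "F 0 * cnj (F 0) = 1" using F(1) by (simp only: complex_norm_square[symmetric]) simp
  have F2: "F 2 = x * x * F 0" using F by simp
  have xs1: "x * x = - 1 - x"
    using x
  proof
    assume e: "x = w6 - 1" show ?thesis unfolding e by (simp add: algebra_simps w6_sq)
  next
    assume e: "x = - w6" show ?thesis unfolding e by (simp add: algebra_simps w6_sq)
  qed
  then have xs: "x * x = - 1 - x" "1 + x + x * x = 0" by simp_all
  have c0: "(F 0 - Dd 0) + (F 1 - Dd 1) + (F 2 - Dd 2) = 0"
  proof -
    have "F 0 + F 1 + F 2 = (1 + x + x * x) * F 0" unfolding F2 F(2) by (simp add: algebra_simps)
    then have "F 0 + F 1 + F 2 = 0" unfolding xs by simp
    moreover have "(F 0 - Dd 0) + (F 1 - Dd 1) + (F 2 - Dd 2) = (1 - w6) * (F 0 + F 1 + F 2)" unfolding Dd by (simp add: algebra_simps)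
    ultimately show ?thesis by simp
  qed
  have cw: "cnj (1 - w6) = w6" by (simp add: w6_cnj del: cis_cnj)
  have m2: "m 2 = m 0 + q * (1 - w6) * (F 0 + F 1)" unfolding m(2) m(1) by (simp add: algebra_simps)
  have alg1: "a * (r * A) + (a + y) * (r * B) + (a + Y) * (r * C) = a * r * (A + B + C) + y * (r * B) + Y * (r * C)"
    for a r A B C y Y :: complex by (simp add: algebra_simps)
  have alg2: "cnj (r * v * f) * (r * (y * f - w * f)) + cnj (r * v * (f + y * f)) * (r * (y * y * f - w * (y * f)))
      = (r * cnj r) * (f * cnj f) * cnj v * ((y - w) + cnj (1 + y) * (y * y - w * y))"
    for r v f y w :: complex by (simp add: algebra_simps)
  have "(\<Sum>i<3. cnj (m i) * (q * (F i - Dd i))) = cnj (m 0) * q * ((F 0 - Dd 0) + (F 1 - Dd 1) + (F 2 - Dd 2))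
     + cnj (q * (1 - w6) * F 0) * (q * (F 1 - Dd 1)) + cnj (q * (1 - w6) * (F 0 + F 1)) * (q * (F 2 - Dd 2))"
    unfolding sum_lt3 m2 m(1) complex_cnj_add[of "m 0"] by (rule alg1)
  also have "\<dots> = cnj (q * (1 - w6) * F 0) * (q * (x * F 0 - w6 * F 0)) + cnj (q * (1 - w6) * (F 0 + x * F 0)) * (q * (x * x * F 0 - w6 * (x * F 0)))"
    unfolding c0 mult_zero_right add_0 unfolding Dd F2 F(2) ..
  also have "\<dots> = (q * cnj q) * (F 0 * cnj (F 0)) * cnj (1 - w6) * ((x - w6) + cnj (1 + x) * (x * x - w6 * x))"
    by (rule alg2)
  also have "\<dots> = of_real k * (w6 * ((x - w6) + cnj (1 + x) * (x * x - w6 * x)))" unfolding q FF cw by simp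
  also have "w6 * ((x - w6) + cnj (1 + x) * (x * x - w6 * x)) = (if x = w6 - 1 then - (2 * w6 - 1) else - 2 * (2 * w6 - 1))"
    using x
  proof
    assume e: "x = w6 - 1"
    have "w6 * ((x - w6) + cnj (1 + x) * (x * x - w6 * x)) = w6 * (cnj w6 * (1 - w6) - 1)" unfolding e by (simp add: algebra_simps)
    also have "\<dots> = - (2 * w6 - 1)" unfolding w6_cnj by (simp add: algebra_simps w6_sq)
    finally show ?thesis using e by simp
  next
    assume e: "x = - w6"
    have ne: "- w6 \<noteq> w6 - 1" unfolding w6_eq by (simp add: complex_eq_iff)
    have cx: "cnj (1 + x) = w6" unfolding e by (simp add: w6_cnj del: cis_cnj)
    have "w6 * ((x - w6) + cnj (1 + x) * (x * x - w6 * x)) = w6 * (- 2 * w6 + w6 * (2 * (w6 * w6)))" unfolding cx unfolding e by (simp add: algebra_simps)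
    also have "\<dots> = - 2 * (2 * w6 - 1)" unfolding w6_sq by (simp add: algebra_simps w6_sq)
    finally show ?thesis using e ne by simp
  qed
  finally have "(\<Sum>i<3. cnj (m i) * (q * (F i - Dd i))) = of_real k * (if x = w6 - 1 then - (\<i> * of_real (sqrt 3)) else - 2 * (\<i> * of_real (sqrt 3)))"
    unfolding i_sqrt3 .
  then have "Im (\<Sum>i<3. cnj (m i) * (q * (F i - Dd i))) = (if x = w6 - 1 then - sqrt 3 * k else - 2 * sqrt 3 * k)" by simp
  then show ?thesis by (simp only: Im_sum)
qed


text \<open>The definition prescribes equal curvatures, but neither equal lengths nor convexity.
  Closing up makes the final tangents sum to zero, so they are spaced by 120 degrees and
  \<open>cis (K * len i)\<close> is the same for all edges. Negative curvature would make the area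
  negative; the remaining wrong ratio contradicts simplicity of the path.\<close>

theorem reuleaux_data:
  assumes C: "curvilinear_polygon_120 3 p \<theta> \<kappa> len E" and E: "E \<in> sets lebesgue"
    and kk: "\<forall>i<3. \<kappa> i \<noteq> 0 \<and> \<kappa> i = \<kappa> 0"
  shows "\<kappa> 0 > 0" "\<And>i. i < 3 \<Longrightarrow> \<kappa> 0 * len i = pi / 3"
    "\<And>i. i < 3 \<Longrightarrow> cis (\<theta> i) = cis (\<theta> 0 + 2 * pi * real i / 3)"
    "measure lebesgue E = (pi - sqrt 3) / (2 * (\<kappa> 0)\<^sup>2)"
    "p 1 = ccurve (p 0) (\<theta> 0) (\<kappa> 0) (len 0) 1" "p 2 = ccurve (p 1) (\<theta> 1) (\<kappa> 0) (len 1) 1" "p 0 = ccurve (p 2) (\<theta> 2) (\<kappa> 0) (len 2) 1"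
proof -
  define K where "K = \<kappa> 0"
  have K0: "K \<noteq> 0" using kk[THEN spec, of 0] unfolding K_def by simp
  have kK: "\<kappa> i = K" if "i < 3" for i using kk[THEN spec, of i] that unfolding K_def by blast
  have l: "len i > 0" "\<bar>K\<bar> * len i < 2 * pi" if "i < 3" for i
    using C that kK[OF that] unfolding curvilinear_polygon_120_def Let_def by auto
  have clos0: "ccurve (p i) (\<theta> i) K (len i) 1 = p (Suc i mod 3)" if "i < 3" for i
    using C that kK[OF that] unfolding curvilinear_polygon_120_def Let_def by auto
  have turn0: "cis (\<theta> (Suc i mod 3)) = cis (\<theta> i + K * len i + pi / 3)" if "i < 3" for i
    using C that kK[OF that] unfolding curvilinear_polygon_120_def Let_def by auto
  define F where "F i = cis (\<theta> i + K * len i)" for i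
  define Dd where "Dd i = cis (\<theta> i)" for i
  define q where "q = 1 / (\<i> * complex_of_real K)"
  define m where "m i = ccen (p i) (\<theta> i) K" for i
  have m_eq: "m i = p i - q * Dd i" for i by (simp add: m_def ccen_def q_def Dd_def)
  have q0: "q \<noteq> 0" using K0 by (simp add: q_def)
  have qq: "q * cnj q = of_real (1 / K\<^sup>2)"
    unfolding complex_norm_square[symmetric] by (simp add: q_def norm_divide norm_mult power_divide)
  have clos: "p (Suc i mod 3) = p i + q * (F i - Dd i)" if "i < 3" for i
    using clos0[OF that] K0 by (simp add: ccurve_def F_def Dd_def q_def)
  have turn: "Dd (Suc i mod 3) = w6 * F i" if "i < 3" for i
    using turn0[OF that] by (simp add: Dd_def F_def cis_mult[symmetric] mult_ac)
  have p1: "p 1 = p 0 + q * (F 0 - Dd 0)" and p2: "p 2 = p 1 + q * (F 1 - Dd 1)" and p0: "p 0 = p 2 + q * (F 2 - Dd 2)"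
    using clos[of 0] clos[of 1] clos[of 2] by (simp_all add: numeral_2_eq_2[symmetric])
  have D1: "Dd 1 = w6 * F 0" and D2: "Dd 2 = w6 * F 1" and D0: "Dd 0 = w6 * F 2"
    using turn[of 0] turn[of 1] turn[of 2] by (simp_all add: numeral_2_eq_2[symmetric])
  show "p 1 = ccurve (p 0) (\<theta> 0) (\<kappa> 0) (len 0) 1" "p 2 = ccurve (p 1) (\<theta> 1) (\<kappa> 0) (len 1) 1" "p 0 = ccurve (p 2) (\<theta> 2) (\<kappa> 0) (len 2) 1"
    using clos0[of 0] clos0[of 1] clos0[of 2] unfolding K_def by (simp_all add: numeral_2_eq_2[symmetric])
  have "q * ((F 0 - Dd 0) + (F 1 - Dd 1) + (F 2 - Dd 2)) = (p 1 - p 0) + (p 2 - p 1) + (p 0 - p 2)"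
    unfolding distrib_left using p0 p1 p2 by (metis add_diff_cancel_left')
  then have "q * ((1 - w6) * (F 0 + F 1 + F 2)) = 0" unfolding D0 D1 D2 by (simp add: algebra_simps)
  moreover have w1: "1 - w6 \<noteq> 0" unfolding w6_eq by (simp add: complex_eq_iff)
  ultimately have F0: "F 0 + F 1 + F 2 = 0" using q0 by simp
  have nF: "norm (F i) = 1" for i by (simp add: F_def)
  obtain x where x: "F 1 = x * F 0" "F 2 = x * F 1" "F 0 = x * F 2" "x = w6 - 1 \<or> x = - w6"
    by (rule unit_sum_zero[OF nF nF nF F0])
  have FD: "F i = Dd i * cis (K * len i)" for i by (simp add: F_def Dd_def cis_mult)
  have Fn: "F i \<noteq> 0" for i using nF[of i] by auto
  have xa: "w6 * cis (K * len i) = x" if "i < 3" for i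
  proof -
    have "w6 * cis (K * len 1) * F 0 = F 1" unfolding FD[of 1] D1 by (simp only: mult_ac)
    from trans[OF this x(1)] have 1: "w6 * cis (K * len 1) = x" using Fn[of 0] by (simp only: mult_cancel_right) simp
    have "w6 * cis (K * len 2) * F 1 = F 2" unfolding FD[of 2] D2 by (simp only: mult_ac)
    from trans[OF this x(2)] have 2: "w6 * cis (K * len 2) = x" using Fn[of 1] by (simp only: mult_cancel_right) simp
    have "w6 * cis (K * len 0) * F 2 = F 0" unfolding FD[of 0] D0 by (simp only: mult_ac)
    from trans[OF this x(3)] have 3: "w6 * cis (K * len 0) = x" using Fn[of 2] by (simp only: mult_cancel_right) simp
    have "i = 0 \<or> i = 1 \<or> i = 2" using that by auto
    then show ?thesis using 1 2 3 by blast
  qed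
  have m1: "m 1 = m 0 + q * (1 - w6) * F 0" "m 2 = m 1 + q * (1 - w6) * F 1"
    unfolding m_eq p2 p1 D1 D2 by (simp_all add: algebra_simps)
  obtain R where R: "AE z in lebesgue. z \<in> E \<longrightarrow> norm z \<le> R" by (rule cpoly_bounded[OF _ C]) simp
  have n3: "0 < (3::nat)" by simp
  have "measure lebesgue E = (\<Sum>i<3. lint (ccurve (p i) (\<theta> i) (\<kappa> i) (len i)) (cdir (\<theta> i) (\<kappa> i) (len i)) (\<lambda>z. z)) / 2"
    by (rule area_boundary(1)[OF cpoly_has_boundary(1)[OF n3 C] E R])
  also have "(\<Sum>i<3. lint (ccurve (p i) (\<theta> i) (\<kappa> i) (len i)) (cdir (\<theta> i) (\<kappa> i) (len i)) (\<lambda>z. z)) =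
     (\<Sum>i<3. Im (cnj (m i) * (q * (F i - Dd i))) + K * len i / K\<^sup>2)"
  proof (rule sum.cong[OF refl])
    fix i assume "i \<in> {..<3::nat}"
    then have i: "i < 3" by simp
    have "ccurve (p i) (\<theta> i) K (len i) 1 - p i = q * (F i - Dd i)" using clos0[OF i] clos[OF i] by simp
    moreover have "len i / K = K * len i / K\<^sup>2" using K0 by (simp add: power2_eq_square)
    ultimately show "lint (ccurve (p i) (\<theta> i) (\<kappa> i) (len i)) (cdir (\<theta> i) (\<kappa> i) (len i)) (\<lambda>z. z) = Im (cnj (m i) * (q * (F i - Dd i))) + K * len i / K\<^sup>2"
      unfolding kK[OF i] lint_arc[OF K0] m_def by (simp only:)
  qed
  also have "\<dots> = (\<Sum>i<3. Im (cnj (m i) * (q * (F i - Dd i)))) + (\<Sum>i<3. K * len i / K\<^sup>2)" by (rule sum.distrib)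
  also have "(\<Sum>i<3. Im (cnj (m i) * (q * (F i - Dd i)))) = (if x = w6 - 1 then - sqrt 3 * (1 / K\<^sup>2) else - 2 * sqrt 3 * (1 / K\<^sup>2))"
    by (rule reuleaux_signed_area[OF qq nF x(1,2,3) D1 D2 D0 m1 x(4)])
  finally have area: "measure lebesgue E = ((if x = w6 - 1 then - sqrt 3 * (1 / K\<^sup>2) else - 2 * sqrt 3 * (1 / K\<^sup>2)) + (\<Sum>i<3. K * len i / K\<^sup>2)) / 2" .
  have Kp: "K > 0"
  proof (rule ccontr)
    assume "\<not> K > 0"
    then have Kn: "K < 0" using K0 by simp
    have "(\<Sum>i<3. K * len i / K\<^sup>2) \<le> 0"
      by (rule sum_nonpos) (use Kn l(1) in \<open>auto intro!: divide_nonpos_nonneg mult_nonpos_nonneg simp: less_imp_le\<close>)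
    moreover have "- sqrt 3 * (1 / K\<^sup>2) < 0" using K0 by simp
    ultimately have "measure lebesgue E < 0" unfolding area by (auto simp: field_simps)
    then show False using measure_nonneg[of lebesgue E] by simp
  qed
  then show "\<kappa> 0 > 0" by (simp add: K_def)
  have al: "0 < K * len i" "K * len i < 2 * pi" if "i < 3" for i using l[OF that] Kp by auto
  have w0: "w6 \<noteq> 0" by simp
  have x1: "x = w6 - 1"
  proof (rule ccontr)
    assume "x \<noteq> w6 - 1"
    then have xm: "x = - w6" using x(4) by blast
    have api: "K * len i = pi" if i: "i < 3" for i
    proof -
      have "w6 * cis (K * len i) = w6 * (- 1)" using xa[OF i] xm by simp
      then have "cis (K * len i) = cis pi" using w0 by (simp only: mult_cancel_left cis_pi) simp
      then obtain n :: int where n: "K * len i = pi + 2 * pi * of_int n" unfolding cis_eq_cis_iff by blast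
      then have "pi * (- 1) < pi * (2 * of_int n)" "pi * (2 * of_int n) < pi * 1" using al[OF i] by (simp_all add: algebra_simps)
      then have "- 1 < 2 * real_of_int n" "2 * real_of_int n < 1" using pi_gt_zero by (simp_all only: mult_less_cancel_left_pos)
      then have "n = 0" by linarith
      then show ?thesis using n by simp
    qed
    \<comment> \<open>With the other ratio every edge is a semicircle, and consecutive ones cross,
      one third along the first and two thirds along the second.\<close>
    have "ccurve (p 0) (\<theta> 0) (\<kappa> 0) (len 0) (1/3) = ccurve (p 1) (\<theta> 1) (\<kappa> 1) (len 1) (2/3)"
    proof -
      have F0D: "F 0 = - Dd 0" using FD[of 0] api[of 0] by simp
      have e0: "ccurve (p 0) (\<theta> 0) K (len 0) (1/3) = m 0 + q * (w6 * Dd 0)"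
      proof -
        have "\<theta> 0 + K * (1/3 * len 0) = \<theta> 0 + pi / 3" using api[of 0] by simp
        then show ?thesis unfolding ccurve_ccen[OF K0] m_def q_def Dd_def by (simp add: cis_mult[symmetric] mult_ac)
      qed
      have e1: "ccurve (p 1) (\<theta> 1) K (len 1) (2/3) = m 1 + q * ((w6 - 1) * Dd 1)"
      proof -
        have ang: "\<theta> 1 + K * (2/3 * len 1) = \<theta> 1 + 2 * pi / 3" using api[of 1] by simp
        have ang2: "cis (\<theta> 1 + 2 * pi / 3) = cis (\<theta> 1) * (w6 - 1)" by (simp only: cis_mult[symmetric] w6_powers(1))
        show ?thesis unfolding ccurve_ccen[OF K0] ang ang2 m_def q_def Dd_def by (simp add: mult_ac)
      qed
      have "m 1 + q * ((w6 - 1) * Dd 1) = m 0 + q * (((1 - w6) + (w6 - 1) * w6) * F 0)" unfolding m1(1) D1 by (simp add: algebra_simps)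
      also have "(1 - w6) + (w6 - 1) * w6 = - w6" by (simp add: algebra_simps w6_sq)
      finally show ?thesis using e0 e1 kK[of 0] kK[of 1] by (simp add: F0D)
    qed
    then have "(0::nat) = 1 \<and> (1/3::real) = 2/3" by (intro cpoly_inj[OF n3 C]) auto
    then show False by simp
  qed
  show a3: "\<kappa> 0 * len i = pi / 3" if i: "i < 3" for i
  proof -
    have "w6 * cis (K * len i) = w6 * w6" using xa[OF i] x1 by (simp add: w6_sq)
    then have "cis (K * len i) = w6" using w0 by (simp only: mult_cancel_left) simp
    then obtain n :: int where n: "K * len i = pi / 3 + 2 * pi * of_int n" unfolding cis_eq_cis_iff by blast
    then have "pi * (- 1 / 3) < pi * (2 * of_int n)" "pi * (2 * of_int n) < pi * (5/3)" using al[OF i] by linarith+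
    then have "- 1 / 3 < 2 * real_of_int n" "2 * real_of_int n < 5 / 3" using pi_gt_zero by (simp_all only: mult_less_cancel_left_pos)
    then have "n = 0" by linarith
    then show ?thesis using n by (simp add: K_def)
  qed
  have KL: "K * len i = pi / 3" if "i < 3" for i using a3[OF that] by (simp add: K_def)
  have t1: "cis (\<theta> 1) = cis (\<theta> 0 + 2 * pi / 3)"
    using turn0[of 0] KL[of 0] by (simp add: add.assoc)
  have t2: "cis (\<theta> 2) = cis (\<theta> 0 + 4 * pi / 3)"
  proof -
    have k1: "\<theta> 1 + K * len 1 + pi / 3 = \<theta> 1 + 2 * pi / 3" using KL[of 1] by simp
    have "cis (\<theta> 2) = cis (\<theta> 1 + K * len 1 + pi / 3)" using turn0[of 1] by (simp add: numeral_2_eq_2[symmetric])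
    then have "cis (\<theta> 2) = cis (\<theta> 1) * cis (2 * pi / 3)" unfolding k1 cis_mult .
    then have "cis (\<theta> 2) = cis (\<theta> 0 + 2 * pi / 3 + 2 * pi / 3)" unfolding t1 cis_mult .
    then show ?thesis by (simp add: add.assoc)
  qed
  show "cis (\<theta> i) = cis (\<theta> 0 + 2 * pi * real i / 3)" if "i < 3" for i
  proof -
    have "i = 0 \<or> i = 1 \<or> i = 2" using that by auto
    then show ?thesis using t1 t2 by auto
  qed
  have "(\<Sum>i<3. K * len i / K\<^sup>2) = pi / K\<^sup>2" 
  proof -
    have k: "K * len 0 = pi / 3" "K * len 1 = pi / 3" "K * len 2 = pi / 3" by (simp_all add: KL)
    show ?thesis unfolding sum_lt3 k by (simp add: add_divide_distrib[symmetric])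
  qed
  then show "measure lebesgue E = (pi - sqrt 3) / (2 * (\<kappa> 0)\<^sup>2)"
    unfolding area using x1 K0 by (simp add: K_def[symmetric] field_simps)
qed

subsection \<open>The shape of the enneagon\<close>

lemma card3_sorted:
  fixes J :: "nat set"
  assumes "card J = 3"
  obtains a b c where "J = {a, b, c}" "a < b" "b < c"
proof -
  have fin: "finite J" using assms card.infinite by fastforce
  define l where "l = sorted_list_of_set J"
  have l: "length l = 3" "sorted_wrt (<) l" "set l = J" using assms fin by (simp_all add: l_def)
  obtain a b c where abc: "l = [a, b, c]" using l(1) by (auto simp: numeral_3_eq_3 length_Suc_conv)
  show thesis by (rule that[of a b c]) (use l abc in auto)
qed

text \<open>A flat edge changes the direction by the factor \<open>w6\<close>; along a concave edge
  the turning by \<open>- pi / 3\<close> offsets the vertex. Equal cubes make the number of flat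
  edges between concave ones even, distinct directions exclude 0 and 6, and with six flat edges only
  the pattern 2, 2, 2 is left.\<close>

lemma enneagon_positions:
  fixes Dd :: "nat \<Rightarrow> complex"
  assumes J: "card J = 3" "J \<subseteq> {..<9}"
    and st: "\<And>i. i < 9 \<Longrightarrow> Dd (Suc i mod 9) = (if i \<in> J then Dd i else w6 * Dd i)"
    and nz: "\<And>i. Dd i \<noteq> 0" and cube: "\<And>i j. i \<in> J \<Longrightarrow> j \<in> J \<Longrightarrow> Dd i ^ 3 = Dd j ^ 3" and inj: "inj_on Dd J"
  obtains a where "a < 3" "J = {a, a + 3, a + 6}"
proof -
  obtain a b c where abc: "J = {a, b, c}" "a < b" "b < c" by (rule card3_sorted[OF J(1)])
  have c9: "c < 9" using J(2) abc by auto
  have step: "Dd (i + 1 + n) = w6 ^ n * Dd i" if "i \<in> J" "i + 1 + n < 9" "\<And>k. k < n \<Longrightarrow> i + 1 + k \<notin> J" for i n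
    using that
  proof (induction n)
    case 0 then show ?case using st[of i] by simp
  next
    case (Suc n)
    have "Dd (i + 1 + n) = w6 ^ n * Dd i" using Suc by simp
    moreover have "i + 1 + n \<notin> J" using Suc(4)[of n] by simp
    moreover have "Suc (i + 1 + n) mod 9 = i + 1 + Suc n" using Suc(3) by simp
    ultimately show ?case using st[of "i + 1 + n"] Suc(3) by simp
  qed
  have par: "even n" if "i \<in> J" "j \<in> J" "Dd j = w6 ^ n * Dd i" for i j n
  proof -
    have "Dd i ^ 3 = (w6 ^ n) ^ 3 * Dd i ^ 3" using cube[OF that(1,2)] unfolding that(3) power_mult_distrib .
    then have "(w6 ^ n) ^ 3 = 1" using nz[of i] by simp
    moreover have "(w6 ^ n) ^ 3 = (- 1) ^ n" unfolding w6_powers(4)[symmetric] by (simp only: power_mult[symmetric] mult.commute)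
    ultimately have e: "(- 1 :: complex) ^ n = 1" by simp
    show "even n"
    proof (rule ccontr)
      assume "odd n" then have "(- 1 :: complex) ^ n = - 1" by simp
      then show False using e by simp
    qed
  qed
  have ne: "n \<noteq> 0 \<and> n \<noteq> 6" if "i \<in> J" "j \<in> J" "i \<noteq> j" "Dd j = w6 ^ n * Dd i" for i j n
  proof -
    have "Dd i \<noteq> Dd j" using inj that(1-3) by (auto dest: inj_onD)
    moreover have "n \<noteq> 0" using \<open>Dd i \<noteq> Dd j\<close> that(4) by (metis mult_1 power_0)
    moreover have "n \<noteq> 6" using \<open>Dd i \<noteq> Dd j\<close> that(4) by (metis mult_1 w6_powers(7))
    ultimately show ?thesis by blast
  qed
  define g1 g2 where "g1 = b - a - 1" and "g2 = c - b - 1"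
  have ba: "b = a + 1 + g1" and cb: "c = b + 1 + g2" using abc by (auto simp: g1_def g2_def)
  have mem: "a \<in> J" "b \<in> J" "c \<in> J" using abc by auto
  have Db: "Dd b = w6 ^ g1 * Dd a"
    unfolding ba by (rule step[OF mem(1)]) (use abc c9 ba cb in auto)
  have Dc: "Dd c = w6 ^ g2 * Dd b"
    unfolding cb by (rule step[OF mem(2)]) (use abc c9 ba cb in auto)
  have Dca: "Dd c = w6 ^ (g1 + g2) * Dd a" unfolding Dc Db by (simp only: power_add mult_ac)
  have "even g1" "even g2" using par mem Db Dc by blast+
  moreover have "g1 \<noteq> 0 \<and> g1 \<noteq> 6" "g2 \<noteq> 0 \<and> g2 \<noteq> 6" "g1 + g2 \<noteq> 0 \<and> g1 + g2 \<noteq> 6"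
    by (rule ne[OF mem(1,2) _ Db], use abc in simp) (rule ne[OF mem(2,3) _ Dc], use abc in simp, rule ne[OF mem(1,3) _ Dca], use abc in simp)
  moreover have "g1 + g2 \<le> 6" using ba cb c9 by simp
  ultimately have "g1 = 2 \<and> g2 = 2" by presburger
  then have "b = a + 3" "c = a + 6" using ba cb by auto
  then have "a < 3" "J = {a, a + 3, a + 6}" using abc c9 by auto
  then show thesis by (rule that)
qed

text \<open>Eisenstein coordinates: multiplication by \<open>w6\<close> has integer coefficients in
  them, and points agree exactly if their coordinates do.\<close>

definition Zc :: "real \<Rightarrow> real \<Rightarrow> complex" where "Zc x y = of_real x + of_real y * w6"

lemma Zc_simps:
  "Zc x y + Zc x' y' = Zc (x + x') (y + y')" "Zc x y - Zc x' y' = Zc (x - x') (y - y')"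
  "Zc x y * w6 = Zc (- y) (x + y)" "of_real r * Zc x y = Zc (r * x) (r * y)" "1 = Zc 1 0" "w6 = Zc 0 1" "- Zc x y = Zc (- x) (- y)"
  by (simp_all add: Zc_def algebra_simps w6_sq)

lemma Im_Zc: "Im (cnj (Zc x y) * Zc x' y') = (x * y' - y * x') * (sqrt 3 / 2)"
  unfolding Zc_def w6_eq by (simp add: algebra_simps)

lemma Im_shift:
  assumes "norm Dd = 1"
  shows "Im (cnj (a + Dd * x) * (a + Dd * y)) = Im (cnj x * y) + Im (cnj a * (Dd * (y - x)))"
proof -
  have DD: "Dd * cnj Dd = 1" using assms by (simp only: complex_norm_square[symmetric]) simp
  have e: "cnj (a + Dd * x) * (a + Dd * y) = cnj a * a + cnj a * (Dd * y) + cnj (cnj a * (Dd * x)) + (Dd * cnj Dd) * (cnj x * y)"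
    by (simp add: algebra_simps)
  show ?thesis unfolding e DD by (simp add: algebra_simps)
qed

lemma ccurve_flat_eq: "ccurve p \<theta> 0 len = seg p (ccurve p \<theta> 0 len 1)" "cdir \<theta> 0 len = (\<lambda>_. ccurve p \<theta> 0 len 1 - p)"
  by (auto simp: fun_eq_iff ccurve_def seg_def cdir_def)

lemma sum_lt9: "(\<Sum>i<9. f i) = f 0 + f 1 + f 2 + f 3 + f 4 + f 5 + f 6 + f 7 + f (8::nat)" for f :: "nat \<Rightarrow> 'a::comm_monoid_add"
proof -
  have "{..<9::nat} = {0,1,2,3,4,5,6,7,8}" by auto
  then show ?thesis by (simp add: add.assoc)
qed

lemma sum_rotate9:
  fixes f :: "nat \<Rightarrow> 'a::comm_monoid_add"
  assumes "j < 9"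
  shows "(\<Sum>i<9. f i) = (\<Sum>k<9. f ((j + k) mod 9))"
proof -
  have inj: "inj_on (\<lambda>k. (j + k) mod 9) {..<9}"
    by (rule inj_onI) (use assms in \<open>auto simp: mod_if split: if_splits\<close>)
  have "(\<lambda>k. (j + k) mod 9) ` {..<9} = {..<9}"
    by (rule card_subset_eq) (auto simp: card_image[OF inj])
  then show ?thesis using sum.reindex[OF inj, of f] by simp
qed

locale enneagon_tiling = arc_tiling +
  assumes clos1: "p1 1 = A 0 1" "p1 2 = A 1 1" "p1 0 = A 2 1"
    and clos2: "j < 9 \<Longrightarrow> B j 1 = p2 (Suc j mod 9)"
    and turn2: "j < 9 \<Longrightarrow> cis (\<theta>2 (Suc j mod 9)) = cis (\<theta>2 j + \<kappa>2 j * len2 j + pi / 3)"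
    and area1: "measure lebesgue (E 1) = (pi - sqrt 3) / (2 * K0\<^sup>2)"
begin

text \<open>The circumradius of the equilateral triangle on the vertices, whose side equals the
  radius \<open>1 / K0\<close> of the arcs.\<close>

definition "tt = 1 / (sqrt 3 * K0)"
definition "cR = p1 0 + of_real tt * cis (\<theta>1 0) * w6"
text \<open>The direction from the centre \<open>cR\<close> to the vertex \<open>p1 0\<close>. By
  \<open>matched_direction\<close> it is also the initial direction of the concave edge matched with
  edge 0.\<close>

definition "D0 = - w6 * cis (\<theta>1 0)"

lemma tt_pos: "tt > 0" using K0 by (simp add: tt_def)

text \<open>Through \<open>i * sqrt 3 = 2 * w6 - 1\<close> the radii of the arcs acquire Eisenstein
  coordinates.\<close>

lemma inv_iK0: "1 / (\<i> * of_real K0) = of_real tt * (1 - 2 * w6)"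
proof -
  have s3: "of_real (sqrt 3) * of_real (sqrt 3) = (3::complex)" by (metis of_real_mult of_real_numeral real_sqrt_mult_self abs_numeral)
  have "of_real tt * (1 - 2 * w6) * (\<i> * of_real K0) = - (of_real tt * of_real K0) * (\<i> * (\<i> * of_real (sqrt 3)))"
    unfolding i_sqrt3 by (simp add: algebra_simps)
  also have "\<dots> = of_real (tt * K0 * sqrt 3)" by (simp add: algebra_simps)
  also have "tt * K0 * sqrt 3 = 1" using K0 by (simp add: tt_def)
  finally show ?thesis using K0 by (simp add: divide_eq_eq)
qed

lemma th1_powers: "cis (\<theta>1 1) = (w6 - 1) * cis (\<theta>1 0)" "cis (\<theta>1 2) = - w6 * cis (\<theta>1 0)"
  using th1[of 1] th1[of 2] w6_powers(1,2) by (simp_all add: cis_mult[symmetric] mult.commute)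

lemma A_end: "i < 3 \<Longrightarrow> A i 1 = p1 i + of_real tt * (2 - w6) * w6 * cis (\<theta>1 i)"
proof -
  assume i: "i < 3"
  have "A i 1 = p1 i + (cis (\<theta>1 i) * w6 - cis (\<theta>1 i)) * (1 / (\<i> * of_real K0))"
  proof -
    have ang: "cis (\<theta>1 i + K0 * (1 * len1 i)) = cis (\<theta>1 i) * w6"
    proof -
      have "\<theta>1 i + K0 * (1 * len1 i) = \<theta>1 i + pi / 3" using len1'(3)[OF i] by simp
      then show ?thesis by (simp only: cis_mult)
    qed
    show ?thesis unfolding ccurve_def ang using K0 by simp
  qed
  also have "\<dots> = p1 i + of_real tt * cis (\<theta>1 i) * ((w6 - 1) * (1 - 2 * w6))" unfolding inv_iK0 by (simp add: algebra_simps)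
  also have "(w6 - 1) * (1 - 2 * w6) = (2 - w6) * w6" by (simp add: algebra_simps w6_sq)
  finally show ?thesis by (simp add: mult_ac)
qed

lemma cR_eq: "p1 0 = cR + of_real tt * D0" "p1 1 = cR + of_real tt * D0 * w6\<^sup>2" "p1 2 = cR + of_real tt * D0 * w6 ^ 4"
proof -
  show 0: "p1 0 = cR + of_real tt * D0" by (simp add: cR_def D0_def)
  have "p1 1 = p1 0 + of_real tt * (2 - w6) * w6 * cis (\<theta>1 0)" using clos1(1) A_end[of 0] by simp
  also have "\<dots> = cR + of_real tt * cis (\<theta>1 0) * ((2 - w6) * w6 - w6)" unfolding 0 D0_def by (simp add: algebra_simps)
  also have "(2 - w6) * w6 - w6 = - w6 * w6\<^sup>2" by (simp add: algebra_simps power2_eq_square w6_sq)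
  finally show 1: "p1 1 = cR + of_real tt * D0 * w6\<^sup>2" by (simp add: D0_def mult_ac)
  have "p1 2 = p1 1 + of_real tt * (2 - w6) * w6 * ((w6 - 1) * cis (\<theta>1 0))" using clos1(2) A_end[of 1] th1_powers(1) by simp
  also have "\<dots> = cR + of_real tt * cis (\<theta>1 0) * ((2 - w6) * w6 * (w6 - 1) - w6 * w6\<^sup>2)" unfolding 1 D0_def by (simp add: algebra_simps)
  also have "(2 - w6) * w6 * (w6 - 1) - w6 * w6\<^sup>2 = - w6 * w6 ^ 4" unfolding w6_powers by (simp add: algebra_simps w6_sq)
  finally show "p1 2 = cR + of_real tt * D0 * w6 ^ 4" by (simp add: D0_def mult_ac)
qed

lemma norm_D0: "norm D0 = 1" by (simp add: D0_def norm_mult)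

text \<open>Equal length, opposite curvature and opposite tangent at the matched end leave one
  possibility: the reversed edge, moved by \<open>p2 j - A i 1\<close>.\<close>

lemma B_reverse:
  assumes k: "\<kappa>2 j = - K0" "len2 j = pi / 3 / K0" and i: "i < 3" and c: "cis (\<theta>2 j) = - cis (\<theta>1 i + pi / 3)"
  shows "B j s = A i (1 - s) + (p2 j - A i 1)" "cdir (\<theta>2 j) (\<kappa>2 j) (len2 j) s = - cdir (\<theta>1 i) K0 (len1 i) (1 - s)"
proof -
  have K: "K0 \<noteq> 0" "- K0 \<noteq> 0" using K0 by auto
  have e2: "cis (\<theta>2 j + - K0 * (s * (pi / 3 / K0))) = - cis (\<theta>1 i + pi / 3 - s * pi / 3)"
  proof -
    have "\<theta>2 j + - K0 * (s * (pi / 3 / K0)) = \<theta>2 j + - (s * pi / 3)" using K by simp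
    then have "cis (\<theta>2 j + - K0 * (s * (pi / 3 / K0))) = - cis (\<theta>1 i + pi / 3) * cis (- (s * pi / 3))"
      by (simp only: cis_mult[symmetric] c)
    then show ?thesis by (simp add: cis_mult)
  qed
  have e1: "\<theta>1 i + K0 * ((1 - s) * len1 i) = \<theta>1 i + pi / 3 - s * pi / 3"
    using K unfolding len1[OF i] by (simp add: field_simps)
  have e0: "\<theta>1 i + K0 * (1 * len1 i) = \<theta>1 i + pi / 3" using len1'(3)[OF i] by simp
  have b: "B j s = p2 j + (- cis (\<theta>1 i + pi / 3 - s * pi / 3) - - cis (\<theta>1 i + pi / 3)) / (\<i> * of_real (- K0))"
    unfolding k ccurve_def e2 c using K by simp
  show "B j s = A i (1 - s) + (p2 j - A i 1)"
    unfolding b ccurve_ccen[OF K(1)] e1 e0 by (simp add: diff_divide_distrib)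
  show "cdir (\<theta>2 j) (\<kappa>2 j) (len2 j) s = - cdir (\<theta>1 i) K0 (len1 i) (1 - s)"
    unfolding cdir_def e1 unfolding k e2 len1[OF i] by simp
qed

lemma wk_B_reverse:
  assumes k: "\<kappa>2 j = - K0" "len2 j = pi / 3 / K0" and i: "i < 3" and c: "cis (\<theta>2 j) = - cis (\<theta>1 i + pi / 3)"
  shows "wk (B j) (cdir (\<theta>2 j) (\<kappa>2 j) (len2 j)) z = - wk (A i) (cdir (\<theta>1 i) K0 (len1 i)) (z - (p2 j - A i 1))"
proof -
  have "B j = (\<lambda>s. A i (1 - s) + (p2 j - A i 1))" "cdir (\<theta>2 j) (\<kappa>2 j) (len2 j) = (\<lambda>s. - cdir (\<theta>1 i) K0 (len1 i) (1 - s))"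
    using B_reverse[OF assms] by blast+
  then show ?thesis
    by (simp only: wk_translate[of "\<lambda>s. A i (1 - s)"] wk_reverse[of "A i" "cdir (\<theta>1 i) K0 (len1 i)"])
qed

text \<open>The constant is minus twice the area of the circular segment between an arc of angle
  \<open>pi / 3\<close> and its chord, negative because the edge is concave.\<close>

lemma lint_B_reverse:
  assumes k: "\<kappa>2 j = - K0" "len2 j = pi / 3 / K0"
  shows "lint (B j) (cdir (\<theta>2 j) (\<kappa>2 j) (len2 j)) (\<lambda>z. z) = Im (cnj (p2 j) * B j 1) + (sqrt 3 / 2 - pi / 3) / K0\<^sup>2"
    "B j 1 = p2 j + of_real tt * (2 - w6) * cis (\<theta>2 j)"
proof -
  have K: "K0 \<noteq> 0" "- K0 \<noteq> 0" using K0 by auto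
  define Y where "Y = cis (\<theta>2 j) * (1 / (\<i> * of_real K0))"
  have cen: "ccen (p2 j) (\<theta>2 j) (- K0) = p2 j + Y" by (simp add: ccen_def Y_def)
  have e: "cis (\<theta>2 j + - K0 * (1 * (pi / 3 / K0))) = cis (\<theta>2 j) * (1 - w6)"
  proof -
    have "\<theta>2 j + - K0 * (1 * (pi / 3 / K0)) = \<theta>2 j + - (pi / 3)" using K by simp
    then show ?thesis by (simp only: cis_mult[symmetric] cis_cnj[symmetric] w6_cnj)
  qed
  have B1: "B j 1 - p2 j = Y * w6"
    unfolding k ccurve_def e Y_def using K by (simp add: algebra_simps diff_divide_distrib)
  have YY: "Y * cnj Y = of_real (1 / K0\<^sup>2)"
    unfolding complex_norm_square[symmetric] Y_def by (simp add: norm_mult norm_divide power_divide)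
  have "cnj (p2 j + Y) * (Y * w6) = cnj (p2 j) * (Y * w6) + (Y * cnj Y) * w6" by (simp add: algebra_simps)
  then have "Im (cnj (p2 j + Y) * (Y * w6)) = Im (cnj (p2 j) * (Y * w6)) + (sqrt 3 / 2) / K0\<^sup>2"
    unfolding YY by (simp only: plus_complex.sel Im_complex_of_real times_complex.sel) (simp add: sin_60)
  moreover have "Im (cnj (p2 j) * (Y * w6)) = Im (cnj (p2 j) * B j 1)"
  proof -
    have "cnj (p2 j) * B j 1 = cnj (p2 j) * (Y * w6) + cnj (p2 j) * p2 j" unfolding B1[symmetric] by (simp add: algebra_simps)
    then show ?thesis by simp
  qed
  ultimately have I: "Im (cnj (p2 j + Y) * (Y * w6)) = Im (cnj (p2 j) * B j 1) + (sqrt 3 / 2) / K0\<^sup>2" by (simp only:)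
  have l: "len2 j / (- K0) = - (pi / 3) / K0\<^sup>2" unfolding k(2) by (simp add: power2_eq_square)
  have "lint (B j) (cdir (\<theta>2 j) (\<kappa>2 j) (len2 j)) (\<lambda>z. z) = Im (cnj (p2 j + Y) * (Y * w6)) + - (pi / 3) / K0\<^sup>2"
    using lint_arc[OF K(2), of "p2 j" "\<theta>2 j" "len2 j"] unfolding cen l unfolding k(1)[symmetric] B1 .
  then show "lint (B j) (cdir (\<theta>2 j) (\<kappa>2 j) (len2 j)) (\<lambda>z. z) = Im (cnj (p2 j) * B j 1) + (sqrt 3 / 2 - pi / 3) / K0\<^sup>2"
    unfolding I by (simp add: diff_divide_distrib)
  have "B j 1 = p2 j + Y * w6" using B1 by (simp add: algebra_simps)
  also have "Y * w6 = of_real tt * cis (\<theta>2 j) * ((1 - 2 * w6) * w6)" unfolding Y_def inv_iK0 by (simp add: mult_ac)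
  also have "(1 - 2 * w6) * w6 = 2 - w6" by (simp add: algebra_simps w6_sq)
  finally show "B j 1 = p2 j + of_real tt * (2 - w6) * cis (\<theta>2 j)" by (simp add: mult_ac)
qed

end

lemma Zc_eq_iff: "Zc x y = Zc x' y' \<longleftrightarrow> x = x' \<and> y = y'"
proof
  assume e: "Zc x y = Zc x' y'"
  then have "Im (Zc x y) = Im (Zc x' y')" "Re (Zc x y) = Re (Zc x' y')" by simp_all
  then show "x = x' \<and> y = y'" unfolding Zc_def w6_eq by simp
qed simp

lemma w6_Zc: "w6\<^sup>2 = Zc (- 1) 1" "w6 ^ 3 = Zc (- 1) 0" "w6 ^ 4 = Zc 0 (- 1)" "w6 ^ 5 = Zc 1 (- 1)"
  unfolding w6_powers Zc_def by simp_all

context enneagon_tiling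
begin

lemma matched_direction:
  assumes "i < 3" "cis (\<theta>2 j) = - cis (\<theta>1 i + pi / 3)"
  shows "cis (\<theta>2 j) = w6 ^ (2 * i) * D0"
proof -
  have e: "cis (\<theta>2 j) = - w6 * cis (\<theta>1 i)" unfolding assms(2) by (simp add: cis_mult add.commute)
  have "i = 0 \<or> i = 1 \<or> i = 2" using assms(1) by auto
  then show ?thesis
  proof (elim disjE)
    assume i: "i = 0" then show ?thesis using e by (simp add: D0_def)
  next
    assume i: "i = 1"
    have "cis (\<theta>2 j) = w6\<^sup>2 * D0" using e unfolding i th1_powers D0_def w6_powers by (simp only: mult_ac minus_mult_left minus_mult_right)
    then show ?thesis using i by simp
  next
    assume i: "i = 2"
    have "cis (\<theta>2 j) = w6 ^ 4 * D0" using e unfolding i th1_powers D0_def w6_powers by simp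
    then show ?thesis using i by simp
  qed
qed

lemma w6_even_inj: "i < 3 \<Longrightarrow> j < 3 \<Longrightarrow> w6 ^ (2 * i) * D0 = w6 ^ (2 * j) * D0 \<Longrightarrow> i = j"
proof -
  assume ij: "i < 3" "j < 3" and "w6 ^ (2 * i) * D0 = w6 ^ (2 * j) * D0"
  then have e: "w6 ^ (2 * i) = w6 ^ (2 * j)" using norm_D0 by auto
  have z: "w6 ^ 0 = Zc 1 0" by (simp add: Zc_def)
  have "i = 0 \<or> i = 1 \<or> i = 2" "j = 0 \<or> j = 1 \<or> j = 2" using ij by auto
  moreover have "(2::nat) * 0 = 0" "(2::nat) * 1 = 2" "(2::nat) * 2 = 4" by simp_all
  ultimately show "i = j" using e by (elim disjE) (simp_all only: z w6_Zc Zc_eq_iff, simp_all)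
qed

text \<open>Cyclic renumbering that starts at the concave edge matched with edge 0 of
  \<open>E 1\<close>; the directions then force positions 0, 3, 6 to be matched with edges 0, 1, 2
  in this order. The sum rule is listed for two types because an obtained fact is not
  polymorphic.\<close>

lemma enneagon_frame:
  obtains e :: "nat \<Rightarrow> nat" where "\<And>k. e k < 9" "\<And>k. Suc (e k) mod 9 = e (Suc k)" "e 9 = e 0"
    "\<And>f :: nat \<Rightarrow> real. (\<Sum>j<9. f j) = (\<Sum>k<9. f (e k))" "\<And>f :: nat \<Rightarrow> complex. (\<Sum>j<9. f j) = (\<Sum>k<9. f (e k))"
    "\<And>k. k mod 3 \<noteq> 0 \<Longrightarrow> \<kappa>2 (e k) = 0"
    "\<And>i. i < 3 \<Longrightarrow> \<kappa>2 (e (3 * i)) = - K0 \<and> len2 (e (3 * i)) = pi / 3 / K0 \<and> cis (\<theta>2 (e (3 * i))) = - cis (\<theta>1 i + pi / 3) \<and> p2 (e (3 * i)) - A i 1 \<in> lat u v"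
    "cis (\<theta>2 (e 0)) = D0" "cis (\<theta>2 (e 1)) = D0" "cis (\<theta>2 (e 2)) = w6 * D0" "cis (\<theta>2 (e 3)) = w6\<^sup>2 * D0" "cis (\<theta>2 (e 4)) = w6\<^sup>2 * D0"
    "cis (\<theta>2 (e 5)) = w6 ^ 3 * D0" "cis (\<theta>2 (e 6)) = w6 ^ 4 * D0" "cis (\<theta>2 (e 7)) = w6 ^ 4 * D0" "cis (\<theta>2 (e 8)) = w6 ^ 5 * D0"
proof -
  let ?J = "{j. j < 9 \<and> \<kappa>2 j < 0}"
  obtain \<sigma> where match: "bij_betw \<sigma> ?J {..<3} \<and> (\<forall>j. j < 9 \<and> \<kappa>2 j < 0 \<longrightarrow> \<kappa>2 j = - K0 \<and> len2 j = pi / 3 / K0 \<and>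
      cis (\<theta>2 j) = - cis (\<theta>1 (\<sigma> j) + pi / 3) \<and> p2 j - A (\<sigma> j) 1 \<in> lat u v)"
    using arcs_match by (rule exE)
  note bij = conjunct1[OF match]
  have \<sigma>: "\<kappa>2 j = - K0 \<and> len2 j = pi / 3 / K0 \<and> cis (\<theta>2 j) = - cis (\<theta>1 (\<sigma> j) + pi / 3) \<and> p2 j - A (\<sigma> j) 1 \<in> lat u v"
    if "j \<in> ?J" for j using conjunct2[OF match] that by blast
  have s3: "\<sigma> j < 3" if "j \<in> ?J" for j using bij_betwE[OF bij] that by auto
  have dir: "cis (\<theta>2 j) = w6 ^ (2 * \<sigma> j) * D0" if "j \<in> ?J" for j
    by (rule matched_direction[OF s3[OF that]]) (use \<sigma>[OF that] in blast)
  have flat: "\<kappa>2 j = 0" if "j < 9" "j \<notin> ?J" for j using k2[OF that(1)] that by auto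
  have st: "cis (\<theta>2 (Suc j mod 9)) = (if j \<in> ?J then cis (\<theta>2 j) else w6 * cis (\<theta>2 j))" if j: "j < 9" for j
  proof (cases "j \<in> ?J")
    case True
    have "\<kappa>2 j * len2 j = - (pi / 3)" using \<sigma>[OF True] K0 by simp
    then have "cis (\<theta>2 (Suc j mod 9)) = cis (\<theta>2 j)" using turn2[OF j] by simp
    then show ?thesis using True by simp
  next
    case False
    have "cis (\<theta>2 (Suc j mod 9)) = w6 * cis (\<theta>2 j)" using turn2[OF j] flat[OF j False] by (simp add: cis_mult add.commute)
    then show ?thesis using False by (simp only: if_False)
  qed
  have cube: "cis (\<theta>2 i) ^ 3 = D0 ^ 3" if "i \<in> ?J" for i
  proof -
    have "(w6 ^ (2 * \<sigma> i)) ^ 3 = (w6 ^ 6) ^ \<sigma> i" unfolding power_mult[symmetric] by (rule arg_cong[of _ _ "power w6"]) simp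
    then have "(w6 ^ (2 * \<sigma> i)) ^ 3 = 1" unfolding w6_powers by simp
    then show ?thesis unfolding dir[OF that] power_mult_distrib by simp
  qed
  have inj: "inj_on (\<lambda>j. cis (\<theta>2 j)) ?J"
  proof (rule inj_onI)
    fix i j assume ij: "i \<in> ?J" "j \<in> ?J" "cis (\<theta>2 i) = cis (\<theta>2 j)"
    have "\<sigma> i = \<sigma> j" by (rule w6_even_inj[OF s3[OF ij(1)] s3[OF ij(2)]]) (use ij(3) in \<open>simp only: dir[OF ij(1)] dir[OF ij(2)]\<close>)
    then show "i = j" using bij ij(1,2) by (auto simp: bij_betw_def dest: inj_onD)
  qed
  have nzc: "\<And>i. cis (\<theta>2 i) \<noteq> 0" by simp
  have Js: "?J \<subseteq> {..<9}" by auto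
  have cube2: "\<And>i j. i \<in> ?J \<Longrightarrow> j \<in> ?J \<Longrightarrow> cis (\<theta>2 i) ^ 3 = cis (\<theta>2 j) ^ 3" using cube by metis
  obtain a where a: "a < 3" "?J = {a, a + 3, a + 6}"
    by (rule enneagon_positions[OF card2 Js st nzc cube2 inj]) blast+
  have J: "j \<in> ?J \<longleftrightarrow> j mod 3 = a" if "j < 9" for j
  proof -
    have "j = a \<or> j = a + 3 \<or> j = a + 6 \<longleftrightarrow> j mod 3 = a" using that a(1) by presburger
    then show ?thesis unfolding a(2) by simp
  qed
  have "0 \<in> \<sigma> ` ?J" unfolding bij_betw_imp_surj_on[OF bij] by simp
  then obtain j0 where j0': "0 = \<sigma> j0" "j0 \<in> ?J" by (rule imageE)
  note j0 = j0'(2) j0'(1)[symmetric]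
  define e where "e k = (j0 + k) mod 9" for k
  have j9: "j0 < 9" using j0 by auto
  have e9: "e k < 9" for k by (simp add: e_def)
  have eS: "Suc (e k) mod 9 = e (Suc k)" for k by (simp add: e_def mod_Suc_eq)
  have e90: "e 9 = e 0" by (simp add: e_def)
  have eJ: "e k \<in> ?J \<longleftrightarrow> k mod 3 = 0" for k
  proof -
    have "e k mod 3 = (j0 + k) mod 3" unfolding e_def by (rule mod_mod_cancel) simp
    moreover have "j0 mod 3 = a" using J[OF j9] j0 by simp
    ultimately show ?thesis using J[OF e9[of k]] a(1) by presburger
  qed
  have d: "cis (\<theta>2 (e (Suc k))) = (if k mod 3 = 0 then cis (\<theta>2 (e k)) else w6 * cis (\<theta>2 (e k)))" for k
    using st[OF e9[of k]] unfolding eJ eS .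
  have e0: "e 0 = j0" using j9 by (simp add: e_def)
  have d0: "cis (\<theta>2 (e 0)) = D0" using dir[OF j0(1)] j0(2) e0 by simp
  have nS: "Suc 0 = 1" "Suc 1 = 2" "Suc 2 = 3" "Suc 3 = 4" "Suc 4 = 5" "Suc 5 = 6" "Suc 6 = 7" "Suc 7 = 8" by simp_all
  have dS: "k mod 3 \<noteq> 0 \<Longrightarrow> cis (\<theta>2 (e (Suc k))) = w6 * cis (\<theta>2 (e k))" and dE: "k mod 3 = 0 \<Longrightarrow> cis (\<theta>2 (e (Suc k))) = cis (\<theta>2 (e k))" for k
    using d[of k] by (simp_all only: if_True if_False simp_thms)
  have pS: "w6 * w6 = w6\<^sup>2" "w6 * w6\<^sup>2 = w6 ^ 3" "w6 * w6 ^ 3 = w6 ^ 4" "w6 * w6 ^ 4 = w6 ^ 5"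
    by (rule power2_eq_square[symmetric]) (simp_all only: power_Suc[symmetric] nS)
  have d1: "cis (\<theta>2 (e 1)) = D0" using dE[of 0] unfolding nS d0 mult.assoc[symmetric] pS by simp
  have d2: "cis (\<theta>2 (e 2)) = w6 * D0" using dS[of 1] unfolding nS d1 mult.assoc[symmetric] pS by simp
  have d3: "cis (\<theta>2 (e 3)) = w6\<^sup>2 * D0" using dS[of 2] unfolding nS d2 mult.assoc[symmetric] pS by simp
  have d4: "cis (\<theta>2 (e 4)) = w6\<^sup>2 * D0" using dE[of 3] unfolding nS d3 mult.assoc[symmetric] pS by simp
  have d5: "cis (\<theta>2 (e 5)) = w6 ^ 3 * D0" using dS[of 4] unfolding nS d4 mult.assoc[symmetric] pS by simp
  have d6: "cis (\<theta>2 (e 6)) = w6 ^ 4 * D0" using dS[of 5] unfolding nS d5 mult.assoc[symmetric] pS by simp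
  have d7: "cis (\<theta>2 (e 7)) = w6 ^ 4 * D0" using dE[of 6] unfolding nS d6 mult.assoc[symmetric] pS by simp
  have d8: "cis (\<theta>2 (e 8)) = w6 ^ 5 * D0" using dS[of 7] unfolding nS d7 mult.assoc[symmetric] pS by simp
  have sg: "\<sigma> (e (3 * i)) = i" if "i < 3" for i
  proof -
    have m: "e (3 * i) \<in> ?J" using eJ by simp
    have "i = 0 \<or> i = 1 \<or> i = 2" using that by auto
    then have "cis (\<theta>2 (e (3 * i))) = w6 ^ (2 * i) * D0" using d0 d3 d6 by auto
    then show ?thesis using w6_even_inj[OF s3[OF m] that] dir[OF m] by simp
  qed
  show thesis
  proof (rule that[of e, OF e9 eS e90 _ _ _ _ d0 d1 d2 d3 d4 d5 d6 d7 d8])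
    show "(\<Sum>j<9. f j) = (\<Sum>k<9. f (e k))" for f :: "nat \<Rightarrow> real" unfolding e_def by (rule sum_rotate9[OF j9])
    show "(\<Sum>j<9. f j) = (\<Sum>k<9. f (e k))" for f :: "nat \<Rightarrow> complex" unfolding e_def by (rule sum_rotate9[OF j9])
    show "\<kappa>2 (e k) = 0" if "k mod 3 \<noteq> 0" for k by (rule flat[OF e9]) (use that in \<open>simp only: eJ not_False_eq_True\<close>)
    show "\<kappa>2 (e (3 * i)) = - K0 \<and> len2 (e (3 * i)) = pi / 3 / K0 \<and> cis (\<theta>2 (e (3 * i))) = - cis (\<theta>1 i + pi / 3) \<and> p2 (e (3 * i)) - A i 1 \<in> lat u v"
      if "i < 3" for i using \<sigma>[of "e (3 * i)"] eJ[of "3 * i"] sg[OF that] by simp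
  qed
qed

text \<open>\<open>Kc\<close> is where the flat edges next to the first concave edge meet after
  prolongation, and each \<open>L\<close> is a flat length plus \<open>tt\<close>. In the basis
  \<open>D0\<close>, \<open>w6 * D0\<close> the hexagon has corners (0, 0), (L0, 0), (L0, L1), (L0 -
  L2, L1 + L2), (-L5, L1 + L2), (-L5, L5). The three pieces cut off by the arcs have together the
  area of \<open>E 1\<close>, so the hexagon has the total area of both tiles.\<close>

theorem enneagon_shape:
  obtains Kc L0 L1 L2 L3 L4 L5 where
    "L0 > tt" "L1 > tt" "L2 > tt" "L3 > tt" "L4 > tt" "L5 > tt" "L0 + L5 = L2 + L3" "L1 + L2 = L4 + L5"
    "Kc - cR \<in> lat u v" "Kc + D0 * Zc L0 L1 - cR \<in> lat u v" "Kc + D0 * Zc (- L5) (L1 + L2) - cR \<in> lat u v"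
    "measure lebesgue (E 1) + measure lebesgue (E 2) = sqrt 3 / 4 * (L0*L1 + L0*L2 + L1*L2 + L3*(L1+L2) + L4*L5)"
    "(\<Sum>j<9. len2 j) = pi / K0 + (L0 + L1 + L2 + L3 + L4 + L5) - 6 * tt"
    "AE z in lebesgue. 2 * of_real pi * \<i> * indicator (E 2) z =
       wseg (Kc + D0 * Zc tt 0) (Kc + D0 * Zc L0 0) z + wseg (Kc + D0 * Zc L0 0) (Kc + D0 * Zc L0 (L1 - tt)) z
     + wseg (Kc + D0 * Zc (L0 - tt) (L1 + tt)) (Kc + D0 * Zc (L0 - L2) (L1 + L2)) z + wseg (Kc + D0 * Zc (L0 - L2) (L1 + L2)) (Kc + D0 * Zc (- L5 + tt) (L1 + L2)) z
     + wseg (Kc + D0 * Zc (- L5) (L1 + L2 - tt)) (Kc + D0 * Zc (- L5) L5) z + wseg (Kc + D0 * Zc (- L5) L5) (Kc + D0 * Zc (- tt) tt) z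
     - wk (A 0) (cdir (\<theta>1 0) K0 (len1 0)) (z - (Kc - cR)) - wk (A 1) (cdir (\<theta>1 1) K0 (len1 1)) (z - (Kc + D0 * Zc L0 L1 - cR))
     - wk (A 2) (cdir (\<theta>1 2) K0 (len1 2)) (z - (Kc + D0 * Zc (- L5) (L1 + L2) - cR))"
proof (rule enneagon_frame)
  fix e :: "nat \<Rightarrow> nat" assume e9: "\<And>k. e k < 9" and eS: "\<And>k. Suc (e k) mod 9 = e (Suc k)" and e90: "e 9 = e 0"
    and sr: "\<And>f :: nat \<Rightarrow> real. (\<Sum>j<9. f j) = (\<Sum>k<9. f (e k))" and sc: "\<And>f :: nat \<Rightarrow> complex. (\<Sum>j<9. f j) = (\<Sum>k<9. f (e k))"
    and fl: "\<And>k. k mod 3 \<noteq> 0 \<Longrightarrow> \<kappa>2 (e k) = 0"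
    and ar: "\<And>i. i < 3 \<Longrightarrow> \<kappa>2 (e (3 * i)) = - K0 \<and> len2 (e (3 * i)) = pi / 3 / K0 \<and> cis (\<theta>2 (e (3 * i))) = - cis (\<theta>1 i + pi / 3) \<and> p2 (e (3 * i)) - A i 1 \<in> lat u v"
    and d: "cis (\<theta>2 (e 0)) = D0" "cis (\<theta>2 (e 1)) = D0" "cis (\<theta>2 (e 2)) = w6 * D0" "cis (\<theta>2 (e 3)) = w6\<^sup>2 * D0" "cis (\<theta>2 (e 4)) = w6\<^sup>2 * D0"
    "cis (\<theta>2 (e 5)) = w6 ^ 3 * D0" "cis (\<theta>2 (e 6)) = w6 ^ 4 * D0" "cis (\<theta>2 (e 7)) = w6 ^ 4 * D0" "cis (\<theta>2 (e 8)) = w6 ^ 5 * D0"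
  define q where "q k = p2 (e k)" for k
  define Kc where "Kc = q 1 - of_real tt * D0"
  define L0 L1 L2 L3 L4 L5 where L: "L0 = len2 (e 1) + tt" "L1 = len2 (e 2) + tt" "L2 = len2 (e 4) + tt"
    "L3 = len2 (e 5) + tt" "L4 = len2 (e 7) + tt" "L5 = len2 (e 8) + tt"
  have qS: "B (e k) 1 = q (Suc k)" for k unfolding q_def clos2[OF e9] eS by simp
  have q9: "q 9 = q 0" unfolding q_def e90 by simp
  have arc: "\<kappa>2 (e 0) = - K0" "\<kappa>2 (e 3) = - K0" "\<kappa>2 (e 6) = - K0" "len2 (e 0) = pi / 3 / K0" "len2 (e 3) = pi / 3 / K0" "len2 (e 6) = pi / 3 / K0"
    "cis (\<theta>2 (e 0)) = - cis (\<theta>1 0 + pi / 3)" "cis (\<theta>2 (e 3)) = - cis (\<theta>1 1 + pi / 3)" "cis (\<theta>2 (e 6)) = - cis (\<theta>1 2 + pi / 3)"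
    "q 0 - A 0 1 \<in> lat u v" "q 3 - A 1 1 \<in> lat u v" "q 6 - A 2 1 \<in> lat u v"
    using ar[of 0] ar[of 1] ar[of 2] by (simp_all add: q_def)
  have flt: "\<kappa>2 (e 1) = 0" "\<kappa>2 (e 2) = 0" "\<kappa>2 (e 4) = 0" "\<kappa>2 (e 5) = 0" "\<kappa>2 (e 7) = 0" "\<kappa>2 (e 8) = 0"
    by (rule fl, simp)+
  have af: "q (Suc k) = q k + of_real (len2 (e k)) * cis (\<theta>2 (e k))" if "\<kappa>2 (e k) = 0" for k
    using qS[of k] unfolding that ccurve_def q_def by simp
  have aa: "q (Suc k) = q k + of_real tt * Zc 2 (- 1) * cis (\<theta>2 (e k))" if "\<kappa>2 (e k) = - K0" "len2 (e k) = pi / 3 / K0" for k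
    using lint_B_reverse(2)[OF that] unfolding qS by (simp add: q_def Zc_def)
  have nS: "Suc 0 = 1" "Suc 1 = 2" "Suc 2 = 3" "Suc 3 = 4" "Suc 4 = 5" "Suc 5 = 6" "Suc 6 = 7" "Suc 7 = 8" "Suc 8 = 9" by simp_all
  have mul: "Zc x y * Zc x' y' = Zc (x * x' - y * y') (x * y' + y * x' + y * y')" for x y x' y'
  proof -
    have "Zc x y * Zc x' y' = of_real (x * x') + of_real (x * y' + y * x') * w6 + of_real (y * y') * (w6 * w6)" by (simp add: Zc_def algebra_simps)
    then show ?thesis unfolding w6_sq by (simp add: Zc_def algebra_simps)
  qed
  have w1: "w6 = Zc 0 1" by (simp add: Zc_def)
  have ad: "Kc + D0 * Zc x y + r * (w * D0) = Kc + D0 * (Zc x y + r * w)" for x y r w by (simp add: algebra_simps)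
  have q1: "q 1 = Kc + D0 * Zc tt 0" by (simp add: Kc_def Zc_def)
  have q2: "q 2 = Kc + D0 * Zc L0 0"
    using af[OF flt(1)] unfolding nS d q1 L by (simp add: Zc_def algebra_simps)
  have q3: "q 3 = Kc + D0 * Zc L0 (L1 - tt)"
    using af[OF flt(2)] unfolding nS d q2 ad w1 Zc_simps(1,4) by (simp add: L)
  have q4: "q 4 = Kc + D0 * Zc (L0 - tt) (L1 + tt)"
    using aa[OF arc(2,5)] unfolding nS d q3 ad w6_Zc Zc_simps(1,4) mul by (simp add: algebra_simps)
  have q5: "q 5 = Kc + D0 * Zc (L0 - L2) (L1 + L2)"
    using af[OF flt(3)] unfolding nS d q4 ad w6_Zc Zc_simps(1,4) by (simp add: L algebra_simps)
  have q6': "q 6 = Kc + D0 * Zc (L0 - L2 - L3 + tt) (L1 + L2)"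
    using af[OF flt(4)] unfolding nS d q5 ad w6_Zc Zc_simps(1,4) by (simp add: L algebra_simps)
  have q7': "q 7 = Kc + D0 * Zc (L0 - L2 - L3) (L1 + L2 - tt)"
    using aa[OF arc(3,6)] unfolding nS d q6' ad w6_Zc Zc_simps(1,4) mul by (simp add: algebra_simps)
  have q8': "q 8 = Kc + D0 * Zc (L0 - L2 - L3) (L1 + L2 - L4)"
    using af[OF flt(5)] unfolding nS d q7' ad w6_Zc Zc_simps(1,4) by (simp add: L algebra_simps)
  have q9': "q 9 = Kc + D0 * Zc (L0 - L2 - L3 + L5 - tt) (L1 + L2 - L4 - L5 + tt)"
    using af[OF flt(6)] unfolding nS d q8' ad w6_Zc Zc_simps(1,4) by (simp add: L algebra_simps)
  \<comment> \<open>Computed backwards from \<open>q 1\<close> through the first arc; comparison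
    with \<open>q 9\<close>, reached by going around, yields the two closing relations.\<close>
  have q0: "q 0 = Kc + D0 * Zc (- tt) tt"
  proof -
    have "q 0 = q 1 - of_real tt * Zc 2 (- 1) * D0" using aa[OF arc(1,4)] unfolding nS d by simp
    also have "\<dots> = Kc + D0 * (Zc tt 0 - of_real tt * Zc 2 (- 1))" unfolding q1 by (simp add: algebra_simps)
    finally show ?thesis unfolding Zc_simps(2,4) by simp
  qed
  have D0nz: "D0 \<noteq> 0" using norm_D0 by auto
  have "Zc (L0 - L2 - L3 + L5 - tt) (L1 + L2 - L4 - L5 + tt) = Zc (- tt) tt" using q9 D0nz unfolding q9' q0 by simp
  then have cl: "L0 + L5 = L2 + L3" "L1 + L2 = L4 + L5" unfolding Zc_eq_iff by auto
  have s1: "L0 - L2 - L3 = - L5" "L1 + L2 - L4 = L5" using cl by auto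
  have q6: "q 6 = Kc + D0 * Zc (- L5 + tt) (L1 + L2)" and q7: "q 7 = Kc + D0 * Zc (- L5) (L1 + L2 - tt)" and q8: "q 8 = Kc + D0 * Zc (- L5) L5"
    unfolding q6' q7' q8' s1 by (rule refl)+
  have q9'': "q 9 = Kc + D0 * Zc (- tt) tt" unfolding q9 q0 ..
  have sh: "q 0 - A 0 1 = Kc - cR" "q 3 - A 1 1 = Kc + D0 * Zc L0 L1 - cR" "q 6 - A 2 1 = Kc + D0 * Zc (- L5) (L1 + L2) - cR"
    unfolding clos1[symmetric] unfolding cR_eq q0 q3 q6 w6_Zc by (simp_all add: Zc_def algebra_simps)
  have tpos: "len2 (e k) > 0" for k by (rule len2(1)[OF e9])
  have K3: "1 / K0\<^sup>2 = 3 * tt\<^sup>2" using K0 by (simp add: tt_def power_divide power_mult_distrib)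
  have area: "measure lebesgue (E 1) + measure lebesgue (E 2) = sqrt 3 / 4 * (L0*L1 + L0*L2 + L1*L2 + L3*(L1+L2) + L4*L5)"
  proof -
    let ?l = "\<lambda>j. lint (B j) (cdir (\<theta>2 j) (\<kappa>2 j) (len2 j)) (\<lambda>z. z)"
    let ?c = "(sqrt 3 / 2 - pi / 3) / K0\<^sup>2"
    have la: "?l (e k) = Im (cnj (q k) * q (Suc k)) + ?c" if "\<kappa>2 (e k) = - K0" "len2 (e k) = pi / 3 / K0" for k
      using lint_B_reverse(1)[OF that] unfolding qS unfolding q_def .
    have lf: "?l (e k) = Im (cnj (q k) * q (Suc k))" if "\<kappa>2 (e k) = 0" for k
    proof -
      have b: "ccurve (p2 (e k)) (\<theta>2 (e k)) 0 (len2 (e k)) 1 = q (Suc k)" using qS[of k] unfolding that .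
      show ?thesis using lint_flat[of "p2 (e k)" "\<theta>2 (e k)" "len2 (e k)"] unfolding b unfolding that q_def .
    qed
    let ?z = "\<lambda>x y x' y'. (x * y' - y * x') * (sqrt 3 / 2)"
    have I: "Im (cnj (Kc + D0 * Zc x y) * (Kc + D0 * Zc x' y')) = ?z x y x' y' + (Im (cnj Kc * (D0 * Zc x' y')) - Im (cnj Kc * (D0 * Zc x y)))" for x y x' y'
      unfolding Im_shift[OF norm_D0] Im_Zc by (simp add: algebra_simps)
    \<comment> \<open>The terms that depend on \<open>Kc\<close> telescope around the polygon, so
      the area is computed as if \<open>Kc\<close> were the origin.\<close>
    have tele: "(a1 + (n1 - n0) + c) + (a2 + (n2 - n1)) + (a3 + (n3 - n2)) + (a4 + (n4 - n3) + c) + (a5 + (n5 - n4)) + (a6 + (n6 - n5))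
        + (a7 + (n7 - n6) + c) + (a8 + (n8 - n7)) + (a9 + (n0 - n8)) = a1 + a2 + a3 + a4 + a5 + a6 + a7 + a8 + a9 + 3 * c"
      for a1 a2 a3 a4 a5 a6 a7 a8 a9 n0 n1 n2 n3 n4 n5 n6 n7 n8 c :: real by simp
    have "(\<Sum>j<9. ?l j) = (\<Sum>k<9. ?l (e k))" by (rule sr)
    also have "\<dots> = ?z (- tt) tt tt 0 + ?z tt 0 L0 0 + ?z L0 0 L0 (L1 - tt) + ?z L0 (L1 - tt) (L0 - tt) (L1 + tt)
        + ?z (L0 - tt) (L1 + tt) (L0 - L2) (L1 + L2) + ?z (L0 - L2) (L1 + L2) (- L5 + tt) (L1 + L2)
        + ?z (- L5 + tt) (L1 + L2) (- L5) (L1 + L2 - tt) + ?z (- L5) (L1 + L2 - tt) (- L5) L5 + ?z (- L5) L5 (- tt) tt + 3 * ?c"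
      unfolding sum_lt9 la[OF arc(1,4)] la[OF arc(2,5)] la[OF arc(3,6)] lf[OF flt(1)] lf[OF flt(2)] lf[OF flt(3)] lf[OF flt(4)] lf[OF flt(5)] lf[OF flt(6)]
        nS q0 q1 q2 q3 q4 q5 q6 q7 q8 q9'' I by (rule tele)
    also have "\<dots> = (L0*L1 + L0*L2 + L1*L2 + L3*(L1+L2) + L4*L5 - 3 * tt\<^sup>2) * (sqrt 3 / 2) + 3 * ?c"
    proof -
      have l3: "L3 = L0 + L5 - L2" and l4: "L4 = L1 + L2 - L5" using cl by auto
      let ?y = "\<lambda>x y x' y'. x * y' - y * x' :: real"
      have "?y (- tt) tt tt 0 + ?y tt 0 L0 0 + ?y L0 0 L0 (L1 - tt) + ?y L0 (L1 - tt) (L0 - tt) (L1 + tt)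
        + ?y (L0 - tt) (L1 + tt) (L0 - L2) (L1 + L2) + ?y (L0 - L2) (L1 + L2) (- L5 + tt) (L1 + L2)
        + ?y (- L5 + tt) (L1 + L2) (- L5) (L1 + L2 - tt) + ?y (- L5) (L1 + L2 - tt) (- L5) L5 + ?y (- L5) L5 (- tt) tt
        = L0*L1 + L0*L2 + L1*L2 + L3*(L1+L2) + L4*L5 - 3 * tt\<^sup>2"
        unfolding l3 l4 by (simp add: algebra_simps power2_eq_square)
      then show ?thesis by (simp only: distrib_right[symmetric])
    qed
    finally have s: "(\<Sum>j<9. ?l j) = (L0*L1 + L0*L2 + L1*L2 + L3*(L1+L2) + L4*L5 - 3 * tt\<^sup>2) * (sqrt 3 / 2) + 3 * ((sqrt 3 / 2 - pi / 3) * (1 / K0\<^sup>2))" by simp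
    have a1: "measure lebesgue (E 1) = (pi - sqrt 3) / 2 * (1 / K0\<^sup>2)" unfolding area1 by simp
    have E2: "E 2 \<in> sets lebesgue" using til by (simp add: periodic_2tiling_def)
    have "AE z in lebesgue. z \<in> E 2 \<longrightarrow> norm z \<le> R" by (rule bd) simp
    from area_boundary(1)[OF b2 E2 this] have "measure lebesgue (E 2) = (\<Sum>j<9. ?l j) / 2" .
    \<comment> \<open>Here the area of \<open>E 1\<close> compensates the circular cuts: all terms
      with \<open>pi\<close> and with \<open>T\<close>, which stands for the square of
      \<open>tt\<close>, cancel.\<close>
    moreover have "(pi - s) / 2 * (3 * T) + ((H - 3 * T) * (s / 2) + 3 * ((s / 2 - pi / 3) * (3 * T))) / 2 = s / 4 * H" for H s T :: real
      by (simp add: field_simps)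
    ultimately show ?thesis unfolding a1 s K3 by (simp only:)
  qed
  have per: "(\<Sum>j<9. len2 j) = pi / K0 + (L0 + L1 + L2 + L3 + L4 + L5) - 6 * tt"
  proof -
    have "(\<Sum>j<9. len2 j) = (\<Sum>k<9. len2 (e k))" by (rule sr)
    then show ?thesis unfolding sum_lt9[of "\<lambda>k. len2 (e k)"] arc L by simp
  qed
  have chain: "AE z in lebesgue. 2 * of_real pi * \<i> * indicator (E 2) z =
       wseg (q 1) (q 2) z + wseg (q 2) (q 3) z + wseg (q 4) (q 5) z + wseg (q 5) (q 6) z
     + wseg (q 7) (q 8) z + wseg (q 8) (q 0) z
     - wk (A 0) (cdir (\<theta>1 0) K0 (len1 0)) (z - (q 0 - A 0 1)) - wk (A 1) (cdir (\<theta>1 1) K0 (len1 1)) (z - (q 3 - A 1 1))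
     - wk (A 2) (cdir (\<theta>1 2) K0 (len1 2)) (z - (q 6 - A 2 1))"
  proof -
    have "AE z in lebesgue. (\<Sum>j<9. wk (B j) (cdir (\<theta>2 j) (\<kappa>2 j) (len2 j)) z) = 2 * of_real pi * \<i> * indicator (E 2) z"
      using b2 by (simp add: has_boundary_def)
    then show ?thesis
    proof eventually_elim
      case (elim z)
      let ?w = "\<lambda>j. wk (B j) (cdir (\<theta>2 j) (\<kappa>2 j) (len2 j)) z"
      have wf: "?w (e k) = wseg (q k) (q (Suc k)) z" if "\<kappa>2 (e k) = 0" for k
      proof -
        have b: "ccurve (p2 (e k)) (\<theta>2 (e k)) 0 (len2 (e k)) 1 = q (Suc k)" using qS[of k] unfolding that .
        have "B (e k) = seg (q k) (q (Suc k))" using ccurve_flat_eq(1)[of "p2 (e k)" "\<theta>2 (e k)" "len2 (e k)"] unfolding b unfolding that q_def .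
        moreover have "cdir (\<theta>2 (e k)) (\<kappa>2 (e k)) (len2 (e k)) = (\<lambda>_. q (Suc k) - q k)"
          using ccurve_flat_eq(2)[of "\<theta>2 (e k)" "len2 (e k)" "p2 (e k)"] unfolding b unfolding that q_def .
        ultimately show ?thesis by (simp only:)
      qed
      have n3: "0 < (3::nat)" "1 < (3::nat)" "2 < (3::nat)" by simp_all
      have w0: "?w (e 0) = - wk (A 0) (cdir (\<theta>1 0) K0 (len1 0)) (z - (q 0 - A 0 1))" 
        using wk_B_reverse[OF arc(1,4) n3(1) arc(7)] unfolding q_def .
      have w3: "?w (e 3) = - wk (A 1) (cdir (\<theta>1 1) K0 (len1 1)) (z - (q 3 - A 1 1))"
        using wk_B_reverse[OF arc(2,5) n3(2) arc(8)] unfolding q_def .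
      have w6: "?w (e 6) = - wk (A 2) (cdir (\<theta>1 2) K0 (len1 2)) (z - (q 6 - A 2 1))"
        using wk_B_reverse[OF arc(3,6) n3(3) arc(9)] unfolding q_def .
      have "(\<Sum>k<9. ?w (e k)) = 2 * of_real pi * \<i> * indicator (E 2) z" using elim unfolding sc[of ?w] .
      then show ?case
        unfolding sum_lt9 w0 w3 w6 wf[OF flt(1)] wf[OF flt(2)] wf[OF flt(3)] wf[OF flt(4)] wf[OF flt(5)] wf[OF flt(6)] nS q9
        by (simp add: algebra_simps)
    qed
  qed
  have Lt: "L0 > tt" "L1 > tt" "L2 > tt" "L3 > tt" "L4 > tt" "L5 > tt" using L tpos by simp_all
  show thesis
    by (rule that[OF Lt cl arc(10-12)[unfolded sh] area per chain[unfolded sh, unfolded q0 q1 q2 q3 q4 q5 q6 q7 q8]])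
qed

end

section \<open>Equality of opposite sides of the hexagon\<close>

lemma wseg_translate: "wseg a b (z - g) = wseg (a + g) (b + g) z"
proof -
  have "seg (a + g) (b + g) = (\<lambda>t. seg a b t + g)" by (auto simp: seg_def fun_eq_iff)
  then show ?thesis by (simp add: wk_translate)
qed

lemma norm_Zc: "(norm (Zc x y))\<^sup>2 = x\<^sup>2 + x * y + y\<^sup>2"
  unfolding cmod_power2 Zc_def w6_eq by (simp add: power2_eq_square algebra_simps)

text \<open>The integer matrix that expresses \<open>g\<close>, \<open>h\<close> in
  \<open>u\<close>, \<open>v\<close> has determinant one, so its inverse is integral too.\<close>

lemma lat_eqI:
  assumes g: "g \<in> lat u v" and h: "h \<in> lat u v" and d: "Im (cnj g * h) = Im (cnj u * v)" "Im (cnj u * v) \<noteq> 0"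
  shows "lat g h = lat u v"
proof
  show "lat g h \<subseteq> lat u v"
  proof
    fix x assume "x \<in> lat g h"
    then obtain k l :: int where x: "x = of_int k * g + of_int l * h" by (auto simp: lat_def)
    obtain a b a' b' :: int where "g = of_int a * u + of_int b * v" "h = of_int a' * u + of_int b' * v" using g h by (auto simp: lat_def)
    then have "x = of_int (k * a + l * a') * u + of_int (k * b + l * b') * v" by (simp add: x algebra_simps)
    then show "x \<in> lat u v" unfolding lat_def by blast
  qed
  obtain a b a' b' :: int where gh: "g = of_int a * u + of_int b * v" "h = of_int a' * u + of_int b' * v" using g h by (auto simp: lat_def)
  have "Im (cnj g * h) = of_int (a * b' - b * a') * Im (cnj u * v)" unfolding gh by (simp add: algebra_simps)
  then have "real_of_int (a * b' - b * a') = 1" using d by simp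
  then have det: "a * b' - b * a' = 1" by linarith
  have U: "of_int b' * g + of_int (- b) * h = of_int (a * b' - b * a') * u" "of_int (- a') * g + of_int a * h = of_int (a * b' - b * a') * v"
    unfolding gh by (simp_all add: algebra_simps)
  show "lat u v \<subseteq> lat g h"
  proof
    fix x assume "x \<in> lat u v"
    then obtain k l :: int where x: "x = of_int k * u + of_int l * v" by (auto simp: lat_def)
    have "x = of_int k * (of_int b' * g + of_int (- b) * h) + of_int l * (of_int (- a') * g + of_int a * h)" unfolding U det x by simp
    also have "\<dots> = of_int (k * b' - l * a') * g + of_int (l * a - k * b) * h" by (simp add: algebra_simps)
    finally show "x \<in> lat g h" unfolding lat_def by blast
  qed
qed

context enneagon_tiling
begin

text \<open>Two differences of the distinguished corners are lattice vectors, with determinant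
  \<open>n\<close> times the covolume for an integer \<open>n\<close>. In terms of the lengths this
  reads \<open>n * H = H + d^2\<close> with \<open>d = L0 - L3\<close>, while
  \<open>H = P + d^2\<close> for a positive \<open>P\<close>. So \<open>1 \<le> n < 2\<close>, that
  is \<open>n = 1\<close> and \<open>d = 0\<close>, and the closing relations give the other two
  pairs.\<close>

theorem enneagon_regular:
  obtains Kc a b c where "a > tt" "b > tt" "c > tt" "Kc - cR \<in> lat u v" "lat u v = lat (D0 * Zc a b) (D0 * Zc (- c) (b + c))"
    "measure lebesgue (E 1) + measure lebesgue (E 2) = sqrt 3 / 2 * (a * b + b * c + c * a)"
    "(\<Sum>j<9. len2 j) = pi / K0 + 2 * (a + b + c) - 6 * tt"
    "AE z in lebesgue. 2 * of_real pi * \<i> * indicator (E 2) z =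
       wseg (Kc + D0 * Zc tt 0) (Kc + D0 * Zc a 0) z + wseg (Kc + D0 * Zc a 0) (Kc + D0 * Zc a (b - tt)) z
     + wseg (Kc + D0 * Zc (a - tt) (b + tt)) (Kc + D0 * Zc (a - c) (b + c)) z + wseg (Kc + D0 * Zc (a - c) (b + c)) (Kc + D0 * Zc (- c + tt) (b + c)) z
     + wseg (Kc + D0 * Zc (- c) (b + c - tt)) (Kc + D0 * Zc (- c) c) z + wseg (Kc + D0 * Zc (- c) c) (Kc + D0 * Zc (- tt) tt) z
     - wk (A 0) (cdir (\<theta>1 0) K0 (len1 0)) (z - (Kc - cR)) - wk (A 1) (cdir (\<theta>1 1) K0 (len1 1)) (z - (Kc + D0 * Zc a b - cR))
     - wk (A 2) (cdir (\<theta>1 2) K0 (len1 2)) (z - (Kc + D0 * Zc (- c) (b + c) - cR))"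
proof (rule enneagon_shape)
  fix Kc L0 L1 L2 L3 L4 L5
  assume Lt: "L0 > tt" "L1 > tt" "L2 > tt" "L3 > tt" "L4 > tt" "L5 > tt" and cl: "L0 + L5 = L2 + L3" "L1 + L2 = L4 + L5"
    and mem: "Kc - cR \<in> lat u v" "Kc + D0 * Zc L0 L1 - cR \<in> lat u v" "Kc + D0 * Zc (- L5) (L1 + L2) - cR \<in> lat u v"
    and area: "measure lebesgue (E 1) + measure lebesgue (E 2) = sqrt 3 / 4 * (L0*L1 + L0*L2 + L1*L2 + L3*(L1+L2) + L4*L5)"
    and per: "(\<Sum>j<9. len2 j) = pi / K0 + (L0 + L1 + L2 + L3 + L4 + L5) - 6 * tt"
    and chain: "AE z in lebesgue. 2 * of_real pi * \<i> * indicator (E 2) z =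
       wseg (Kc + D0 * Zc tt 0) (Kc + D0 * Zc L0 0) z + wseg (Kc + D0 * Zc L0 0) (Kc + D0 * Zc L0 (L1 - tt)) z
     + wseg (Kc + D0 * Zc (L0 - tt) (L1 + tt)) (Kc + D0 * Zc (L0 - L2) (L1 + L2)) z + wseg (Kc + D0 * Zc (L0 - L2) (L1 + L2)) (Kc + D0 * Zc (- L5 + tt) (L1 + L2)) z
     + wseg (Kc + D0 * Zc (- L5) (L1 + L2 - tt)) (Kc + D0 * Zc (- L5) L5) z + wseg (Kc + D0 * Zc (- L5) L5) (Kc + D0 * Zc (- tt) tt) z
     - wk (A 0) (cdir (\<theta>1 0) K0 (len1 0)) (z - (Kc - cR)) - wk (A 1) (cdir (\<theta>1 1) K0 (len1 1)) (z - (Kc + D0 * Zc L0 L1 - cR))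
     - wk (A 2) (cdir (\<theta>1 2) K0 (len1 2)) (z - (Kc + D0 * Zc (- L5) (L1 + L2) - cR))"
  have Lp: "L0 > 0" "L1 > 0" "L2 > 0" "L3 > 0" "L4 > 0" "L5 > 0" using Lt tt_pos by auto
  define H where "H = L0*L1 + L0*L2 + L1*L2 + L3*(L1+L2) + L4*L5"
  define d where "d = L0 - L3"
  have l: "L3 = L0 - d" "L5 = L2 - d" "L4 = L1 + d" using cl by (auto simp: d_def)
  have Im_rot: "Im (cnj (D0 * x) * (D0 * y)) = Im (cnj x * y)" for x y using Im_shift[OF norm_D0, of 0] by simp
  have vol: "Im (cnj u * v) = sqrt 3 / 4 * H" using covolume area by (simp add: H_def)
  have "(Kc + D0 * Zc L0 L1 - cR) - (Kc - cR) \<in> lat u v" "(Kc + D0 * Zc (- L5) (L1 + L2) - cR) - (Kc - cR) \<in> lat u v"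
    by (intro lat_group mem)+
  then have am: "D0 * Zc L0 L1 \<in> lat u v" "D0 * Zc (- L5) (L1 + L2) \<in> lat u v" by simp_all
  then obtain i j i' j' :: int where ij: "D0 * Zc L0 L1 = of_int i * u + of_int j * v" "D0 * Zc (- L5) (L1 + L2) = of_int i' * u + of_int j' * v"
    by (auto simp: lat_def)
  have "Im (cnj (D0 * Zc L0 L1) * (D0 * Zc (- L5) (L1 + L2))) = of_int (i * j' - j * i') * Im (cnj u * v)"
    unfolding ij by (simp add: algebra_simps)
  then have "(L0 * (L1 + L2) + L1 * L5) * (sqrt 3 / 2) = of_int (i * j' - j * i') * (sqrt 3 / 4 * H)" unfolding Im_rot Im_Zc vol by simp
  moreover have "2 * X = n * H" if "X * (sqrt 3 / 2) = n * (sqrt 3 / 4 * H)" for X n :: real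
  proof -
    have "2 * X = (X * (sqrt 3 / 2)) * (4 / sqrt 3)" by simp
    also have "\<dots> = (n * (sqrt 3 / 4 * H)) * (4 / sqrt 3)" by (simp only: that)
    finally show ?thesis by simp
  qed
  ultimately have "2 * (L0 * (L1 + L2) + L1 * L5) = of_int (i * j' - j * i') * H" by blast
  moreover have "2 * (L0 * (L1 + L2) + L1 * L5) = H + d\<^sup>2" unfolding H_def l by (simp add: algebra_simps power2_eq_square)
  ultimately have nH: "of_int (i * j' - j * i') * H = H + d\<^sup>2" by simp
  define P where "P = 2 * (L0*L1 + L2*L3 + L4*L5)"
  have "H = P + d\<^sup>2" unfolding H_def P_def l by (simp add: algebra_simps power2_eq_square)
  moreover have "P > 0" unfolding P_def using Lp by (intro mult_pos_pos add_pos_pos) simp_all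
  ultimately have Hd: "d\<^sup>2 < H" by linarith
  have H0: "H > 0" using Hd by (smt (verit) zero_le_power2)
  have "1 * H \<le> of_int (i * j' - j * i') * H" "of_int (i * j' - j * i') * H < 2 * H" using nH Hd by auto
  then have "1 \<le> real_of_int (i * j' - j * i')" "real_of_int (i * j' - j * i') < 2" using H0 by (simp_all only: mult_le_cancel_right_pos mult_less_cancel_right_pos)
  then have n1: "i * j' - j * i' = 1" by linarith
  then have "d = 0" using nH by simp
  then have e: "L3 = L0" "L5 = L2" "L4 = L1" using l by auto
  show thesis
  proof (rule that[of L0 L1 L2 Kc])
    have "Im (cnj (D0 * Zc L0 L1) * (D0 * Zc (- L5) (L1 + L2))) = Im (cnj u * v)"
      using \<open>Im (cnj (D0 * Zc L0 L1) * (D0 * Zc (- L5) (L1 + L2))) = of_int (i * j' - j * i') * Im (cnj u * v)\<close> n1 by simp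
    then show "lat u v = lat (D0 * Zc L0 L1) (D0 * Zc (- L2) (L1 + L2))" using lat_eqI[OF am] D e by simp
    show "measure lebesgue (E 1) + measure lebesgue (E 2) = sqrt 3 / 2 * (L0 * L1 + L1 * L2 + L2 * L0)"
      unfolding area e by (simp add: algebra_simps)
    show "(\<Sum>j<9. len2 j) = pi / K0 + 2 * (L0 + L1 + L2) - 6 * tt" unfolding per e by simp
  qed (use Lt mem chain e in simp_all)
qed

end

subsection \<open>Cut honeycombs\<close>

text \<open>The frame of the competitor: a regular hexagon with centre \<open>z0\<close>, side
  \<open>s\<close> and a corner in direction \<open>c\<close>. The curves \<open>Ar\<close> are
  parameters, so that the arcs of the given \<open>E 1\<close> can be inserted later instead of a
  standard parametrisation.\<close>

locale honeycomb_cut =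
  fixes z0 c :: complex and s t :: real and Ar Ar' :: "nat \<Rightarrow> real \<Rightarrow> complex"
  assumes c: "norm c = 1" and t: "0 < t" "t < s"
begin

definition pt :: "real \<Rightarrow> real \<Rightarrow> complex" where "pt x y = z0 + c * Zc x y"
definition co1 :: "complex \<Rightarrow> real" where "co1 z = lc1 c (c * w6) (z - z0)"
definition co2 :: "complex \<Rightarrow> real" where "co2 z = lc2 c (c * w6) (z - z0)"
text \<open>The hexagon as an intersection of three strips, which makes membership a matter of
  linear arithmetic.\<close>

definition Hx :: "complex set" where "Hx = {z. \<bar>co1 z\<bar> \<le> s \<and> \<bar>co2 z\<bar> \<le> s \<and> \<bar>co1 z + co2 z\<bar> \<le> s}"
definition Gh :: "complex set" where "Gh = lat (c * Zc s s) (c * Zc (- s) (2 * s))"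
text \<open>Lattice vectors that carry the corner \<open>pt s 0\<close> to itself and to the two
  other cut corners, \<open>pt (- s) s\<close> and \<open>pt 0 (- s)\<close>.\<close>

definition gs :: "nat \<Rightarrow> complex" where "gs i = (if i = 0 then 0 else if i = 1 then c * Zc (- 2 * s) s else c * Zc (- s) (- s))"
text \<open>The Reuleaux triangle centred at the corner \<open>pt s 0\<close>: discs about its three
  vertices, with its side \<open>sqrt 3 * t\<close> as radius.\<close>

definition Rx :: "complex set" where
  "Rx = cball (pt (s + t) 0) (sqrt 3 * t) \<inter> cball (pt (s - t) t) (sqrt 3 * t) \<inter> cball (pt s (- t)) (sqrt 3 * t)"
definition Cx :: "complex set" where "Cx = Hx - (\<Union>i<3. (+) (gs i) ` Rx)"

lemma c0: "c \<noteq> 0" using c by auto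

lemma s0: "s > 0" using t by simp

lemma Im_c: "Im (cnj (c * x) * (c * y)) = Im (cnj x * y)" using Im_shift[OF c, of 0] by simp

lemma det_c: "Im (cnj c * (c * w6)) = sqrt 3 / 2" using Im_c[of 1 w6] by (simp add: sin_60)

lemma co_pt: "co1 (pt x y) = x" "co2 (pt x y) = y"
proof -
  have d: "Im (cnj c * (c * w6)) \<noteq> 0" unfolding det_c by simp
  have "pt x y - z0 = of_real x * c + of_real y * (c * w6)" by (simp add: pt_def Zc_def algebra_simps)
  then show "co1 (pt x y) = x" "co2 (pt x y) = y" unfolding co1_def co2_def by (simp_all only: lc_comb[OF d])
qed

lemma pt_co: "pt (co1 z) (co2 z) = z"
proof -
  have d: "Im (cnj c * (c * w6)) \<noteq> 0" unfolding det_c by simp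
  from lat_coords[OF d, of "z - z0"] have "z - z0 = c * Zc (co1 z) (co2 z)" unfolding co1_def[symmetric] co2_def[symmetric] Zc_def by (simp add: algebra_simps)
  then show ?thesis by (simp add: pt_def algebra_simps)
qed

lemma pt_add: "pt x y + c * Zc x' y' = pt (x + x') (y + y')" "pt x y - c * Zc x' y' = pt (x - x') (y - y')" "pt x y - pt x' y' = c * Zc (x - x') (y - y')"
  unfolding pt_def Zc_simps(1,2)[symmetric] by (simp_all add: algebra_simps)

lemma co_shift: "co1 (z - c * Zc x y) = co1 z - x" "co2 (z - c * Zc x y) = co2 z - y"
proof -
  have "z - c * Zc x y = pt (co1 z - x) (co2 z - y)" by (subst pt_co[symmetric]) (simp only: pt_add)
  then show "co1 (z - c * Zc x y) = co1 z - x" "co2 (z - c * Zc x y) = co2 z - y" by (simp_all add: co_pt)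
qed

lemma AE_co:
  assumes "x \<noteq> 0 \<or> y \<noteq> 0"
  shows "AE z in lebesgue. x * co1 z + y * co2 z \<noteq> r"
proof -
  let ?w = "of_real y * c - of_real x * (c * w6)"
  have "?w = c * Zc y (- x)" by (simp add: Zc_def algebra_simps)
  moreover have "Zc y (- x) \<noteq> Zc 0 0" using assms by (auto simp: Zc_eq_iff)
  ultimately have w: "?w \<noteq> 0" using c0 by (simp add: Zc_def)
  have "x * co1 z + y * co2 z = (Im (cnj ?w * z) - Im (cnj ?w * z0)) / (sqrt 3 / 2)" for z
    unfolding co1_def co2_def lc1_def lc2_def det_c by (simp add: algebra_simps add_divide_distrib diff_divide_distrib)
  then have "x * co1 z + y * co2 z = r \<longrightarrow> Im (cnj ?w * z) = r * (sqrt 3 / 2) + Im (cnj ?w * z0)" for z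
    by (simp only:) (simp add: field_simps)
  then show ?thesis using AE_line[OF w, of "r * (sqrt 3 / 2) + Im (cnj ?w * z0)"] by (auto elim!: eventually_mono)
qed

lemma triangle_mem:
  assumes det: "m1 * n2 - n1 * m2 = 1"
  shows "z \<in> convex hull {z0, pt (s * m1) (s * n1), pt (s * m2) (s * n2)} \<longleftrightarrow>
    0 \<le> co1 z * n2 - co2 z * m2 \<and> 0 \<le> m1 * co2 z - n1 * co1 z \<and> (co1 z * n2 - co2 z * m2) + (m1 * co2 z - n1 * co1 z) \<le> s"
    (is "_ \<longleftrightarrow> 0 \<le> ?v \<and> 0 \<le> ?w \<and> ?v + ?w \<le> s")
proof -
  have comb: "(1 - y - w) *\<^sub>R z0 + y *\<^sub>R pt (s * m1) (s * n1) + w *\<^sub>R pt (s * m2) (s * n2) = pt (s * (y * m1 + w * m2)) (s * (y * n1 + w * n2))" for y w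
    by (simp add: pt_def Zc_def scaleR_conv_of_real algebra_simps)
  show ?thesis
  proof
    assume "z \<in> convex hull {z0, pt (s * m1) (s * n1), pt (s * m2) (s * n2)}"
    then obtain x y w where xyw: "0 \<le> x" "0 \<le> y" "0 \<le> w" "x + y + w = 1" "z = x *\<^sub>R z0 + y *\<^sub>R pt (s * m1) (s * n1) + w *\<^sub>R pt (s * m2) (s * n2)"
      unfolding convex_hull_3 by auto
    have "x = 1 - y - w" using xyw(4) by simp
    then have z: "z = pt (s * (y * m1 + w * m2)) (s * (y * n1 + w * n2))" using xyw(5) comb by simp
    have "?v = s * y * (m1 * n2 - n1 * m2)" "?w = s * w * (m1 * n2 - n1 * m2)" unfolding z co_pt by (simp_all add: algebra_simps)
    then have vw: "?v = s * y" "?w = s * w" unfolding det by simp_all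
    have "s * y + s * w \<le> s * 1" unfolding distrib_left[symmetric] using xyw s0 by (intro mult_left_mono) auto
    then show "0 \<le> ?v \<and> 0 \<le> ?w \<and> ?v + ?w \<le> s" unfolding vw using xyw s0 by simp
  next
    assume vw: "0 \<le> ?v \<and> 0 \<le> ?w \<and> ?v + ?w \<le> s"
    define y w where "y = ?v / s" and "w = ?w / s"
    have sy: "s * y = ?v" "s * w = ?w" using s0 by (simp_all add: y_def w_def)
    have "y + w \<le> 1" using vw s0 unfolding y_def w_def add_divide_distrib[symmetric] by simp
    then have yw: "0 \<le> 1 - y - w" "0 \<le> y" "0 \<le> w" "(1 - y - w) + y + w = 1" using vw s0 by (simp_all add: y_def w_def)
    have "s * (y * m1 + w * m2) = (s * y) * m1 + (s * w) * m2" "s * (y * n1 + w * n2) = (s * y) * n1 + (s * w) * n2" by (simp_all add: algebra_simps)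
    moreover have "?v * m1 + ?w * m2 = co1 z * (m1 * n2 - n1 * m2)" "?v * n1 + ?w * n2 = co2 z * (m1 * n2 - n1 * m2)" by (simp_all add: algebra_simps)
    ultimately have "s * (y * m1 + w * m2) = co1 z" "s * (y * n1 + w * n2) = co2 z" unfolding sy det by simp_all
    then have "z = (1 - y - w) *\<^sub>R z0 + y *\<^sub>R pt (s * m1) (s * n1) + w *\<^sub>R pt (s * m2) (s * n2)" unfolding comb by (simp add: pt_co)
    then show "z \<in> convex hull {z0, pt (s * m1) (s * n1), pt (s * m2) (s * n2)}" unfolding convex_hull_3 using yw by blast
  qed
qed

lemma triangle_chain:
  assumes det: "m1 * n2 - n1 * m2 = 1"
  shows "AE z in lebesgue. wseg z0 (pt (s * m1) (s * n1)) z + wseg (pt (s * m1) (s * n1)) (pt (s * m2) (s * n2)) z + wseg (pt (s * m2) (s * n2)) z0 z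
    = 2 * of_real pi * \<i> * indicator (convex hull {z0, pt (s * m1) (s * n1), pt (s * m2) (s * n2)}) z"
proof -
  let ?T = "convex hull {z0, pt (s * m1) (s * n1), pt (s * m2) (s * n2)}"
  have e: "Im (cnj (pt (s * m1) (s * n1) - z0) * (pt (s * m2) (s * n2) - z0)) = s\<^sup>2 * (m1 * n2 - n1 * m2) * (sqrt 3 / 2)"
    unfolding pt_def add_diff_cancel_left' Im_c Im_Zc by (simp add: algebra_simps power2_eq_square)
  have pos: "Im (cnj (pt (s * m1) (s * n1) - z0) * (pt (s * m2) (s * n2) - z0)) > 0" unfolding e det using s0 by simp
  have "AE z in lebesgue. z \<in> ?T \<longrightarrow> z \<in> interior ?T" by (rule interior_convex_AE) (rule convex_convex_hull)
  then show ?thesis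
  proof eventually_elim
    case (elim z)
    show ?case
    proof (cases "z \<in> ?T")
      case True then show ?thesis using triangle_inside[OF pos] elim by simp
    next
      case False then show ?thesis using triangle_outside[OF False] by simp
    qed
  qed
qed

text \<open>Six triangles around \<open>z0\<close>; every spoke occurs twice with opposite
  orientation and cancels.\<close>

lemma hexagon_chain:
  "AE z in lebesgue. wseg (pt s 0) (pt 0 s) z + wseg (pt 0 s) (pt (- s) s) z + wseg (pt (- s) s) (pt (- s) 0) z
     + wseg (pt (- s) 0) (pt 0 (- s)) z + wseg (pt 0 (- s)) (pt s (- s)) z + wseg (pt s (- s)) (pt s 0) z = 2 * of_real pi * \<i> * indicator Hx z"
proof -
  let ?T = "\<lambda>m1 n1 m2 n2. convex hull {z0, pt (s * m1) (s * n1), pt (s * m2) (s * n2)}"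
  have "AE z in lebesgue. co1 z \<noteq> 0" "AE z in lebesgue. co2 z \<noteq> 0" "AE z in lebesgue. co1 z + co2 z \<noteq> 0"
    using AE_co[of 1 0 0] AE_co[of 0 1 0] AE_co[of 1 1 0] by simp_all
  moreover note triangle_chain[of 1 1 0 0, simplified] triangle_chain[of 0 1 1 "-1", simplified] triangle_chain[of "-1" 0 1 "-1", simplified]
    triangle_chain[of "-1" "-1" 0 0, simplified] triangle_chain[of 0 "-1" "-1" 1, simplified] triangle_chain[of 1 0 "-1" 1, simplified]
  ultimately show ?thesis
  proof eventually_elim
    case (elim z)
    note m = triangle_mem[of 1 1 0 0 z, simplified] triangle_mem[of 0 1 1 "-1" z, simplified] triangle_mem[of "-1" 0 1 "-1" z, simplified]
      triangle_mem[of "-1" "-1" 0 0 z, simplified] triangle_mem[of 0 "-1" "-1" 1 z, simplified] triangle_mem[of 1 0 "-1" 1 z, simplified]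
    have ind: "indicator (convex hull {z0, pt s 0, pt 0 s}) z + indicator (convex hull {z0, pt 0 s, pt (- s) s}) z + indicator (convex hull {z0, pt (- s) s, pt (- s) 0}) z
      + indicator (convex hull {z0, pt (- s) 0, pt 0 (- s)}) z + indicator (convex hull {z0, pt 0 (- s), pt s (- s)}) z + indicator (convex hull {z0, pt s (- s), pt s 0}) z
      = (indicator Hx z :: complex)"
      unfolding indicator_def m Hx_def mem_Collect_eq using elim(1-3) s0
      by (cases "co1 z > 0"; cases "co2 z > 0"; cases "co1 z + co2 z > 0") (auto simp: abs_le_iff)
    have r: "wseg (pt x y) z0 z = - wseg z0 (pt x y) z" for x y by (rule wseg_reverse)
    have tele: "e0 + e1 + e2 + e3 + e4 + e5 = k * (i0 + i1 + i2 + i3 + i4 + i5)"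
      if h: "a0 + e0 + - a1 = k * i0" "a1 + e1 + - a2 = k * i1" "a2 + e2 + - a3 = k * i2" "a3 + e3 + - a4 = k * i3" "a4 + e4 + - a5 = k * i4" "a5 + e5 + - a0 = k * i5"
      for a0 a1 a2 a3 a4 a5 e0 e1 e2 e3 e4 e5 k i0 i1 i2 i3 i4 i5 :: complex
      unfolding distrib_left h[symmetric] by simp
    show ?case unfolding ind[symmetric] by (rule tele[OF elim(4-9)[unfolded r]])
  qed
qed

lemma Hx_convex: "convex Hx"
proof (rule convexI)
  fix x y :: complex and p q :: real assume xy: "x \<in> Hx" "y \<in> Hx" "0 \<le> p" "0 \<le> q" "p + q = 1"
  have e: "p *\<^sub>R x + q *\<^sub>R y = pt (p * co1 x + q * co1 y) (p * co2 x + q * co2 y)"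
  proof -
    have "p *\<^sub>R pt (co1 x) (co2 x) + q *\<^sub>R pt (co1 y) (co2 y) = of_real (p + q) * z0 + c * Zc (p * co1 x + q * co1 y) (p * co2 x + q * co2 y)"
      by (simp add: pt_def Zc_def scaleR_conv_of_real algebra_simps)
    then show ?thesis unfolding pt_co xy(5) by (simp add: pt_def)
  qed
  have b: "\<bar>p * a + q * b\<bar> \<le> s" if "\<bar>a\<bar> \<le> s" "\<bar>b\<bar> \<le> s" for a b
    using convex_bound_le[of a s b p q] convex_bound_le[of "- a" s "- b" p q] that xy(3-5) by (auto simp: abs_le_iff)
  have "(p * co1 x + q * co1 y) + (p * co2 x + q * co2 y) = p * (co1 x + co2 x) + q * (co1 y + co2 y)" by (simp add: algebra_simps)
  then show "p *\<^sub>R x + q *\<^sub>R y \<in> Hx" unfolding e Hx_def mem_Collect_eq co_pt using xy(1,2) by (simp only:) (auto simp: Hx_def intro!: b)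
qed

lemma Hx_hull: "Hx = convex hull {pt s 0, pt 0 s, pt (- s) s, pt (- s) 0, pt 0 (- s), pt s (- s)}" (is "_ = convex hull ?V")
proof
  have "?V \<subseteq> Hx" using s0 by (auto simp: Hx_def co_pt)
  then show "convex hull ?V \<subseteq> Hx" using Hx_convex by (rule hull_minimal[of _ Hx convex])
  have "(1/2) *\<^sub>R pt s 0 + (1/2) *\<^sub>R pt (- s) 0 \<in> convex hull ?V"
    by (rule convexD[OF convex_convex_hull]) (auto intro: hull_inc)
  moreover have "(1/2) *\<^sub>R pt s 0 + (1/2) *\<^sub>R pt (- s) 0 = z0" by (simp add: pt_def Zc_def scaleR_conv_of_real algebra_simps)
  ultimately have z0: "z0 \<in> convex hull ?V" by simp
  have T: "convex hull {z0, a, b} \<subseteq> convex hull ?V" if "a \<in> ?V" "b \<in> ?V" for a b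
  proof (rule hull_minimal[of _ _ convex, OF _ convex_convex_hull])
    show "{z0, a, b} \<subseteq> convex hull ?V" using z0 that hull_inc[of a ?V convex] hull_inc[of b ?V convex] by blast
  qed
  show "Hx \<subseteq> convex hull ?V"
  proof
    fix z assume z: "z \<in> Hx"
    note m = triangle_mem[of 1 1 0 0 z, simplified] triangle_mem[of 0 1 1 "-1" z, simplified] triangle_mem[of "-1" 0 1 "-1" z, simplified]
      triangle_mem[of "-1" "-1" 0 0 z, simplified] triangle_mem[of 0 "-1" "-1" 1 z, simplified] triangle_mem[of 1 0 "-1" 1 z, simplified]
    have "z \<in> convex hull {z0, pt s 0, pt 0 s} \<or> z \<in> convex hull {z0, pt 0 s, pt (- s) s} \<or> z \<in> convex hull {z0, pt (- s) s, pt (- s) 0}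
      \<or> z \<in> convex hull {z0, pt (- s) 0, pt 0 (- s)} \<or> z \<in> convex hull {z0, pt 0 (- s), pt s (- s)} \<or> z \<in> convex hull {z0, pt s (- s), pt s 0}"
      unfolding m using z unfolding Hx_def by (auto simp: abs_le_iff)
    then show "z \<in> convex hull ?V" using T by (elim disjE) blast+
  qed
qed

lemma Hx_compact: "compact Hx" unfolding Hx_hull by (intro compact_convex_hull finite_imp_compact) simp

lemma Rx_convex: "convex Rx" and Rx_compact: "compact Rx"
  unfolding Rx_def by (auto intro!: convex_Int convex_cball compact_Int_closed)

text \<open>The centres of the hexagons form a sublattice of index 3 in the triangular lattice of
  side \<open>s\<close>, so locating the hexagon of a point becomes arithmetic modulo 3.\<close>

lemma Gh_mem: "g \<in> Gh \<longleftrightarrow> (\<exists>m n :: int. 3 dvd (m - n) \<and> g = c * Zc (s * of_int m) (s * of_int n))"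
proof
  assume "g \<in> Gh"
  then obtain k l :: int where "g = of_int k * (c * Zc s s) + of_int l * (c * Zc (- s) (2 * s))" unfolding Gh_def lat_def by blast
  then have "g = c * Zc (s * of_int (k - l)) (s * of_int (k + 2 * l))" by (simp add: Zc_def algebra_simps)
  moreover have "3 dvd ((k - l) - (k + 2 * l))" by presburger
  ultimately show "\<exists>m n :: int. 3 dvd (m - n) \<and> g = c * Zc (s * of_int m) (s * of_int n)" by blast
next
  assume "\<exists>m n :: int. 3 dvd (m - n) \<and> g = c * Zc (s * of_int m) (s * of_int n)"
  then obtain m n :: int where mn: "3 dvd (m - n)" "g = c * Zc (s * of_int m) (s * of_int n)" by blast
  then obtain r where r: "m = n + 3 * r" by (metis dvdE diff_add_cancel add.commute)
  have "g = of_int (n + 2 * r) * (c * Zc s s) + of_int (- r) * (c * Zc (- s) (2 * s))" unfolding mn(2) r by (simp add: Zc_def algebra_simps)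
  then show "g \<in> Gh" unfolding Gh_def lat_def by blast
qed

lemma Gh_group: "g \<in> Gh \<Longrightarrow> h \<in> Gh \<Longrightarrow> g + h \<in> Gh" "g \<in> Gh \<Longrightarrow> h \<in> Gh \<Longrightarrow> g - h \<in> Gh"
  unfolding Gh_def by (rule lat_group; assumption)+

lemma gs_mem: "gs i \<in> Gh"
proof -
  have "0 = c * Zc (s * of_int 0) (s * of_int 0)" "c * Zc (- 2 * s) s = c * Zc (s * of_int (- 2)) (s * of_int 1)" "c * Zc (- s) (- s) = c * Zc (s * of_int (- 1)) (s * of_int (- 1))"
    by (simp_all add: Zc_def algebra_simps)
  then show ?thesis unfolding gs_def Gh_mem by (smt (verit) dvd_0_right dvd_minus_iff dvd_refl)
qed

lemma gs_inj: "i < 3 \<Longrightarrow> j < 3 \<Longrightarrow> gs i = gs j \<Longrightarrow> i = j"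
proof -
  assume ij: "i < 3" "j < 3" "gs i = gs j"
  have z: "0 = c * Zc 0 0" by (simp add: Zc_def)
  have "i = 0 \<or> i = 1 \<or> i = 2" "j = 0 \<or> j = 1 \<or> j = 2" using ij by auto
  then show "i = j" using ij(3) c0 s0 unfolding gs_def z by (elim disjE) (auto simp: Zc_eq_iff)
qed

text \<open>Off the lines carrying the sides, two centres whose hexagons contain \<open>z\<close>
  differ by less than two steps in all three coordinate directions; with the condition modulo 3 only
  equality is left.\<close>

lemma hexagon_tiling: "AE z in lebesgue. \<exists>!g. g \<in> Gh \<and> z - g \<in> Hx"
proof -
  have "AE z in lebesgue. \<forall>n::int. co1 z \<noteq> s * of_int n" "AE z in lebesgue. \<forall>n::int. co2 z \<noteq> s * of_int n" "AE z in lebesgue. \<forall>n::int. co1 z + co2 z \<noteq> s * of_int n"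
    unfolding AE_all_countable using AE_co[of 1 0] AE_co[of 0 1] AE_co[of 1 1] by simp_all
  then show ?thesis
  proof eventually_elim
    case (elim z)
    have mem: "z - c * Zc (s * of_int m) (s * of_int n) \<in> Hx \<longleftrightarrow> \<bar>co1 z - s * of_int m\<bar> \<le> s \<and> \<bar>co2 z - s * of_int n\<bar> \<le> s \<and> \<bar>co1 z + co2 z - s * of_int (m + n)\<bar> \<le> s" for m n :: int
      unfolding Hx_def mem_Collect_eq co_shift by (simp add: algebra_simps)
    have strict: "\<bar>x - s * of_int m\<bar> < s" if "\<forall>n::int. x \<noteq> s * of_int n" "\<bar>x - s * of_int m\<bar> \<le> s" for x and m :: int
    proof -
      have "x \<noteq> s * of_int (m + 1)" "x \<noteq> s * of_int (m - 1)" using that(1) by blast+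
      then show ?thesis using that(2) by (auto simp: algebra_simps abs_le_iff abs_less_iff)
    qed
    have close: "\<bar>m - m'\<bar> < 2" if "\<forall>n::int. x \<noteq> s * of_int n" "\<bar>x - s * of_int m\<bar> \<le> s" "\<bar>x - s * of_int m'\<bar> \<le> s" for x and m m' :: int
    proof -
      have "\<bar>s * of_int m - s * of_int m'\<bar> < s * 2" using strict[OF that(1,2)] strict[OF that(1,3)] by (auto simp: abs_less_iff)
      then have "s * \<bar>of_int (m - m')\<bar> < s * 2" using s0 by (simp add: right_diff_distrib[symmetric] abs_mult)
      then have "\<bar>real_of_int (m - m')\<bar> < 2" using s0 by (simp only: mult_less_cancel_left_pos)
      then show ?thesis by linarith
    qed
    have "\<exists>g. g \<in> Gh \<and> z - g \<in> Hx"
    proof -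
      define m n where "m = \<lfloor>co1 z / s\<rfloor>" and "n = \<lfloor>co2 z / s\<rfloor>"
      have fm: "s * of_int m \<le> co1 z" "co1 z < s * of_int m + s" "s * of_int n \<le> co2 z" "co2 z < s * of_int n + s"
        using floor_divide_lower[OF s0, of "co1 z"] floor_divide_upper[OF s0, of "co1 z"] floor_divide_lower[OF s0, of "co2 z"] floor_divide_upper[OF s0, of "co2 z"]
        by (simp_all add: m_def n_def algebra_simps)
      \<comment> \<open>Of the four corners of the rhombus around \<open>z\<close>, either two
        opposite ones are centres, and then the other diagonal decides between them, or exactly one
        is.\<close>
      have "3 dvd (m - n) \<or> 3 dvd (m - (n + 1)) \<or> 3 dvd ((m + 1) - n)" by presburger
      then show ?thesis
      proof (elim disjE)
        assume d: "3 dvd (m - n)"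
        then have d2: "3 dvd ((m + 1) - (n + 1))" by simp
        show ?thesis
        proof (cases "co1 z + co2 z \<le> s * of_int (m + n) + s")
          case True
          then have "z - c * Zc (s * of_int m) (s * of_int n) \<in> Hx" unfolding mem using fm by (auto simp: algebra_simps abs_le_iff)
          then show ?thesis using d Gh_mem by blast
        next
          case False
          then have "z - c * Zc (s * of_int (m + 1)) (s * of_int (n + 1)) \<in> Hx" unfolding mem using fm by (auto simp: algebra_simps abs_le_iff)
          then show ?thesis using d2 Gh_mem by blast
        qed
      next
        assume d: "3 dvd (m - (n + 1))"
        have "z - c * Zc (s * of_int m) (s * of_int (n + 1)) \<in> Hx" unfolding mem using fm by (auto simp: algebra_simps abs_le_iff)
        then show ?thesis using d Gh_mem by blast
      next
        assume d: "3 dvd ((m + 1) - n)"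
        have "z - c * Zc (s * of_int (m + 1)) (s * of_int n) \<in> Hx" unfolding mem using fm by (auto simp: algebra_simps abs_le_iff)
        then show ?thesis using d Gh_mem by blast
      qed
    qed
    moreover have "g = h" if gh: "g \<in> Gh \<and> z - g \<in> Hx" "h \<in> Gh \<and> z - h \<in> Hx" for g h
    proof -
      obtain m n m' n' :: int where mn: "3 dvd (m - n)" "g = c * Zc (s * of_int m) (s * of_int n)" "3 dvd (m' - n')" "h = c * Zc (s * of_int m') (s * of_int n')"
        using gh Gh_mem by blast
      have H: "z - c * Zc (s * of_int m) (s * of_int n) \<in> Hx" "z - c * Zc (s * of_int m') (s * of_int n') \<in> Hx" using gh mn by auto
      have "\<bar>m - m'\<bar> < 2" "\<bar>n - n'\<bar> < 2" "\<bar>(m + n) - (m' + n')\<bar> < 2"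
        using H unfolding mem by (blast intro: close[OF elim(1)] close[OF elim(2)] close[OF elim(3)])+
      then have "m = m' \<and> n = n'" using mn(1,3) by presburger
      then show ?thesis using mn by simp
    qed
    ultimately show ?case by blast
  qed
qed

text \<open>Each of the three translates lies in the disc of radius \<open>sqrt 3 * t\<close> about
  its vertex \<open>P k\<close> farthest from \<open>z0\<close>. These vertices form an equilateral
  triangle of side \<open>sqrt 3 * (s + t)\<close>, which exceeds \<open>2 * sqrt 3 * t\<close>
  because \<open>t < s\<close>.\<close>

lemma Rx_disjoint:
  assumes ij: "i < 3" "j < 3" and z: "z - gs i \<in> Rx" "z - gs j \<in> Rx"
  shows "i = j"
proof -
  define P where "P k = (if k = 0 then pt (s + t) 0 else if k = 1 then pt (- s - t) (s + t) else pt 0 (- s - t))" for k :: nat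
  have d: "dist (P k) z \<le> sqrt 3 * t" if "k < 3" "z - gs k \<in> Rx" for k
  proof -
    have "k = 0 \<or> k = 1 \<or> k = 2" using that by auto
    then have "P k - gs k = pt (s + t) 0 \<or> P k - gs k = pt (s - t) t \<or> P k - gs k = pt s (- t)"
      by (elim disjE) (simp_all add: P_def gs_def pt_add)
    then have "dist (P k - gs k) (z - gs k) \<le> sqrt 3 * t" using that(2) unfolding Rx_def by auto
    then show ?thesis by (simp add: dist_norm)
  qed
  have "dist (P i) (P j) \<le> 2 * sqrt 3 * t" using d[OF ij(1) z(1)] d[OF ij(2) z(2)] dist_triangle2[of "P i" "P j" z] by simp
  then have "(dist (P i) (P j))\<^sup>2 \<le> (2 * sqrt 3 * t)\<^sup>2" by (rule power_mono) simp
  then have le: "(dist (P i) (P j))\<^sup>2 \<le> 12 * t\<^sup>2" by (simp add: power_mult_distrib)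
  have nn: "(dist (pt x y) (pt x' y'))\<^sup>2 = (x - x')\<^sup>2 + (x - x') * (y - y') + (y - y')\<^sup>2" for x y x' y'
    unfolding dist_norm pt_add by (simp add: norm_mult c norm_Zc)
  have gt: "12 * t\<^sup>2 < 3 * (s + t)\<^sup>2"
  proof -
    have "(2 * t)\<^sup>2 < (s + t)\<^sup>2" using t by (intro power_strict_mono) auto
    then show ?thesis by (simp add: power_mult_distrib)
  qed
  have "i = 0 \<or> i = 1 \<or> i = 2" "j = 0 \<or> j = 1 \<or> j = 2" using ij by auto
  then show ?thesis
  proof (rule_tac ccontr)
    assume ne: "i \<noteq> j"
    have "(dist (P i) (P j))\<^sup>2 = 3 * (s + t)\<^sup>2"
      using \<open>i = 0 \<or> i = 1 \<or> i = 2\<close> \<open>j = 0 \<or> j = 1 \<or> j = 2\<close> ne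
      by (elim disjE) (simp_all add: P_def nn, simp_all add: power2_eq_square algebra_simps)
    then show False using le gt by simp
  qed
qed

end

text \<open>What the competitor needs to know about the arcs: end points, speed, position relative
  to \<open>Rx\<close> and the hexagon, and that they bound \<open>Rx\<close> in the sense of Cauchy
  integrals.\<close>

locale honeycomb_arcs = honeycomb_cut +
  fixes ell :: real
  assumes der: "i < 3 \<Longrightarrow> (Ar i has_vector_derivative Ar' i \<tau>) (at \<tau>)" and contd: "i < 3 \<Longrightarrow> continuous_on UNIV (Ar' i)"
    and ends: "Ar 0 0 = pt (s - t) t" "Ar 0 1 = pt s (- t)" "Ar 1 0 = pt s (- t)" "Ar 1 1 = pt (s + t) 0" "Ar 2 0 = pt (s + t) 0" "Ar 2 1 = pt (s - t) t"
    and img: "i < 3 \<Longrightarrow> \<tau> \<in> {0..1} \<Longrightarrow> Ar i \<tau> \<in> Rx \<and> Ar i \<tau> + gs i \<in> Hx"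
    and loop: "AE z in lebesgue. (\<Sum>i<3. wk (Ar i) (Ar' i) z) = 2 * of_real pi * \<i> * indicator Rx z"
    and speed: "i < 3 \<Longrightarrow> norm (Ar' i \<tau>) \<le> ell"
begin

lemma Ar_cont: "i < 3 \<Longrightarrow> continuous_on UNIV (Ar i)"
  using der by (intro continuous_at_imp_continuous_on ballI) (blast intro: has_vector_derivative_continuous)

definition Q :: "nat \<Rightarrow> complex set" where "Q i = Rx \<inter> (+) (- gs i) ` Hx"

text \<open>Boundary chain of the sector \<open>Q i\<close>: a radius from the centre of
  \<open>Rx\<close>, the arc, and a radius back.\<close>

definition qc :: "nat \<Rightarrow> complex \<Rightarrow> complex" where
  "qc i z = wseg (pt s 0) (Ar i 0) z + wk (Ar i) (Ar' i) z + wseg (Ar i 1) (pt s 0) z"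

lemma Q_mem: "z \<in> Q i \<longleftrightarrow> z \<in> Rx \<and> z + gs i \<in> Hx"
  unfolding Q_def Int_iff mem_translate by simp

lemma Q_convex: "convex (Q i)" and Q_closed: "closed (Q i)"
proof -
  show "convex (Q i)" unfolding Q_def by (intro convex_Int Rx_convex convex_translation Hx_convex)
  show "closed (Q i)" unfolding Q_def by (intro closed_Int compact_imp_closed Rx_compact compact_translation Hx_compact)
qed

lemma corner_Rx: "pt s 0 \<in> Rx"
proof -
  have d: "dist (pt x y) (pt s 0) = norm (Zc (x - s) y)" for x y unfolding dist_norm pt_add by (simp add: norm_mult c)
  have w: "norm w6 = 1" "norm (w6 - 1) = 1" unfolding w6_powers(1)[symmetric] by simp_all
  have "Zc t 0 = of_real t" "Zc (- t) t = of_real t * (w6 - 1)" "Zc 0 (- t) = - of_real t * w6" by (simp_all add: Zc_def algebra_simps)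
  then have "norm (Zc t 0) = t" "norm (Zc (- t) t) = t" "norm (Zc 0 (- t)) = t" using t w by (simp_all add: norm_mult)
  moreover have "1 * t \<le> sqrt 3 * t" using t by (intro mult_right_mono) simp_all
  ultimately show ?thesis unfolding Rx_def by (simp add: d)
qed

lemma corner_Q: "pt s 0 \<in> Q i"
proof -
  have "pt s 0 + gs i = pt s 0 \<or> pt s 0 + gs i = pt (- s) s \<or> pt s 0 + gs i = pt 0 (- s)" unfolding gs_def by (simp add: pt_add)
  then show ?thesis unfolding Q_mem using corner_Rx s0 by (auto simp: Hx_def co_pt)
qed

lemma sector_outside:
  assumes i: "i < 3" and z: "z \<notin> Q i"
  shows "qc i z = 0"
proof (rule primitive_outside_convex[OF Q_closed Q_convex z])
  fix F :: "complex \<Rightarrow> complex"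
  assume F: "\<And>\<gamma> \<gamma>'. (\<And>t. (\<gamma> has_vector_derivative \<gamma>' t) (at t)) \<Longrightarrow> continuous_on UNIV \<gamma>' \<Longrightarrow> \<gamma> ` {0..1} \<subseteq> Q i \<Longrightarrow>
       wk \<gamma> \<gamma>' z = F (\<gamma> 1) - F (\<gamma> 0)"
  have A: "Ar i ` {0..1} \<subseteq> Q i" using img[OF i] by (auto simp: Q_mem)
  have e: "Ar i 0 \<in> Q i" "Ar i 1 \<in> Q i" using A by auto
  have sg: "wseg a b z = F b - F a" if "a \<in> Q i" "b \<in> Q i" for a b
  proof -
    have "seg a b ` {0..1} \<subseteq> Q i" unfolding seg_image using closed_segment_subset[OF that Q_convex] .
    from F[OF seg_has_vector_derivative _ this] show ?thesis by simp
  qed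
  have "wk (Ar i) (Ar' i) z = F (Ar i 1) - F (Ar i 0)" by (rule F[OF der[OF i] contd[OF i] A])
  then show "qc i z = 0" unfolding qc_def sg[OF corner_Q e(1)] sg[OF e(2) corner_Q] by simp
qed

lemma sector_sum: "(\<Sum>i<3. qc i z) = (\<Sum>i<3. wk (Ar i) (Ar' i) z)"
  unfolding sum_lt3 qc_def ends wseg_reverse[of "pt s 0" "pt s (- t)"] wseg_reverse[of "pt s 0" "pt (s + t) 0"] wseg_reverse[of "pt s 0" "pt (s - t) t"]
  by simp

lemma Q_unique:
  assumes u: "\<exists>!g. g \<in> Gh \<and> z - g \<in> Hx" and ij: "i < 3" "j < 3" "z \<in> Q i" "z \<in> Q j"
  shows "i = j"
proof -
  have "- gs k \<in> Gh" for k using gs_mem[of k] unfolding Gh_def by (rule lat_group(3))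
  moreover have "z - - gs i \<in> Hx" "z - - gs j \<in> Hx" using ij by (simp_all add: Q_mem)
  ultimately have "- gs i = - gs j" using u by blast
  then show ?thesis using gs_inj ij by simp
qed

text \<open>Each \<open>qc i\<close> vanishes outside its convex sector. Almost every point lies in
  at most one sector, because translated hexagons do not overlap, and the three chains add up to the
  boundary of \<open>Rx\<close>; so the one remaining value is \<open>2 * pi * i\<close>, with no
  winding number computed.\<close>

lemma sector_chain: "AE z in lebesgue. \<forall>i<3. qc i z = 2 * of_real pi * \<i> * indicator (Q i) z"
  using hexagon_tiling loop
proof eventually_elim
  case (elim z)
  show ?case
  proof (intro allI impI)
    fix i :: nat assume i: "i < 3"
    show "qc i z = 2 * of_real pi * \<i> * indicator (Q i) z"
    proof (cases "z \<in> Q i")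
      case True
      have "qc j z = (if j = i then qc i z else 0)" if "j < 3" for j
        using sector_outside[OF that] Q_unique[OF elim(1) that i _ True] by auto
      then have "(\<Sum>j<3. qc j z) = (\<Sum>j<3. if j = i then qc i z else 0)" by (intro sum.cong) auto
      then have "(\<Sum>j<3. qc j z) = qc i z" using i by simp
      moreover have "(\<Sum>j<3. qc j z) = 2 * of_real pi * \<i> * indicator Rx z" unfolding sector_sum using elim(2) .
      ultimately show ?thesis using True by (simp add: Q_mem)
    next
      case False then show ?thesis using sector_outside[OF i] by simp
    qed
  qed
qed

text \<open>Read off from the chains: at a point of \<open>Rx\<close> the sum of the
  \<open>qc i\<close> is nonzero, so some term is, and its sector contains the point.\<close>

lemma Rx_covered: "AE z in lebesgue. z \<in> Rx \<longrightarrow> (\<exists>i<3. z + gs i \<in> Hx)"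
  using loop
proof eventually_elim
  case (elim z)
  show ?case
  proof
    assume z: "z \<in> Rx"
    have "(\<Sum>i<3. qc i z) \<noteq> 0" unfolding sector_sum elim using z by simp
    have "\<exists>i<3. qc i z \<noteq> 0"
    proof (rule ccontr)
      assume "\<not> (\<exists>i<3. qc i z \<noteq> 0)"
      then have "(\<Sum>i<3. qc i z) = 0" by (intro sum.neutral) auto
      then show False using \<open>(\<Sum>i<3. qc i z) \<noteq> 0\<close> by contradiction
    qed
    then obtain i where "i < 3" "qc i z \<noteq> 0" by blast
    then have "z \<in> Q i" using sector_outside by blast
    then show "\<exists>i<3. z + gs i \<in> Hx" using \<open>i < 3\<close> Q_mem by blast
  qed
qed

lemma Cx_indicator: "(indicator Cx z :: complex) = indicator Hx z - (\<Sum>i<3. indicator (Q i) (z - gs i))"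
proof (cases "z \<in> Hx \<and> (\<exists>i<3. z - gs i \<in> Rx)")
  case True
  then obtain i where i: "i < 3" "z - gs i \<in> Rx" "z \<in> Hx" by blast
  have "indicator (Q j) (z - gs j) = (if j = i then 1 else 0 :: complex)" if "j < 3" for j
  proof (cases "j = i")
    case True then show ?thesis using i by (simp add: Q_mem)
  next
    case False then show ?thesis using Rx_disjoint[OF that i(1) _ i(2)] by (auto simp: Q_mem indicator_def)
  qed
  then have "(\<Sum>j<3. indicator (Q j) (z - gs j)) = (\<Sum>j<3. if j = i then 1 else 0 :: complex)" by (intro sum.cong) auto
  then have "(\<Sum>j<3. indicator (Q j) (z - gs j)) = (1 :: complex)" using i by simp
  moreover have "z \<notin> Cx" using i by (auto simp: Cx_def mem_translate)
  ultimately show ?thesis using i by simp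
next
  case False
  then have "z - gs i \<notin> Q i" if "i < 3" for i using that by (auto simp: Q_mem)
  then have "(\<Sum>j<3. indicator (Q j) (z - gs j)) = (0 :: complex)" by (intro sum.neutral) auto
  moreover have "z \<in> Cx \<longleftrightarrow> z \<in> Hx" using False by (auto simp: Cx_def mem_translate)
  ultimately show ?thesis by (simp add: indicator_def)
qed

lemma edge_split:
  assumes z: "z \<notin> closed_segment a b" and e: "c' = a + of_real r * (b - a)" "0 \<le> r" "r \<le> 1"
  shows "wseg a b z = wseg a c' z + wseg c' b z"
proof (rule wseg_split[OF z])
  have "c' = seg a b r" using e by (simp add: seg_def)
  then show "c' \<in> closed_segment a b" unfolding seg_image[symmetric] using e by auto
qed

text \<open>This is \<open>hexagon_chain\<close> minus the three sector chains. The radii of the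
  sectors lie on sides of the hexagon, which are split at distance \<open>t\<close> from the cut
  corners, and cancel there.\<close>

theorem cut_chain:
  "AE z in lebesgue. wseg (pt (s - t) t) (pt 0 s) z + wseg (pt 0 s) (pt (t - s) s) z + wseg (pt (- s) (s - t)) (pt (- s) 0) z
     + wseg (pt (- s) 0) (pt (- t) (t - s)) z + wseg (pt t (- s)) (pt s (- s)) z + wseg (pt s (- s)) (pt s (- t)) z
     - (\<Sum>i<3. wk (Ar i) (Ar' i) (z - gs i)) = 2 * of_real pi * \<i> * indicator Cx z"
proof -
  have "AE z in lebesgue. \<forall>i<3. qc i (z - gs 0) = 2 * of_real pi * \<i> * indicator (Q i) (z - gs 0)" 
    "AE z in lebesgue. \<forall>i<3. qc i (z - gs 1) = 2 * of_real pi * \<i> * indicator (Q i) (z - gs 1)"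
    "AE z in lebesgue. \<forall>i<3. qc i (z - gs 2) = 2 * of_real pi * \<i> * indicator (Q i) (z - gs 2)" by (rule AE_translate[OF sector_chain])+
  then show ?thesis using hexagon_chain AE_not_segment[of "pt s 0" "pt 0 s"] AE_not_segment[of "pt 0 s" "pt (- s) s"] AE_not_segment[of "pt (- s) s" "pt (- s) 0"]
     AE_not_segment[of "pt (- s) 0" "pt 0 (- s)"] AE_not_segment[of "pt 0 (- s)" "pt s (- s)"] AE_not_segment[of "pt s (- s)" "pt s 0"]
  proof eventually_elim
    case (elim z)
    define r where "r = t / s"
    have r: "0 \<le> r" "r \<le> 1" "0 \<le> 1 - r" "1 - r \<le> 1" "s * r = t" using t by (auto simp: r_def)
    have sp: "pt x y + of_real q * (pt x' y' - pt x y) = pt (x + q * (x' - x)) (y + q * (y' - y))" for x y x' y' q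
      unfolding pt_add(3) by (simp add: pt_def Zc_def algebra_simps)
    have q: "(1 - r) * s = s - t" "r * s = t" using r(5) by (simp_all add: algebra_simps)
    have e1: "pt (s - t) t = pt s 0 + of_real r * (pt 0 s - pt s 0)" unfolding sp using q by simp
    have e2: "pt (t - s) s = pt 0 s + of_real (1 - r) * (pt (- s) s - pt 0 s)" unfolding sp using q by simp
    have e3: "pt (- s) (s - t) = pt (- s) s + of_real r * (pt (- s) 0 - pt (- s) s)" unfolding sp using q by simp
    have e4: "pt (- t) (t - s) = pt (- s) 0 + of_real (1 - r) * (pt 0 (- s) - pt (- s) 0)" unfolding sp using q by simp
    have e5: "pt t (- s) = pt 0 (- s) + of_real r * (pt s (- s) - pt 0 (- s))" unfolding sp using q by simp
    have e6: "pt s (- t) = pt s (- s) + of_real (1 - r) * (pt s 0 - pt s (- s))" unfolding sp using q by simp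
    note S = edge_split[OF elim(5) e1 r(1,2)] edge_split[OF elim(6) e2 r(3,4)] edge_split[OF elim(7) e3 r(1,2)]
      edge_split[OF elim(8) e4 r(3,4)] edge_split[OF elim(9) e5 r(1,2)] edge_split[OF elim(10) e6 r(3,4)]
    have g: "gs 0 = 0" "gs 1 = c * Zc (- 2 * s) s" "gs 2 = c * Zc (- s) (- s)" by (simp_all add: gs_def)
    have q0: "qc 0 (z - gs 0) = wseg (pt s 0) (pt (s - t) t) z + wk (Ar 0) (Ar' 0) (z - gs 0) + wseg (pt s (- t)) (pt s 0) z"
      unfolding qc_def ends wseg_translate unfolding g by simp
    have q1: "qc 1 (z - gs 1) = wseg (pt (- s) s) (pt (- s) (s - t)) z + wk (Ar 1) (Ar' 1) (z - gs 1) + wseg (pt (t - s) s) (pt (- s) s) z"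
      unfolding qc_def ends wseg_translate unfolding g pt_add by simp
    have q2: "qc 2 (z - gs 2) = wseg (pt 0 (- s)) (pt t (- s)) z + wk (Ar 2) (Ar' 2) (z - gs 2) + wseg (pt (- t) (t - s)) (pt 0 (- s)) z"
      unfolding qc_def ends wseg_translate unfolding g pt_add by simp
    have qq: "qc 0 (z - gs 0) = 2 * of_real pi * \<i> * indicator (Q 0) (z - gs 0)" "qc 1 (z - gs 1) = 2 * of_real pi * \<i> * indicator (Q 1) (z - gs 1)"
      "qc 2 (z - gs 2) = 2 * of_real pi * \<i> * indicator (Q 2) (z - gs 2)" using elim(1-3) by (auto dest: spec[of _ 0] spec[of _ 1] spec[of _ 2])
    have "2 * of_real pi * \<i> * indicator Cx z = 2 * of_real pi * \<i> * indicator Hx z - (qc 0 (z - gs 0) + qc 1 (z - gs 1) + qc 2 (z - gs 2))"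
      unfolding Cx_indicator sum_lt3 qq by (simp only: right_diff_distrib distrib_left)
    also have "\<dots> = wseg (pt (s - t) t) (pt 0 s) z + wseg (pt 0 s) (pt (t - s) s) z + wseg (pt (- s) (s - t)) (pt (- s) 0) z
     + wseg (pt (- s) 0) (pt (- t) (t - s)) z + wseg (pt t (- s)) (pt s (- s)) z + wseg (pt s (- s)) (pt s (- t)) z
     - (\<Sum>i<3. wk (Ar i) (Ar' i) (z - gs i))"
      unfolding elim(4)[symmetric] S q0 q1 q2 sum_lt3 by (simp only: diff_conv_add_uminus minus_add_distrib add_ac) simp
    finally show ?case by simp
  qed
qed

lemma Rx_sets: "Rx \<in> sets lebesgue" and Cx_sets: "Cx \<in> sets lebesgue"
proof -
  have b: "Hx \<in> sets borel" "\<And>g. (+) g ` Rx \<in> sets borel" "Rx \<in> sets borel"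
    by (intro borel_closed compact_imp_closed compact_translation Hx_compact Rx_compact)+
  then have "Cx \<in> sets borel" unfolding Cx_def by (intro sets.Diff sets.finite_UN) auto
  then show "Rx \<in> sets lebesgue" "Cx \<in> sets lebesgue" using b by (simp_all add: sets_completionI_sets)
qed

definition tile :: "nat \<Rightarrow> complex set" where "tile k = (if k = 1 then Rx else Cx)"

lemma Gh_det: "Im (cnj (c * Zc s s) * (c * Zc (- s) (2 * s))) = 3 * sqrt 3 / 2 * s\<^sup>2"
  unfolding Im_c Im_Zc by (simp add: power2_eq_square)

text \<open>Every translate of \<open>Rx\<close> is shared by three hexagons. A point is first
  assigned to its hexagon; it then belongs to exactly one of the three translates of
  \<open>Rx\<close> removed from it, or to the remainder.\<close>

theorem cut_tiling: "periodic_2tiling Gh tile"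
proof (rule tilingI)
  show "plane_lattice Gh" unfolding Gh_def by (rule plane_lattice_lat) (unfold Gh_det, use s0 in simp)
  show "tile 1 \<in> sets lebesgue" "tile 2 \<in> sets lebesgue" by (simp_all add: tile_def Rx_sets Cx_sets)
  have "countable Gh" unfolding Gh_def by (rule lat_countable)
  then have "AE z in lebesgue. \<forall>g\<in>Gh. z - g \<in> Rx \<longrightarrow> (\<exists>i<3. z - g + gs i \<in> Hx)"
    unfolding AE_ball_countable[OF \<open>countable Gh\<close>] using AE_translate[OF Rx_covered] by blast
  then show "AE z in lebesgue. \<exists>!x. x \<in> {1,2} \<times> Gh \<and> z - snd x \<in> tile (fst x)"
    using hexagon_tiling
  proof eventually_elim
    case (elim z)
    obtain h where h: "h \<in> Gh" "z - h \<in> Hx" and hu: "\<And>g. g \<in> Gh \<Longrightarrow> z - g \<in> Hx \<Longrightarrow> g = h" using elim(2) by blast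
    have one: "\<exists>i<3. g = h + gs i \<and> z - h - gs i \<in> Rx" if g: "g \<in> Gh" "z - g \<in> Rx" for g
    proof -
      obtain i where i: "i < 3" "z - g + gs i \<in> Hx" using elim(1) g by blast
      then have "g - gs i = h" using hu[of "g - gs i"] Gh_group(2)[OF g(1) gs_mem] by (simp add: algebra_simps)
      then have "g = h + gs i" by (simp add: algebra_simps)
      then show ?thesis using i g(2) by (auto simp: algebra_simps)
    qed
    have Cx_h: "z - g \<in> Cx \<longleftrightarrow> g = h \<and> (\<forall>i<3. z - h - gs i \<notin> Rx)" if "g \<in> Gh" for g
      using hu[OF that] h by (auto simp: Cx_def mem_translate)
    show ?case
    proof (cases "\<exists>i<3. z - h - gs i \<in> Rx")
      case True
      then obtain i where i: "i < 3" "z - h - gs i \<in> Rx" by blast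
      show ?thesis
      proof (rule ex1I[of _ "(1, h + gs i)"])
        show "(1, h + gs i) \<in> {1,2} \<times> Gh \<and> z - snd (1, h + gs i) \<in> tile (fst (1, h + gs i))"
          using i Gh_group(1)[OF h(1) gs_mem] by (simp add: tile_def algebra_simps)
        fix x :: "nat \<times> complex" assume x: "x \<in> {1,2} \<times> Gh \<and> z - snd x \<in> tile (fst x)"
        obtain k g where kg: "x = (k, g)" by (cases x)
        show "x = (1, h + gs i)"
        proof (cases "k = 1")
          case True
          then have "g \<in> Gh" "z - g \<in> Rx" using x kg by (auto simp: tile_def)
          then obtain j where j: "j < 3" "g = h + gs j" "z - h - gs j \<in> Rx" using one by blast
          have "j = i" by (rule Rx_disjoint[OF j(1) i(1) j(3) i(2)])
          then show ?thesis using kg True j by simp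
        next
          case False
          then have "g \<in> Gh" "z - g \<in> Cx" using x kg by (auto simp: tile_def)
          then show ?thesis using Cx_h i by blast
        qed
      qed
    next
      case False
      show ?thesis
      proof (rule ex1I[of _ "(2, h)"])
        show "(2, h) \<in> {1,2} \<times> Gh \<and> z - snd (2, h) \<in> tile (fst (2, h))" using Cx_h[OF h(1)] False h by (auto simp: tile_def)
        fix x :: "nat \<times> complex" assume x: "x \<in> {1,2} \<times> Gh \<and> z - snd x \<in> tile (fst x)"
        obtain k g where kg: "x = (k, g)" by (cases x)
        show "x = (2, h)"
        proof (cases "k = 1")
          case True
          then have "g \<in> Gh" "z - g \<in> Rx" using x kg by (auto simp: tile_def)
          then show ?thesis using one False by blast
        next
          case k: False
          then have "k = 2" "g \<in> Gh" "z - g \<in> Cx" using x kg by (auto simp: tile_def)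
          then show ?thesis using Cx_h kg by blast
        qed
      qed
    qed
  qed
qed

text \<open>The total area comes from the covolume of the tiling, so nothing is integrated over the
  cut hexagon.\<close>

theorem cut_area: "measure lebesgue Rx + measure lebesgue Cx = 3 * sqrt 3 / 2 * s\<^sup>2" "Rx \<in> lmeasurable" "Cx \<in> lmeasurable"
proof -
  have "bounded (Rx \<union> Hx)" using Rx_compact Hx_compact by (simp add: compact_imp_bounded)
  then obtain M where M: "\<And>z. z \<in> Rx \<union> Hx \<Longrightarrow> norm z \<le> M" unfolding bounded_iff by blast
  have bd: "norm z \<le> M" if "z \<in> tile k" for z k using that M[of z] by (auto simp: tile_def Cx_def split: if_splits)
  interpret bt: bounded_tiling "c * Zc s s" "c * Zc (- s) (2 * s)" tile M
    by unfold_locales (unfold Gh_det, use s0 cut_tiling bd in \<open>auto simp: Gh_def\<close>)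
  show "measure lebesgue Rx + measure lebesgue Cx = 3 * sqrt 3 / 2 * s\<^sup>2" using bt.covolume unfolding Gh_det by (simp add: tile_def)
  have "bounded Rx" "bounded Cx" using M by (auto simp: bounded_iff Cx_def)
  then show "Rx \<in> lmeasurable" "Cx \<in> lmeasurable" using Rx_sets Cx_sets by (blast intro: bounded_set_imp_lmeasurable)+
qed

lemma Rx_perimeter: "perimeter Rx \<le> ereal (3 * ell)"
proof -
  have "has_boundary {..<3} Ar Ar' Rx" unfolding has_boundary_def using Ar_cont contd loop by auto
  from perimeter_le_length[OF this Rx_sets, of "\<lambda>_. ell"] show ?thesis using speed by simp
qed

lemma Cx_perimeter: "perimeter Cx \<le> ereal (6 * (s - t) + 3 * ell)"
proof -
  \<comment> \<open>Start points of the six straight edges, in the order of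
    \<open>cut_chain\<close>; the indices 6 to 8 are left for the reversed arcs.\<close>
  define a where "a = (!) [pt (s - t) t, pt 0 s, pt (- s) (s - t), pt (- s) 0, pt t (- s), pt s (- s)]"
  define b where "b = (!) [pt 0 s, pt (t - s) s, pt (- s) 0, pt (- t) (t - s), pt s (- s), pt s (- t)]"
  define \<gamma> where "\<gamma> k = (if k < 6 then seg (a k) (b k) else (\<lambda>\<tau>. Ar (k - 6) (1 - \<tau>) + gs (k - 6)))" for k
  define \<gamma>' where "\<gamma>' k = (if k < 6 then (\<lambda>_. b k - a k) else (\<lambda>\<tau>. - Ar' (k - 6) (1 - \<tau>)))" for k
  have wa: "wk (\<gamma> k) (\<gamma>' k) z = - wk (Ar (k - 6)) (Ar' (k - 6)) (z - gs (k - 6))" if "6 \<le> k" for k z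
  proof -
    have "\<gamma> k = (\<lambda>\<tau>. Ar (k - 6) (1 - \<tau>) + gs (k - 6))" "\<gamma>' k = (\<lambda>\<tau>. - Ar' (k - 6) (1 - \<tau>))" using that by (auto simp: \<gamma>_def \<gamma>'_def)
    then show ?thesis by (simp only: wk_translate[of "\<lambda>\<tau>. Ar (k - 6) (1 - \<tau>)"] wk_reverse[of "Ar (k - 6)" "Ar' (k - 6)"])
  qed
  have ws: "wk (\<gamma> k) (\<gamma>' k) z = wseg (a k) (b k) z" if "k < 6" for k z using that by (simp add: \<gamma>_def \<gamma>'_def)
  have sum: "(\<Sum>k<9. wk (\<gamma> k) (\<gamma>' k) z) = wseg (pt (s - t) t) (pt 0 s) z + wseg (pt 0 s) (pt (t - s) s) z + wseg (pt (- s) (s - t)) (pt (- s) 0) z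
     + wseg (pt (- s) 0) (pt (- t) (t - s)) z + wseg (pt t (- s)) (pt s (- s)) z + wseg (pt s (- s)) (pt s (- t)) z
     - (\<Sum>i<3. wk (Ar i) (Ar' i) (z - gs i))" for z
    unfolding sum_lt9 sum_lt3 by (simp add: wa ws) (simp add: a_def b_def)
  have cr: "continuous_on UNIV (\<lambda>\<tau>::real. f (1 - \<tau>))" if "continuous_on UNIV f" for f :: "real \<Rightarrow> complex"
    by (rule continuous_on_compose2[OF that]) (auto intro: continuous_intros)
  have "has_boundary {..<9} \<gamma> \<gamma>' Cx"
    unfolding has_boundary_def
  proof (intro conjI ballI)
    fix k :: nat assume k: "k \<in> {..<9}"
    then have k6: "\<not> k < 6 \<Longrightarrow> k - 6 < 3" by auto
    have "continuous_on UNIV (\<lambda>\<tau>. Ar (k - 6) (1 - \<tau>) + gs (k - 6))" "continuous_on UNIV (\<lambda>\<tau>. - Ar' (k - 6) (1 - \<tau>))" if "\<not> k < 6"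
      using cr[OF Ar_cont[OF k6[OF that]]] cr[OF contd[OF k6[OF that]]] by (simp_all add: continuous_on_add continuous_on_minus)
    then show "continuous_on UNIV (\<gamma> k)" "continuous_on UNIV (\<gamma>' k)" unfolding \<gamma>_def \<gamma>'_def by (simp_all add: seg_continuous)
  next
    show "AE z in lebesgue. (\<Sum>k<9. wk (\<gamma> k) (\<gamma>' k) z) = 2 * of_real pi * \<i> * indicator Cx z" unfolding sum by (rule cut_chain)
  qed simp
  moreover have "norm (\<gamma>' k \<tau>) \<le> (if k < 6 then s - t else ell)" if "k \<in> {..<9}" for k \<tau>
  proof (cases "k < 6")
    case True
    have len: "norm (pt x y - pt x' y') = s - t" if "(x - x')\<^sup>2 + (x - x') * (y - y') + (y - y')\<^sup>2 = (s - t)\<^sup>2" for x y x' y'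
    proof -
      have "(norm (pt x y - pt x' y'))\<^sup>2 = (s - t)\<^sup>2" unfolding pt_add(3) using that by (simp add: norm_mult c norm_Zc)
      then show ?thesis using t by (simp add: power2_eq_iff_nonneg)
    qed
    have len1: "norm (pt 0 s - pt (s - t) t) = s - t" "norm (pt (t - s) s - pt 0 s) = s - t" "norm (pt (- s) 0 - pt (- s) (s - t)) = s - t"
      "norm (pt (- t) (t - s) - pt (- s) 0) = s - t" "norm (pt s (- s) - pt t (- s)) = s - t" "norm (pt s (- t) - pt s (- s)) = s - t"
      by (rule len, simp add: power2_eq_square algebra_simps)+
    have "k = 0 \<or> k = 1 \<or> k = 2 \<or> k = 3 \<or> k = 4 \<or> k = 5" using True by auto
    then have "norm (b k - a k) = s - t"
      by (elim disjE) (simp_all add: a_def b_def len1)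
    then show ?thesis using True by (simp add: \<gamma>'_def)
  next
    case False
    then show ?thesis using that speed[of "k - 6"] by (auto simp: \<gamma>'_def)
  qed
  ultimately have "perimeter Cx \<le> ereal (\<Sum>k<9. if k < (6::nat) then s - t else ell)" by (rule perimeter_le_length[OF _ Cx_sets])
  then show ?thesis unfolding sum_lt9 by (simp add: algebra_simps)
qed

end

section \<open>The arcs of the given tile in the honeycomb frame\<close>

lemma Zc_mult: "Zc x y * Zc x' y' = Zc (x * x' - y * y') (x * y' + y * x' + y * y')"
proof -
  have "Zc x y * Zc x' y' = of_real (x * x') + of_real (x * y' + y * x') * w6 + of_real (y * y') * (w6 * w6)" by (simp add: Zc_def algebra_simps)
  then show ?thesis unfolding w6_sq by (simp add: Zc_def algebra_simps)
qed

text \<open>In this sixth of the circle both Eisenstein coordinates are nonnegative and satisfy one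
  quadratic equation, so the inclusion of arcs in discs and strips becomes a set of polynomial
  inequalities.\<close>

lemma cis_Zc:
  assumes "0 \<le> \<phi>" "\<phi> \<le> pi / 3"
  obtains x y where "cis \<phi> = Zc x y" "0 \<le> x" "0 \<le> y" "x\<^sup>2 + x * y + y\<^sup>2 = 1" "x \<le> 1" "y \<le> 1" "1 \<le> x + y"
proof -
  define x y where "x = cos \<phi> - sin \<phi> / sqrt 3" and "y = 2 * sin \<phi> / sqrt 3"
  have e: "cis \<phi> = Zc x y" unfolding Zc_def w6_eq x_def y_def by (simp add: complex_eq_iff)
  have y0: "0 \<le> y" using assms by (auto simp: y_def intro!: divide_nonneg_nonneg mult_nonneg_nonneg sin_ge_zero)
  have "0 \<le> sin (pi / 3 - \<phi>)" using assms by (intro sin_ge_zero) auto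
  then have "0 \<le> sqrt 3 * cos \<phi> - sin \<phi>" unfolding sin_diff sin_60 cos_60 by simp
  then have "0 \<le> (sqrt 3 * cos \<phi> - sin \<phi>) / sqrt 3" by (rule divide_nonneg_nonneg) simp
  then have x0: "0 \<le> x" by (simp add: x_def diff_divide_distrib)
  have q: "x\<^sup>2 + x * y + y\<^sup>2 = 1" unfolding norm_Zc[symmetric] e[symmetric] by simp
  have xy: "0 \<le> x * y" using x0 y0 by simp
  have "x\<^sup>2 \<le> 1\<^sup>2" "y\<^sup>2 \<le> 1\<^sup>2" using q xy zero_le_power2[of x] zero_le_power2[of y] unfolding one_power2 by linarith+
  then have 1: "x \<le> 1" "y \<le> 1" by (auto intro: power2_le_imp_le)
  have "(x + y)\<^sup>2 = (x\<^sup>2 + x * y + y\<^sup>2) + x * y" by (simp add: power2_eq_square algebra_simps)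
  then have "1\<^sup>2 \<le> (x + y)\<^sup>2" unfolding q using xy by simp
  then have "1 \<le> x + y" by (rule power2_le_imp_le) (use x0 y0 in simp)
  then show thesis using that e x0 y0 q 1 by blast
qed

lemma ae_eqI:
  assumes "S \<in> sets lebesgue" "T \<in> sets lebesgue" "AE z in lebesgue. z \<in> S \<longleftrightarrow> z \<in> T"
  shows "ae_eq S T"
proof -
  have "AE z in lebesgue. z \<notin> S - T" "AE z in lebesgue. z \<notin> T - S" using assms(3) by (auto elim!: eventually_mono)
  then show ?thesis unfolding ae_eq_def using assms(1,2) by (simp add: AE_iff_null_sets)
qed

context honeycomb_cut
begin

lemma dist_pt: "dist (pt x y) (pt x' y') \<le> sqrt 3 * t \<longleftrightarrow> (x - x')\<^sup>2 + (x - x') * (y - y') + (y - y')\<^sup>2 \<le> 3 * t\<^sup>2"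
proof -
  have "(dist (pt x y) (pt x' y'))\<^sup>2 = (x - x')\<^sup>2 + (x - x') * (y - y') + (y - y')\<^sup>2" unfolding dist_norm pt_add(3) by (simp add: norm_mult c norm_Zc)
  moreover have "(sqrt 3 * t)\<^sup>2 = 3 * t\<^sup>2" by (simp add: power_mult_distrib)
  moreover have "dist (pt x y) (pt x' y') \<le> sqrt 3 * t \<longleftrightarrow> (dist (pt x y) (pt x' y'))\<^sup>2 \<le> (sqrt 3 * t)\<^sup>2"
    using t by (intro power_mono_iff[symmetric]) auto
  ultimately show ?thesis by simp
qed

lemma psi_eq: "z0 + c * Zc x y = pt x y" by (simp add: pt_def)

lemma Hx_eq_image: "(\<lambda>z. z0 + c * z) ` reg_hexagon s = Hx"
proof -
  have six: "{complex_of_real s * cis (real k * pi / 3) | k. k < (6::nat)} = {Zc s 0, Zc 0 s, Zc (- s) s, Zc (- s) 0, Zc 0 (- s), Zc s (- s)}"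
  proof -
    have "cis (real k * pi / 3) = w6 ^ k" for k by (simp add: Complex.DeMoivre)
    then have "{complex_of_real s * cis (real k * pi / 3) | k. k < (6::nat)} = (\<lambda>k. of_real s * w6 ^ k) ` {..<6}" by auto
    also have "{..<6::nat} = {0, 1, 2, 3, 4, 5}" by auto
    finally show ?thesis by (simp only: image_insert image_empty w6_Zc Zc_simps(4)) (simp add: Zc_def)
  qed
  have "(\<lambda>z. z0 + c * z) ` reg_hexagon s = (+) z0 ` ((\<lambda>z. c * z) ` (convex hull {Zc s 0, Zc 0 s, Zc (- s) s, Zc (- s) 0, Zc 0 (- s), Zc s (- s)}))"
    unfolding reg_hexagon_def six image_image ..
  also have "\<dots> = convex hull ((+) z0 ` ((\<lambda>z. c * z) ` {Zc s 0, Zc 0 s, Zc (- s) s, Zc (- s) 0, Zc 0 (- s), Zc s (- s)}))"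
    unfolding convex_hull_translation convex_hull_linear_image[OF bounded_linear.linear[OF bounded_linear_mult_right]] ..
  also have "\<dots> = Hx" unfolding Hx_hull image_insert image_empty psi_eq ..
  finally show ?thesis .
qed

lemma cis_thirds: "j < 3 \<Longrightarrow> complex_of_real r * cis (2 * pi * real j / 3) = (if j = 0 then Zc r 0 else if j = 1 then Zc (- r) r else Zc 0 (- r))"
proof -
  assume "j < (3::nat)"
  then consider "j = 0" | "j = 1" | "j = 2" by linarith
  then show ?thesis
  proof cases
    case 3
    have "2 * pi * real j / 3 = 4 * pi / 3" using 3 by simp
    then show ?thesis using 3 w6_powers(2) by (simp add: Zc_def)
  next
    case 2
    have "2 * pi * real j / 3 = 2 * pi / 3" using 2 by simp
    then have e: "cis (2 * pi * real j / 3) = w6 - 1" by (simp only: w6_powers(1))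
    show ?thesis unfolding e using 2 by (simp add: Zc_def algebra_simps)
  qed (simp add: Zc_def)
qed

lemma gs_eq: "j < 3 \<Longrightarrow> gs j = c * (complex_of_real s * cis (2 * pi * real j / 3) - of_real s)"
  unfolding cis_thirds gs_def by (simp add: Zc_def algebra_simps)

lemma reuleaux_image: "(\<lambda>z. z0 + c * z) ` reuleaux_at p t = (+) (c * (p - of_real s)) ` Rx"
proof (rule set_eqI)
  fix z
  define w where "w = (z - z0) / c"
  have z: "z = z0 + c * w" using c0 by (simp add: w_def)
  have inj: "z \<in> (\<lambda>z. z0 + c * z) ` reuleaux_at p t \<longleftrightarrow> w \<in> reuleaux_at p t" unfolding z using c0 by auto
  have d: "dist (pt (s + x) y) (z - c * (p - of_real s)) = dist (p + Zc x y) w" for x y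
  proof -
    have "pt (s + x) y - (z - c * (p - of_real s)) = c * (p + Zc x y - w)" unfolding z pt_def Zc_def by (simp add: algebra_simps)
    then show ?thesis unfolding dist_norm by (simp add: norm_mult c)
  qed
  have L: "{..<3::nat} = {0, 1, 2}" by auto
  have "w \<in> reuleaux_at p t \<longleftrightarrow> dist (p + Zc t 0) w \<le> sqrt 3 * t \<and> dist (p + Zc (- t) t) w \<le> sqrt 3 * t \<and> dist (p + Zc 0 (- t)) w \<le> sqrt 3 * t"
    unfolding reuleaux_at_def L using cis_thirds[of 0 t] cis_thirds[of 1 t] cis_thirds[of 2 t] by simp
  also have "\<dots> \<longleftrightarrow> z - c * (p - of_real s) \<in> Rx" unfolding Rx_def Int_iff mem_cball d[symmetric] by auto
  finally show "z \<in> (\<lambda>z. z0 + c * z) ` reuleaux_at p t \<longleftrightarrow> z \<in> (+) (c * (p - of_real s)) ` Rx" unfolding inj mem_translate .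
qed

lemma Rx_eq_image: "(\<lambda>z. z0 + c * z) ` reuleaux_at (of_real s) t = Rx"
  unfolding reuleaux_image by simp

lemma Cx_eq_image: "(\<lambda>z. z0 + c * z) ` cut_hexagon s t = Cx"
proof -
  have inj: "inj (\<lambda>z. z0 + c * z)" using c0 by (auto intro!: injI)
  have "(\<lambda>z. z0 + c * z) ` cut_hexagon s t = Hx - (\<Union>j<3. (+) (c * (complex_of_real s * cis (2 * pi * real j / 3) - of_real s)) ` Rx)"
    unfolding cut_hexagon_def image_set_diff[OF inj] image_UN reuleaux_image Hx_eq_image ..
  also have "(\<Union>j<3. (+) (c * (complex_of_real s * cis (2 * pi * real j / 3) - of_real s)) ` Rx) = (\<Union>j<3. (+) (gs j) ` Rx)"
    by (intro SUP_cong refl) (simp add: gs_eq)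
  finally show ?thesis unfolding Cx_def .
qed

lemma Gh_eq_image: "(\<lambda>z. (z0 + c * z) - (z0 + c * 0)) ` honeycomb_lattice s = Gh"
proof -
  have c30: "of_real (sqrt 3 * s) * cis (pi / 6) = Zc s s" unfolding Zc_def w6_eq
    by (simp add: complex_eq_iff cos_30 sin_30)
  have i: "of_real (sqrt 3 * s) * \<i> = Zc (- s) (2 * s)"
  proof -
    have "of_real (sqrt 3 * s) * \<i> = of_real s * (\<i> * of_real (sqrt 3))" by simp
    then show ?thesis unfolding i_sqrt3 by (simp add: Zc_def algebra_simps)
  qed
  have hl: "honeycomb_lattice s = lat (Zc s s) (Zc (- s) (2 * s))"
    unfolding honeycomb_lattice_def lat_def mult.assoc c30 i ..
  have eq: "of_int m * (c * Zc s s) + of_int n * (c * Zc (- s) (2 * s)) = c * (of_int m * Zc s s + of_int n * Zc (- s) (2 * s))" for m n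
    by (simp add: algebra_simps)
  show ?thesis unfolding hl Gh_def lat_def eq by auto
qed

end

context enneagon_tiling
begin

text \<open>Direction from the centre of the hexagon to its corner \<open>cR\<close>. With this
  exponent \<open>p1 2\<close> is \<open>cR\<close> moved by \<open>tt\<close> in direction
  \<open>cc\<close>, as the end points in \<open>honeycomb_arcs\<close> demand.\<close>

definition "cc = D0 * w6 ^ 4"

lemma norm_cc: "norm cc = 1" by (simp add: cc_def norm_mult norm_power norm_D0)

lemma D0_cc: "D0 = cc * Zc (- 1) 1"
proof -
  have "cc * Zc (- 1) 1 = D0 * w6 ^ (4 + 2)" unfolding cc_def w6_Zc(1)[symmetric] power_add by simp
  then show ?thesis by (simp add: w6_powers(7))
qed

lemma D0_Zc: "D0 * Zc x y = cc * Zc (- x - y) x"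
  unfolding D0_cc mult.assoc Zc_mult by simp

lemma th_cc: "cis (\<theta>1 0) = cc * w6 ^ 4"
proof -
  have "cc * w6 ^ 4 = - (w6 * w6 ^ 4 * w6 ^ 4) * cis (\<theta>1 0)" by (simp add: cc_def D0_def)
  also have "w6 * w6 ^ 4 * w6 ^ 4 = - 1" unfolding w6_powers by (simp add: algebra_simps w6_sq)
  finally show ?thesis by simp
qed

lemma th1_pow: "i < 3 \<Longrightarrow> cis (\<theta>1 i) = cc * w6 ^ 4 * w6 ^ (2 * i)" and p1_pow: "i < 3 \<Longrightarrow> p1 i = cR + of_real tt * D0 * w6 ^ (2 * i)"
proof -
  assume "i < 3"
  then consider "i = 0" | "i = 1" | "i = 2" by linarith
  then show "cis (\<theta>1 i) = cc * w6 ^ 4 * w6 ^ (2 * i)"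
  proof cases
    case 1 then show ?thesis by (simp add: th_cc)
  next
    case 2
    have "cis (\<theta>1 1) = cc * w6 ^ 4 * w6\<^sup>2" unfolding th1_powers th_cc w6_powers(3) by (simp only: mult_ac)
    then show ?thesis using 2 by simp
  next
    case 3
    have "cis (\<theta>1 2) = cc * w6 ^ 4 * w6 ^ 4" unfolding th1_powers th_cc w6_powers(5) by (simp only: mult_ac)
    then show ?thesis using 3 by simp
  qed
  show "p1 i = cR + of_real tt * D0 * w6 ^ (2 * i)" if "i < 3"
  proof -
    from that consider "i = 0" | "i = 1" | "i = 2" by linarith
    then show ?thesis using cR_eq by cases simp_all
  qed
qed

lemma A_frame:
  assumes i: "i < 3" and \<tau>: "\<tau> \<in> {0..1}"
  obtains x y where "0 \<le> x" "0 \<le> y" "x\<^sup>2 + x * y + y\<^sup>2 = 1" "x \<le> 1" "y \<le> 1" "1 \<le> x + y"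
    "A i \<tau> = cR + cc * (of_real tt * (w6 ^ (2 * i) * Zc (1 - 2 * x - y) (x - y)))"
proof -
  have t0: "0 \<le> \<tau> * pi / 3" and t1: "\<tau> * pi / 3 \<le> pi / 3" using \<tau> by auto
  obtain x y where xy: "cis (\<tau> * pi / 3) = Zc x y" "0 \<le> x" "0 \<le> y" "x\<^sup>2 + x * y + y\<^sup>2 = 1" "x \<le> 1" "y \<le> 1" "1 \<le> x + y"
    by (rule cis_Zc[OF t0 t1])
  have ang: "cis (\<theta>1 i + K0 * (\<tau> * len1 i)) = cis (\<theta>1 i) * Zc x y"
  proof -
    have "\<theta>1 i + K0 * (\<tau> * len1 i) = \<theta>1 i + \<tau> * pi / 3" unfolding len1[OF i] using K0 by simp
    then show ?thesis by (simp only: cis_mult[symmetric] xy(1))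
  qed
  have "A i \<tau> = p1 i + (cis (\<theta>1 i) * Zc x y - cis (\<theta>1 i)) * (1 / (\<i> * of_real K0))" unfolding ccurve_def ang using K0 by simp
  also have "\<dots> = cR + cc * (of_real tt * (w6 ^ (2 * i) * (Zc (- 1) 1 + w6 ^ 4 * (1 - 2 * w6) * (Zc x y - 1))))"
    unfolding inv_iK0 th1_pow[OF i] p1_pow[OF i] D0_cc by (simp only: algebra_simps mult_1_left mult_1_right)
  also have "Zc (- 1) 1 + w6 ^ 4 * (1 - 2 * w6) * (Zc x y - 1) = Zc (1 - 2 * x - y) (x - y)"
  proof -
    have e: "1 - 2 * w6 = Zc 1 (- 2)" "Zc x y - 1 = Zc (x - 1) y" by (simp_all add: Zc_def)
    show ?thesis unfolding e w6_Zc Zc_mult Zc_simps(1) by (simp add: algebra_simps)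
  qed
  finally show thesis using that xy by blast
qed

context
  fixes s assumes s: "tt < s"
begin

interpretation hc: honeycomb_cut "cR - cc * of_real s" cc s tt A "\<lambda>i. cdir (\<theta>1 i) K0 (len1 i)"
  by unfold_locales (simp_all add: norm_cc tt_pos s)

lemma cR_pt: "cR + cc * Zc x y = hc.pt (s + x) y" unfolding hc.pt_def by (simp add: Zc_def algebra_simps)

lemma D0_pt: "cR + D0 * Zc x y = hc.pt (s - x - y) x"
  unfolding D0_Zc cR_pt by (rule arg_cong2[of _ _ _ _ hc.pt]) simp_all

lemma A_pt:
  assumes i: "i < 3" and \<tau>: "\<tau> \<in> {0..1}"
  obtains x y where "0 \<le> x" "0 \<le> y" "x\<^sup>2 + x * y + y\<^sup>2 = 1" "x \<le> 1" "y \<le> 1" "1 \<le> x + y"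
    "A i \<tau> = (if i = 0 then hc.pt (s + tt * (1 - 2 * x - y)) (tt * (x - y)) else if i = 1 then hc.pt (s + tt * (x + 2 * y - 1)) (tt * (1 - 2 * x - y))
      else hc.pt (s + tt * (x - y)) (tt * (x + 2 * y - 1)))"
proof (rule A_frame[OF i \<tau>])
  fix x y assume xy: "0 \<le> x" "0 \<le> y" "x\<^sup>2 + x * y + y\<^sup>2 = 1" "x \<le> 1" "y \<le> 1" "1 \<le> x + y"
    and A: "A i \<tau> = cR + cc * (of_real tt * (w6 ^ (2 * i) * Zc (1 - 2 * x - y) (x - y)))"
  from i consider "i = 0" | "i = 1" | "i = 2" by linarith
  then have "A i \<tau> = (if i = 0 then hc.pt (s + tt * (1 - 2 * x - y)) (tt * (x - y)) else if i = 1 then hc.pt (s + tt * (x + 2 * y - 1)) (tt * (1 - 2 * x - y))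
      else hc.pt (s + tt * (x - y)) (tt * (x + 2 * y - 1)))"
  proof cases
    case 1
    then show ?thesis unfolding A by (simp add: Zc_simps(4) cR_pt)
  next
    case 2
    have e: "w6 ^ (2 * i) = Zc (- 1) 1" using 2 w6_Zc(1) by simp
    show ?thesis unfolding A e Zc_mult Zc_simps(4) cR_pt using 2 by (simp add: algebra_simps)
  next
    case 3
    have e: "w6 ^ (2 * i) = Zc 0 (- 1)" using 3 w6_Zc(3) by simp
    show ?thesis unfolding A e Zc_mult Zc_simps(4) cR_pt using 3 by (simp add: algebra_simps)
  qed
  then show thesis using that xy by blast
qed

text \<open>\<open>N\<close> is the squared length in Eisenstein coordinates. Edge \<open>i\<close>
  keeps distance exactly \<open>sqrt 3 * tt\<close> from the opposite vertex, which also bars it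
  from the interior; the distances to the other two vertices are controlled by
  \<open>1 \<le> x + y\<close>.\<close>

lemma A_img:
  assumes i: "i < 3" and \<tau>: "\<tau> \<in> {0..1}"
  shows "A i \<tau> \<in> hc.Rx" "A i \<tau> + hc.gs i \<in> hc.Hx" "A i \<tau> \<notin> interior hc.Rx"
proof -
  obtain x y where xy: "0 \<le> x" "0 \<le> y" "x\<^sup>2 + x * y + y\<^sup>2 = 1" "x \<le> 1" "y \<le> 1" "1 \<le> x + y"
    and A: "A i \<tau> = (if i = 0 then hc.pt (s + tt * (1 - 2 * x - y)) (tt * (x - y)) else if i = 1 then hc.pt (s + tt * (x + 2 * y - 1)) (tt * (1 - 2 * x - y))
      else hc.pt (s + tt * (x - y)) (tt * (x + 2 * y - 1)))" by (rule A_pt[OF assms])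
  define N where "N a b = a\<^sup>2 + a * b + b\<^sup>2" for a b :: real
  have N3: "N (tt * (2 * x + y)) (tt * (y - x)) = 3 * tt\<^sup>2" "N (- tt * (x + 2 * y)) (tt * (2 * x + y)) = 3 * tt\<^sup>2" "N (tt * (y - x)) (- tt * (x + 2 * y)) = 3 * tt\<^sup>2"
  proof -
    have "N (tt * (2 * x + y)) (tt * (y - x)) = 3 * tt\<^sup>2 * (x\<^sup>2 + x * y + y\<^sup>2)" "N (- tt * (x + 2 * y)) (tt * (2 * x + y)) = 3 * tt\<^sup>2 * (x\<^sup>2 + x * y + y\<^sup>2)"
      "N (tt * (y - x)) (- tt * (x + 2 * y)) = 3 * tt\<^sup>2 * (x\<^sup>2 + x * y + y\<^sup>2)"
      unfolding N_def by (simp_all add: power2_eq_square algebra_simps)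
    then show "N (tt * (2 * x + y)) (tt * (y - x)) = 3 * tt\<^sup>2" "N (- tt * (x + 2 * y)) (tt * (2 * x + y)) = 3 * tt\<^sup>2" "N (tt * (y - x)) (- tt * (x + 2 * y)) = 3 * tt\<^sup>2"
      unfolding xy(3) by simp_all
  qed
  have q1: "3 * tt\<^sup>2 * ((x\<^sup>2 + x * y + y\<^sup>2) - 2 * x - y + 1) \<le> 3 * tt\<^sup>2" and q2: "3 * tt\<^sup>2 * ((x\<^sup>2 + x * y + y\<^sup>2) - x - 2 * y + 1) \<le> 3 * tt\<^sup>2"
    unfolding xy(3) using xy by (auto intro!: mult_left_le)
  have N1: "N (tt * (2 * x + y - 2)) (tt * (1 + y - x)) \<le> 3 * tt\<^sup>2" "N (tt * (1 - x - 2 * y)) (tt * (2 * x + y - 2)) \<le> 3 * tt\<^sup>2" "N (tt * (1 + y - x)) (tt * (1 - x - 2 * y)) \<le> 3 * tt\<^sup>2"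
    using q1 unfolding N_def by (simp_all add: power2_eq_square algebra_simps)
  have N2: "N (tt * (2 * x + y - 1)) (tt * (y - x - 1)) \<le> 3 * tt\<^sup>2" "N (tt * (2 - x - 2 * y)) (tt * (2 * x + y - 1)) \<le> 3 * tt\<^sup>2" "N (tt * (y - x - 1)) (tt * (2 - x - 2 * y)) \<le> 3 * tt\<^sup>2"
    using q2 unfolding N_def by (simp_all add: power2_eq_square algebra_simps)
  have dN: "dist (hc.pt a b) (hc.pt a' b') \<le> sqrt 3 * tt \<longleftrightarrow> N (a - a') (b - b') \<le> 3 * tt\<^sup>2" for a b a' b'
    unfolding N_def by (rule hc.dist_pt)
  have i3: "i = 0 \<or> i = 1 \<or> i = 2" using i by auto
  have t0: "tt * (2 * x + y - 1) \<le> tt * 2" "tt * (x + 2 * y - 1) \<le> tt * 2" "0 \<le> tt * (2 * x + y - 1)" "0 \<le> tt * (x + 2 * y - 1)" "tt * (x - y) \<le> tt * 1" "tt * (y - x) \<le> tt * 1"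
    using xy tt_pos by (auto intro!: mult_left_mono mult_nonneg_nonneg)
  have t1: "tt * (2 * x + y - 1) \<le> 2 * s" "tt * (x + 2 * y - 1) \<le> 2 * s" "tt * (x - y) \<le> s" "tt * (y - x) \<le> s" using t0 s by linarith+
  show "A i \<tau> \<in> hc.Rx"
    unfolding hc.Rx_def Int_iff mem_cball A using i3 N1 N2 N3
    by (elim disjE) (simp_all add: dN, simp_all add: algebra_simps)
  show "A i \<tau> + hc.gs i \<in> hc.Hx"
    unfolding A hc.gs_def hc.Hx_def mem_Collect_eq using i3 t0(3,4) t1 s tt_pos
    by (elim disjE) (simp_all add: hc.pt_add hc.co_pt, simp_all add: abs_le_iff algebra_simps)
  show "A i \<tau> \<notin> interior hc.Rx"
  proof
    assume m: "A i \<tau> \<in> interior hc.Rx"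
    have "interior hc.Rx \<subseteq> interior (cball (hc.pt (s + tt) 0) (sqrt 3 * tt))" "interior hc.Rx \<subseteq> interior (cball (hc.pt (s - tt) tt) (sqrt 3 * tt))"
      "interior hc.Rx \<subseteq> interior (cball (hc.pt s (- tt)) (sqrt 3 * tt))" unfolding hc.Rx_def interior_Int by blast+
    then have lt: "dist (hc.pt (s + tt) 0) (A i \<tau>) < sqrt 3 * tt" "dist (hc.pt (s - tt) tt) (A i \<tau>) < sqrt 3 * tt" "dist (hc.pt s (- tt)) (A i \<tau>) < sqrt 3 * tt"
      using m by (auto simp: interior_cball)
    have sq: "N (a - a') (b - b') < 3 * tt\<^sup>2" if "dist (hc.pt a b) (hc.pt a' b') < sqrt 3 * tt" for a b a' b'
    proof -
      have "(dist (hc.pt a b) (hc.pt a' b'))\<^sup>2 < (sqrt 3 * tt)\<^sup>2" using that by (intro power_strict_mono) auto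
      moreover have "(dist (hc.pt a b) (hc.pt a' b'))\<^sup>2 = N (a - a') (b - b')" unfolding dist_norm hc.pt_add(3) N_def by (simp add: norm_mult norm_cc norm_Zc)
      ultimately show ?thesis by (simp add: power_mult_distrib)
    qed
    from i3 show False
    proof (elim disjE)
      assume "i = 0" then show False using lt(1) A sq[of "s + tt" 0 "s + tt * (1 - 2 * x - y)" "tt * (x - y)"] N3(1) by (simp add: algebra_simps)
    next
      assume "i = 1" then show False using lt(2) A sq[of "s - tt" tt "s + tt * (x + 2 * y - 1)" "tt * (1 - 2 * x - y)"] N3(2) by (simp add: algebra_simps)
    next
      assume "i = 2" then show False using lt(3) A sq[of s "- tt" "s + tt * (x - y)" "tt * (x + 2 * y - 1)"] N3(3) by (simp add: algebra_simps)
    qed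
  qed
qed

lemma A_ends: "A 0 0 = hc.pt (s - tt) tt" "A 0 1 = hc.pt s (- tt)" "A 1 0 = hc.pt s (- tt)" "A 1 1 = hc.pt (s + tt) 0" "A 2 0 = hc.pt (s + tt) 0" "A 2 1 = hc.pt (s - tt) tt"
proof -
  have e: "of_real tt * D0 = D0 * Zc tt 0" "of_real tt * D0 * w6\<^sup>2 = D0 * Zc (- tt) tt" "of_real tt * D0 * w6 ^ 4 = D0 * Zc 0 (- tt)"
    unfolding w6_powers by (simp_all add: Zc_def algebra_simps)
  have p0: "p1 0 = hc.pt (s - tt) tt" unfolding cR_eq e(1) D0_pt by simp
  have p1: "p1 1 = hc.pt s (- tt)" unfolding cR_eq e(2) D0_pt by simp
  have p2: "p1 2 = hc.pt (s + tt) 0" unfolding cR_eq e(3) D0_pt by simp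
  show "A 0 0 = hc.pt (s - tt) tt" "A 0 1 = hc.pt s (- tt)" "A 1 0 = hc.pt s (- tt)" "A 1 1 = hc.pt (s + tt) 0" "A 2 0 = hc.pt (s + tt) 0" "A 2 1 = hc.pt (s - tt) tt"
    unfolding ccurve_0 clos1[symmetric] by (rule p0 p1 p2)+
qed

text \<open>The arcs lie in the convex set \<open>Rx\<close>, so their Cauchy integrals vanish
  outside and \<open>E 1\<close> is almost contained in \<open>Rx\<close>. Conversely the connected
  interior of \<open>Rx\<close> avoids the arcs and so lies on one side of them; it is the inside,
  because \<open>E 1\<close> has positive area.\<close>

lemma E1_eq_Rx:
  assumes ins: "AE z in lebesgue. z \<in> E 1 \<longleftrightarrow> z \<in> inside (\<Union>i<3. A i ` {0..1})"
  shows "AE z in lebesgue. z \<in> E 1 \<longleftrightarrow> z \<in> hc.Rx"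
proof -
  let ?S = "\<Union>i<3. A i ` {0..1}"
  have ae: "AE z in lebesgue. (\<Sum>i<3. wk (A i) (cdir (\<theta>1 i) K0 (len1 i)) z) = 2 * of_real pi * \<i> * indicator (E 1) z" using b1 by (simp add: has_boundary_def)
  have out: "AE z in lebesgue. z \<in> E 1 \<longrightarrow> z \<in> hc.Rx"
    using ae
  proof eventually_elim
    case (elim z)
    have "(\<Sum>i<3. wk (A i) (cdir (\<theta>1 i) K0 (len1 i)) z) = 0" if "z \<notin> hc.Rx"
    proof (rule primitive_outside_convex[OF compact_imp_closed[OF hc.Rx_compact] hc.Rx_convex that])
      fix F :: "complex \<Rightarrow> complex"
      assume F: "\<And>\<gamma> \<gamma>'. (\<And>t. (\<gamma> has_vector_derivative \<gamma>' t) (at t)) \<Longrightarrow> continuous_on UNIV \<gamma>' \<Longrightarrow> \<gamma> ` {0..1} \<subseteq> hc.Rx \<Longrightarrow>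
        wk \<gamma> \<gamma>' z = F (\<gamma> 1) - F (\<gamma> 0)"
      have w: "wk (A i) (cdir (\<theta>1 i) K0 (len1 i)) z = F (A i 1) - F (A i 0)" if "i < 3" for i
        by (rule F[OF ccurve_has_vector_derivative cdir_continuous]) (use A_img(1)[OF that] in blast)
      show ?thesis unfolding sum_lt3 using w[of 0] w[of 1] w[of 2] by (simp add: A_ends[simplified])
    qed
    then show ?case using elim by (auto simp: indicator_def split: if_splits)
  qed
  have int: "AE z in lebesgue. z \<in> hc.Rx \<longrightarrow> z \<in> interior hc.Rx" by (rule interior_convex_AE[OF hc.Rx_convex])
  have disj: "interior hc.Rx \<subseteq> - ?S" using A_img(3) by auto
  have conn: "connected (interior hc.Rx)" by (intro convex_connected convex_interior hc.Rx_convex)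
  have "\<exists>w. w \<in> interior hc.Rx \<and> w \<in> inside ?S"
  proof (rule ccontr)
    assume n: "\<not> (\<exists>w. w \<in> interior hc.Rx \<and> w \<in> inside ?S)"
    have "AE z in lebesgue. z \<notin> E 1" using ins out int by eventually_elim (use n in blast)
    moreover have "E 1 \<in> sets lebesgue" using til by (simp add: periodic_2tiling_def)
    ultimately have "E 1 \<in> null_sets lebesgue" by (simp add: AE_iff_null_sets)
    then have "measure lebesgue (E 1) = 0" by (simp add: measure_eq_0_null_sets)
    moreover have "pi > sqrt 3"
    proof -
      have "sqrt 3 < 2" by (rule real_less_lsqrt) auto
      then show ?thesis using pi_gt3 by linarith
    qed
    ultimately show False unfolding area1 using K0 by simp
  qed
  then obtain w where w: "w \<in> interior hc.Rx" "w \<in> inside ?S" by blast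
  have "z \<in> inside ?S" if "z \<in> interior hc.Rx" for z
  proof -
    have "connected_component (- ?S) w z" unfolding connected_component_def using conn disj w(1) that by blast
    then show ?thesis using inside_same_component w(2) by blast
  qed
  then show ?thesis using ins out int by (auto elim: eventually_elim2) 
qed

end

end

subsection \<open>Rigidity from isoperimetry\<close>

lemma ereal_half_sum: "(ereal x + ereal y) / 2 = ereal ((x + y) / 2)"
proof -
  have "(ereal x + ereal y) / ereal 2 = ereal ((x + y) / 2)" by simp
  then show ?thesis by simp
qed

lemma sqrt3_less_pi: "sqrt 3 < pi"
proof -
  have "sqrt 3 < 2" by (rule real_less_lsqrt) auto
  then show ?thesis using pi_gt3 by linarith
qed

text \<open>The defect in \<open>(a + b + c)^2 >= 3 * (a * b + b * c + c * a)\<close> is half the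
  sum of the squared differences.\<close>

lemma symmetric_equality:
  fixes a b c s :: real
  assumes "a > 0" "b > 0" "c > 0" "s > 0" "a * b + b * c + c * a = 3 * s\<^sup>2" "a + b + c \<le> 3 * s"
  shows "a = s" "b = s" "c = s"
proof -
  have "(a + b + c)\<^sup>2 \<le> (3 * s)\<^sup>2" using assms by (intro power_mono) auto
  moreover have "(a - b)\<^sup>2 + (b - c)\<^sup>2 + (c - a)\<^sup>2 = 2 * (a + b + c)\<^sup>2 - 6 * (a * b + b * c + c * a)"
    by (simp add: power2_eq_square algebra_simps)
  ultimately have le: "(a - b)\<^sup>2 + (b - c)\<^sup>2 + (c - a)\<^sup>2 \<le> 0" unfolding assms(5) by (simp add: power_mult_distrib)
  have "(a - b)\<^sup>2 \<le> 0" "(b - c)\<^sup>2 \<le> 0" using le zero_le_power2[of "a - b"] zero_le_power2[of "b - c"] zero_le_power2[of "c - a"] by linarith+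
  then have e: "b = a" "c = a" by simp_all
  have "a\<^sup>2 = s\<^sup>2" using assms(5) unfolding e by (simp add: power2_eq_square)
  then have "a = s" using assms by (simp add: power2_eq_iff_nonneg)
  then show "a = s" "b = s" "c = s" using e by simp_all
qed

context enneagon_tiling
begin

text \<open>\<open>s\<close> is the side of the regular hexagon whose area equals that of both tiles
  together, so that the cut honeycomb of side \<open>s\<close> is an admissible competitor.\<close>

theorem enneagon_conclusion:
  assumes ins: "AE z in lebesgue. z \<in> E 1 \<longleftrightarrow> z \<in> inside (\<Union>i<3. A i ` {0..1})"
    and iso: "isoperimetric_tiling (lat u v) E"
    and per1: "perimeter (E 1) = ereal (pi / K0)" and per2: "perimeter (E 2) = ereal (\<Sum>j<9. len2 j)"
    and sdef: "s = sqrt (2 * (measure lebesgue (E 1) + measure lebesgue (E 2)) / (3 * sqrt 3))"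
  shows "tt < s \<and> (\<exists>\<psi>. isometry_plane \<psi> \<and> lat u v = (\<lambda>z. \<psi> z - \<psi> 0) ` honeycomb_lattice s
      \<and> ae_eq (E 1) (\<psi> ` reuleaux_at (complex_of_real s) tt) \<and> (\<exists>g\<in>lat u v. ae_eq (E 2) ((+) g ` \<psi> ` cut_hexagon s tt)))
      \<and> tiling_perimeter E = ereal (pi / K0 + 3 * s - 3 * tt)"
proof (rule enneagon_regular)
  fix Kc a b c
  assume abc: "a > tt" "b > tt" "c > tt" and Kc: "Kc - cR \<in> lat u v" and lt: "lat u v = lat (D0 * Zc a b) (D0 * Zc (- c) (b + c))"
    and area: "measure lebesgue (E 1) + measure lebesgue (E 2) = sqrt 3 / 2 * (a * b + b * c + c * a)"
    and len: "(\<Sum>j<9. len2 j) = pi / K0 + 2 * (a + b + c) - 6 * tt"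
    and chain: "AE z in lebesgue. 2 * of_real pi * \<i> * indicator (E 2) z =
       wseg (Kc + D0 * Zc tt 0) (Kc + D0 * Zc a 0) z + wseg (Kc + D0 * Zc a 0) (Kc + D0 * Zc a (b - tt)) z
     + wseg (Kc + D0 * Zc (a - tt) (b + tt)) (Kc + D0 * Zc (a - c) (b + c)) z + wseg (Kc + D0 * Zc (a - c) (b + c)) (Kc + D0 * Zc (- c + tt) (b + c)) z
     + wseg (Kc + D0 * Zc (- c) (b + c - tt)) (Kc + D0 * Zc (- c) c) z + wseg (Kc + D0 * Zc (- c) c) (Kc + D0 * Zc (- tt) tt) z
     - wk (A 0) (cdir (\<theta>1 0) K0 (len1 0)) (z - (Kc - cR)) - wk (A 1) (cdir (\<theta>1 1) K0 (len1 1)) (z - (Kc + D0 * Zc a b - cR))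
     - wk (A 2) (cdir (\<theta>1 2) K0 (len1 2)) (z - (Kc + D0 * Zc (- c) (b + c) - cR))"
  have abc0: "a > 0" "b > 0" "c > 0" using abc tt_pos by auto
  \<comment> \<open>Leads to \<open>tt < s\<close>: all sides exceed \<open>tt\<close>, and three
    times the square of \<open>s\<close> is the sum of their pairwise products.\<close>
  have pr: "tt * tt < a * b" "tt * tt < b * c" "tt * tt < c * a" using abc tt_pos by (intro mult_strict_mono; simp)+
  have "s\<^sup>2 = 2 * (sqrt 3 / 2 * (a * b + b * c + c * a)) / (3 * sqrt 3)"
    unfolding sdef area using pr abc0 by (intro real_sqrt_pow2) (auto intro!: divide_nonneg_nonneg mult_nonneg_nonneg add_nonneg_nonneg)
  then have s2: "a * b + b * c + c * a = 3 * s\<^sup>2" by simp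
  have "tt\<^sup>2 < s\<^sup>2" using s2 pr by (simp add: power2_eq_square)
  moreover have "s \<ge> 0" unfolding sdef area using abc0 by (auto intro!: real_sqrt_ge_zero divide_nonneg_nonneg mult_nonneg_nonneg add_nonneg_nonneg)
  ultimately have s: "tt < s" by (rule power2_less_imp_less)
  have s0: "s > 0" using s tt_pos by simp
  have E1s: "E 1 \<in> sets lebesgue" and E2s: "E 2 \<in> sets lebesgue" using til by (simp_all add: periodic_2tiling_def)
  note R1 = E1_eq_Rx[OF s ins]
  interpret hc: honeycomb_arcs "cR - cc * of_real s" cc s tt A "\<lambda>i. cdir (\<theta>1 i) K0 (len1 i)" "pi / 3 / K0"
  proof unfold_locales
    show "AE z in lebesgue. (\<Sum>i<3. wk (A i) (cdir (\<theta>1 i) K0 (len1 i)) z) = 2 * of_real pi * \<i> * indicator (honeycomb_cut.Rx (cR - cc * of_real s) cc s tt) z"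
    proof -
      have "AE z in lebesgue. (\<Sum>i<3. wk (A i) (cdir (\<theta>1 i) K0 (len1 i)) z) = 2 * of_real pi * \<i> * indicator (E 1) z" using b1 by (simp add: has_boundary_def)
      then show ?thesis using R1 by eventually_elim (simp add: indicator_def)
    qed
    show "norm (cdir (\<theta>1 i) K0 (len1 i) \<tau>) \<le> pi / 3 / K0" if "i < 3" for i \<tau> using norm_cdir[OF len1'(1)[OF that]] len1[OF that] by simp
  qed (use norm_cc tt_pos s A_ends[OF s] A_img[OF s] ccurve_has_vector_derivative cdir_continuous in auto)
  have emE1: "emeasure lebesgue hc.Rx = emeasure lebesgue (E 1)" by (rule emeasure_eq_AE[OF _ hc.Rx_sets E1s]) (use R1 in \<open>auto elim!: eventually_mono\<close>)
  then have mE1: "measure lebesgue hc.Rx = measure lebesgue (E 1)" by (simp add: measure_def)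
  have "sqrt 3 / 2 * (3 * s\<^sup>2) = 3 * sqrt 3 / 2 * s\<^sup>2" by simp
  then have mE2: "measure lebesgue hc.Cx = measure lebesgue (E 2)" using hc.cut_area(1) area unfolding s2 mE1 by linarith
  have bd2: "AE z in lebesgue. z \<in> E 2 \<longrightarrow> norm z \<le> R" by (rule bd) simp
  have emE2: "emeasure lebesgue hc.Cx = emeasure lebesgue (E 2)"
  proof -
    have "emeasure lebesgue (E 2) = ennreal (measure lebesgue (E 2))" using area_boundary(2)[OF b2 E2s bd2] by (intro emeasure_eq_ennreal_measure) auto
    then show ?thesis unfolding emeasure_eq_measure2[OF hc.cut_area(3)] mE2 by simp
  qed
  \<comment> \<open>The only place where minimality enters. In the comparison the arcs and the terms
    with \<open>tt\<close> drop out, leaving \<open>a + b + c \<le> 3 * s\<close>.\<close>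
  have "tiling_perimeter E \<le> tiling_perimeter hc.tile"
    using iso hc.cut_tiling emE1 emE2 unfolding isoperimetric_tiling_def by (auto simp: hc.tile_def)
  also have "\<dots> \<le> (ereal (3 * (pi / 3 / K0)) + ereal (6 * (s - tt) + 3 * (pi / 3 / K0))) / 2"
  proof -
    have "hc.tile 1 = hc.Rx" "hc.tile 2 = hc.Cx" by (simp_all add: hc.tile_def)
    then show ?thesis unfolding tiling_perimeter_def
      by (simp only:) (intro ereal_divide_right_mono add_mono hc.Rx_perimeter hc.Cx_perimeter, simp)
  qed
  finally have "a + b + c \<le> 3 * s" unfolding tiling_perimeter_def per1 per2 len ereal_half_sum by (simp add: field_simps)
  note eq = symmetric_equality[OF abc0 s0 s2 this]
  \<comment> \<open>The lattice vector from the centre of \<open>E 1\<close> to the corner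
    \<open>Kc\<close> of the hexagon of \<open>E 2\<close>; the given \<open>E 2\<close> is the cut
    hexagon only after this translation.\<close>
  define g where "g = Kc - cR"
  have gG: "g \<in> lat u v" using Kc by (simp add: g_def)
  have kp: "Kc + D0 * Zc x y = hc.pt (s - x - y) x + g" for x y using D0_pt[OF s, of x y] by (simp add: g_def algebra_simps)
  have gs1: "D0 * Zc s s = hc.gs 1" and gs2: "D0 * Zc (- s) (s + s) = hc.gs 2" unfolding D0_Zc by (simp_all add: hc.gs_def)
  have latt: "lat u v = hc.Gh"
  proof -
    have "lat (hc.gs 1) (hc.gs 2) = hc.Gh"
      unfolding hc.Gh_def
    proof (rule lat_eqI)
      show "hc.gs 1 \<in> lat (cc * Zc s s) (cc * Zc (- s) (2 * s))" "hc.gs 2 \<in> lat (cc * Zc s s) (cc * Zc (- s) (2 * s))"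
        unfolding hc.Gh_def[symmetric] by (rule hc.gs_mem)+
      have g: "hc.gs 1 = cc * Zc (- 2 * s) s" "hc.gs 2 = cc * Zc (- s) (- s)" by (simp_all add: hc.gs_def)
      show "Im (cnj (hc.gs 1) * hc.gs 2) = Im (cnj (cc * Zc s s) * (cc * Zc (- s) (2 * s)))" unfolding g hc.Im_c Im_Zc by (simp add: algebra_simps)
      show "Im (cnj (cc * Zc s s) * (cc * Zc (- s) (2 * s))) \<noteq> 0" unfolding hc.Gh_det using s0 by simp
    qed
    then show ?thesis unfolding lt eq gs1 gs2 .
  qed
  \<comment> \<open>With equal sides the chain of \<open>E 2\<close> is, term by term, the chain of
    the cut hexagon moved by \<open>g\<close>, and equal Cauchy integrals give equal
    indicators.\<close>
  have "AE z in lebesgue. z \<in> E 2 \<longleftrightarrow> z \<in> (+) g ` hc.Cx"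
    using chain AE_translate[OF hc.cut_chain, of g]
  proof eventually_elim
    case (elim z)
    have P: "s - tt - 0 = s - tt" "s - s - 0 = 0" "s - s - (s - tt) = tt - s" "s - (s - tt) - (s + tt) = - s" "s - s = 0" "s - 0 - (s + s) = - s"
      "s - (- s + tt) - (s + s) = - tt" "- s + tt = tt - s" "s - - s - (s + s - tt) = tt" "s - - s - s = s" "s - - tt - tt = s" "0 - 0 = (0::real)" "0 - (s - tt) = tt - s" by simp_all
    have P7: "s - (tt - s) - (s + s) = - tt" by simp
    have sh: "z - (Kc - cR) = z - g - hc.gs 0" "z - (Kc + hc.gs 1 - cR) = z - g - hc.gs 1" "z - (Kc + hc.gs 2 - cR) = z - g - hc.gs 2"
      by (simp_all add: g_def hc.gs_def)
    have "2 * of_real pi * \<i> * indicator (E 2) z = (2 * of_real pi * \<i> * indicator hc.Cx (z - g) :: complex)"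
      unfolding elim(1) elim(2)[symmetric] eq gs1 gs2 sh kp P P7 wseg_translate sum_lt3 by (simp only: diff_diff_eq)
    then have "(indicator (E 2) z :: complex) = indicator hc.Cx (z - g)" by simp
    then show ?case unfolding mem_translate by (auto simp: indicator_def split: if_splits)
  qed
  moreover have "(+) g ` hc.Cx \<in> sets lebesgue" by (rule translate_lebesgue[OF hc.Cx_sets])
  ultimately have ae2: "ae_eq (E 2) ((+) g ` hc.Cx)" by (intro ae_eqI E2s)
  have ae1: "ae_eq (E 1) hc.Rx" by (rule ae_eqI[OF E1s hc.Rx_sets]) (use R1 in \<open>auto elim!: eventually_mono\<close>)
  have "isometry_plane (\<lambda>z. cR - cc * of_real s + cc * z)" unfolding isometry_plane_def using norm_cc by blast
  moreover have "tiling_perimeter E = ereal (pi / K0 + 3 * s - 3 * tt)"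
    unfolding tiling_perimeter_def per1 per2 len eq ereal_half_sum by (simp add: field_simps)
  ultimately show ?thesis using s gG ae1 ae2 latt
    by (intro conjI exI[of _ "\<lambda>z. cR - cc * of_real s + cc * z"]) (simp_all only: hc.Rx_eq_image hc.Cx_eq_image hc.Gh_eq_image, blast)
qed

end

text \<open>\<open>s\<close> and \<open>t\<close> are functions of the two areas alone, so the
  isometry onto the model expresses uniqueness. \<open>E 2\<close> is determined up to a lattice
  vector, since replacing it by such a translate gives the same tiling.\<close>

theorem theorem3p3:
  fixes G :: "complex set" and E :: "nat \<Rightarrow> complex set"
  assumes "periodic_2tiling G E"
    and "nondegenerate_tiling E"
    and "isoperimetric_tiling G E"
    and "reuleaux_triangle (E 1)"
    and "curvilinear_enneagon_6_3 (E 2)"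
  shows "(\<exists>s t \<psi>.
            s = sqrt (2 * (measure lebesgue (E 1) + measure lebesgue (E 2)) / (3 * sqrt 3)) \<and>
            t = sqrt (2 * measure lebesgue (E 1) / (3 * (pi - sqrt 3))) \<and>
            0 < t \<and> t < s \<and> isometry_plane \<psi> \<and>
            G = (\<lambda>z. \<psi> z - \<psi> 0) ` honeycomb_lattice s \<and>
            ae_eq (E 1) (\<psi> ` reuleaux_at (complex_of_real s) t) \<and>
            (\<exists>g\<in>G. ae_eq (E 2) ((+) g ` \<psi> ` cut_hexagon s t)))
       \<and> 0 < measure lebesgue (E 1) / (measure lebesgue (E 1) + measure lebesgue (E 2))
       \<and> measure lebesgue (E 1) / (measure lebesgue (E 1) + measure lebesgue (E 2)) < pi / sqrt 3 - 1
       \<and> tiling_perimeter E =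
           ereal (sqrt 2 * sqrt (pi - sqrt 3) * sqrt (measure lebesgue (E 1))
                  + root 4 12 * sqrt (measure lebesgue (E 1) + measure lebesgue (E 2)))"
proof -
  have E1s: "E 1 \<in> sets lebesgue" and E2s: "E 2 \<in> sets lebesgue" using assms(1) by (simp_all add: periodic_2tiling_def)
  obtain u v where uv: "G = lat u v" "Im (cnj u * v) > 0"
    using assms(1) plane_latticeE unfolding periodic_2tiling_def by metis
  obtain p1 \<theta>1 \<kappa>1 len1 where C1: "curvilinear_polygon_120 3 p1 \<theta>1 \<kappa>1 len1 (E 1)" and kk: "\<forall>i<3. \<kappa>1 i \<noteq> 0 \<and> \<kappa>1 i = \<kappa>1 0"
    using assms(4) unfolding reuleaux_triangle_def by blast
  obtain p2 \<theta>2 \<kappa>2 len2 where C2: "curvilinear_polygon_120 9 p2 \<theta>2 \<kappa>2 len2 (E 2)"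
    and c6: "card {i. i < 9 \<and> \<kappa>2 i = 0} = 6" and c3: "card {i. i < (9::nat) \<and> \<kappa>2 i < 0} = 3"
    using assms(5) unfolding curvilinear_enneagon_6_3_def by blast
  define K where "K = \<kappa>1 0"
  have kK: "\<kappa>1 i = K" if "i < 3" for i using kk that unfolding K_def by blast
  note rd = reuleaux_data[OF C1 E1s kk, folded K_def]
  obtain R1 where R1: "AE z in lebesgue. z \<in> E 1 \<longrightarrow> norm z \<le> R1" by (rule cpoly_bounded[OF _ C1]) simp_all
  obtain R2 where R2: "AE z in lebesgue. z \<in> E 2 \<longrightarrow> norm z \<le> R2" by (rule cpoly_bounded[OF _ C2]) simp_all
  \<comment> \<open>Six zero and three negative curvatures exhaust the nine edges, so no edge of
    \<open>E 2\<close> is convex.\<close>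
  have k2: "\<kappa>2 j \<le> 0" if "j < 9" for j
  proof -
    have "card ({i. i < 9 \<and> \<kappa>2 i = 0} \<union> {i. i < 9 \<and> \<kappa>2 i < 0}) = 9"
      using c6 c3 by (subst card_Un_disjoint) auto
    then have U: "{i. i < 9 \<and> \<kappa>2 i = 0} \<union> {i. i < 9 \<and> \<kappa>2 i < 0} = {..<9}" by (intro card_subset_eq) auto
    have "j \<in> {i. i < 9 \<and> \<kappa>2 i = 0} \<union> {i. i < 9 \<and> \<kappa>2 i < 0}" unfolding U using that by simp
    then show ?thesis by auto
  qed
  have n3: "0 < (3::nat)" "0 < (9::nat)" by simp_all
  have b1: "has_boundary {..<3::nat} (\<lambda>i. ccurve (p1 i) (\<theta>1 i) K (len1 i)) (\<lambda>i. cdir (\<theta>1 i) K (len1 i)) (E 1)"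
  proof -
    have k: "\<kappa>1 0 = K" "\<kappa>1 1 = K" "\<kappa>1 2 = K" using kK by simp_all
    show ?thesis using cpoly_has_boundary(1)[OF n3(1) C1] unfolding has_boundary_def sum_lt3 k by (simp add: ccurve_continuous cdir_continuous)
  qed
  have ins: "AE z in lebesgue. z \<in> E 1 \<longleftrightarrow> z \<in> inside (\<Union>i<3. ccurve (p1 i) (\<theta>1 i) K (len1 i) ` {0..1})"
  proof -
    have cl1: "\<And>i. i < 3 \<Longrightarrow> ccurve (p1 i) (\<theta>1 i) (\<kappa>1 i) (len1 i) 1 = p1 (Suc i mod 3)"
      using C1 unfolding curvilinear_polygon_120_def Let_def by blast
    have "path_image (cpoly_path 3 p1 \<theta>1 \<kappa>1 len1) = (\<Union>i<3. ccurve (p1 i) (\<theta>1 i) (\<kappa>1 i) (len1 i) ` {0..1})"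
      by (rule cpoly_image[OF n3(1)]) (rule cl1)
    also have "\<dots> = (\<Union>i<3. ccurve (p1 i) (\<theta>1 i) K (len1 i) ` {0..1})" by (auto simp: kK)
    finally have im: "path_image (cpoly_path 3 p1 \<theta>1 \<kappa>1 len1) = (\<Union>i<3. ccurve (p1 i) (\<theta>1 i) K (len1 i) ` {0..1})" .
    show ?thesis using cpoly_has_boundary(2)[OF n3(1) C1] unfolding im .
  qed
  have poly2: "\<And>i. i < 9 \<Longrightarrow> 0 < len2 i \<and> \<bar>\<kappa>2 i\<bar> * len2 i < 2 * pi" "\<And>i. i < 9 \<Longrightarrow> ccurve (p2 i) (\<theta>2 i) (\<kappa>2 i) (len2 i) 1 = p2 (Suc i mod 9)"
    "\<And>i. i < 9 \<Longrightarrow> cis (\<theta>2 (Suc i mod 9)) = cis (\<theta>2 i + \<kappa>2 i * len2 i + pi / 3)"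
    using C2 unfolding curvilinear_polygon_120_def Let_def by blast+
  have l1: "len1 i = pi / 3 / K" if "i < 3" for i using rd(1) rd(2)[OF that] by (simp add: field_simps)
  interpret enneagon_tiling u v E "max R1 R2" p1 p2 \<theta>1 \<theta>2 len1 len2 \<kappa>2 K
  proof unfold_locales
    show "periodic_2tiling (lat u v) E" using assms(1) uv(1) by simp
    show "AE z in lebesgue. z \<in> E k \<longrightarrow> norm z \<le> max R1 R2" if "k \<in> {1, 2}" for k
    proof -
      from that consider "k = 1" | "k = 2" by blast
      then show ?thesis
      proof cases
        case 1 then show ?thesis using R1 by (auto elim!: eventually_mono)
      next
        case 2 then show ?thesis using R2 by (auto elim!: eventually_mono)
      qed
    qed
    show "has_boundary {..<9} (\<lambda>i. ccurve (p2 i) (\<theta>2 i) (\<kappa>2 i) (len2 i)) (\<lambda>i. cdir (\<theta>2 i) (\<kappa>2 i) (len2 i)) (E 2)"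
      by (rule cpoly_has_boundary(1)[OF n3(2) C2])
  qed (use uv(2) b1 rd l1 poly2 k2 c3 in \<open>simp_all\<close>)
  define m1 m2 where m: "m1 = measure lebesgue (E 1)" "m2 = measure lebesgue (E 2)"
  define s where "s = sqrt (2 * (m1 + m2) / (3 * sqrt 3))"
  have pi3: "0 < pi - sqrt 3" using sqrt3_less_pi by simp
  have tt2: "tt\<^sup>2 = 1 / (3 * K\<^sup>2)" unfolding tt_def by (simp add: power_divide power_mult_distrib)
  have m1: "m1 = (pi - sqrt 3) / 2 * (3 * tt\<^sup>2)" unfolding tt2 m area1 by simp
  have per1: "perimeter (E 1) = ereal (pi / K)"
    using cpoly_perimeter[OF n3(1) C1 E1s] l1[of 0] l1[of 1] l1[of 2] unfolding sum_lt3 by simp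
  have per2: "perimeter (E 2) = ereal (\<Sum>j<9. len2 j)" by (rule cpoly_perimeter[OF n3(2) C2 E2s])
  have iso: "isoperimetric_tiling (lat u v) E" using assms(3) uv(1) by simp
  have sm: "s = sqrt (2 * (measure lebesgue (E 1) + measure lebesgue (E 2)) / (3 * sqrt 3))" unfolding s_def m ..
  note con = enneagon_conclusion[OF ins iso per1 per2 sm]
  have ts: "tt < s" using con by blast
  have tper: "tiling_perimeter E = ereal (pi / K + 3 * s - 3 * tt)" using con by blast
  obtain \<psi> where psi: "isometry_plane \<psi>" "lat u v = (\<lambda>z. \<psi> z - \<psi> 0) ` honeycomb_lattice s"
      "ae_eq (E 1) (\<psi> ` reuleaux_at (complex_of_real s) tt)" "\<exists>g\<in>lat u v. ae_eq (E 2) ((+) g ` \<psi> ` cut_hexagon s tt)" using con by blast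
  have s0: "s > 0" using ts tt_pos by simp
  have "0 \<le> 2 * (m1 + m2) / (3 * sqrt 3)" using s0 unfolding s_def by (metis less_le real_sqrt_gt_0_iff)
  then have "s\<^sup>2 = 2 * (m1 + m2) / (3 * sqrt 3)" unfolding s_def by (rule real_sqrt_pow2)
  then have A: "m1 + m2 = 3 * sqrt 3 / 2 * s\<^sup>2" by simp
  have tm: "tt = sqrt (2 * m1 / (3 * (pi - sqrt 3)))"
  proof -
    have "2 * (p / 2 * (3 * x)) / (3 * p) = x" if "p \<noteq> 0" for p x :: real using that by simp
    from this[of "pi - sqrt 3" "tt\<^sup>2"] have "2 * m1 / (3 * (pi - sqrt 3)) = tt\<^sup>2" unfolding m1 using pi3 by simp
    then show ?thesis using tt_pos by simp
  qed
  have m10: "m1 > 0" unfolding m1 using pi3 tt_pos by simp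
  have A0: "m1 + m2 > 0" unfolding A using s0 by simp
  have r1: "0 < m1 / (m1 + m2)" using m10 A0 by simp
  \<comment> \<open>A restatement of \<open>tt < s\<close>: \<open>m1\<close> is a fixed multiple of
    the square of \<open>tt\<close>, and \<open>m1 + m2\<close> of the square of
    \<open>s\<close>.\<close>
  have r2: "m1 / (m1 + m2) < pi / sqrt 3 - 1"
  proof -
    have "tt\<^sup>2 < s\<^sup>2" using ts tt_pos by (intro power_strict_mono) auto
    then have "m1 < (pi - sqrt 3) / 2 * (3 * s\<^sup>2)" unfolding m1 using pi3 by (intro mult_strict_left_mono) auto
    also have "\<dots> = (pi / sqrt 3 - 1) * (3 * sqrt 3 / 2 * s\<^sup>2)" by (simp add: field_simps)
    finally have "m1 < (pi / sqrt 3 - 1) * (m1 + m2)" unfolding A .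
    then show ?thesis using A0 by (simp only: pos_divide_less_eq)
  qed
  \<comment> \<open>The two summands on the right are \<open>(pi - sqrt 3) * sqrt 3 * tt\<close>,
    which equals \<open>pi / K - 3 * tt\<close>, and \<open>3 * s\<close>.\<close>
  have P: "pi / K + 3 * s - 3 * tt = sqrt 2 * sqrt (pi - sqrt 3) * sqrt m1 + root 4 12 * sqrt (m1 + m2)"
  proof -
    have "sqrt 2 * sqrt (pi - sqrt 3) * sqrt m1 = sqrt ((pi - sqrt 3)\<^sup>2 * 3 * tt\<^sup>2)"
      unfolding m1 real_sqrt_mult[symmetric] by (simp add: power2_eq_square)
    also have "\<dots> = (pi - sqrt 3) * sqrt 3 * tt" using pi3 tt_pos by (simp add: real_sqrt_mult)
    finally have 1: "sqrt 2 * sqrt (pi - sqrt 3) * sqrt m1 = (pi - sqrt 3) * sqrt 3 * tt" .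
    have "root 4 12 = sqrt (sqrt 12)" using real_root_mult_exp[of 2 2 12] by (simp add: sqrt_def)
    then have "root 4 12 * sqrt (m1 + m2) = sqrt (sqrt 12 * (3 * sqrt 3 / 2 * s\<^sup>2))" unfolding A by (simp only: real_sqrt_mult)
    also have "sqrt 12 * (3 * sqrt 3 / 2 * s\<^sup>2) = (3 * s)\<^sup>2"
    proof -
      have h: "sqrt 12 * sqrt 3 = 6" unfolding real_sqrt_mult[symmetric] by simp
      have "sqrt 12 * (3 * sqrt 3 / 2 * s\<^sup>2) = (sqrt 12 * sqrt 3) * (3 / 2 * s\<^sup>2)" by (simp only: times_divide_eq_left times_divide_eq_right mult_ac)
      also have "\<dots> = 9 * s\<^sup>2" unfolding h by simp
      finally show ?thesis by (simp add: power_mult_distrib)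
    qed
    also have "sqrt ((3 * s)\<^sup>2) = 3 * s" by (rule real_sqrt_unique) (use s0 in simp_all)
    finally have 2: "root 4 12 * sqrt (m1 + m2) = 3 * s" .
    have "pi / K = pi * (sqrt 3 * tt)" unfolding tt_def using rd(1) by simp
    moreover have "sqrt 3 * sqrt 3 = 3" by simp
    ultimately show ?thesis unfolding 1 2 by (simp add: algebra_simps)
  qed
  show ?thesis
    unfolding m[symmetric] uv(1) using s_def tm tt_pos ts psi r1 r2 tper P by (intro conjI exI[of _ s] exI[of _ tt] exI[of _ \<psi>]) simp_all
qed

end
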